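(* Let $\{Y_t\}$ be the stationary and ergodic INAR(1) process $Y_t=\sum_{i=1}^{Y_{t-1}}U_{t,i}+\varepsilon_t$ described in the context, under the null hypothesis: the true thinning parameter is $p_0\in(0,1)$ and the i.i.d. innovations have probability generating function (PGF) $g_\varepsilon(\cdot;\theta_0)$, where $\theta_0\in\Theta$ and $\{g_\varepsilon(\cdot;\theta):\theta\in\Theta\}$ is a given family of PGFs of nonnegative integer-valued random variables, $\Theta\subset\mathbb R$ open. Assume: (A.1) The $\varepsilon_t$ are i.i.d. discrete nonnegative random variables with finite second moment and PGF $g_\varepsilon(\cdot;\theta_0)$. (A.2) For all $u\in[0,1]$, $g_\varepsilon(u;\theta)$ has a first partial derivative with respect to $\theta$, and there are constants $D_1,D_2,D_3>0$ and a measurable function $v$ on $[0,1]$ such that for all $u\in[0,1]$ and all $\theta$ with $|\theta-\theta_0|\le D_2$, $$\left|\frac{\partial g_\varepsilon(u;\theta)}{\partial\theta}-\frac{\partial g_\varepsilon(u;\theta)}{\partial\theta}\Big|_{\theta=\theta_0}\right|\le D_1|\theta-\theta_0|\,v(u),\qquad \left|\frac{\partial g_\varepsilon(u;\theta)}{\partial\theta}\right|\le D_3\,v(u).$$ (A.3) The nonnegative weight function $w$ satisfies $0<\int_0^1w(u)\,du<\infty$ and $\int_0^1w(u)v^2(u)\,du<\infty$. (A.4) With $\vartheta_0=(p_0,\theta_0)'$, the estimator $\widehat\vartheta_T=(\widehat p_T,\widehat\theta_T)'$ satisfies, as $T\to\infty$, $$\sqrt T(\widehat\vartheta_T-\vartheta_0)=\frac1{\sqrt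 T}\sum_{t=q+1}^{T}\ell(\mathbf Y_{t-q};\vartheta_0)+o_P(1),$$ where $q\ge1$ is fixed, $\mathbf Y_{t-q}=(Y_t,\dots,Y_{t-q})'$, $\ell=(\ell_1,\ell_2)'$, and for $j=1,2$ the sequence $\{\ell_j(\mathbf Y_{t-q};\vartheta_0)\}_{t\ge q+1}$ is a martingale difference sequence (with respect to $\mathcal I_t=\sigma\{Y_s:s\le t\}$) with finite variances. Let $S_T$ be the test statistic defined in the context, and for $t\ge q+1$, $u\in[0,1]$ let $$\mathcal Z_t(u;p_0,\theta_0)=Z_t(u;p_0,\theta_0)-h_1(u;p_0,\theta_0)\,\ell_1(\mathbf Y_{t-q};\vartheta_0)-h_2(u;p_0,\theta_0)\,\ell_2(\mathbf Y_{t-q};\vartheta_0),$$ with $Z_t,h_1,h_2$ as in the context, and $\bar{\mathcal Z}_T(u;p_0,\theta_0)=\frac1{\sqrt T}\sum_{t=q+1}^T\mathcal Z_t(u;p_0,\theta_0)$. Then, as $T\to\infty$: (i) the limit distribution of $S_T$ is the same as that of $\int_0^1\bar{\mathcal Z}_T^2(u;p_0,\theta_0)\,w(u)\,du$; (ii) the process $\{\bar{\mathcal Z}_T(u;p_0,\theta_0):u\in[0,1]\}$ converges in distribution in $\mathcal C[0,1]$ to a zero-mean Gaussian process $\{\mathcal Z(u;p_0,\theta_0):u\in[0,1]\}$ with covariance function $\mathbb E\big[\mathcal Z_{q+1}(u_1;p_0,\theta_0)\mathcal Z_{q+1}(u_2;p_0,\theta_0)\big]$, $u_1,u_2\in[0,1]$;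 (iii) $S_T$ converges in distribution to $\int_0^1\mathcal Z^2(u;p_0,\theta_0)\,w(u)\,du$.
   Context: INAR(1) model: $\{Y_t\}$ is a sequence of nonnegative integer-valued random variables with $Y_t=\sum_{i=1}^{Y_{t-1}}U_{t,i}+\varepsilon_t$, where the $U_{t,i}$ are independent with $P(U_{t,i}=1)=p$, $P(U_{t,i}=0)=1-p$, $p\in(0,1)$; $U_{t,1},U_{t,2},\dots$ are independent of $Y_{t-1}$ and $\varepsilon_t$; the $\varepsilon_t$ are i.i.d. nonnegative integer-valued with finite variance and $\varepsilon_t$ is independent of $Y_{t-1}$. The conditional law of $Y_t$ given $\mathcal I_{t-1}=\sigma\{Y_s:s\le t-1\}$ is the convolution of the binomial distribution with parameters $(Y_{t-1},p)$ and the law of $\varepsilon_t$. $\{Y_t\}$ is taken to be the (unique) strictly stationary and ergodic solution. The PGF of a nonnegative integer-valued random variable $X$ is $\mathbb E[u^X]$, $u\in[0,1]$ (with $0^0=1$). $g_Y$ denotes the PGF of the stationary marginal law of $Y_t$. Test statistic: given observations $Y_1,\dots,Y_T$ and an estimator $(\widehat p_T,\widehat\theta_T)'$ of $(p_0,\theta_0)'$ computed from them (with $\widehat\theta_T\in\Theta$), let $$\widehat g_{T,Y}(u)=\frac1T\sum_{t=1}^Tu^{Y_t},\qquad \widehat g_{T0}(u)=g_\varepsilon(u;\widehat\theta_T)\,\widehat g_{T,Y}(1+\widehat p_T(u-1)),$$ $$S_T=T\int_0^1\big(\widehat g_{T,Y}(u)-\widehat g_{T0}(u)\big)^2w(u)\,du,$$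 where $w\ge0$ is a measurable weight function on $[0,1]$. Auxiliary quantities: for $t\ge2$, $$Z_t(u;p,\theta)=u^{Y_t}-(1+p(u-1))^{Y_{t-1}}g_\varepsilon(u;\theta),$$ $$h_1(u;p,\theta)=\frac{\partial g_Y(1+p(u-1))}{\partial p}\,g_\varepsilon(u;\theta),\qquad h_2(u;p,\theta)=g_Y(1+p(u-1))\,\frac{\partial g_\varepsilon(u;\theta)}{\partial\theta},$$ where in $h_1$ the derivative is taken of $p\mapsto g_Y(1+p(u-1))$ with the function $g_Y$ held fixed, i.e. $\frac{\partial g_Y(1+p(u-1))}{\partial p}=\mathbb E\big[Y_1(1+p(u-1))^{Y_1-1}\big](u-1)$. "The limit distribution of $S_T$ is the same as that of $X_T$" means that $S_T$ and $X_T$ converge in distribution to the same limit. $\mathcal C[0,1]$ is the space of continuous functions on $[0,1]$ with the supremum norm.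
   Formalization: The convergence in C[0,1] in (ii) is proved under the added assumption that u ↦ ∂g_ε(u;θ)/∂θ at θ=θ₀ is continuous on [0,1]; (A.2) does not imply this, and without it the process in (ii) need not have continuous paths. (i), (iii) and the Gaussian process do not need it. *)

theory Defs
  imports "HOL-Probability.Probability"
begin

section \<open>Probability generating functions and convergence\<close>

definition pgf :: "'a measure \<Rightarrow> ('a \<Rightarrow> nat) \<Rightarrow> real \<Rightarrow> real" where
  "pgf M X u = (\<integral>\<omega>. u ^ X \<omega> \<partial>M)"

definition tends_to_zero_in_prob :: "'a measure \<Rightarrow> (nat \<Rightarrow> 'a \<Rightarrow> real) \<Rightarrow> bool" where
  "tends_to_zero_in_prob M R \<longleftrightarrow>
     (\<forall>e>0. (\<lambda>T. measure M {\<omega> \<in> space M. \<bar>R T \<omega>\<bar> \<ge> e}) \<longlonglongrightarrow> 0)"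

text \<open>The members of \<open>C01\<close> are the functions that are continuous on the unit interval and
  \<^const>\<open>undefined\<close> outside it; the distance is the supremum distance.\<close>

definition C01 :: "(real \<Rightarrow> real) metric" where
  "C01 = cfunspace (top_of_set {0..1}) euclidean_metric"

definition metric_borel :: "'b metric \<Rightarrow> 'b measure" where
  "metric_borel m = sigma (mspace m) {A. openin (mtopology_of m) A}"

definition conv_in_distribution ::
    "'b metric \<Rightarrow> 'a measure \<Rightarrow> (nat \<Rightarrow> 'a \<Rightarrow> 'b) \<Rightarrow> 'c measure \<Rightarrow> ('c \<Rightarrow> 'b) \<Rightarrow> bool" where
  "conv_in_distribution m M X N Z \<longleftrightarrow>
     (\<forall>T. X T \<in> measurable M (metric_borel m)) \<and> Z \<in> measurable N (metric_borel m) \<and>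
     (\<forall>\<Phi>. continuous_map (mtopology_of m) euclideanreal \<Phi> \<and> bounded (\<Phi> ` mspace m) \<longrightarrow>
        (\<lambda>T. \<integral>\<omega>. \<Phi> (X T \<omega>) \<partial>M) \<longlonglongrightarrow> (\<integral>x. \<Phi> (Z x) \<partial>N))"

text \<open>The second disjunct admits normal laws of variance zero.\<close>

definition gaussian_rv :: "'c measure \<Rightarrow> ('c \<Rightarrow> real) \<Rightarrow> bool" where
  "gaussian_rv N X \<longleftrightarrow> X \<in> borel_measurable N \<and>
     ((\<exists>m s. s > 0 \<and> distributed N lborel X (\<lambda>x. ennreal (normal_density m s x))) \<or>
      (\<exists>c. AE x in N. X x = c))"

definition gaussian_process :: "'c measure \<Rightarrow> 'i set \<Rightarrow> ('i \<Rightarrow> 'c \<Rightarrow> real) \<Rightarrow> bool" where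
  "gaussian_process N I Z \<longleftrightarrow>
     (\<forall>A a. finite A \<and> A \<subseteq> I \<longrightarrow> gaussian_rv N (\<lambda>x. \<Sum>i\<in>A. a i * Z i x))"


section \<open>Integer-valued processes and the INAR(1) model\<close>

definition path_space :: "(int \<Rightarrow> nat) measure" where
  "path_space = PiM UNIV (\<lambda>_. count_space UNIV)"

definition strictly_stationary :: "'a measure \<Rightarrow> (int \<Rightarrow> 'a \<Rightarrow> nat) \<Rightarrow> bool" where
  "strictly_stationary M Y \<longleftrightarrow>
     (\<forall>h. distr M path_space (\<lambda>\<omega> t. Y (t + h) \<omega>) = distr M path_space (\<lambda>\<omega> t. Y t \<omega>))"

definition ergodic_process :: "'a measure \<Rightarrow> (int \<Rightarrow> 'a \<Rightarrow> nat) \<Rightarrow> bool" where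
  "ergodic_process M Y \<longleftrightarrow>
     (\<forall>A \<in> sets path_space. (\<lambda>x t. x (t + 1)) -` A = A \<longrightarrow>
        measure M {\<omega> \<in> space M. (\<lambda>t. Y t \<omega>) \<in> A} \<in> {0, 1})"

definition past :: "'a measure \<Rightarrow> (int \<Rightarrow> 'a \<Rightarrow> nat) \<Rightarrow> int \<Rightarrow> 'a measure" where
  "past M Y t = sigma (space M) {Y s -` B \<inter> space M | s B. s \<le> t}"

definition martingale_difference ::
    "'a measure \<Rightarrow> (int \<Rightarrow> 'a measure) \<Rightarrow> int \<Rightarrow> (int \<Rightarrow> 'a \<Rightarrow> real) \<Rightarrow> bool" where
  "martingale_difference M F t0 X \<longleftrightarrow>
     (\<forall>t\<ge>t0. X t \<in> borel_measurable (F t) \<and> integrable M (X t) \<and>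
        (AE \<omega> in M. real_cond_exp M (F (t - 1)) (X t) \<omega> = 0))"

text \<open>The variables \<open>U t i\<close> are used for \<open>i \<ge> 1\<close> only. The last conjunct says that the
  conditional law of \<open>Y t\<close> given its past is the convolution of the binomial law with parameters
  \<open>Y (t - 1)\<close> and \<open>p\<close> and the law of \<open>eps t\<close>; it is not a consequence of the preceding ones, which
  do not relate \<open>U t\<close> and \<open>eps t\<close> to \<open>Y s\<close> for \<open>s < t - 1\<close>.\<close>

definition INAR1 ::
    "'a measure \<Rightarrow> real \<Rightarrow> (int \<Rightarrow> 'a \<Rightarrow> nat) \<Rightarrow> (int \<Rightarrow> nat \<Rightarrow> 'a \<Rightarrow> nat) \<Rightarrow> (int \<Rightarrow> 'a \<Rightarrow> nat) \<Rightarrow> bool"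
where
  "INAR1 M p Y U eps \<longleftrightarrow>
     (\<forall>t. Y t \<in> measurable M (count_space UNIV)) \<and>
     (\<forall>t. AE \<omega> in M. Y t \<omega> = (\<Sum>i\<in>{1..Y (t - 1) \<omega>}. U t i \<omega>) + eps t \<omega>) \<and>
     prob_space.indep_vars M (\<lambda>_. count_space UNIV) (\<lambda>(t, i). U t i) (UNIV \<times> {1..}) \<and>
     (\<forall>t. \<forall>i\<ge>1. measure M {\<omega> \<in> space M. U t i \<omega> = 1} = p \<and>
                 measure M {\<omega> \<in> space M. U t i \<omega> = 0} = 1 - p) \<and>
     (\<forall>t. prob_space.indep_set M
            (sets (vimage_algebra (space M) (\<lambda>\<omega>. \<lambda>i\<in>{1..}. U t i \<omega>)
                     (PiM {1..} (\<lambda>_. count_space UNIV))))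
            (sets (vimage_algebra (space M) (\<lambda>\<omega>. (Y (t - 1) \<omega>, eps t \<omega>)) (count_space UNIV)))) \<and>
     prob_space.indep_vars M (\<lambda>_. count_space UNIV) eps UNIV \<and>
     (\<forall>s t. distr M (count_space UNIV) (eps s) = distr M (count_space UNIV) (eps t)) \<and>
     (\<forall>t. integrable M (\<lambda>\<omega>. (real (eps t \<omega>))\<^sup>2)) \<and>
     (\<forall>t. prob_space.indep_var M (count_space UNIV) (eps t) (count_space UNIV) (Y (t - 1))) \<and>
     (\<forall>t k. AE \<omega> in M.
        real_cond_exp M (past M Y (t - 1)) (indicator {x \<in> space M. Y t x = k}) \<omega> =
        (\<Sum>j\<le>k. pmf (binomial_pmf (Y (t - 1) \<omega>) p) j *
                 measure M {x \<in> space M. eps t x = k - j}))"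


section \<open>The test statistic\<close>

definition sample :: "(int \<Rightarrow> 'a \<Rightarrow> nat) \<Rightarrow> nat \<Rightarrow> 'a \<Rightarrow> nat list" where
  "sample Y T \<omega> = map (\<lambda>t. Y t \<omega>) [1..int T]"

definition ghat :: "(int \<Rightarrow> 'a \<Rightarrow> nat) \<Rightarrow> nat \<Rightarrow> real \<Rightarrow> 'a \<Rightarrow> real" where
  "ghat Y T u \<omega> = 1 / real T * (\<Sum>t\<in>{1..int T}. u ^ Y t \<omega>)"

text \<open>Below, \<open>g u \<theta>\<close> is the PGF of the innovations at \<open>u\<close> under the parameter \<open>\<theta>\<close>, and
  \<open>phat\<close>, \<open>thhat\<close> are the two components of the estimator as functions of the sample.\<close>

definition ghat0 ::
    "(real \<Rightarrow> real \<Rightarrow> real) \<Rightarrow> (nat list \<Rightarrow> real) \<Rightarrow> (nat list \<Rightarrow> real) \<Rightarrow>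
     (int \<Rightarrow> 'a \<Rightarrow> nat) \<Rightarrow> nat \<Rightarrow> real \<Rightarrow> 'a \<Rightarrow> real" where
  "ghat0 g phat thhat Y T u \<omega> =
     g u (thhat (sample Y T \<omega>)) * ghat Y T (1 + phat (sample Y T \<omega>) * (u - 1)) \<omega>"

definition S_stat ::
    "(real \<Rightarrow> real \<Rightarrow> real) \<Rightarrow> (nat list \<Rightarrow> real) \<Rightarrow> (nat list \<Rightarrow> real) \<Rightarrow> (real \<Rightarrow> real) \<Rightarrow>
     (int \<Rightarrow> 'a \<Rightarrow> nat) \<Rightarrow> nat \<Rightarrow> 'a \<Rightarrow> real" where
  "S_stat g phat thhat w Y T \<omega> =
     real T * (\<integral>u. (ghat Y T u \<omega> - ghat0 g phat thhat Y T u \<omega>)\<^sup>2 * w u \<partial>lebesgue_on {0..1})"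


section \<open>The approximating process\<close>

definition Z_inc ::
    "(real \<Rightarrow> real \<Rightarrow> real) \<Rightarrow> (int \<Rightarrow> 'a \<Rightarrow> nat) \<Rightarrow> int \<Rightarrow> real \<Rightarrow> real \<Rightarrow> real \<Rightarrow> 'a \<Rightarrow> real" where
  "Z_inc g Y t u p \<theta> \<omega> = u ^ Y t \<omega> - (1 + p * (u - 1)) ^ Y (t - 1) \<omega> * g u \<theta>"

text \<open>By stationarity \<open>pgf M (Y 1)\<close> is the PGF of the marginal law of the process; it is held fixed
  in the derivative.\<close>

definition h1 ::
    "'a measure \<Rightarrow> (real \<Rightarrow> real \<Rightarrow> real) \<Rightarrow> (int \<Rightarrow> 'a \<Rightarrow> nat) \<Rightarrow> real \<Rightarrow> real \<Rightarrow> real \<Rightarrow> real" where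
  "h1 M g Y u p \<theta> = deriv (\<lambda>r. pgf M (Y 1) (1 + r * (u - 1))) p * g u \<theta>"

definition h2 ::
    "'a measure \<Rightarrow> (real \<Rightarrow> real \<Rightarrow> real) \<Rightarrow> (int \<Rightarrow> 'a \<Rightarrow> nat) \<Rightarrow> real \<Rightarrow> real \<Rightarrow> real \<Rightarrow> real" where
  "h2 M g Y u p \<theta> = pgf M (Y 1) (1 + p * (u - 1)) * deriv (g u) \<theta>"

definition lags :: "(int \<Rightarrow> 'a \<Rightarrow> nat) \<Rightarrow> nat \<Rightarrow> int \<Rightarrow> 'a \<Rightarrow> nat list" where
  "lags Y q t \<omega> = map (\<lambda>k. Y (t - int k) \<omega>) [0..<Suc q]"

definition Z_adj ::
    "'a measure \<Rightarrow> (real \<Rightarrow> real \<Rightarrow> real) \<Rightarrow> (int \<Rightarrow> 'a \<Rightarrow> nat) \<Rightarrow> nat \<Rightarrow>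
     (nat list \<Rightarrow> real \<times> real \<Rightarrow> real) \<Rightarrow> (nat list \<Rightarrow> real \<times> real \<Rightarrow> real) \<Rightarrow>
     int \<Rightarrow> real \<Rightarrow> real \<Rightarrow> real \<Rightarrow> 'a \<Rightarrow> real" where
  "Z_adj M g Y q l1 l2 t u p \<theta> \<omega> =
     Z_inc g Y t u p \<theta> \<omega> - h1 M g Y u p \<theta> * l1 (lags Y q t \<omega>) (p, \<theta>)
                         - h2 M g Y u p \<theta> * l2 (lags Y q t \<omega>) (p, \<theta>)"

text \<open>As a function of \<open>u\<close>, \<open>Z_bar\<close> is continuous whenever \<open>\<lambda>u. deriv (g u) \<theta>\<close> is (this factor enters
  through \<open>h2\<close>). Dominating the derivative by a merely measurable, possibly unbounded function of
  \<open>u\<close> does not imply that continuity, so a claim about \<open>Z_bar\<close> as a random element of \<open>C01\<close> has to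
  assume it.\<close>

definition Z_bar ::
    "'a measure \<Rightarrow> (real \<Rightarrow> real \<Rightarrow> real) \<Rightarrow> (int \<Rightarrow> 'a \<Rightarrow> nat) \<Rightarrow> nat \<Rightarrow>
     (nat list \<Rightarrow> real \<times> real \<Rightarrow> real) \<Rightarrow> (nat list \<Rightarrow> real \<times> real \<Rightarrow> real) \<Rightarrow>
     nat \<Rightarrow> real \<Rightarrow> real \<Rightarrow> real \<Rightarrow> 'a \<Rightarrow> real" where
  "Z_bar M g Y q l1 l2 T u p \<theta> \<omega> =
     1 / sqrt (real T) * (\<Sum>t\<in>{int q + 1..int T}. Z_adj M g Y q l1 l2 t u p \<theta> \<omega>)"

end

theory Submission
  imports Defs
begin

text \<open>
  Since \<open>g\<close> is a power series, \<open>Z_inc t u\<close> is the series of \<open>u ^ k\<close> times the centred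
  indicators \<open>1{Y t = k} - P(Y t = k | Y (t - 1))\<close>. Together with the two components of the
  estimator's expansion these indicators form a stationary ergodic sequence of martingale
  differences with values in the sequences, and their \<open>L\<^sup>2\<close> norms are summable: they are at most
  a constant times \<open>sqrt (P (Y 1 = k))\<close>, and the marginal law has a finite second moment because
  thinning contracts. A process with values in the summable sequences whose coordinates have
  summable \<open>L\<^sup>2\<close> norms, uniformly in \<open>T\<close>, converges weakly as soon as its
  finite-dimensional characteristic functions do, so tightness in \<open>C[0,1]\<close> never has to be discussed:
  \<open>Z_bar\<close> is the image of such a process under a Lipschitz map, both for the supremum norm and for the
  weighted \<open>L\<^sup>2\<close> norm. The finite-dimensional convergence is the central limit theorem for
  martingale differences, where the ergodic theorem in \<open>L\<^sup>1\<close> controls the averages of their squares.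
\<close>

section \<open>The ergodic theorem\<close>

text \<open>The obstacle is \<open>v\<close>: it is only measurable and may be unbounded, so the
  coefficient \<open>h2\<close> may be unbounded in \<open>u\<close>, and the supremum norm is
  available only when the derivative of \<open>g\<close> at the true parameter is continuous in
  \<open>u\<close>. The quadratic statistic is therefore never treated as a function of a random
  element of \<open>C01\<close>. Every bound carries the factor \<open>1 + v u\<close>, whose square
  is integrable against \<open>w\<close>, and the square root of the statistic is a weighted L2 norm
  of a series, Lipschitz in the l1 norm of its coordinates. The error of replacing the statistic by
  its expansion is likewise a random variable free of \<open>u\<close> times \<open>1 + v u\<close>.
  The two estimator components are coordinates of the same sequence as the indicators, because the
  covariance of the limit involves their joint law. A second moment of \<open>Y\<close> is not among
  the hypotheses: the drift inequality of the chain is integrated after truncation, since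
  integrating it directly would presuppose the moment. The square root in the summability condition
  is where this second moment is consumed.\<close>

locale ergodic_map = prob_space P for P :: "'b measure" +
  fixes \<theta> :: "'b \<Rightarrow> 'b"
  assumes measurable_map [measurable]: "\<theta> \<in> measurable P P"
    and preserving: "distr P P \<theta> = P"
    and ergodic: "A \<in> sets P \<Longrightarrow> \<theta> -` A \<inter> space P = A \<Longrightarrow> prob A \<in> {0, 1}"
begin

text \<open>The maximum of the Birkhoff sums of lengths 1 to \<open>n + 1\<close>, in recursive
  form: a sum started at \<open>x\<close> is \<open>f x\<close> plus either nothing or a sum started
  at \<open>\<theta> x\<close>. The recursion makes
  \<open>max_sum f (Suc n) x - max_sum f n (\<theta> x)\<close> explicit.\<close>

primrec max_sum :: "('b \<Rightarrow> real) \<Rightarrow> nat \<Rightarrow> 'b \<Rightarrow> real" where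
  "max_sum f 0 x = f x"
| "max_sum f (Suc n) x = f x + max 0 (max_sum f n (\<theta> x))"

definition birkhoff_sum :: "('b \<Rightarrow> real) \<Rightarrow> nat \<Rightarrow> 'b \<Rightarrow> real" where
  "birkhoff_sum f n x = (\<Sum>i<n. f ((\<theta> ^^ i) x))"

lemma max_sum_mono: "max_sum f n x \<le> max_sum f (Suc n) x"
proof (induction n arbitrary: x)
  case (Suc n)
  show ?case using Suc[of "\<theta> x"] by simp
qed simp

lemma birkhoff_sum_Suc: "birkhoff_sum f (Suc n) x = f x + birkhoff_sum f n (\<theta> x)"
  unfolding birkhoff_sum_def by (subst sum.lessThan_Suc_shift) (simp add: funpow_swap1)

lemma birkhoff_sum_le_max_sum: "birkhoff_sum f (Suc n) x \<le> max_sum f n x"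
proof (induction n arbitrary: x)
  case 0
  show ?case by (simp add: birkhoff_sum_def)
next
  case (Suc n)
  show ?case using Suc[of "\<theta> x"] by (subst birkhoff_sum_Suc) simp
qed

lemma measurable_max_sum [measurable]:
  "f \<in> borel_measurable P \<Longrightarrow> max_sum f n \<in> borel_measurable P"
proof (induction n)
  case 0 then show ?case by (simp add: fun_eq_iff[symmetric])
next
  case (Suc n)
  note [measurable] = Suc.prems Suc.IH[OF Suc.prems]
  have "(\<lambda>x. f x + max 0 (max_sum f n (\<theta> x))) \<in> borel_measurable P" by measurable
  then show ?case by simp
qed

lemma integrable_comp:
  fixes h :: "'b \<Rightarrow> real"
  assumes "integrable P h" shows "integrable P (\<lambda>x. h (\<theta> x))"
  using assms by (subst integrable_distr_eq[symmetric, of \<theta> P P]) (auto simp: preserving)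

lemma integral_comp:
  fixes h :: "'b \<Rightarrow> real"
  assumes [measurable]: "h \<in> borel_measurable P"
  shows "(\<integral>x. h (\<theta> x) \<partial>P) = (\<integral>x. h x \<partial>P)"
  by (subst integral_distr[symmetric, of \<theta> P P]) (auto simp: preserving)

lemma integrable_max_sum:
  assumes f: "integrable P f" shows "integrable P (max_sum f n)"
proof (induction n)
  case 0
  show ?case using f by simp
next
  case (Suc n)
  have "integrable P (\<lambda>x. f x + max 0 (max_sum f n (\<theta> x)))"
    using f integrable_comp[OF Suc] by auto
  then show ?case by simp
qed

lemma max_sum_ge: "f x \<le> max_sum f n x"
  by (induction n) (use max_sum_mono order_trans in \<open>auto\<close>)

text \<open>The set on which the maximal sums are unbounded is invariant, so it is null or full. If
  it were full, \<open>max_sum f (Suc n) x - max_sum f n (\<theta> x)\<close> would converge to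
  \<open>f x\<close> almost everywhere; its integral is nonnegative because the maxima increase and
  \<open>\<theta>\<close> preserves the measure, so the integral of \<open>f\<close> could not be
  negative.\<close>

lemma birkhoff_sum_bounded_above:
  assumes f: "integrable P f" and neg: "(\<integral>x. f x \<partial>P) < 0"
  shows "AE x in P. \<exists>B. \<forall>n. birkhoff_sum f n x \<le> B"
proof -
  have [measurable]: "f \<in> borel_measurable P" using f by auto
  define A where "A = {x \<in> space P. \<forall>B::nat. \<exists>n. max_sum f n x > real B}"
  have [measurable]: "A \<in> sets P" unfolding A_def by measurable
  have \<theta>space: "\<theta> x \<in> space P" if "x \<in> space P" for x
    using measurable_space[OF measurable_map that] .
  have inv: "x \<in> A \<longleftrightarrow> \<theta> x \<in> A" if x: "x \<in> space P" for x
  proof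
    assume a: "x \<in> A"
    show "\<theta> x \<in> A" unfolding A_def
    proof (safe)
      fix B :: nat
      obtain B' :: nat where B': "real B' > max (f x) (f x + real B)" using reals_Archimedean2 by blast
      obtain n where n: "max_sum f n x > real B'" using a by (auto simp: A_def)
      with B' have "n \<noteq> 0" by (cases n) auto
      then obtain m where "n = Suc m" by (cases n) auto
      with n B' show "\<exists>n. max_sum f n (\<theta> x) > real B" by (intro exI[of _ m]) auto
    qed (use \<theta>space x in auto)
  next
    assume a: "\<theta> x \<in> A"
    show "x \<in> A" unfolding A_def
    proof (safe)
      fix B :: nat
      obtain B' :: nat where B': "real B' > real B - f x" using reals_Archimedean2 by blast
      obtain n where n: "max_sum f n (\<theta> x) > real B'" using a by (auto simp: A_def)
      show "\<exists>n. max_sum f n x > real B" by (rule exI[of _ "Suc n"]) (use n B' in auto)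
    qed (use x in auto)
  qed
  have "prob A \<in> {0, 1}"
  proof (rule ergodic)
    show "\<theta> -` A \<inter> space P = A" using inv by (auto simp: A_def)
  qed simp
  moreover have "prob A \<noteq> 1"
  proof
    assume "prob A = 1"
    then have AE_A: "AE x in P. x \<in> A" using prob_eq_1[of A] by simp
    \<comment> \<open>The difference equals \<open>f x\<close> plus the negative part of
      \<open>max_sum f n (\<theta> x)\<close>. That part vanishes once the maximum is positive, and
      it is at most \<open>\<bar>f (\<theta> x)\<bar>\<close> because the maximum is at least
      \<open>f (\<theta> x)\<close>.\<close>
    let ?d = "\<lambda>n x. max_sum f (Suc n) x - max_sum f n (\<theta> x)"
    have "(\<lambda>n. (\<integral>x. ?d n x \<partial>P)) \<longlonglongrightarrow> (\<integral>x. f x \<partial>P)"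
    proof (rule integral_dominated_convergence[where w = "\<lambda>x. \<bar>f x\<bar> + \<bar>f (\<theta> x)\<bar>"])
      show "integrable P (\<lambda>x. \<bar>f x\<bar> + \<bar>f (\<theta> x)\<bar>)"
        using f integrable_comp[OF f] by auto
      show "AE x in P. (\<lambda>n. ?d n x) \<longlonglongrightarrow> f x"
        using AE_A
      proof eventually_elim
        case (elim x)
        then have "x \<in> space P" by (simp add: A_def)
        then have "\<theta> x \<in> A" using inv elim by blast
        then obtain n0 where n0: "max_sum f n0 (\<theta> x) > 0" by (auto simp: A_def dest: spec[of _ 0])
        have "max_sum f n (\<theta> x) > 0" if "n \<ge> n0" for n
          using n0 lift_Suc_mono_le[of "\<lambda>n. max_sum f n (\<theta> x)", OF max_sum_mono that] by linarith
        then have "eventually (\<lambda>n. ?d n x = f x) sequentially"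
          unfolding eventually_sequentially by (intro exI[of _ n0]) (auto simp: max_def less_imp_le)
        then show ?case by (rule tendsto_eventually)
      qed
      show "AE x in P. norm (?d n x) \<le> \<bar>f x\<bar> + \<bar>f (\<theta> x)\<bar>" for n
      proof (rule AE_I2)
        fix x
        show "norm (?d n x) \<le> \<bar>f x\<bar> + \<bar>f (\<theta> x)\<bar>"
          using max_sum_ge[of f "\<theta> x" n] by (simp add: max_def abs_if)
      qed
    qed measurable
    moreover have "(\<integral>x. ?d n x \<partial>P) \<ge> 0" for n
    proof -
      have "(\<integral>x. ?d n x \<partial>P) = (\<integral>x. max_sum f (Suc n) x \<partial>P) - (\<integral>x. max_sum f n (\<theta> x) \<partial>P)"
        using integrable_max_sum[OF f, of "Suc n"] integrable_comp[OF integrable_max_sum[OF f, of n]]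
        by (intro Bochner_Integration.integral_diff)
      also have "(\<integral>x. max_sum f n (\<theta> x) \<partial>P) = (\<integral>x. max_sum f n x \<partial>P)"
        by (rule integral_comp) simp
      also have "(\<integral>x. max_sum f (Suc n) x \<partial>P) - \<dots> \<ge> 0"
        using integral_mono[OF integrable_max_sum[OF f, of n] integrable_max_sum[OF f, of "Suc n"]] max_sum_mono
        by (simp del: max_sum.simps)
      finally show ?thesis .
    qed
    ultimately have "(\<integral>x. f x \<partial>P) \<ge> 0"
      by (intro LIMSEQ_le_const) auto
    with neg show False by simp
  qed
  ultimately have "AE x in P. x \<notin> A" using prob_eq_0[of A] by auto
  with AE_space show ?thesis
  proof eventually_elim
    case (elim x)
    then obtain B :: nat where B: "\<And>n. max_sum f n x \<le> real B" by (force simp: A_def not_less)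
    have "birkhoff_sum f n x \<le> real B" for n
    proof (cases n)
      case 0 then show ?thesis by (simp add: birkhoff_sum_def)
    next
      case (Suc m)
      then show ?thesis using birkhoff_sum_le_max_sum[of f m x] B by (meson order_trans)
    qed
    then show ?case by blast
  qed
qed

text \<open>Subtracting a constant \<open>e'\<close> strictly between the mean and \<open>e\<close>
  makes the mean negative, so the sums of \<open>f - e'\<close> are bounded above; the bound divided
  by \<open>n\<close> falls below the gap \<open>e - e'\<close>.\<close>

lemma birkhoff_sum_limsup:
  assumes f: "integrable P f" and e: "e > (\<integral>x. f x \<partial>P)"
  shows "AE x in P. \<forall>\<^sub>F n in sequentially. birkhoff_sum f n x / real n < e"
proof -
  obtain e' where e': "(\<integral>x. f x \<partial>P) < e'" "e' < e" using dense[OF e] by blast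
  have "AE x in P. \<exists>B. \<forall>n. birkhoff_sum (\<lambda>x. f x - e') n x \<le> B"
    using f e' by (intro birkhoff_sum_bounded_above) (auto simp: prob_space)
  then show ?thesis
  proof eventually_elim
    case (elim x)
    then obtain B where B: "\<And>n. birkhoff_sum f n x \<le> B + real n * e'"
      by (auto simp: birkhoff_sum_def sum_subtractf algebra_simps)
    have "(\<lambda>n. B / real n) \<longlonglongrightarrow> 0" by (rule lim_const_over_n)
    then have "\<forall>\<^sub>F n in sequentially. B / real n < e - e'"
      by (rule order_tendstoD) (use e' in simp)
    then show ?case using eventually_gt_at_top[of 0]
    proof eventually_elim
      case (elim n)
      have "birkhoff_sum f n x / real n \<le> (B + real n * e') / real n"
        by (rule divide_right_mono[OF B]) simp
      also have "\<dots> = B / real n + e'" using elim by (simp add: field_simps)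
      finally show ?case using elim by simp
    qed
  qed
qed

theorem birkhoff:
  assumes f: "integrable P f"
  shows "AE x in P. (\<lambda>n. birkhoff_sum f n x / real n) \<longlonglongrightarrow> (\<integral>x. f x \<partial>P)"
proof -
  let ?m = "\<integral>x. f x \<partial>P"
  have "AE x in P. \<forall>k::nat. \<forall>\<^sub>F n in sequentially. birkhoff_sum f n x / real n < ?m + 1 / Suc k"
    unfolding AE_all_countable by (intro allI birkhoff_sum_limsup f) simp
  moreover have "AE x in P. \<forall>k::nat. \<forall>\<^sub>F n in sequentially.
      birkhoff_sum (\<lambda>x. - f x) n x / real n < - ?m + 1 / Suc k"
    unfolding AE_all_countable by (intro allI birkhoff_sum_limsup) (use f in auto)
  ultimately show ?thesis
  proof eventually_elim
    case (elim x)
    show ?case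
    proof (rule LIMSEQ_I)
      fix r :: real assume "r > 0"
      then obtain k where k: "1 / Suc k < r" using nat_approx_posE by blast
      have "\<forall>\<^sub>F n in sequentially. norm (birkhoff_sum f n x / real n - ?m) < r"
        using elim(1)[rule_format, of k] elim(2)[rule_format, of k]
      proof eventually_elim
        case (elim n)
        then show ?case using k by (auto simp: birkhoff_sum_def sum_negf abs_less_iff)
      qed
      then show "\<exists>no. \<forall>n\<ge>no. norm (birkhoff_sum f n x / real n - ?m) < r"
        by (simp add: eventually_sequentially)
    qed
  qed
qed

lemma integrable_funpow:
  fixes h :: "'b \<Rightarrow> real"
  assumes "integrable P h" shows "integrable P (\<lambda>x. h ((\<theta> ^^ i) x))"
  using assms
proof (induction i arbitrary: h)
  case (Suc i)
  show ?case using Suc.IH[OF integrable_comp[OF Suc.prems]] by simp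
qed simp

lemma integral_funpow:
  fixes h :: "'b \<Rightarrow> real"
  assumes "h \<in> borel_measurable P" shows "(\<integral>x. h ((\<theta> ^^ i) x) \<partial>P) = (\<integral>x. h x \<partial>P)"
  using assms
proof (induction i arbitrary: h)
  case (Suc i)
  note [measurable] = Suc.prems
  show ?case using Suc.IH[of "\<lambda>x. h (\<theta> x)"] integral_comp[of h] by simp
qed simp

text \<open>Scheffe's argument: for nonnegative \<open>f\<close> the negative part of the deviation
  is dominated by the constant mean, hence converges in mean, and since the averages have the right
  mean the L1 norm is twice the integral of that part.\<close>

theorem birkhoff_L1:
  assumes f: "integrable P f" and nonneg: "\<And>x. f x \<ge> 0"
  shows "(\<lambda>n. \<integral>x. \<bar>birkhoff_sum f n x / real n - (\<integral>x. f x \<partial>P)\<bar> \<partial>P) \<longlonglongrightarrow> 0"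
proof -
  let ?m = "\<integral>x. f x \<partial>P"
  let ?A = "\<lambda>n x. birkhoff_sum f n x / real n"
  have [measurable]: "f \<in> borel_measurable P" using f by auto
  have [measurable]: "birkhoff_sum f n \<in> borel_measurable P" for n unfolding birkhoff_sum_def by measurable
  have m: "?m \<ge> 0" using nonneg by simp
  have intA: "integrable P (?A n)" for n
    unfolding birkhoff_sum_def using integrable_funpow[OF f] by (intro integrable_divide Bochner_Integration.integrable_sum) auto
  have EA: "(\<integral>x. ?A n x \<partial>P) = ?m" if "n > 0" for n
    unfolding birkhoff_sum_def using that integrable_funpow[OF f] by (simp add: integral_funpow)
  have "(\<lambda>n. \<integral>x. max 0 (?m - ?A n x) \<partial>P) \<longlonglongrightarrow> (\<integral>x. 0 \<partial>P)"
  proof (rule integral_dominated_convergence[where w = "\<lambda>_. ?m"])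
    show "AE x in P. (\<lambda>n. max 0 (?m - ?A n x)) \<longlonglongrightarrow> 0"
      using birkhoff[OF f]
    proof eventually_elim
      case (elim x)
      have "(\<lambda>n. max 0 (?m - ?A n x)) \<longlonglongrightarrow> max 0 (?m - ?m)"
        by (intro tendsto_intros elim)
      then show ?case by simp
    qed
    show "AE x in P. norm (max 0 (?m - ?A n x)) \<le> ?m" for n
      using m nonneg by (intro AE_I2) (auto simp: birkhoff_sum_def sum_nonneg)
  qed auto
  then have "(\<lambda>n. 2 * (\<integral>x. max 0 (?m - ?A n x) \<partial>P)) \<longlonglongrightarrow> 0"
    by (auto intro: tendsto_mult_right_zero)
  moreover have "\<forall>\<^sub>F n in sequentially. 2 * (\<integral>x. max 0 (?m - ?A n x) \<partial>P) = (\<integral>x. \<bar>?A n x - ?m\<bar> \<partial>P)"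
    using eventually_gt_at_top[of 0]
  proof eventually_elim
    case (elim n)
    have "(\<integral>x. \<bar>?A n x - ?m\<bar> \<partial>P) = (\<integral>x. 2 * max 0 (?m - ?A n x) + (?A n x - ?m) \<partial>P)"
      by (rule Bochner_Integration.integral_cong) (auto simp: max_def abs_if)
    also have "\<dots> = 2 * (\<integral>x. max 0 (?m - ?A n x) \<partial>P) + ((\<integral>x. ?A n x \<partial>P) - ?m)"
      using intA[of n] by (subst Bochner_Integration.integral_add) (auto simp: prob_space)
    finally show ?case using EA[OF elim] by simp
  qed
  ultimately show ?thesis by (rule Lim_transform_eventually)
qed

end

section \<open>A martingale central limit theorem\<close>

text \<open>A discrete variation of constants formula. With \<open>x t\<close> the characteristic
  function of the sum of \<open>t\<close> terms and \<open>\<tau>\<close> the one-step Gaussian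
  factor, it turns one-step errors into the error after \<open>n\<close> steps.\<close>

lemma power_telescope:
  fixes x :: "nat \<Rightarrow> 'a::comm_ring_1"
  shows "x n - \<tau> ^ n * x 0 = (\<Sum>t<n. \<tau> ^ (n - 1 - t) * (x (Suc t) - \<tau> * x t))"
proof (induction n)
  case (Suc n)
  have "(\<Sum>t<n. \<tau> ^ (n - t) * (x (Suc t) - \<tau> * x t)) = \<tau> * (\<Sum>t<n. \<tau> ^ (n - 1 - t) * (x (Suc t) - \<tau> * x t))"
    unfolding sum_distrib_left
  proof (rule sum.cong)
    fix t assume "t \<in> {..<n}"
    then have "n - t = Suc (n - 1 - t)" by auto
    then show "\<tau> ^ (n - t) * (x (Suc t) - \<tau> * x t) = \<tau> * (\<tau> ^ (n - 1 - t) * (x (Suc t) - \<tau> * x t))"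
      by (metis (no_types) mult.assoc power_Suc)
  qed simp
  then show ?case using Suc by (simp add: algebra_simps)
qed simp

text \<open>Abel summation: moving the index of \<open>u\<close> by one costs two boundary terms and
  the increments of the weights \<open>a\<close>.\<close>

lemma summation_by_parts_shift:
  fixes a u :: "nat \<Rightarrow> 'a::comm_ring_1"
  shows "(\<Sum>t<Suc n. a t * u t) - (\<Sum>t<Suc n. a t * u (Suc t)) =
    a 0 * u 0 - a n * u (Suc n) + (\<Sum>t<n. (a (Suc t) - a t) * u (Suc t))"
  by (subst sum.lessThan_Suc_shift) (simp add: sum_subtractf algebra_simps)

lemma iexp_second_order:
  "cmod (iexp x - (1 + \<i> * x - x\<^sup>2 / 2)) \<le> min (x\<^sup>2) (\<bar>x\<bar> ^ 3 / 6)"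
proof -
  have "(\<Sum>k \<le> 2. (\<i> * x)^k / fact k) = 1 + \<i> * complex_of_real x - x\<^sup>2 / 2"
    by (simp add: numeral_2_eq_2 power_mult_distrib fact_numeral)
  with iexp_approx1[of x 2] iexp_approx2[of x 2] show ?thesis
    by (simp add: fact_numeral numeral_eq_Suc)
qed

text \<open>The library version restricts the points of the measure space to a Euclidean space.\<close>

lemma integral_norm_bound_le:
  fixes f :: "'a \<Rightarrow> 'b::{banach, second_countable_topology}"
  assumes "integrable M f" "integrable M g" "\<And>x. x \<in> space M \<Longrightarrow> norm (f x) \<le> g x"
  shows "norm (\<integral>x. f x \<partial>M) \<le> (\<integral>x. g x \<partial>M)"
  by (rule order_trans[OF integral_norm_bound integral_mono[OF integrable_norm[OF assms(1)] assms(2,3)]])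

text \<open>The martingale property enters only as \<open>orthogonal\<close>: the next term has mean
  zero against exponentials of the preceding partial sum. Ergodicity enters only as the L1 law of
  large numbers for the squares.\<close>

locale stationary_martingale_difference = prob_space M for M :: "'a measure" +
  fixes d :: "nat \<Rightarrow> 'a \<Rightarrow> real" and v :: real
  assumes measurable_d [measurable]: "\<And>t. d t \<in> borel_measurable M"
    and stationary: "\<And>t. distr M borel (\<lambda>\<omega> n. d (t + n) \<omega>) = distr M borel (\<lambda>\<omega> n. d n \<omega>)"
    and square_integrable: "integrable M (\<lambda>\<omega>. (d 0 \<omega>)\<^sup>2)"
    and orthogonal: "\<And>t c. (\<integral>\<omega>. iexp (c * (\<Sum>s<t. d s \<omega>)) * of_real (d t \<omega>) \<partial>M) = 0"
    and variance: "v = (\<integral>\<omega>. (d 0 \<omega>)\<^sup>2 \<partial>M)"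
    and variance_ergodic: "(\<lambda>m. \<integral>\<omega>. \<bar>(\<Sum>j<m. (d j \<omega>)\<^sup>2) / real m - v\<bar> \<partial>M) \<longlonglongrightarrow> 0"
begin

lemma shift_integral:
  fixes h :: "(nat \<Rightarrow> real) \<Rightarrow> real"
  assumes [measurable]: "h \<in> borel_measurable borel"
  shows "(\<integral>\<omega>. h (\<lambda>n. d (t + n) \<omega>) \<partial>M) = (\<integral>\<omega>. h (\<lambda>n. d n \<omega>) \<partial>M)"
proof -
  have [measurable]: "(\<lambda>\<omega> n. d (t + n) \<omega>) \<in> borel_measurable M" for t
    by (rule measurable_coordinatewise_then_product) simp
  show ?thesis
    using integral_distr[of "\<lambda>\<omega> n. d (t + n) \<omega>" M borel h] integral_distr[of "\<lambda>\<omega> n. d n \<omega>" M borel h]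
      stationary[of t] measurable_coordinatewise_then_product[of "\<lambda>\<omega> n. d n \<omega>" M] by simp
qed

lemma shift_integrable:
  fixes h :: "(nat \<Rightarrow> real) \<Rightarrow> real"
  assumes [measurable]: "h \<in> borel_measurable borel"
  shows "integrable M (\<lambda>\<omega>. h (\<lambda>n. d (t + n) \<omega>)) \<longleftrightarrow> integrable M (\<lambda>\<omega>. h (\<lambda>n. d n \<omega>))"
proof -
  have [measurable]: "(\<lambda>\<omega> n. d (t + n) \<omega>) \<in> borel_measurable M" for t
    by (rule measurable_coordinatewise_then_product) simp
  show ?thesis
    using integrable_distr_eq[of "\<lambda>\<omega> n. d (t + n) \<omega>" M borel h] integrable_distr_eq[of "\<lambda>\<omega> n. d n \<omega>" M borel h]
      stationary[of t] measurable_coordinatewise_then_product[of "\<lambda>\<omega> n. d n \<omega>" M] by simp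
qed

lemma integrable_sq: "integrable M (\<lambda>\<omega>. (d t \<omega>)\<^sup>2)"
  using shift_integrable[of "\<lambda>z. (z 0)\<^sup>2" t] square_integrable by simp

lemma integrable_d: "integrable M (d t)"
  using integrable_sq[of t] by (rule square_integrable_imp_integrable[rotated]) simp

lemma v_nonneg: "v \<ge> 0"
  unfolding variance by simp

abbreviation S :: "nat \<Rightarrow> 'a \<Rightarrow> real" where "S t \<omega> \<equiv> \<Sum>s<t. d s \<omega>"

definition cs :: "nat \<Rightarrow> 'a \<Rightarrow> real" where "cs t \<omega> = (d t \<omega>)\<^sup>2 - v"

lemma measurable_cs [measurable]: "cs t \<in> borel_measurable M"
  unfolding cs_def by measurable

lemma integrable_cs: "integrable M (cs t)"
  unfolding cs_def using integrable_sq by auto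

text \<open>The bound for one increment of the telescoping weights. The cap 2 makes it dominated,
  the other branch makes it vanish with \<open>c\<close>, so its mean against an integrable factor
  tends to zero by dominated convergence.\<close>

definition G :: "real \<Rightarrow> real \<Rightarrow> real" where "G c y = min 2 (\<bar>c * y\<bar> + c\<^sup>2 * v)"

lemma G_nonneg: "G c y \<ge> 0" using v_nonneg by (auto simp: G_def)

lemma integrable_G: "integrable M (\<lambda>\<omega>. G c (d s \<omega>) * \<bar>cs t \<omega>\<bar>)"
  by (rule Bochner_Integration.integrable_bound[of M "\<lambda>\<omega>. 2 * \<bar>cs t \<omega>\<bar>"])
     (use integrable_cs v_nonneg in \<open>auto simp: G_def abs_mult intro!: mult_right_mono\<close>)

text \<open>Four error budgets, all free of the time index by stationarity: \<open>H\<close> for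
  shifting the centred squares by one step, \<open>X\<close> for a boundary term, \<open>L\<close>
  for a window average, \<open>R\<close> for the Taylor remainder of the exponential.\<close>

definition H :: "real \<Rightarrow> nat \<Rightarrow> real" where "H c j = (\<integral>\<omega>. G c (d 0 \<omega>) * \<bar>cs (Suc j) \<omega>\<bar> \<partial>M)"
definition X :: real where "X = (\<integral>\<omega>. \<bar>cs 0 \<omega>\<bar> \<partial>M)"
definition L :: "nat \<Rightarrow> real" where "L m = (\<integral>\<omega>. \<bar>(\<Sum>j<m. (d j \<omega>)\<^sup>2) / real m - v\<bar> \<partial>M)"
definition R :: "real \<Rightarrow> real" where "R c = (\<integral>\<omega>. min ((c * d 0 \<omega>)\<^sup>2) (\<bar>c * d 0 \<omega>\<bar> ^ 3 / 6) \<partial>M)"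

lemma H_shift: "(\<integral>\<omega>. G c (d t \<omega>) * \<bar>cs (Suc t + j) \<omega>\<bar> \<partial>M) = H c j"
proof -
  have "(\<lambda>z. G c (z 0) * \<bar>(z (Suc j))\<^sup>2 - v\<bar>) \<in> borel_measurable borel"
    unfolding G_def by measurable
  from shift_integral[OF this, of t] show ?thesis by (simp add: H_def cs_def)
qed

lemma X_shift: "(\<integral>\<omega>. \<bar>cs t \<omega>\<bar> \<partial>M) = X"
  using shift_integral[of "\<lambda>z. \<bar>(z 0)\<^sup>2 - v\<bar>" t] by (simp add: X_def cs_def)

lemma L_shift: "(\<integral>\<omega>. \<bar>(\<Sum>j<m. (d (t + j) \<omega>)\<^sup>2) / real m - v\<bar> \<partial>M) = L m"
  using shift_integral[of "\<lambda>z. \<bar>(\<Sum>j<m. (z j)\<^sup>2) / real m - v\<bar>" t] by (simp add: L_def)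

lemma R_shift: "(\<integral>\<omega>. min ((c * d t \<omega>)\<^sup>2) (\<bar>c * d t \<omega>\<bar> ^ 3 / 6) \<partial>M) = R c"
  using shift_integral[of "\<lambda>z. min ((c * z 0)\<^sup>2) (\<bar>c * z 0\<bar> ^ 3 / 6)" t] by (simp add: R_def)

lemma X_nonneg: "X \<ge> 0" by (simp add: X_def)
lemma H_nonneg: "H c j \<ge> 0" by (simp add: H_def G_nonneg)

text \<open>Summation by parts leaves two boundary terms, each of mean at most \<open>X\<close>, and
  fewer than \<open>n\<close> increments. Each of these contributes at most \<open>H c j\<close>,
  because the increment is bounded by a function of the term \<open>j + 1\<close> steps before the
  centred square it multiplies.\<close>

lemma weight_shift:
  fixes a :: "nat \<Rightarrow> 'a \<Rightarrow> complex"
  assumes [measurable]: "\<And>t. a t \<in> borel_measurable M"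
    and a1: "\<And>t \<omega>. norm (a t \<omega>) \<le> 1"
    and a2: "\<And>t \<omega>. Suc t < n \<Longrightarrow> norm (a (Suc t) \<omega> - a t \<omega>) \<le> G c (d t \<omega>)"
  shows "norm ((\<integral>\<omega>. (\<Sum>t<n. a t \<omega> * of_real (cs (t + j) \<omega>)) \<partial>M)
             - (\<integral>\<omega>. (\<Sum>t<n. a t \<omega> * of_real (cs (t + Suc j) \<omega>)) \<partial>M)) \<le> 2 * X + real n * H c j"
proof (cases n)
  case 0 then show ?thesis using X_nonneg by simp
next
  case (Suc k)
  have int: "integrable M (\<lambda>\<omega>. a t \<omega> * of_real (cs i \<omega>))" for t i
    by (rule Bochner_Integration.integrable_bound[of M "\<lambda>\<omega>. cs i \<omega>"])
       (use integrable_cs a1 in \<open>auto simp: norm_mult intro!: mult_left_le_one_le\<close>)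
  have diff: "(\<integral>\<omega>. (\<Sum>t<n. a t \<omega> * of_real (cs (t + j) \<omega>)) \<partial>M) - (\<integral>\<omega>. (\<Sum>t<n. a t \<omega> * of_real (cs (t + Suc j) \<omega>)) \<partial>M)
    = (\<integral>\<omega>. (\<Sum>t<n. a t \<omega> * of_real (cs (t + j) \<omega>)) - (\<Sum>t<n. a t \<omega> * of_real (cs (t + Suc j) \<omega>)) \<partial>M)"
    by (rule Bochner_Integration.integral_diff[symmetric]; intro Bochner_Integration.integrable_sum int)
  have "norm (\<integral>\<omega>. (\<Sum>t<n. a t \<omega> * of_real (cs (t + j) \<omega>)) - (\<Sum>t<n. a t \<omega> * of_real (cs (t + Suc j) \<omega>)) \<partial>M)
    \<le> (\<integral>\<omega>. \<bar>cs j \<omega>\<bar> + \<bar>cs (Suc k + j) \<omega>\<bar> + (\<Sum>t<k. G c (d t \<omega>) * \<bar>cs (Suc t + j) \<omega>\<bar>) \<partial>M)"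
  proof (rule integral_norm_bound_le)
    show "integrable M (\<lambda>\<omega>. (\<Sum>t<n. a t \<omega> * of_real (cs (t + j) \<omega>)) - (\<Sum>t<n. a t \<omega> * of_real (cs (t + Suc j) \<omega>)))"
      by (intro Bochner_Integration.integrable_diff Bochner_Integration.integrable_sum int)
    show "integrable M (\<lambda>\<omega>. \<bar>cs j \<omega>\<bar> + \<bar>cs (Suc k + j) \<omega>\<bar> + (\<Sum>t<k. G c (d t \<omega>) * \<bar>cs (Suc t + j) \<omega>\<bar>))"
      using integrable_cs integrable_G by (intro Bochner_Integration.integrable_add Bochner_Integration.integrable_sum integrable_abs) auto
    fix \<omega> assume "\<omega> \<in> space M"
    have "(\<Sum>t<n. a t \<omega> * of_real (cs (t + j) \<omega>)) - (\<Sum>t<n. a t \<omega> * of_real (cs (t + Suc j) \<omega>))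
      = a 0 \<omega> * of_real (cs j \<omega>) - a k \<omega> * of_real (cs (Suc k + j) \<omega>)
        + (\<Sum>t<k. (a (Suc t) \<omega> - a t \<omega>) * of_real (cs (Suc t + j) \<omega>))"
      using summation_by_parts_shift[of "\<lambda>t. a t \<omega>" "\<lambda>t. of_real (cs (t + j) \<omega>)" k] Suc by simp
    also have "norm \<dots> \<le> norm (a 0 \<omega> * of_real (cs j \<omega>)) + norm (a k \<omega> * of_real (cs (Suc k + j) \<omega>))
       + norm (\<Sum>t<k. (a (Suc t) \<omega> - a t \<omega>) * of_real (cs (Suc t + j) \<omega>))"
      by (meson add_mono norm_triangle_ineq norm_triangle_ineq4 order_refl order_trans)
    also have "norm (a 0 \<omega> * of_real (cs j \<omega>)) \<le> \<bar>cs j \<omega>\<bar>"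
      using a1[of 0 \<omega>] by (simp add: norm_mult mult_left_le_one_le)
    also have "norm (a k \<omega> * of_real (cs (Suc k + j) \<omega>)) \<le> \<bar>cs (Suc k + j) \<omega>\<bar>"
      using a1[of k \<omega>] by (simp add: norm_mult mult_left_le_one_le)
    also have "norm (\<Sum>t<k. (a (Suc t) \<omega> - a t \<omega>) * of_real (cs (Suc t + j) \<omega>)) \<le> (\<Sum>t<k. G c (d t \<omega>) * \<bar>cs (Suc t + j) \<omega>\<bar>)"
      by (rule sum_norm_le) (use a2 Suc in \<open>auto simp: norm_mult intro!: mult_right_mono\<close>)
    finally show "norm ((\<Sum>t<n. a t \<omega> * of_real (cs (t + j) \<omega>)) - (\<Sum>t<n. a t \<omega> * of_real (cs (t + Suc j) \<omega>)))
       \<le> \<bar>cs j \<omega>\<bar> + \<bar>cs (Suc k + j) \<omega>\<bar> + (\<Sum>t<k. G c (d t \<omega>) * \<bar>cs (Suc t + j) \<omega>\<bar>)" by simp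
  qed
  also have "\<dots> = (\<integral>\<omega>. \<bar>cs j \<omega>\<bar> \<partial>M) + (\<integral>\<omega>. \<bar>cs (Suc k + j) \<omega>\<bar> \<partial>M) + (\<integral>\<omega>. (\<Sum>t<k. G c (d t \<omega>) * \<bar>cs (Suc t + j) \<omega>\<bar>) \<partial>M)"
    by (subst Bochner_Integration.integral_add, (intro Bochner_Integration.integrable_add Bochner_Integration.integrable_sum integrable_abs integrable_cs integrable_G)+)+ simp
  also have "(\<integral>\<omega>. (\<Sum>t<k. G c (d t \<omega>) * \<bar>cs (Suc t + j) \<omega>\<bar>) \<partial>M) = (\<Sum>t<k. H c j)"
    by (subst Bochner_Integration.integral_sum, rule integrable_G) (simp only: H_shift)
  also have "(\<integral>\<omega>. \<bar>cs j \<omega>\<bar> \<partial>M) + (\<integral>\<omega>. \<bar>cs (Suc k + j) \<omega>\<bar> \<partial>M) + (\<Sum>t<k. H c j) = X + X + (\<Sum>t<k. H c j)"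
    by (simp only: X_shift)
  also have "\<dots> \<le> 2 * X + real n * H c j"
    using Suc H_nonneg[of c j] by (simp add: algebra_simps)
  finally show ?thesis unfolding diff .
qed

text \<open>The characteristic function is telescoped with weights \<open>a t\<close> that change slowly in \<open>t\<close>, so the
  centred squares \<open>cs t\<close> may be replaced by their averages over a window of length \<open>m\<close>; these are
  small in \<open>L\<^sup>1\<close> by ergodicity. Conditional variances are not needed.\<close>

lemma weight_average:
  fixes a :: "nat \<Rightarrow> 'a \<Rightarrow> complex"
  assumes [measurable]: "\<And>t. a t \<in> borel_measurable M"
    and a1: "\<And>t \<omega>. norm (a t \<omega>) \<le> 1"
    and a2: "\<And>t \<omega>. Suc t < n \<Longrightarrow> norm (a (Suc t) \<omega> - a t \<omega>) \<le> G c (d t \<omega>)"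
    and m: "m > 0"
  shows "norm (\<integral>\<omega>. (\<Sum>t<n. a t \<omega> * of_real (cs t \<omega>)) \<partial>M)
    \<le> (\<Sum>i<m. 2 * X + real n * H c i) + real n * L m"
proof -
  let ?N = "\<lambda>j. \<integral>\<omega>. (\<Sum>t<n. a t \<omega> * of_real (cs (t + j) \<omega>)) \<partial>M"
  let ?K = "\<Sum>i<m. 2 * X + real n * H c i"
  have int: "integrable M (\<lambda>\<omega>. a t \<omega> * of_real (cs i \<omega>))" for t i
    by (rule Bochner_Integration.integrable_bound[of M "\<lambda>\<omega>. cs i \<omega>"])
       (use integrable_cs a1 in \<open>auto simp: norm_mult intro!: mult_left_le_one_le\<close>)
  have N: "norm (?N 0 - ?N j) \<le> (\<Sum>i<j. 2 * X + real n * H c i)" for j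
  proof (induction j)
    case (Suc j)
    from norm_diff_triangle_le[OF Suc weight_shift[OF assms(1) a1 a2, of n j]]
    show ?case by simp
  qed simp
  have K: "norm (?N 0 - ?N j) \<le> ?K" if "j < m" for j
  proof -
    have "(\<Sum>i<j. 2 * X + real n * H c i) \<le> ?K"
      using that X_nonneg H_nonneg by (intro sum_mono2) auto
    with N[of j] show ?thesis by linarith
  qed
  have avg: "(\<Sum>j<m. ?N j) = of_nat m * (\<integral>\<omega>. (\<Sum>t<n. a t \<omega> * of_real ((\<Sum>j<m. (d (t + j) \<omega>)\<^sup>2) / real m - v)) \<partial>M)"
  proof -
    have "(\<Sum>j<m. ?N j) = (\<integral>\<omega>. (\<Sum>j<m. \<Sum>t<n. a t \<omega> * of_real (cs (t + j) \<omega>)) \<partial>M)"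
      by (rule Bochner_Integration.integral_sum[symmetric]) (intro Bochner_Integration.integrable_sum int)
    also have "\<dots> = (\<integral>\<omega>. of_nat m * (\<Sum>t<n. a t \<omega> * of_real ((\<Sum>j<m. (d (t + j) \<omega>)\<^sup>2) / real m - v)) \<partial>M)"
    proof (rule Bochner_Integration.integral_cong)
      fix \<omega>
      have *: "of_real (real m) * (of_real ((\<Sum>j<m. (d (t + j) \<omega>)\<^sup>2) / real m - v) :: complex) = of_real (\<Sum>j<m. cs (t + j) \<omega>)" for t
        unfolding of_real_mult[symmetric] using m by (simp add: cs_def sum_subtractf field_simps)
      have "(\<Sum>j<m. \<Sum>t<n. a t \<omega> * of_real (cs (t + j) \<omega>)) = (\<Sum>t<n. a t \<omega> * of_real (\<Sum>j<m. cs (t + j) \<omega>))"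
        by (subst sum.swap) (simp add: sum_distrib_left)
      also have "\<dots> = of_nat m * (\<Sum>t<n. a t \<omega> * of_real ((\<Sum>j<m. (d (t + j) \<omega>)\<^sup>2) / real m - v))"
        unfolding sum_distrib_left *[symmetric] by (simp add: mult_ac)
      finally show "(\<Sum>j<m. \<Sum>t<n. a t \<omega> * of_real (cs (t + j) \<omega>)) = \<dots>" .
    qed simp
    finally show ?thesis by simp
  qed
  let ?A = "\<integral>\<omega>. (\<Sum>t<n. a t \<omega> * of_real ((\<Sum>j<m. (d (t + j) \<omega>)\<^sup>2) / real m - v)) \<partial>M"
  have intd: "integrable M (\<lambda>\<omega>. (\<Sum>j<m. (d (t + j) \<omega>)\<^sup>2) / real m - v)" for t
    using integrable_sq by auto
  have intad: "integrable M (\<lambda>\<omega>. a t \<omega> * of_real ((\<Sum>j<m. (d (t + j) \<omega>)\<^sup>2) / real m - v))" for t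
    by (rule Bochner_Integration.integrable_bound[OF intd[of t]])
       (use a1 in \<open>auto simp: norm_mult simp del: of_real_diff of_real_divide intro!: mult_left_le_one_le\<close>)
  have "norm ?A \<le> (\<integral>\<omega>. (\<Sum>t<n. \<bar>(\<Sum>j<m. (d (t + j) \<omega>)\<^sup>2) / real m - v\<bar>) \<partial>M)"
  proof (rule integral_norm_bound_le)
    show "integrable M (\<lambda>\<omega>. (\<Sum>t<n. a t \<omega> * of_real ((\<Sum>j<m. (d (t + j) \<omega>)\<^sup>2) / real m - v)))"
      by (intro Bochner_Integration.integrable_sum intad)
    show "integrable M (\<lambda>\<omega>. (\<Sum>t<n. \<bar>(\<Sum>j<m. (d (t + j) \<omega>)\<^sup>2) / real m - v\<bar>))"
      by (intro Bochner_Integration.integrable_sum integrable_abs intd)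
    fix \<omega>
    show "norm (\<Sum>t<n. a t \<omega> * of_real ((\<Sum>j<m. (d (t + j) \<omega>)\<^sup>2) / real m - v)) \<le> (\<Sum>t<n. \<bar>(\<Sum>j<m. (d (t + j) \<omega>)\<^sup>2) / real m - v\<bar>)"
      by (rule sum_norm_le) (use a1 in \<open>auto simp: norm_mult simp del: of_real_diff of_real_divide intro!: mult_left_le_one_le\<close>)
  qed
  also have "\<dots> = real n * L m"
    by (subst Bochner_Integration.integral_sum) (use intd in \<open>auto simp: L_shift\<close>)
  finally have A: "norm ?A \<le> real n * L m" .
  have "real m * norm (?N 0) = norm (of_nat m * ?N 0)" by (simp add: norm_mult)
  also have "of_nat m * ?N 0 = (\<Sum>j<m. ?N 0 - ?N j) + of_nat m * ?A"
    unfolding avg[symmetric] by (simp add: sum_subtractf)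
  also have "norm \<dots> \<le> (\<Sum>j<m. ?K) + real m * (real n * L m)"
  proof (rule order_trans[OF norm_triangle_ineq add_mono])
    show "norm (\<Sum>j<m. ?N 0 - ?N j) \<le> (\<Sum>j<m. ?K)"
      by (rule sum_norm_le, rule K) simp
    show "norm (of_nat m * ?A) \<le> real m * (real n * L m)"
      unfolding norm_mult norm_of_nat by (rule mult_left_mono[OF A]) simp
  qed
  also have "\<dots> = real m * (?K + real n * L m)" by (simp add: algebra_simps)
  finally show ?thesis using m by simp
qed

text \<open>The factor \<open>iexp (c * d t)\<close> is compared with the Gaussian factor
  \<open>\<tau>\<close> one step at a time. The linear term of the exponential drops out by
  \<open>orthogonal\<close>; what remains is the centred square, the Taylor remainder and the error
  of \<open>\<tau>\<close> against \<open>1 - c\<^sup>2 * v / 2\<close>.\<close>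

lemma char_bound:
  fixes c :: real
  assumes m: "m > 0"
  defines "\<tau> \<equiv> exp (- c\<^sup>2 * v / 2)"
  shows "norm ((\<integral>\<omega>. iexp (c * S n \<omega>) \<partial>M) - of_real (\<tau> ^ n))
    \<le> c\<^sup>2 / 2 * ((\<Sum>i<m. 2 * X + real n * H c i) + real n * L m) + real n * R c + real n * (c\<^sup>2 * v)\<^sup>2"
proof -
  define e where "e = (\<lambda>t \<omega>. iexp (c * S t \<omega>))"
  have [measurable]: "e t \<in> borel_measurable M" for t unfolding e_def by measurable
  have e1: "norm (e t \<omega>) = 1" for t \<omega> by (simp add: e_def)
  have \<tau>: "0 < \<tau>" "\<tau> \<le> 1" using v_nonneg by (auto simp: \<tau>_def)
  define \<rho> where "\<rho> = (\<lambda>t \<omega>. iexp (c * d t \<omega>) - (1 + \<i> * of_real (c * d t \<omega>) - of_real ((c * d t \<omega>)\<^sup>2 / 2)))"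
  have [measurable]: "\<rho> t \<in> borel_measurable M" for t unfolding \<rho>_def by measurable
  have \<rho>: "norm (\<rho> t \<omega>) \<le> min ((c * d t \<omega>)\<^sup>2) (\<bar>c * d t \<omega>\<bar> ^ 3 / 6)" for t \<omega>
    using iexp_second_order[of "c * d t \<omega>"] by (simp add: \<rho>_def)
  define r where "r = 1 - \<tau> - c\<^sup>2 * v / 2"
  have z: "c\<^sup>2 * v / 2 \<ge> 0" using v_nonneg by simp
  have r: "\<bar>r\<bar> \<le> (c\<^sup>2 * v)\<^sup>2"
  proof -
    let ?z = "c\<^sup>2 * v / 2"
    have "1 - ?z \<le> exp (- ?z)" using exp_ge_add_one_self[of "- ?z"] by simp
    moreover have "exp (- ?z) \<le> 1 - ?z + ?z\<^sup>2"
    proof -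
      have "exp (- ?z) \<le> 1 / (1 + ?z)"
        using exp_ge_add_one_self[of ?z] z by (simp add: exp_minus field_simps)
      also have "\<dots> \<le> 1 - ?z + ?z\<^sup>2"
      proof -
        have "1 \<le> (1 - ?z + ?z\<^sup>2) * (1 + ?z)"
          using zero_le_power[OF z, of 3] by (simp add: algebra_simps power2_eq_square power3_eq_cube)
        then show ?thesis using z by (subst pos_divide_le_eq) auto
      qed
      finally show ?thesis .
    qed
    ultimately have "\<bar>r\<bar> \<le> ?z\<^sup>2" by (auto simp: r_def \<tau>_def)
    also have "\<dots> \<le> (c\<^sup>2 * v)\<^sup>2" using v_nonneg by (intro power_mono) auto
    finally show ?thesis .
  qed
  have int_e: "integrable M (e t)" for t
    by (rule integrable_const_bound[of _ 1]) (auto simp: e1)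
  have int_ecs: "integrable M (\<lambda>\<omega>. e t \<omega> * of_real (cs t \<omega>))" for t
    by (rule Bochner_Integration.integrable_bound[OF integrable_cs[of t]]) (auto simp: norm_mult e1)
  have int_ed: "integrable M (\<lambda>\<omega>. e t \<omega> * of_real (d t \<omega>))" for t
    by (rule Bochner_Integration.integrable_bound[OF integrable_d[of t]]) (auto simp: norm_mult e1)
  have int_min: "integrable M (\<lambda>\<omega>. min ((c * d t \<omega>)\<^sup>2) (\<bar>c * d t \<omega>\<bar> ^ 3 / 6))" for t
    by (rule Bochner_Integration.integrable_bound[of M "\<lambda>\<omega>. c\<^sup>2 * (d t \<omega>)\<^sup>2"])
       (use integrable_sq in \<open>auto simp: power_mult_distrib\<close>)
  have int_e\<rho>: "integrable M (\<lambda>\<omega>. e t \<omega> * \<rho> t \<omega>)" for t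
    by (rule Bochner_Integration.integrable_bound[OF int_min[of t]])
       (use \<rho> in \<open>auto simp: norm_mult e1\<close>)
  have step: "(\<integral>\<omega>. e (Suc t) \<omega> \<partial>M) - of_real \<tau> * (\<integral>\<omega>. e t \<omega> \<partial>M)
     = - (of_real (c\<^sup>2 / 2)) * (\<integral>\<omega>. e t \<omega> * of_real (cs t \<omega>) \<partial>M) + (\<integral>\<omega>. e t \<omega> * \<rho> t \<omega> \<partial>M) + of_real r * (\<integral>\<omega>. e t \<omega> \<partial>M)" for t
  proof -
    have eq: "e (Suc t) \<omega> = of_real \<tau> * e t \<omega> + (\<i> * of_real c) * (e t \<omega> * of_real (d t \<omega>))
       - of_real (c\<^sup>2 / 2) * (e t \<omega> * of_real (cs t \<omega>)) + e t \<omega> * \<rho> t \<omega> + of_real r * e t \<omega>" for \<omega>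
    proof -
      have "e (Suc t) \<omega> = e t \<omega> * iexp (c * d t \<omega>)"
        by (simp add: e_def exp_add[symmetric] algebra_simps)
      moreover have "iexp (c * d t \<omega>) = \<rho> t \<omega> + (1 + \<i> * of_real (c * d t \<omega>) - of_real ((c * d t \<omega>)\<^sup>2 / 2))"
        by (simp add: \<rho>_def)
      ultimately have *: "e (Suc t) \<omega> = e t \<omega> * (\<rho> t \<omega> + (1 + \<i> * of_real (c * d t \<omega>) - of_real ((c * d t \<omega>)\<^sup>2 / 2)))"
        by (simp only:)
      show ?thesis unfolding * by (simp add: r_def cs_def algebra_simps power_mult_distrib)
    qed
    have "(\<integral>\<omega>. e (Suc t) \<omega> \<partial>M) = of_real \<tau> * (\<integral>\<omega>. e t \<omega> \<partial>M) + (\<i> * of_real c) * (\<integral>\<omega>. e t \<omega> * of_real (d t \<omega>) \<partial>M)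
       - of_real (c\<^sup>2 / 2) * (\<integral>\<omega>. e t \<omega> * of_real (cs t \<omega>) \<partial>M) + (\<integral>\<omega>. e t \<omega> * \<rho> t \<omega> \<partial>M) + of_real r * (\<integral>\<omega>. e t \<omega> \<partial>M)"
      unfolding eq using int_e int_ecs int_ed int_e\<rho>
      by (simp del: of_real_divide of_real_power of_real_mult)
    then show ?thesis using orthogonal[of c t] by (simp add: e_def)
  qed
  have "(\<integral>\<omega>. e 0 \<omega> \<partial>M) = 1" by (simp add: e_def prob_space)
  then have "(\<integral>\<omega>. e n \<omega> \<partial>M) - of_real (\<tau> ^ n) = (\<Sum>t<n. of_real \<tau> ^ (n - 1 - t) * ((\<integral>\<omega>. e (Suc t) \<omega> \<partial>M) - of_real \<tau> * (\<integral>\<omega>. e t \<omega> \<partial>M)))"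
    using power_telescope[of "\<lambda>t. \<integral>\<omega>. e t \<omega> \<partial>M" n "of_real \<tau>"] by simp
  also have "\<dots> = (\<Sum>t<n. of_real \<tau> ^ (n - 1 - t) * (- (of_real (c\<^sup>2 / 2)) * (\<integral>\<omega>. e t \<omega> * of_real (cs t \<omega>) \<partial>M)))
      + (\<Sum>t<n. of_real \<tau> ^ (n - 1 - t) * (\<integral>\<omega>. e t \<omega> * \<rho> t \<omega> \<partial>M)) + (\<Sum>t<n. of_real \<tau> ^ (n - 1 - t) * (of_real r * (\<integral>\<omega>. e t \<omega> \<partial>M)))"
    unfolding step sum.distrib[symmetric] by (simp add: algebra_simps)
  also have "norm \<dots> \<le> c\<^sup>2 / 2 * ((\<Sum>i<m. 2 * X + real n * H c i) + real n * L m) + real n * R c + real n * (c\<^sup>2 * v)\<^sup>2"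
  proof (rule order_trans[OF norm_triangle_ineq add_mono], rule order_trans[OF norm_triangle_ineq add_mono])
    \<comment> \<open>The weight absorbs the powers of \<open>\<tau>\<close> as well as the past
      exponential. It still changes slowly, because \<open>1 - \<tau>\<close> is at most
      \<open>c\<^sup>2 * v / 2\<close>; hence the second summand in \<open>G\<close>.\<close>
    define a where "a = (\<lambda>t \<omega>. of_real \<tau> ^ (n - 1 - t) * e t \<omega>)"
    have [measurable]: "a t \<in> borel_measurable M" for t unfolding a_def by measurable
    have a1: "norm (a t \<omega>) \<le> 1" for t \<omega>
      using \<tau> by (simp add: a_def norm_mult e1 norm_power power_le_one)
    have a2: "norm (a (Suc t) \<omega> - a t \<omega>) \<le> G c (d t \<omega>)" if "Suc t < n" for t \<omega>
    proof -
      have "n - 1 - t = Suc (n - 1 - Suc t)" using that by auto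
      moreover have "e (Suc t) \<omega> = e t \<omega> * iexp (c * d t \<omega>)"
        by (simp add: e_def exp_add[symmetric] algebra_simps)
      ultimately have "a (Suc t) \<omega> - a t \<omega> = of_real \<tau> ^ (n - 1 - Suc t) * e t \<omega> * (iexp (c * d t \<omega>) - of_real \<tau>)"
        by (simp add: a_def algebra_simps)
      also have "norm \<dots> \<le> norm (iexp (c * d t \<omega>) - of_real \<tau>)"
        using \<tau> by (simp add: norm_mult e1 norm_power power_le_one mult_left_le_one_le)
      also have "\<dots> \<le> G c (d t \<omega>)"
        unfolding G_def
      proof (rule min.boundedI)
        show "norm (iexp (c * d t \<omega>) - of_real \<tau>) \<le> 2"
          using norm_triangle_ineq4[of "iexp (c * d t \<omega>)" "of_real \<tau>"] \<tau> by simp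
        have "1 - \<tau> \<le> c\<^sup>2 * v / 2" using exp_ge_add_one_self[of "- (c\<^sup>2 * v / 2)"] by (simp add: \<tau>_def)
        moreover have "norm (1 - of_real \<tau> :: complex) = 1 - \<tau>"
          using \<tau> by (metis abs_of_nonneg diff_ge_0_iff_ge norm_of_real of_real_1 of_real_diff)
        moreover have "norm (iexp (c * d t \<omega>) - 1) \<le> \<bar>c * d t \<omega>\<bar>"
          using iexp_approx1[of "c * d t \<omega>" 0] by simp
        moreover have "norm (iexp (c * d t \<omega>) - of_real \<tau>) \<le> norm (iexp (c * d t \<omega>) - 1) + norm (1 - of_real \<tau> :: complex)"
          using norm_triangle_ineq[of "iexp (c * d t \<omega>) - 1" "1 - of_real \<tau> :: complex"] by simp
        ultimately show "norm (iexp (c * d t \<omega>) - of_real \<tau>) \<le> \<bar>c * d t \<omega>\<bar> + c\<^sup>2 * v"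
          using z by linarith
      qed
      finally show ?thesis .
    qed
    have "(\<Sum>t<n. of_real \<tau> ^ (n - 1 - t) * (- (of_real (c\<^sup>2 / 2)) * (\<integral>\<omega>. e t \<omega> * of_real (cs t \<omega>) \<partial>M)))
       = - (of_real (c\<^sup>2 / 2)) * (\<Sum>t<n. of_real \<tau> ^ (n - 1 - t) * (\<integral>\<omega>. e t \<omega> * of_real (cs t \<omega>) \<partial>M))"
      unfolding sum_distrib_left by (rule sum.cong) (simp_all add: mult_ac)
    also have "(\<Sum>t<n. of_real \<tau> ^ (n - 1 - t) * (\<integral>\<omega>. e t \<omega> * of_real (cs t \<omega>) \<partial>M))
       = (\<integral>\<omega>. (\<Sum>t<n. a t \<omega> * of_real (cs t \<omega>)) \<partial>M)"
      unfolding a_def mult.assoc using int_ecs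
      by (subst Bochner_Integration.integral_sum) auto
    finally have *: "(\<Sum>t<n. of_real \<tau> ^ (n - 1 - t) * (- (of_real (c\<^sup>2 / 2)) * (\<integral>\<omega>. e t \<omega> * of_real (cs t \<omega>) \<partial>M)))
        = - (of_real (c\<^sup>2 / 2)) * (\<integral>\<omega>. (\<Sum>t<n. a t \<omega> * of_real (cs t \<omega>)) \<partial>M)" .
    have "norm (- (of_real (c\<^sup>2 / 2)) :: complex) = c\<^sup>2 / 2"
      by (simp add: norm_divide norm_power)
    then show "norm (\<Sum>t<n. of_real \<tau> ^ (n - 1 - t) * (- (of_real (c\<^sup>2 / 2)) * (\<integral>\<omega>. e t \<omega> * of_real (cs t \<omega>) \<partial>M)))
        \<le> c\<^sup>2 / 2 * ((\<Sum>i<m. 2 * X + real n * H c i) + real n * L m)"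
      unfolding * norm_mult
      using mult_left_mono[OF weight_average[of a n c m, OF _ a1 a2 m], of "c\<^sup>2 / 2"] by simp
    have "norm (\<Sum>t<n. of_real \<tau> ^ (n - 1 - t) * (\<integral>\<omega>. e t \<omega> * \<rho> t \<omega> \<partial>M)) \<le> (\<Sum>t<n. R c)"
    proof (rule sum_norm_le)
      fix t
      have "norm (of_real \<tau> ^ (n - 1 - t) * (\<integral>\<omega>. e t \<omega> * \<rho> t \<omega> \<partial>M)) \<le> norm (\<integral>\<omega>. e t \<omega> * \<rho> t \<omega> \<partial>M)"
        using \<tau> by (simp add: norm_mult norm_power power_le_one mult_left_le_one_le)
      also have "\<dots> \<le> R c" unfolding R_shift[of c t, symmetric]
        by (rule integral_norm_bound_le[OF int_e\<rho> int_min]) (use \<rho> in \<open>auto simp: norm_mult e1\<close>)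
      finally show "norm (of_real \<tau> ^ (n - 1 - t) * (\<integral>\<omega>. e t \<omega> * \<rho> t \<omega> \<partial>M)) \<le> R c" .
    qed
    then show "norm (\<Sum>t<n. of_real \<tau> ^ (n - 1 - t) * (\<integral>\<omega>. e t \<omega> * \<rho> t \<omega> \<partial>M)) \<le> real n * R c" by simp
    have "norm (\<Sum>t<n. of_real \<tau> ^ (n - 1 - t) * (of_real r * (\<integral>\<omega>. e t \<omega> \<partial>M))) \<le> (\<Sum>t<n. (c\<^sup>2 * v)\<^sup>2)"
    proof (rule sum_norm_le)
      fix t
      have "norm (\<integral>\<omega>. e t \<omega> \<partial>M) \<le> (\<integral>\<omega>. 1 \<partial>M)"
        by (rule integral_norm_bound_le[OF int_e]) (auto simp: e1)
      then have "norm (\<integral>\<omega>. e t \<omega> \<partial>M) \<le> 1" by (simp add: prob_space)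
      then have "\<tau> ^ (n - 1 - t) * (\<bar>r\<bar> * norm (\<integral>\<omega>. e t \<omega> \<partial>M)) \<le> 1 * ((c\<^sup>2 * v)\<^sup>2 * 1)"
        using \<tau> r by (intro mult_mono power_le_one) auto
      then show "norm (of_real \<tau> ^ (n - 1 - t) * (of_real r * (\<integral>\<omega>. e t \<omega> \<partial>M))) \<le> (c\<^sup>2 * v)\<^sup>2"
        using \<tau> by (simp add: norm_mult norm_power)
    qed
    then show "norm (\<Sum>t<n. of_real \<tau> ^ (n - 1 - t) * (of_real r * (\<integral>\<omega>. e t \<omega> \<partial>M))) \<le> real n * (c\<^sup>2 * v)\<^sup>2" by simp
  qed
  finally show ?thesis by (simp add: e_def)
qed

lemma H_tendsto: "(\<lambda>T. H (1 / sqrt (real T)) j) \<longlonglongrightarrow> 0"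
proof -
  have "(\<lambda>T. \<integral>\<omega>. G (1 / sqrt (real T)) (d 0 \<omega>) * \<bar>cs (Suc j) \<omega>\<bar> \<partial>M) \<longlonglongrightarrow> (\<integral>\<omega>. 0 \<partial>M)"
  proof (rule integral_dominated_convergence[where w = "\<lambda>\<omega>. 2 * \<bar>cs (Suc j) \<omega>\<bar>"])
    show "AE \<omega> in M. (\<lambda>T. G (1 / sqrt (real T)) (d 0 \<omega>) * \<bar>cs (Suc j) \<omega>\<bar>) \<longlonglongrightarrow> 0"
    proof (rule AE_I2)
      fix \<omega>
      have c: "(\<lambda>T. 1 / sqrt (real T)) \<longlonglongrightarrow> 0"
        by (rule tendsto_divide_0[OF tendsto_const])
           (auto intro!: filterlim_compose[OF sqrt_at_top filterlim_real_sequentially] filterlim_at_top_imp_at_infinity)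
      have "(\<lambda>T. min 2 (\<bar>1 / sqrt (real T) * d 0 \<omega>\<bar> + (1 / sqrt (real T))\<^sup>2 * v) * \<bar>cs (Suc j) \<omega>\<bar>) \<longlonglongrightarrow> min 2 (\<bar>0 * d 0 \<omega>\<bar> + 0\<^sup>2 * v) * \<bar>cs (Suc j) \<omega>\<bar>"
        by (intro tendsto_intros c)
      then show "(\<lambda>T. G (1 / sqrt (real T)) (d 0 \<omega>) * \<bar>cs (Suc j) \<omega>\<bar>) \<longlonglongrightarrow> 0"
        by (simp add: G_def)
    qed
    show "AE \<omega> in M. norm (G (1 / sqrt (real T)) (d 0 \<omega>) * \<bar>cs (Suc j) \<omega>\<bar>) \<le> 2 * \<bar>cs (Suc j) \<omega>\<bar>" for T
      using v_nonneg by (intro AE_I2) (auto simp: G_def abs_mult intro!: mult_right_mono)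
    show "(\<lambda>\<omega>. G (1 / sqrt (real T)) (d 0 \<omega>) * \<bar>cs (Suc j) \<omega>\<bar>) \<in> borel_measurable M" for T
      unfolding G_def by measurable
  qed (use integrable_cs in auto)
  then show ?thesis by (simp add: H_def)
qed

text \<open>The minimum in \<open>R\<close> takes the place of a Lindeberg condition: after
  multiplication by \<open>T\<close> its quadratic branch gives the dominating function
  \<open>(d 0 \<omega>)\<^sup>2\<close> and its cubic branch the pointwise limit zero, so second
  moments suffice.\<close>

lemma R_tendsto: "(\<lambda>T. real T * R (1 / sqrt (real T))) \<longlonglongrightarrow> 0"
proof -
  have "(\<lambda>T. \<integral>\<omega>. real T * min ((1 / sqrt (real T) * d 0 \<omega>)\<^sup>2) (\<bar>1 / sqrt (real T) * d 0 \<omega>\<bar> ^ 3 / 6) \<partial>M) \<longlonglongrightarrow> (\<integral>\<omega>. 0 \<partial>M)"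
  proof (rule integral_dominated_convergence[where w = "\<lambda>\<omega>. (d 0 \<omega>)\<^sup>2"])
    have c: "(\<lambda>T. 1 / sqrt (real T)) \<longlonglongrightarrow> 0"
      by (rule tendsto_divide_0[OF tendsto_const])
         (auto intro!: filterlim_compose[OF sqrt_at_top filterlim_real_sequentially] filterlim_at_top_imp_at_infinity)
    show "AE \<omega> in M. (\<lambda>T. real T * min ((1 / sqrt (real T) * d 0 \<omega>)\<^sup>2) (\<bar>1 / sqrt (real T) * d 0 \<omega>\<bar> ^ 3 / 6)) \<longlonglongrightarrow> 0"
    proof (rule AE_I2)
      fix \<omega>
      show "(\<lambda>T. real T * min ((1 / sqrt (real T) * d 0 \<omega>)\<^sup>2) (\<bar>1 / sqrt (real T) * d 0 \<omega>\<bar> ^ 3 / 6)) \<longlonglongrightarrow> 0"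
      proof (rule Lim_null_comparison)
        show "(\<lambda>T. 1 / sqrt (real T) * (\<bar>d 0 \<omega>\<bar> ^ 3)) \<longlonglongrightarrow> 0"
          using tendsto_mult_left_zero[OF c] by auto
        show "\<forall>\<^sub>F T in sequentially. norm (real T * min ((1 / sqrt (real T) * d 0 \<omega>)\<^sup>2) (\<bar>1 / sqrt (real T) * d 0 \<omega>\<bar> ^ 3 / 6)) \<le> 1 / sqrt (real T) * (\<bar>d 0 \<omega>\<bar> ^ 3)"
          using eventually_gt_at_top[of 0]
        proof eventually_elim
          case (elim T)
          have "norm (real T * min ((1 / sqrt (real T) * d 0 \<omega>)\<^sup>2) (\<bar>1 / sqrt (real T) * d 0 \<omega>\<bar> ^ 3 / 6)) \<le> real T * (\<bar>1 / sqrt (real T) * d 0 \<omega>\<bar> ^ 3)"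
            unfolding abs_mult[of "real T"] real_norm_def by (rule mult_mono) (auto simp: min_le_iff_disj)
          also have "\<dots> = 1 / sqrt (real T) * (\<bar>d 0 \<omega>\<bar> ^ 3)"
            using elim by (simp add: abs_mult power_mult_distrib power_divide power3_eq_cube field_simps)
          finally show ?case .
        qed
      qed
    qed
    show "AE \<omega> in M. norm (real T * min ((1 / sqrt (real T) * d 0 \<omega>)\<^sup>2) (\<bar>1 / sqrt (real T) * d 0 \<omega>\<bar> ^ 3 / 6)) \<le> (d 0 \<omega>)\<^sup>2" for T
    proof (rule AE_I2)
      fix \<omega>
      have "norm (real T * min ((1 / sqrt (real T) * d 0 \<omega>)\<^sup>2) (\<bar>1 / sqrt (real T) * d 0 \<omega>\<bar> ^ 3 / 6)) \<le> real T * (1 / sqrt (real T) * d 0 \<omega>)\<^sup>2"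
        by (auto simp: abs_mult intro!: mult_left_mono)
      also have "\<dots> \<le> (d 0 \<omega>)\<^sup>2" by (cases "T = 0") (auto simp: power_mult_distrib power_divide)
      finally show "norm (real T * min ((1 / sqrt (real T) * d 0 \<omega>)\<^sup>2) (\<bar>1 / sqrt (real T) * d 0 \<omega>\<bar> ^ 3 / 6)) \<le> (d 0 \<omega>)\<^sup>2" .
    qed
  qed (use square_integrable in auto)
  then show ?thesis by (simp add: R_def)
qed

text \<open>The number of terms may be smaller than the normalising \<open>T\<close>, since the sums
  of the model have \<open>T - q\<close> terms. The window length \<open>m\<close> is fixed first,
  so that \<open>L m\<close> is small; for fixed \<open>m\<close> the other errors vanish as
  \<open>T\<close> grows.\<close>

theorem central_limit:
  assumes N: "\<And>T. N T \<le> T"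
  shows "(\<lambda>T. (\<integral>\<omega>. iexp (1 / sqrt (real T) * S (N T) \<omega>) \<partial>M) - of_real (exp (- (real (N T) / real T) * v / 2))) \<longlonglongrightarrow> 0"
proof (rule LIMSEQ_I)
  fix r :: real assume r: "r > 0"
  have "\<forall>\<^sub>F m in sequentially. L m < r"
    using order_tendstoD(2)[OF variance_ergodic r] by (simp add: L_def)
  then have "\<forall>\<^sub>F m in sequentially. m > 0 \<and> L m < r"
    using eventually_gt_at_top[of 0] by eventually_elim simp
  then obtain m where m: "m > 0" "L m < r"
    using eventually_happens trivial_limit_sequentially by blast
  let ?c = "\<lambda>T. 1 / sqrt (real T)"
  let ?B = "\<lambda>T. 1 / 2 * ((\<Sum>i<m. 2 * X * (1 / real T) + H (?c T) i) + L m) + real T * R (?c T) + v\<^sup>2 * (1 / real T)"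
  have "?B \<longlonglongrightarrow> 1 / 2 * ((\<Sum>i<m. 2 * X * 0 + 0) + L m) + 0 + v\<^sup>2 * 0"
    by (intro tendsto_intros H_tendsto R_tendsto lim_const_over_n)
  then have "?B \<longlonglongrightarrow> L m / 2" by simp
  moreover have "L m \<ge> 0" by (simp add: L_def)
  then have "L m / 2 < r" using m r by simp
  ultimately have "\<forall>\<^sub>F T in sequentially. ?B T < r"
    by (rule order_tendstoD)
  then have "\<forall>\<^sub>F T in sequentially. norm ((\<integral>\<omega>. iexp (?c T * S (N T) \<omega>) \<partial>M) - of_real (exp (- (real (N T) / real T) * v / 2)) - 0) < r"
    using eventually_gt_at_top[of 0]
  proof eventually_elim
    case (elim T)
    have c2: "(?c T)\<^sup>2 = 1 / real T" by (simp add: power_divide)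
    have pow: "exp (- (real (N T) / real T) * v / 2) = exp (- (?c T)\<^sup>2 * v / 2) ^ N T"
      unfolding exp_of_nat_mult[symmetric] c2 by simp
    have n: "real (N T) / real T \<le> 1" using N[of T] elim by simp
    have R0: "R (?c T) \<ge> 0" unfolding R_def by (intro Bochner_Integration.integral_nonneg) auto
    have "norm ((\<integral>\<omega>. iexp (?c T * S (N T) \<omega>) \<partial>M) - of_real (exp (- (real (N T) / real T) * v / 2)))
       \<le> (?c T)\<^sup>2 / 2 * ((\<Sum>i<m. 2 * X + real (N T) * H (?c T) i) + real (N T) * L m) + real (N T) * R (?c T) + real (N T) * ((?c T)\<^sup>2 * v)\<^sup>2"
      unfolding pow by (rule char_bound) (rule m)
    also have "\<dots> = 1 / 2 * ((\<Sum>i<m. 2 * X * (1 / real T) + real (N T) / real T * H (?c T) i) + real (N T) / real T * L m) + real (N T) * R (?c T) + real (N T) / real T * (v\<^sup>2 * (1 / real T))"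
      unfolding c2 by (simp add: sum_distrib_left sum.distrib power_divide power_mult_distrib power2_eq_square algebra_simps add_divide_distrib sum_divide_distrib)
    also have "\<dots> \<le> 1 / 2 * ((\<Sum>i<m. 2 * X * (1 / real T) + 1 * H (?c T) i) + 1 * L m) + real T * R (?c T) + 1 * (v\<^sup>2 * (1 / real T))"
      using n N[of T] H_nonneg \<open>L m \<ge> 0\<close> R0 
      by (intro add_mono mult_left_mono sum_mono mult_right_mono order_refl) auto
    also have "\<dots> < r" using elim by simp
    finally show ?case by simp
  qed
  then show "\<exists>no. \<forall>T\<ge>no. norm ((\<integral>\<omega>. iexp (?c T * S (N T) \<omega>) \<partial>M) - of_real (exp (- (real (N T) / real T) * v / 2)) - 0) < r"
    by (simp add: eventually_sequentially)
qed

end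

section \<open>Weak convergence of summable random sequences\<close>

text \<open>The phase \<open>b\<close> covers sines and constants, so the product-to-sum formula
  closes the class under products. Expectations of its members are determined by characteristic
  functions.\<close>

inductive trig_poly :: "nat \<Rightarrow> ((nat \<Rightarrow> real) \<Rightarrow> real) \<Rightarrow> bool" for n where
  cos: "trig_poly n (\<lambda>x. a * cos ((\<Sum>j<n. s j * x j) + b))"
| add: "trig_poly n f \<Longrightarrow> trig_poly n g \<Longrightarrow> trig_poly n (\<lambda>x. f x + g x)"

lemma trig_poly_const: "trig_poly n (\<lambda>_. a)"
  using trig_poly.cos[of n a "\<lambda>_. 0" 0] by simp

lemma trig_poly_mult:
  assumes "trig_poly n f" "trig_poly n g"
  shows "trig_poly n (\<lambda>x. f x * g x)"
  using assms
proof (induction arbitrary: g)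
  case (cos a s b)
  from cos.prems show ?case
  proof (induction)
    case (cos a' s' b')
    have "(\<lambda>x. a * cos ((\<Sum>j<n. s j * x j) + b) * (a' * cos ((\<Sum>j<n. s' j * x j) + b'))) =
      (\<lambda>x. a * a' / 2 * cos ((\<Sum>j<n. (s j - s' j) * x j) + (b - b')) + a * a' / 2 * cos ((\<Sum>j<n. (s j + s' j) * x j) + (b + b')))"
    proof
      fix x :: "nat \<Rightarrow> real"
      have *: "(\<Sum>j<n. (s j - s' j) * x j) + (b - b') = ((\<Sum>j<n. s j * x j) + b) - ((\<Sum>j<n. s' j * x j) + b')"
        "(\<Sum>j<n. (s j + s' j) * x j) + (b + b') = ((\<Sum>j<n. s j * x j) + b) + ((\<Sum>j<n. s' j * x j) + b')"
        by (simp_all add: sum.distrib sum_subtractf algebra_simps)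
      show "a * cos ((\<Sum>j<n. s j * x j) + b) * (a' * cos ((\<Sum>j<n. s' j * x j) + b')) =
        a * a' / 2 * cos ((\<Sum>j<n. (s j - s' j) * x j) + (b - b')) + a * a' / 2 * cos ((\<Sum>j<n. (s j + s' j) * x j) + (b + b'))"
        unfolding * cos_add cos_diff by (simp add: field_simps)
    qed
    then show ?case by (simp only:) (intro trig_poly.intros)
  next
    case (add f g)
    then show ?case by (simp add: distrib_left trig_poly.add)
  qed
next
  case (add f1 f2)
  then show ?case by (simp add: distrib_right trig_poly.add)
qed

inductive coord_poly :: "nat \<Rightarrow> ((nat \<Rightarrow> real) \<Rightarrow> real) \<Rightarrow> bool" for n where
  coord: "j < n \<Longrightarrow> coord_poly n (\<lambda>y. y j)"
| const: "coord_poly n (\<lambda>_. a)"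
| add: "coord_poly n f \<Longrightarrow> coord_poly n g \<Longrightarrow> coord_poly n (\<lambda>x. f x + g x)"
| mult: "coord_poly n f \<Longrightarrow> coord_poly n g \<Longrightarrow> coord_poly n (\<lambda>x. f x * g x)"

lemma coord_poly_sin:
  assumes "coord_poly n f" shows "trig_poly n (\<lambda>x. f (\<lambda>j. if j < n then sin (c * x j) else 0))"
  using assms
proof induction
  case (coord j)
  \<comment> \<open>The sine of one coordinate is a cosine whose frequency vector is supported at
    \<open>j\<close>, with phase \<open>- pi / 2\<close>.\<close>
  have "(\<lambda>x. sin (c * x j)) = (\<lambda>x. 1 * cos ((\<Sum>i<n. (if i = j then c else 0) * x i) + (- pi / 2)))" for x :: "nat \<Rightarrow> real"
    using coord by (auto simp: fun_eq_iff cos_diff if_distrib[of "\<lambda>z. z * _"] sum.delta cong: if_cong)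
  with coord trig_poly.cos[of n 1 "\<lambda>i. if i = j then c else 0" "- pi / 2"] show ?case by simp
qed (auto intro: trig_poly_const trig_poly.add trig_poly_mult)

lemma continuous_on_coord_poly: "coord_poly n f \<Longrightarrow> continuous_on S f"
proof (induction rule: coord_poly.induct)
  case (coord j)
  show ?case by (rule continuous_on_subset[OF continuous_on_product_coordinates]) simp
qed (auto intro!: continuous_intros)

text \<open>A triangle wave of slope one at the origin. Since it is a continuous function of a sine, replacing
  the coordinates by their triangle waves turns the Stone--Weierstrass theorem on a cube into uniform
  approximation by trigonometric polynomials on the whole space.\<close>

definition tri :: "real \<Rightarrow> real \<Rightarrow> real" where
  "tri R t = 2 * R / pi * arcsin (sin (pi / (2 * R) * t))"

text \<open>Within \<open>\<bar>t\<bar> \<le> R\<close> the wave is the identity; outside, the error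
  is at most \<open>2 * \<bar>t\<bar>\<close>, hence at most \<open>2 * t\<^sup>2 / R\<close>. The
  quadratic form lets uniformly bounded second moments control the error.\<close>

lemma tri_error:
  assumes R: "R > 0" shows "\<bar>t - tri R t\<bar> \<le> 2 * t\<^sup>2 / R"
proof -
  define z where "z = pi / (2 * R) * t"
  have t: "t = 2 * R / pi * z" using R by (simp add: z_def)
  have e: "t - tri R t = 2 * R / pi * (z - arcsin (sin z))"
    unfolding tri_def z_def[symmetric] by (subst t) (simp add: right_diff_distrib)
  show ?thesis
  proof (cases "\<bar>z\<bar> \<le> pi / 2")
    case True
    then have "arcsin (sin z) = z" by (intro arcsin_sin) auto
    then show ?thesis using e R by simp
  next
    case False
    have "\<bar>arcsin (sin z)\<bar> \<le> pi / 2"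
      using arcsin_bounded[of "sin z"] by (auto simp: abs_le_iff)
    with False have "\<bar>z - arcsin (sin z)\<bar> \<le> 2 * \<bar>z\<bar>" by linarith
    then have "2 * R / pi * \<bar>z - arcsin (sin z)\<bar> \<le> 2 * R / pi * (2 * \<bar>z\<bar>)"
      using R by (intro mult_left_mono) auto
    also have "\<dots> = 2 * \<bar>t\<bar>" using R by (subst t) (simp add: abs_mult)
    also have "\<dots> \<le> 2 * t\<^sup>2 / R"
    proof -
      have "\<bar>t\<bar> \<ge> R" using False R unfolding z_def by (simp add: abs_mult field_simps)
      then have "\<bar>t\<bar> * R \<le> \<bar>t\<bar> * \<bar>t\<bar>" by (intro mult_left_mono) auto
      then show ?thesis using R by (simp add: pos_le_divide_eq power2_eq_square)
    qed
    finally show ?thesis unfolding e using R by (simp add: abs_mult)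
  qed
qed

text \<open>The coordinates from \<open>n\<close> on are frozen at 0, so that two points of the box
  differ in one of the first \<open>n\<close> coordinates and \<open>coord_poly n\<close> separates
  them.\<close>

lemma compact_box: "compact {y :: nat \<Rightarrow> real. \<forall>j. y j \<in> (if j < n then {-1..1} else {0})}"
proof -
  have "compactin (product_topology (\<lambda>_. euclidean) UNIV) (PiE UNIV (\<lambda>j. if j < n then {-1..1} else {0::real}))"
    unfolding compactin_PiE by auto
  then show ?thesis by (simp add: euclidean_product_topology PiE_def Pi_def)
qed

lemma continuous_on_finite_lipschitz:
  fixes f :: "(nat \<Rightarrow> real) \<Rightarrow> real"
  assumes "\<And>x y. \<bar>f x - f y\<bar> \<le> L * (\<Sum>j<n. \<bar>x j - y j\<bar>)"
  shows "continuous_on S f"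
  unfolding continuous_on_def
proof
  fix x
  have c: "((\<lambda>y. y j) \<longlongrightarrow> x j) (at x within S)" for j
    using continuous_on_subset[OF continuous_on_product_coordinates[of j], of "insert x S"]
    by (auto simp: continuous_on_def intro: tendsto_within_subset)
  have "((\<lambda>y. L * (\<Sum>j<n. \<bar>y j - x j\<bar>)) \<longlongrightarrow> L * (\<Sum>j<n. \<bar>x j - x j\<bar>)) (at x within S)"
    by (intro tendsto_intros c)
  then have "((\<lambda>y. f y - f x) \<longlongrightarrow> 0) (at x within S)"
    by (intro Lim_null_comparison[of "\<lambda>y. f y - f x"]) (use assms in \<open>auto intro!: always_eventually\<close>)
  then show "(f \<longlongrightarrow> f x) (at x within S)" by (simp add: LIM_zero_iff)
qed

text \<open>\<open>f\<close> after the triangle wave is a continuous function of the sines of the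
  first \<open>n\<close> coordinates, which lie in a compact box whatever the coordinates are. A
  polynomial approximation there becomes a trigonometric one, uniform on the whole space.\<close>

lemma sine_approximation:
  fixes f :: "(nat \<Rightarrow> real) \<Rightarrow> real"
  assumes lip: "\<And>x y. \<bar>f x - f y\<bar> \<le> L * (\<Sum>j<n. \<bar>x j - y j\<bar>)" and R: "R > 0" and e: "e > 0"
  obtains P where "trig_poly n P" "\<And>x. \<bar>f (\<lambda>j. tri R (x j)) - P x\<bar> < e"
proof -
  let ?K = "{y :: nat \<Rightarrow> real. \<forall>j. y j \<in> (if j < n then {-1..1} else {0})}"
  let ?h = "\<lambda>y :: nat \<Rightarrow> real. f (\<lambda>j. 2 * R / pi * arcsin (y j))"
  have "continuous_on ?K ?h"
  proof (rule continuous_on_compose2[OF continuous_on_finite_lipschitz[OF lip]])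
    show "continuous_on ?K (\<lambda>y j. 2 * R / pi * arcsin (y j))"
    proof (rule continuous_on_coordinatewise_then_product)
      fix j
      have "continuous_on ?K (\<lambda>y. y j)"
        by (rule continuous_on_subset[OF continuous_on_product_coordinates]) simp
      moreover have "\<forall>y\<in>?K. - 1 \<le> y j \<and> y j \<le> 1"
      proof
        fix y assume "y \<in> ?K"
        then have "y j \<in> (if j < n then {-1..1} else {0})" by blast
        then show "- 1 \<le> y j \<and> y j \<le> 1" by (auto split: if_splits)
      qed
      ultimately show "continuous_on ?K (\<lambda>y. 2 * R / pi * arcsin (y j))"
        by (intro continuous_intros) auto
    qed
  qed auto
  then have "\<exists>g. coord_poly n g \<and> (\<forall>x \<in> ?K. \<bar>?h x - g x\<bar> < e)"
  proof (rule Stone_Weierstrass_HOL[OF compact_box, rotated 5])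
    fix x y assume "x \<in> ?K \<and> y \<in> ?K \<and> x \<noteq> y"
    then obtain j where "x j \<noteq> y j" "x j \<in> (if j < n then {-1..1} else {0})" "y j \<in> (if j < n then {-1..1} else {0})"
      by blast
    then show "\<exists>f. coord_poly n f \<and> f x \<noteq> f y"
      by (intro exI[of _ "\<lambda>y. y j"]) (auto intro: coord_poly.coord split: if_splits)
  qed (use e in \<open>auto intro: coord_poly.intros continuous_on_coord_poly\<close>)
  then obtain g where g: "coord_poly n g" "\<And>x. x \<in> ?K \<Longrightarrow> \<bar>?h x - g x\<bar> < e" by blast
  let ?s = "\<lambda>(x :: nat \<Rightarrow> real) j. if j < n then sin (pi / (2 * R) * x j) else 0"
  show ?thesis
  proof (rule that)
    show "trig_poly n (\<lambda>x. g (?s x))" by (rule coord_poly_sin[OF g(1)])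
    fix x
    \<comment> \<open>The Lipschitz bound sees only the first \<open>n\<close> coordinates, so
      zeroing the sines beyond \<open>n\<close> does not change the value of
      \<open>f\<close>.\<close>
    have "\<bar>f (\<lambda>j. tri R (x j)) - ?h (?s x)\<bar> \<le> L * (\<Sum>j<n. \<bar>tri R (x j) - 2 * R / pi * arcsin (?s x j)\<bar>)"
      by (rule lip)
    also have "\<dots> = 0" by (simp add: tri_def)
    finally have "f (\<lambda>j. tri R (x j)) = ?h (?s x)" by simp
    moreover have "?s x \<in> ?K" by auto
    ultimately show "\<bar>f (\<lambda>j. tri R (x j)) - g (?s x)\<bar> < e" using g(2) by simp
  qed
qed

lemma (in prob_space) abs_moment_le:
  fixes X :: "'a \<Rightarrow> real"
  assumes [measurable]: "X \<in> borel_measurable M" and "integrable M (\<lambda>\<omega>. (X \<omega>)\<^sup>2)" "(\<integral>\<omega>. (X \<omega>)\<^sup>2 \<partial>M) \<le> c\<^sup>2" "c \<ge> 0"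
  shows "(\<integral>\<omega>. \<bar>X \<omega>\<bar> \<partial>M) \<le> c"
proof -
  have "integrable M X" using assms(2) by (rule square_integrable_imp_integrable[rotated]) simp
  then have "0 \<le> (\<integral>\<omega>. (X \<omega>)\<^sup>2 \<partial>M) - (\<integral>\<omega>. \<bar>X \<omega>\<bar> \<partial>M)\<^sup>2"
    using variance_eq[of "\<lambda>\<omega>. \<bar>X \<omega>\<bar>"] variance_positive[of "\<lambda>\<omega>. \<bar>X \<omega>\<bar>"] assms(2) by simp
  with assms(3) have "(\<integral>\<omega>. \<bar>X \<omega>\<bar> \<partial>M)\<^sup>2 \<le> c\<^sup>2" by linarith
  then show ?thesis using assms(4) power2_le_imp_le by blast
qed

text \<open>The type contains all sequences, while the norm makes sense for summable ones only;
  elsewhere \<open>F\<close> is unconstrained.\<close>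

definition l1_lipschitz :: "real \<Rightarrow> real \<Rightarrow> ((nat \<Rightarrow> real) \<Rightarrow> real) \<Rightarrow> bool" where
  "l1_lipschitz B L F \<longleftrightarrow> (\<forall>x. summable (\<lambda>j. \<bar>x j\<bar>) \<longrightarrow> \<bar>F x\<bar> \<le> B) \<and>
     (\<forall>x y. summable (\<lambda>j. \<bar>x j\<bar>) \<longrightarrow> summable (\<lambda>j. \<bar>y j\<bar>) \<longrightarrow> \<bar>F x - F y\<bar> \<le> L * (\<Sum>j. \<bar>x j - y j\<bar>))"

definition trunc :: "nat \<Rightarrow> (nat \<Rightarrow> real) \<Rightarrow> nat \<Rightarrow> real" where
  "trunc n x j = (if j < n then x j else 0)"

lemma summable_trunc: "summable (\<lambda>j. \<bar>trunc n x j\<bar>)"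
  by (rule summable_finite[of "{..<n}"]) (auto simp: trunc_def)

lemma l1_lipschitz_trunc:
  assumes F: "l1_lipschitz B L F"
  shows "\<bar>F (trunc n x) - F (trunc n y)\<bar> \<le> L * (\<Sum>j<n. \<bar>x j - y j\<bar>)"
proof -
  have "(\<Sum>j. \<bar>trunc n x j - trunc n y j\<bar>) = (\<Sum>j<n. \<bar>trunc n x j - trunc n y j\<bar>)"
    by (rule suminf_finite) (auto simp: trunc_def)
  also have "\<dots> = (\<Sum>j<n. \<bar>x j - y j\<bar>)" by (simp add: trunc_def)
  finally show ?thesis using F summable_trunc unfolding l1_lipschitz_def by metis
qed

lemma l1_lipschitz_trunc_trunc:
  assumes F: "l1_lipschitz B L F" and nm: "n \<le> m"
  shows "\<bar>F (trunc m x) - F (trunc n x)\<bar> \<le> L * (\<Sum>j\<in>{n..<m}. \<bar>x j\<bar>)"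
proof -
  have "(\<Sum>j. \<bar>trunc m x j - trunc n x j\<bar>) = (\<Sum>j\<in>{n..<m}. \<bar>trunc m x j - trunc n x j\<bar>)"
    using nm by (intro suminf_finite) (auto simp: trunc_def)
  also have "\<dots> = (\<Sum>j\<in>{n..<m}. \<bar>x j\<bar>)" by (simp add: trunc_def)
  finally show ?thesis using F summable_trunc unfolding l1_lipschitz_def by metis
qed

lemma l1_lipschitz_tendsto:
  assumes F: "l1_lipschitz B L F" and x: "summable (\<lambda>j. \<bar>x j\<bar>)"
  shows "(\<lambda>n. F (trunc n x)) \<longlonglongrightarrow> F x"
proof -
  have "(\<lambda>n. L * (\<Sum>j. \<bar>x (j + n)\<bar>)) \<longlonglongrightarrow> L * 0"
    using suminf_exist_split2[OF x] by (intro tendsto_intros) 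
  moreover have "\<bar>F (trunc n x) - F x\<bar> \<le> L * (\<Sum>j. \<bar>x (j + n)\<bar>)" for n
  proof -
    have s: "summable (\<lambda>j. \<bar>trunc n x j - x j\<bar>)"
      by (rule summable_comparison_test'[OF x]) (auto simp: trunc_def)
    have "(\<Sum>j. \<bar>trunc n x j - x j\<bar>) = (\<Sum>j. \<bar>trunc n x (j + n) - x (j + n)\<bar>) + (\<Sum>j<n. \<bar>trunc n x j - x j\<bar>)"
      by (rule suminf_split_initial_segment[OF s])
    also have "\<dots> = (\<Sum>j. \<bar>x (j + n)\<bar>)" by (simp add: trunc_def)
    finally show ?thesis using F summable_trunc x unfolding l1_lipschitz_def by metis
  qed
  ultimately have "(\<lambda>n. F (trunc n x) - F x) \<longlonglongrightarrow> 0"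
    by (intro Lim_null_comparison[of "\<lambda>n. F (trunc n x) - F x"]) auto
  then show ?thesis by (simp add: LIM_zero_iff)
qed

lemma measurable_l1_lipschitz_trunc:
  assumes F: "l1_lipschitz B L F" and [measurable]: "\<And>j. (\<lambda>\<omega>. X \<omega> j) \<in> borel_measurable M"
  shows "(\<lambda>\<omega>. F (trunc n (X \<omega>))) \<in> borel_measurable M"
proof -
  have "(\<lambda>x. F (trunc n x)) \<in> borel_measurable borel"
    by (rule borel_measurable_continuous_onI, rule continuous_on_finite_lipschitz, rule l1_lipschitz_trunc[OF F])
  moreover have "X \<in> borel_measurable M" by (rule measurable_coordinatewise_then_product) simp
  ultimately show ?thesis by (rule measurable_compose[rotated])
qed

text \<open>Truncations reduce the question to continuous functions of finitely many coordinates,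
  and \<open>F\<close> is their pointwise limit; no sigma-algebra on the space of summable sequences
  is introduced.\<close>

lemma measurable_l1_lipschitz:
  assumes F: "l1_lipschitz B L F" and meas: "\<And>j. (\<lambda>\<omega>. X \<omega> j) \<in> borel_measurable M"
    and X: "\<And>\<omega>. \<omega> \<in> space M \<Longrightarrow> summable (\<lambda>j. \<bar>X \<omega> j\<bar>)"
  shows "(\<lambda>\<omega>. F (X \<omega>)) \<in> borel_measurable M"
  by (rule borel_measurable_LIMSEQ_real[of M "\<lambda>n \<omega>. F (trunc n (X \<omega>))"])
     (use measurable_l1_lipschitz_trunc[OF F, of X M] meas l1_lipschitz_tendsto[OF F X] in auto)

text \<open>The error is at most \<open>L\<close> times the tail of the first absolute moments, each
  of which is at most the root \<open>c j\<close> of the second-moment bound. The estimate is thus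
  the same for every process with these second moments.\<close>

lemma (in prob_space) l1_lipschitz_truncation_error:
  assumes F: "l1_lipschitz B L F" and L: "L \<ge> 0"
    and meas [measurable]: "\<And>j. (\<lambda>\<omega>. X \<omega> j) \<in> borel_measurable M"
    and X: "\<And>\<omega>. \<omega> \<in> space M \<Longrightarrow> summable (\<lambda>j. \<bar>X \<omega> j\<bar>)"
    and sq: "\<And>j. integrable M (\<lambda>\<omega>. (X \<omega> j)\<^sup>2)" "\<And>j. (\<integral>\<omega>. (X \<omega> j)\<^sup>2 \<partial>M) \<le> (c j)\<^sup>2"
    and c: "\<And>j. c j \<ge> 0" "summable c"
  shows "\<bar>(\<integral>\<omega>. F (X \<omega>) \<partial>M) - (\<integral>\<omega>. F (trunc n (X \<omega>)) \<partial>M)\<bar> \<le> L * (\<Sum>j. c (j + n))"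
proof -
  have int: "integrable M (\<lambda>\<omega>. F (trunc n (X \<omega>)))" for n
    by (rule integrable_const_bound[of _ B])
       (use F summable_trunc measurable_l1_lipschitz_trunc[OF F meas] in \<open>auto simp: l1_lipschitz_def\<close>)
  have intX: "integrable M (\<lambda>\<omega>. X \<omega> j)" for j
    using sq(1) by (rule square_integrable_imp_integrable[rotated]) simp
  \<comment> \<open>Comparing with a longer truncation at \<open>m\<close>, and letting
    \<open>m\<close> grow only at the end, keeps every sum of moments finite.\<close>
  have "(\<lambda>m. \<integral>\<omega>. F (trunc m (X \<omega>)) \<partial>M) \<longlonglongrightarrow> (\<integral>\<omega>. F (X \<omega>) \<partial>M)"
    by (rule integral_dominated_convergence[where w = "\<lambda>_. B"])
       (use F X summable_trunc measurable_l1_lipschitz_trunc[OF F meas] measurable_l1_lipschitz[OF F meas X] l1_lipschitz_tendsto[OF F X]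
         in \<open>auto simp: l1_lipschitz_def\<close>)
  then have lim: "(\<lambda>m. \<bar>(\<integral>\<omega>. F (trunc m (X \<omega>)) \<partial>M) - (\<integral>\<omega>. F (trunc n (X \<omega>)) \<partial>M)\<bar>) \<longlonglongrightarrow> \<bar>(\<integral>\<omega>. F (X \<omega>) \<partial>M) - (\<integral>\<omega>. F (trunc n (X \<omega>)) \<partial>M)\<bar>"
    by (intro tendsto_intros)
  have "\<forall>m\<ge>n. \<bar>(\<integral>\<omega>. F (trunc m (X \<omega>)) \<partial>M) - (\<integral>\<omega>. F (trunc n (X \<omega>)) \<partial>M)\<bar> \<le> L * (\<Sum>j. c (j + n))"
  proof (intro allI impI)
    fix m assume "n \<le> m"
    have "(\<integral>\<omega>. F (trunc m (X \<omega>)) \<partial>M) - (\<integral>\<omega>. F (trunc n (X \<omega>)) \<partial>M) = (\<integral>\<omega>. F (trunc m (X \<omega>)) - F (trunc n (X \<omega>)) \<partial>M)"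
      using int by simp
    also have "\<bar>\<dots>\<bar> \<le> (\<integral>\<omega>. \<bar>F (trunc m (X \<omega>)) - F (trunc n (X \<omega>))\<bar> \<partial>M)"
      by (rule integral_abs_bound)
    also have "\<dots> \<le> (\<integral>\<omega>. L * (\<Sum>j\<in>{n..<m}. \<bar>X \<omega> j\<bar>) \<partial>M)"
      by (rule integral_mono) (use int intX l1_lipschitz_trunc_trunc[OF F \<open>n \<le> m\<close>] in auto)
    also have "\<dots> = L * (\<Sum>j\<in>{n..<m}. \<integral>\<omega>. \<bar>X \<omega> j\<bar> \<partial>M)"
      using intX by simp
    also have "\<dots> \<le> L * (\<Sum>j\<in>{n..<m}. c j)"
      using L by (intro mult_left_mono sum_mono abs_moment_le) (use sq c in auto)
    also have "(\<Sum>j\<in>{n..<m}. c j) = (\<Sum>j<m-n. c (j + n))"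
      using \<open>n \<le> m\<close> sum.shift_bounds_nat_ivl[of c 0 n "m - n"] by (simp add: atLeast0LessThan)
    also have "L * \<dots> \<le> L * (\<Sum>j. c (j + n))"
      using L c by (intro mult_left_mono sum_le_suminf) (auto simp: summable_iff_shift)
    finally show "\<bar>(\<integral>\<omega>. F (trunc m (X \<omega>)) \<partial>M) - (\<integral>\<omega>. F (trunc n (X \<omega>)) \<partial>M)\<bar> \<le> L * (\<Sum>j. c (j + n))" .
  qed
  then show ?thesis using LIMSEQ_le_const2[OF lim] by blast
qed

lemma trig_poly_bounded:
  assumes "trig_poly n P" shows "\<exists>K. \<forall>x. \<bar>P x\<bar> \<le> K"
  using assms
proof induction
  case (cos a s b)
  have "\<bar>a * cos z\<bar> \<le> \<bar>a\<bar>" for z by (simp add: abs_mult mult_left_le)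
  then show ?case by blast
next
  case (add f g)
  then obtain K K' where "\<And>x. \<bar>f x\<bar> \<le> K" "\<And>x. \<bar>g x\<bar> \<le> K'" by blast
  then have "\<bar>f x + g x\<bar> \<le> K + K'" for x by (meson abs_triangle_ineq add_mono order_trans)
  then show ?case by blast
qed

lemma measurable_trig_poly:
  assumes "trig_poly n P" and [measurable]: "\<And>j. (\<lambda>\<omega>. X \<omega> j) \<in> borel_measurable M"
  shows "(\<lambda>\<omega>. P (X \<omega>)) \<in> borel_measurable M"
  using assms(1) by induction simp_all

lemma (in prob_space) integrable_trig_poly:
  assumes P: "trig_poly n P" and [measurable]: "\<And>j. (\<lambda>\<omega>. X \<omega> j) \<in> borel_measurable M"
  shows "integrable M (\<lambda>\<omega>. P (X \<omega>))"
proof -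
  obtain K where "\<And>x. \<bar>P x\<bar> \<le> K" using trig_poly_bounded[OF P] by blast
  then show ?thesis
    by (intro integrable_const_bound[of _ K] measurable_trig_poly[OF P]) auto
qed

text \<open>Replacing each coordinate by its triangle wave costs a multiple of its second moment
  over \<open>R\<close>; after that only the uniform error \<open>e\<close> remains.\<close>

lemma (in prob_space) tri_replacement_error:
  fixes f :: "(nat \<Rightarrow> real) \<Rightarrow> real"
  assumes lip: "\<And>x y. \<bar>f x - f y\<bar> \<le> L * (\<Sum>j<n. \<bar>x j - y j\<bar>)" and bd: "\<And>x. \<bar>f x\<bar> \<le> B" and L: "L \<ge> 0" and R: "R > 0"
    and [measurable]: "\<And>j. (\<lambda>\<omega>. X \<omega> j) \<in> borel_measurable M"
    and sq: "\<And>j. integrable M (\<lambda>\<omega>. (X \<omega> j)\<^sup>2)" "\<And>j. (\<integral>\<omega>. (X \<omega> j)\<^sup>2 \<partial>M) \<le> (c j)\<^sup>2"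
    and P: "trig_poly n P" "\<And>x. \<bar>f (\<lambda>j. tri R (x j)) - P x\<bar> < e"
  shows "\<bar>(\<integral>\<omega>. f (X \<omega>) \<partial>M) - (\<integral>\<omega>. P (X \<omega>) \<partial>M)\<bar> \<le> 2 * L * (\<Sum>j<n. (c j)\<^sup>2) / R + e"
proof -
  have fm: "f \<in> borel_measurable borel"
    by (rule borel_measurable_continuous_onI, rule continuous_on_finite_lipschitz, rule lip)
  have X: "X \<in> borel_measurable M" by (rule measurable_coordinatewise_then_product) simp
  have int: "integrable M (\<lambda>\<omega>. f (X \<omega>))"
    by (rule integrable_const_bound[of _ B]) (use bd measurable_compose[OF X fm] in auto)
  have intP: "integrable M (\<lambda>\<omega>. P (X \<omega>))" by (rule integrable_trig_poly[OF P(1)]) simp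
  have "(\<integral>\<omega>. f (X \<omega>) \<partial>M) - (\<integral>\<omega>. P (X \<omega>) \<partial>M) = (\<integral>\<omega>. f (X \<omega>) - P (X \<omega>) \<partial>M)"
    using int intP by simp
  also have "\<bar>\<dots>\<bar> \<le> (\<integral>\<omega>. \<bar>f (X \<omega>) - P (X \<omega>)\<bar> \<partial>M)" by (rule integral_abs_bound)
  also have "\<dots> \<le> (\<integral>\<omega>. 2 * L / R * (\<Sum>j<n. (X \<omega> j)\<^sup>2) + e \<partial>M)"
  proof (rule integral_mono)
    show "integrable M (\<lambda>\<omega>. 2 * L / R * (\<Sum>j<n. (X \<omega> j)\<^sup>2) + e)" using sq by auto
    fix \<omega>
    have "\<bar>f (X \<omega>) - f (\<lambda>j. tri R (X \<omega> j))\<bar> \<le> L * (\<Sum>j<n. \<bar>X \<omega> j - tri R (X \<omega> j)\<bar>)" by (rule lip)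
    also have "\<dots> \<le> L * (\<Sum>j<n. 2 * (X \<omega> j)\<^sup>2 / R)"
      by (intro mult_left_mono sum_mono tri_error R L)
    also have "\<dots> = 2 * L / R * (\<Sum>j<n. (X \<omega> j)\<^sup>2)"
      by (simp add: sum_distrib_left mult_ac)
    finally show "\<bar>f (X \<omega>) - P (X \<omega>)\<bar> \<le> 2 * L / R * (\<Sum>j<n. (X \<omega> j)\<^sup>2) + e"
      using P(2)[of "X \<omega>"] by linarith
  qed (use int intP in auto)
  also have "\<dots> = 2 * L / R * (\<Sum>j<n. (\<integral>\<omega>. (X \<omega> j)\<^sup>2 \<partial>M)) + e"
    using sq by (simp add: prob_space)
  also have "\<dots> \<le> 2 * L / R * (\<Sum>j<n. (c j)\<^sup>2) + e"
    using L R by (intro add_mono mult_left_mono sum_mono sq) auto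
  finally show ?thesis by (simp add: mult_ac)
qed

text \<open>The approximations are chosen in the order \<open>n\<close>, \<open>R\<close>,
  \<open>P\<close>: the tail of \<open>c\<close> fixes \<open>n\<close>, the second moments below
  \<open>n\<close> fix the size \<open>R\<close> of the triangle waves, and compactness yields
  \<open>P\<close>. All three errors are uniform in \<open>T\<close>, so only the expectation of one
  fixed trigonometric polynomial has to converge.\<close>

theorem l1_weak_convergence:
  fixes X :: "nat \<Rightarrow> 'a \<Rightarrow> nat \<Rightarrow> real" and Z :: "'c \<Rightarrow> nat \<Rightarrow> real"
  assumes "prob_space M" "prob_space N"
    and measX [measurable]: "\<And>T j. (\<lambda>\<omega>. X T \<omega> j) \<in> borel_measurable M"
    and measZ [measurable]: "\<And>j. (\<lambda>\<omega>. Z \<omega> j) \<in> borel_measurable N"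
    and sumX: "\<And>T \<omega>. \<omega> \<in> space M \<Longrightarrow> summable (\<lambda>j. \<bar>X T \<omega> j\<bar>)"
    and sumZ: "\<And>\<omega>. \<omega> \<in> space N \<Longrightarrow> summable (\<lambda>j. \<bar>Z \<omega> j\<bar>)"
    and sqX: "\<And>T j. integrable M (\<lambda>\<omega>. (X T \<omega> j)\<^sup>2)" "\<And>T j. (\<integral>\<omega>. (X T \<omega> j)\<^sup>2 \<partial>M) \<le> (c j)\<^sup>2"
    and sqZ: "\<And>j. integrable N (\<lambda>\<omega>. (Z \<omega> j)\<^sup>2)" "\<And>j. (\<integral>\<omega>. (Z \<omega> j)\<^sup>2 \<partial>N) \<le> (c j)\<^sup>2"
    and c: "\<And>j. c j \<ge> 0" "summable c"
    and conv: "\<And>n s b. (\<lambda>T. \<integral>\<omega>. cos ((\<Sum>j<n. s j * X T \<omega> j) + b) \<partial>M)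
                  \<longlonglongrightarrow> (\<integral>\<omega>. cos ((\<Sum>j<n. s j * Z \<omega> j) + b) \<partial>N)"
    and F: "l1_lipschitz B L F" and L: "L \<ge> 0"
  shows "(\<lambda>T. \<integral>\<omega>. F (X T \<omega>) \<partial>M) \<longlonglongrightarrow> (\<integral>\<omega>. F (Z \<omega>) \<partial>N)"
proof (rule LIMSEQ_I)
  interpret M: prob_space M by fact
  interpret N: prob_space N by fact
  fix r :: real assume r: "r > 0"
  have "(\<lambda>n. L * (\<Sum>j. c (j + n))) \<longlonglongrightarrow> L * 0"
    using suminf_exist_split2[OF c(2)] by (intro tendsto_intros)
  then have "\<forall>\<^sub>F n in sequentially. L * (\<Sum>j. c (j + n)) < r / 10"
    using r by (intro order_tendstoD(2)[of _ 0]) auto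
  then obtain n where n: "L * (\<Sum>j. c (j + n)) < r / 10"
    using eventually_happens trivial_limit_sequentially by blast
  \<comment> \<open>The quotient makes the triangle-wave error at most \<open>r / 10\<close>; the
    summand 1 keeps \<open>R\<close> positive when the quotient vanishes.\<close>
  define R where "R = 1 + 20 * L * (\<Sum>j<n. (c j)\<^sup>2) / r"
  have nn: "L * (\<Sum>j<n. (c j)\<^sup>2) \<ge> 0" using L by (simp add: sum_nonneg)
  have R: "R > 0" unfolding R_def using nn r by (intro add_pos_nonneg divide_nonneg_pos) auto
  have Rb: "2 * L * (\<Sum>j<n. (c j)\<^sup>2) / R \<le> r / 10"
  proof -
    have "20 * L * (\<Sum>j<n. (c j)\<^sup>2) \<le> R * r" unfolding R_def using r by (simp add: algebra_simps)
    then show ?thesis using R r by (simp add: field_simps)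
  qed
  have lip: "\<And>x y. \<bar>F (trunc n x) - F (trunc n y)\<bar> \<le> L * (\<Sum>j<n. \<bar>x j - y j\<bar>)" by (rule l1_lipschitz_trunc[OF F])
  have bd: "\<And>x. \<bar>F (trunc n x)\<bar> \<le> B" using F summable_trunc by (simp add: l1_lipschitz_def)
  obtain P where P: "trig_poly n P" "\<And>x. \<bar>F (trunc n (\<lambda>j. tri R (x j))) - P x\<bar> < r / 10"
    using sine_approximation[of "\<lambda>x. F (trunc n x)", OF lip R, of "r / 10"] r by auto
  have eX: "\<bar>(\<integral>\<omega>. F (X T \<omega>) \<partial>M) - (\<integral>\<omega>. P (X T \<omega>) \<partial>M)\<bar> < 3 * r / 10" for T
    using M.tri_replacement_error[where f = "\<lambda>x. F (trunc n x)" and X = "X T" and c = c, OF lip bd L R measX sqX P]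
      M.l1_lipschitz_truncation_error[where X = "X T" and n = n, OF F L measX sumX sqX c] n Rb by linarith
  have eZ: "\<bar>(\<integral>\<omega>. F (Z \<omega>) \<partial>N) - (\<integral>\<omega>. P (Z \<omega>) \<partial>N)\<bar> < 3 * r / 10"
    using N.tri_replacement_error[where f = "\<lambda>x. F (trunc n x)" and X = Z and c = c, OF lip bd L R measZ sqZ P]
      N.l1_lipschitz_truncation_error[where X = Z and n = n, OF F L measZ sumZ sqZ c] n Rb by linarith
  have "(\<lambda>T. \<integral>\<omega>. P (X T \<omega>) \<partial>M) \<longlonglongrightarrow> (\<integral>\<omega>. P (Z \<omega>) \<partial>N)"
    using P(1)
  proof induction
    case (cos a s b)
    show ?case using tendsto_mult_left[OF conv[where n = n and s = s and b = b], of a] by simp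
  next
    case (add f g)
    then show ?case
      using tendsto_add[OF add.IH] M.integrable_trig_poly[OF add.hyps(1) measX] M.integrable_trig_poly[OF add.hyps(2) measX]
       N.integrable_trig_poly[OF add.hyps(1) measZ] N.integrable_trig_poly[OF add.hyps(2) measZ] by simp
  qed
  from LIMSEQ_D[OF this, of "r / 10"] r obtain T0 where
    T0: "\<And>T. T \<ge> T0 \<Longrightarrow> \<bar>(\<integral>\<omega>. P (X T \<omega>) \<partial>M) - (\<integral>\<omega>. P (Z \<omega>) \<partial>N)\<bar> < r / 10" by auto
  show "\<exists>no. \<forall>T\<ge>no. norm ((\<integral>\<omega>. F (X T \<omega>) \<partial>M) - (\<integral>\<omega>. F (Z \<omega>) \<partial>N)) < r"
  proof (intro exI allI impI)
    fix T assume "T \<ge> T0"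
    with T0[OF this] eX[of T] eZ r show "norm ((\<integral>\<omega>. F (X T \<omega>) \<partial>M) - (\<integral>\<omega>. F (Z \<omega>) \<partial>N)) < r"
      unfolding real_norm_def by linarith
  qed
qed

section \<open>Gaussian sequences with a given covariance\<close>

definition sq_int :: "'a measure \<Rightarrow> ('a \<Rightarrow> real) \<Rightarrow> bool" where
  "sq_int M f \<longleftrightarrow> f \<in> borel_measurable M \<and> integrable M (\<lambda>\<omega>. (f \<omega>)\<^sup>2)"

lemma sq_int_mult: 
  assumes "sq_int M f" "sq_int M g" shows "integrable M (\<lambda>\<omega>. f \<omega> * g \<omega>)"
proof (rule Bochner_Integration.integrable_bound[of M "\<lambda>\<omega>. (f \<omega>)\<^sup>2 + (g \<omega>)\<^sup>2"])
  have *: "\<bar>a * b\<bar> \<le> a\<^sup>2 + b\<^sup>2" for a b :: real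
  proof -
    have "0 \<le> \<bar>a\<bar> * \<bar>b\<bar>" by simp
    moreover have "2 * (\<bar>a\<bar> * \<bar>b\<bar>) \<le> a\<^sup>2 + b\<^sup>2" using sum_squares_bound[of "\<bar>a\<bar>" "\<bar>b\<bar>"] by simp
    ultimately show ?thesis unfolding abs_mult by linarith
  qed
  show "AE x in M. norm (f x * g x) \<le> norm ((f x)\<^sup>2 + (g x)\<^sup>2)" using * by auto
qed (use assms in \<open>auto simp: sq_int_def\<close>)

lemma sq_int_add: 
  assumes "sq_int M f" "sq_int M g" shows "sq_int M (\<lambda>\<omega>. f \<omega> + g \<omega>)"
proof -
  have "(\<lambda>\<omega>. (f \<omega> + g \<omega>)\<^sup>2) = (\<lambda>\<omega>. (f \<omega>)\<^sup>2 + (g \<omega>)\<^sup>2 + 2 * (f \<omega> * g \<omega>))"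
    by (simp add: power2_eq_square algebra_simps)
  then show ?thesis using assms sq_int_mult[OF assms] unfolding sq_int_def by auto
qed

lemma sq_int_cmult: "sq_int M f \<Longrightarrow> sq_int M (\<lambda>\<omega>. c * f \<omega>)"
  unfolding sq_int_def power_mult_distrib by (intro conjI borel_measurable_times borel_measurable_const integrable_mult_right) simp_all

lemma sq_int_diff: "sq_int M f \<Longrightarrow> sq_int M g \<Longrightarrow> sq_int M (\<lambda>\<omega>. f \<omega> - g \<omega>)"
  using sq_int_add[of M f "\<lambda>\<omega>. - 1 * g \<omega>"] sq_int_cmult[of M g "-1"] by simp

lemma sq_int_0: "sq_int M (\<lambda>_. 0)"
  by (simp add: sq_int_def)

lemma sq_int_sum: "(\<And>i. i \<in> A \<Longrightarrow> sq_int M (f i)) \<Longrightarrow> sq_int M (\<lambda>\<omega>. \<Sum>i\<in>A. f i \<omega>)"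
  by (induction A rule: infinite_finite_induct) (auto simp: sq_int_0 intro: sq_int_add)

text \<open>If \<open>x n\<close> depends linearly on its predecessors, the normalising root is 0
  and division by zero makes the normalised vector the zero function. Degenerate directions thus
  drop out without a case distinction.\<close>

fun gram_schmidt :: "'a measure \<Rightarrow> (nat \<Rightarrow> 'a \<Rightarrow> real) \<Rightarrow> nat \<Rightarrow> 'a \<Rightarrow> real" where
  "gram_schmidt M x n =
    (let r = (\<lambda>\<omega>. x n \<omega> - (\<Sum>k<n. (\<integral>\<omega>. x n \<omega> * gram_schmidt M x k \<omega> \<partial>M) * gram_schmidt M x k \<omega>))
     in (\<lambda>\<omega>. r \<omega> / sqrt (\<integral>\<omega>. (r \<omega>)\<^sup>2 \<partial>M)))"

declare gram_schmidt.simps [simp del]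

text \<open>A Cholesky factorisation of the infinite Gram matrix: expanding each \<open>x i\<close>
  in the orthonormalised sequence gives a lower triangular \<open>a\<close>, one array serving all
  sizes \<open>n\<close>.\<close>

lemma gram_schmidt_factorization:
  assumes x: "\<And>n. sq_int M (x n)"
  obtains a :: "nat \<Rightarrow> nat \<Rightarrow> real" where
    "\<And>n i j. i < n \<Longrightarrow> j < n \<Longrightarrow> (\<integral>\<omega>. x i \<omega> * x j \<omega> \<partial>M) = (\<Sum>k<n. a i k * a j k)"
proof -
  define e where "e = gram_schmidt M x"
  define r where "r = (\<lambda>n \<omega>. x n \<omega> - (\<Sum>k<n. (\<integral>\<omega>. x n \<omega> * e k \<omega> \<partial>M) * e k \<omega>))"
  define \<rho> where "\<rho> = (\<lambda>n. sqrt (\<integral>\<omega>. (r n \<omega>)\<^sup>2 \<partial>M))"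
  define ip where "ip = (\<lambda>f g :: 'a \<Rightarrow> real. \<integral>\<omega>. f \<omega> * g \<omega> \<partial>M)"
  have r_ip: "r n = (\<lambda>\<omega>. x n \<omega> - (\<Sum>k<n. ip (x n) (e k) * e k \<omega>))" for n
    by (simp add: r_def ip_def)
  have e: "e n = (\<lambda>\<omega>. r n \<omega> / \<rho> n)" for n
    unfolding e_def \<rho>_def r_def by (subst gram_schmidt.simps) (simp add: Let_def)
  have sq: "sq_int M (r n) \<and> sq_int M (e n)" for n
  proof (induction n rule: less_induct)
    case (less n)
    have "sq_int M (r n)" unfolding r_def
      by (intro sq_int_diff x sq_int_sum sq_int_cmult) (use less in auto)
    then show ?case unfolding e using sq_int_cmult[of M "r n" "1 / \<rho> n"] by simp
  qed
  have ip_diff: "ip (\<lambda>\<omega>. f \<omega> - g \<omega>) h = ip f h - ip g h" if "sq_int M f" "sq_int M g" "sq_int M h" for f g h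
    unfolding ip_def left_diff_distrib using that by (intro Bochner_Integration.integral_diff sq_int_mult)
  have ip_sum: "ip (\<lambda>\<omega>. \<Sum>k\<in>A. f k \<omega>) h = (\<Sum>k\<in>A. ip (f k) h)" if "\<And>k. k \<in> A \<Longrightarrow> sq_int M (f k)" "sq_int M h" for f :: "nat \<Rightarrow> 'a \<Rightarrow> real" and h A
    unfolding ip_def sum_distrib_right using that by (intro Bochner_Integration.integral_sum sq_int_mult) auto
  have ip_cmult: "ip (\<lambda>\<omega>. c * f \<omega>) h = c * ip f h" for c f h
    unfolding ip_def by (simp add: mult.assoc)
  have ip_comm: "ip f h = ip h f" for f h unfolding ip_def by (simp add: mult.commute)
  have \<rho>2: "ip (r n) (r n) = (\<rho> n)\<^sup>2" for n unfolding \<rho>_def ip_def by (simp add: power2_eq_square)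
  have e_null: "e n = (\<lambda>_. 0)" if "\<rho> n = 0" for n unfolding e using that by simp
  have e_unit: "ip (e n) (e n) = 1" if "\<rho> n \<noteq> 0" for n
  proof -
    have "ip (e n) (e n) = ip (r n) (r n) / (\<rho> n)\<^sup>2"
      unfolding e ip_def by (simp add: power2_eq_square)
    then show ?thesis using that \<rho>2 by simp
  qed
  have orth: "k < n \<Longrightarrow> ip (e n) (e k) = 0" for n k
  proof (induction n arbitrary: k rule: less_induct)
    case (less n)
    have orth': "ip (e j) (e k) = 0" if "j < n" "j \<noteq> k" for j
      using less.IH[of j k] less.IH[of k j] less.prems that ip_comm by (cases "j < k") auto
    have "ip (r n) (e k) = ip (x n) (e k) - (\<Sum>j<n. ip (x n) (e j) * ip (e j) (e k))"
      unfolding r_ip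
      by (subst ip_diff, (intro x sq_int_sum sq_int_cmult conjunct2[OF sq])+, subst ip_sum)
         (auto intro!: sq_int_cmult simp: sq ip_cmult)
    also have "(\<Sum>j<n. ip (x n) (e j) * ip (e j) (e k)) = (\<Sum>j<n. if j = k then ip (x n) (e k) * ip (e k) (e k) else 0)"
      by (rule sum.cong) (auto simp: orth')
    also have "\<dots> = ip (x n) (e k) * ip (e k) (e k)" using less.prems by simp
    finally have "ip (r n) (e k) = ip (x n) (e k) * (1 - ip (e k) (e k))" by (simp add: algebra_simps)
    \<comment> \<open>Either \<open>e k\<close> is a unit vector and the bracket vanishes, or it is
      the zero function and so is its inner product with \<open>x n\<close>.\<close>
    also have "\<dots> = 0"
    proof (cases "\<rho> k = 0")
      case True
      then show ?thesis unfolding e_null[OF True] ip_def by simp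
    qed (simp add: e_unit)
    finally have "ip (r n) (e k) = 0" .
    then show ?case using ip_cmult[of "1 / \<rho> n" "r n" "e k"] unfolding e[of n] by simp
  qed
  have orth2: "ip (e j) (e k) = (if j = k \<and> \<rho> j \<noteq> 0 then 1 else 0)" for j k
  proof (cases j k rule: linorder_cases)
    case equal
    then show ?thesis using e_unit[of k] e_null[of k] by (auto simp: ip_def)
  next
    case less
    then show ?thesis using orth[OF less] by (subst ip_comm) simp
  next
    case greater
    then show ?thesis using orth[OF greater] by simp
  qed
  \<comment> \<open>Below the diagonal the Fourier coefficients, on it the norm of the residual,
    since \<open>r n\<close> is \<open>\<rho> n\<close> times \<open>e n\<close> almost
    everywhere.\<close>
  define a where "a = (\<lambda>n k. if k < n then ip (x n) (e k) else if k = n then \<rho> n else 0)"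
  have a0: "a n k = 0" if "\<rho> k = 0" for n k
    using that e_null[OF that] by (auto simp: a_def ip_def)
  have x_eq: "AE \<omega> in M. x i \<omega> = (\<Sum>k<n. a i k * e k \<omega>)" if "i < n" for i n
  proof -
    have "AE \<omega> in M. r i \<omega> = \<rho> i * e i \<omega>"
    proof (cases "\<rho> i = 0")
      case True
      have "integrable M (\<lambda>\<omega>. (r i \<omega>)\<^sup>2)" using sq by (simp add: sq_int_def)
      moreover have "(\<integral>\<omega>. (r i \<omega>)\<^sup>2 \<partial>M) = 0" using True by (simp add: \<rho>_def)
      ultimately have "AE \<omega> in M. (r i \<omega>)\<^sup>2 = 0"
        by (subst (asm) integral_nonneg_eq_0_iff_AE) auto
      then show ?thesis by eventually_elim (simp add: True)
    next
      case False
      then show ?thesis by (simp add: e)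
    qed
    then show ?thesis
    proof eventually_elim
      case (elim \<omega>)
      have "(\<Sum>k<n. a i k * e k \<omega>) = (\<Sum>k<Suc i. a i k * e k \<omega>)"
        using that by (intro sum.mono_neutral_right) (auto simp: a_def)
      also have "\<dots> = (\<Sum>k<i. ip (x i) (e k) * e k \<omega>) + r i \<omega>"
        by (simp add: a_def elim)
      also have "\<dots> = x i \<omega>" by (simp add: r_def ip_def)
      finally show ?case by simp
    qed
  qed
  show ?thesis
  proof (rule that[of a])
    fix n i j :: nat assume ij: "i < n" "j < n"
    have [measurable]: "x k \<in> borel_measurable M" "e k \<in> borel_measurable M" for k using x sq by (auto simp: sq_int_def)
    have "(\<integral>\<omega>. x i \<omega> * x j \<omega> \<partial>M) = ip (\<lambda>\<omega>. \<Sum>k<n. a i k * e k \<omega>) (\<lambda>\<omega>. \<Sum>k<n. a j k * e k \<omega>)"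
      unfolding ip_def
    proof (rule integral_cong_AE)
      show "AE \<omega> in M. x i \<omega> * x j \<omega> = (\<Sum>k<n. a i k * e k \<omega>) * (\<Sum>k<n. a j k * e k \<omega>)"
        using x_eq[OF ij(1)] x_eq[OF ij(2)] by eventually_elim simp
    qed measurable
    also have "\<dots> = (\<Sum>k<n. a i k * ip (e k) (\<lambda>\<omega>. \<Sum>k<n. a j k * e k \<omega>))"
      by (subst ip_sum) (auto simp: ip_cmult intro!: sq_int_sum sq_int_cmult conjunct2[OF sq])
    also have "\<dots> = (\<Sum>k<n. a i k * (\<Sum>l<n. a j l * ip (e k) (e l)))"
    proof (rule sum.cong)
      fix k
      have "ip (e k) (\<lambda>\<omega>. \<Sum>k<n. a j k * e k \<omega>) = (\<Sum>l<n. a j l * ip (e k) (e l))"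
        by (subst ip_comm, subst ip_sum) (auto simp: ip_cmult ip_comm intro!: sq_int_cmult conjunct2[OF sq])
      then show "a i k * ip (e k) (\<lambda>\<omega>. \<Sum>k<n. a j k * e k \<omega>) = a i k * (\<Sum>l<n. a j l * ip (e k) (e l))" by simp
    qed simp
    also have "\<dots> = (\<Sum>k<n. a i k * a j k)"
    proof (rule sum.cong)
      fix k assume k: "k \<in> {..<n}"
      have "(\<Sum>l<n. a j l * ip (e k) (e l)) = (\<Sum>l<n. if l = k then a j k else 0)"
        by (rule sum.cong) (auto simp: orth2 a0)
      then show "a i k * (\<Sum>l<n. a j l * ip (e k) (e l)) = a i k * a j k" using k by simp
    qed simp
    finally show "(\<integral>\<omega>. x i \<omega> * x j \<omega> \<partial>M) = (\<Sum>k<n. a i k * a j k)" .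
  qed
qed

text \<open>The limit process has to live on a measure over functions from reals to reals, so the
  independent standard normal variables are indexed by the reals; the construction draws on the
  coordinates \<open>real k\<close>.\<close>

definition gauss_space :: "(real \<Rightarrow> real) measure" where
  "gauss_space = PiM UNIV (\<lambda>_. std_normal_distribution)"

lemma prob_space_std_normal: "prob_space std_normal_distribution"
  using prob_space_normal_density[of 1 0] by simp

lemma prob_space_gauss_space: "prob_space gauss_space"
  unfolding gauss_space_def by (rule prob_space_PiM) (rule prob_space_std_normal)

lemma measurable_gauss_component [measurable]: "(\<lambda>y. y i) \<in> borel_measurable gauss_space"
  using measurable_component_singleton[of i UNIV "\<lambda>_. std_normal_distribution"] by (simp add: gauss_space_def)

lemma distr_gauss_component: "distr gauss_space borel (\<lambda>y. y i) = std_normal_distribution"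
proof -
  have "distr gauss_space borel (\<lambda>y. y i) = distr gauss_space std_normal_distribution (\<lambda>y. y i)"
    by (rule distr_cong) auto
  also have "\<dots> = std_normal_distribution"
    unfolding gauss_space_def by (rule distr_PiM_component) (auto simp: prob_space_std_normal)
  finally show ?thesis .
qed

lemma indep_gauss: "prob_space.indep_vars gauss_space (\<lambda>_. borel) (\<lambda>i y. y i) A"
proof -
  interpret prob_space gauss_space by (rule prob_space_gauss_space)
  have "distr gauss_space (PiM UNIV (\<lambda>_. borel)) (\<lambda>x. x) = distr gauss_space gauss_space (\<lambda>x. x)"
    by (rule distr_cong) (auto simp: gauss_space_def cong: sets_PiM_cong)
  then have "indep_vars (\<lambda>_. borel) (\<lambda>i y. y i) (UNIV :: real set)"
    by (subst indep_vars_iff_distr_eq_PiM) (auto simp: distr_gauss_component distr_id gauss_space_def[symmetric] restrict_def)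
  then show ?thesis by (rule indep_vars_subset) simp
qed

lemma gauss_component_moments:
  "integrable gauss_space (\<lambda>y. y i)" "integrable gauss_space (\<lambda>y. (y i)\<^sup>2)"
  "(\<integral>y. y i \<partial>gauss_space) = 0" "(\<integral>y. (y i)\<^sup>2 \<partial>gauss_space) = 1"
proof -
  have 1: "has_bochner_integral std_normal_distribution (\<lambda>x. x) 0"
    using std_normal_moment_odd[of 0] by (intro has_bochner_integral_density) (auto simp: normal_density_nonneg)
  have 2: "has_bochner_integral std_normal_distribution (\<lambda>x. x\<^sup>2) 1"
    using std_normal_moment_even[of 1] by (intro has_bochner_integral_density) (auto simp: normal_density_nonneg)
  have idm: "(\<lambda>x::real. x) \<in> borel_measurable borel" by simp
  have m: "(\<lambda>y. y i) \<in> measurable gauss_space borel" by simp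
  have "integrable (distr gauss_space borel (\<lambda>y. y i)) (\<lambda>x. x) \<and> (\<integral>x. x \<partial>distr gauss_space borel (\<lambda>y. y i)) = 0"
    unfolding distr_gauss_component using 1 by (simp add: has_bochner_integral_iff)
  then show "integrable gauss_space (\<lambda>y. y i)" "(\<integral>y. y i \<partial>gauss_space) = 0"
    unfolding integrable_distr_eq[OF m idm] integral_distr[OF m idm] by blast+
  have s: "(\<lambda>x::real. x\<^sup>2) \<in> borel_measurable borel" by simp
  have "integrable (distr gauss_space borel (\<lambda>y. y i)) (\<lambda>x. x\<^sup>2) \<and> (\<integral>x. x\<^sup>2 \<partial>distr gauss_space borel (\<lambda>y. y i)) = 1"
    unfolding distr_gauss_component using 2 by (simp add: has_bochner_integral_iff)
  then show "integrable gauss_space (\<lambda>y. (y i)\<^sup>2)" "(\<integral>y. (y i)\<^sup>2 \<partial>gauss_space) = 1"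
    unfolding integrable_distr_eq[OF m s] integral_distr[OF m s] by blast+
qed

lemma sq_int_gauss: "sq_int gauss_space (\<lambda>y. y i)"
  using gauss_component_moments[of i] by (simp add: sq_int_def)

lemma gauss_component_product:
  "(\<integral>y. y i * y j \<partial>gauss_space) = (if i = j then 1 else 0)"
proof (cases "i = j")
  case True
  then show ?thesis using gauss_component_moments(4)[of i] by (simp add: power2_eq_square)
next
  case False
  interpret prob_space gauss_space by (rule prob_space_gauss_space)
  have "(\<integral>y. (\<Prod>k\<in>{i, j}. y k) \<partial>gauss_space) = (\<Prod>k\<in>{i, j}. \<integral>y. y k \<partial>gauss_space)"
    by (rule indep_vars_lebesgue_integral) (auto intro!: indep_gauss gauss_component_moments)
  then show ?thesis using False by (simp add: gauss_component_moments)
qed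

lemma char_gauss_combination:
  "(\<integral>y. iexp (\<Sum>k<n. b k * y (real k)) \<partial>gauss_space) = of_real (exp (- (\<Sum>k<n. (b k)\<^sup>2) / 2))"
proof -
  interpret prob_space gauss_space by (rule prob_space_gauss_space)
  have "(\<integral>y. iexp (\<Sum>k<n. b k * y (real k)) \<partial>gauss_space) = (\<integral>y. (\<Prod>i\<in>real ` {..<n}. iexp (b (nat \<lfloor>i\<rfloor>) * y i)) \<partial>gauss_space)"
    by (subst prod.reindex) (auto simp: inj_on_def exp_sum sum_distrib_left)
  also have "\<dots> = (\<Prod>i\<in>real ` {..<n}. \<integral>y. iexp (b (nat \<lfloor>i\<rfloor>) * y i) \<partial>gauss_space)"
  proof (rule indep_vars_lebesgue_integral)
    show "indep_vars (\<lambda>_. borel) (\<lambda>i y. iexp (b (nat \<lfloor>i\<rfloor>) * y i)) (real ` {..<n})"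
      by (rule indep_vars_compose2[OF indep_gauss]) simp
    show "integrable gauss_space (\<lambda>y. iexp (b (nat \<lfloor>i\<rfloor>) * y i))" for i
      by (rule integrable_const_bound[of _ 1]) auto
  qed simp
  also have "\<dots> = (\<Prod>i\<in>real ` {..<n}. of_real (exp (- (b (nat \<lfloor>i\<rfloor>))\<^sup>2 / 2)))"
  proof (rule prod.cong)
    fix i :: real
    have "(\<integral>y. iexp (b (nat \<lfloor>i\<rfloor>) * y i) \<partial>gauss_space) = char (distr gauss_space borel (\<lambda>y. y i)) (b (nat \<lfloor>i\<rfloor>))"
      unfolding char_def by (subst integral_distr) auto
    then show "(\<integral>y. iexp (b (nat \<lfloor>i\<rfloor>) * y i) \<partial>gauss_space) = of_real (exp (- (b (nat \<lfloor>i\<rfloor>))\<^sup>2 / 2))"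
      by (simp add: distr_gauss_component char_std_normal_distribution)
  qed simp
  also have "\<dots> = (\<Prod>k<n. of_real (exp (- (b k)\<^sup>2 / 2)))"
    by (subst prod.reindex) (auto simp: inj_on_def)
  also have "\<dots> = of_real (exp (- (\<Sum>k<n. (b k)\<^sup>2) / 2))"
    by (simp only: of_real_prod[symmetric] exp_sum[symmetric, OF finite_lessThan])
       (simp add: sum_negf sum_divide_distrib)
  finally show ?thesis .
qed

text \<open>Row \<open>j\<close> of the triangular factor applied to independent standard normals
  gives the \<open>j\<close>-th variable. Triangularity makes it a finite combination, so the whole
  sequence lives on one space.\<close>

theorem gaussian_sequence:
  assumes x: "\<And>n. sq_int M (x n)"
  obtains V :: "nat \<Rightarrow> (real \<Rightarrow> real) \<Rightarrow> real" where
    "\<And>j. sq_int gauss_space (V j)"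
    "\<And>j. (\<integral>y. V j y \<partial>gauss_space) = 0"
    "\<And>i j. (\<integral>y. V i y * V j y \<partial>gauss_space) = (\<integral>\<omega>. x i \<omega> * x j \<omega> \<partial>M)"
    "\<And>n s. (\<integral>y. iexp (\<Sum>j<n. s j * V j y) \<partial>gauss_space) = of_real (exp (- (\<integral>\<omega>. (\<Sum>j<n. s j * x j \<omega>)\<^sup>2 \<partial>M) / 2))"
proof -
  interpret G: prob_space gauss_space by (rule prob_space_gauss_space)
  obtain a :: "nat \<Rightarrow> nat \<Rightarrow> real" where a:
    "\<And>n i j. i < n \<Longrightarrow> j < n \<Longrightarrow> (\<integral>\<omega>. x i \<omega> * x j \<omega> \<partial>M) = (\<Sum>k<n. a i k * a j k)"
    using gram_schmidt_factorization[of M x, OF x] by blast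
  \<comment> \<open>Triangularity is recovered from the identity alone: for \<open>i < k\<close> the
    squares of row \<open>i\<close> have the same sum over the first \<open>k\<close> and over the
    first \<open>k + 1\<close> columns.\<close>
  have a0: "a i k = 0" if "i < k" for i k
  proof -
    have "(\<Sum>l<Suc k. a i l * a i l) = (\<Sum>l<k. a i l * a i l)"
      using a[of i k i] a[of i "Suc k" i] that by simp
    then show ?thesis by simp
  qed
  define V where "V = (\<lambda>j (y :: real \<Rightarrow> real). \<Sum>k\<le>j. a j k * y (real k))"
  have V: "V j y = (\<Sum>k<n. a j k * y (real k))" if "j < n" for j n y
    unfolding V_def using that a0 by (intro sum.mono_neutral_left) auto
  show ?thesis
  proof (rule that[of V])
    show sqV: "sq_int gauss_space (V j)" for j
      unfolding V_def by (intro sq_int_sum sq_int_cmult sq_int_gauss)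
    show "(\<integral>y. V j y \<partial>gauss_space) = 0" for j
      unfolding V_def by (subst Bochner_Integration.integral_sum) (auto simp: gauss_component_moments)
    show "(\<integral>y. V i y * V j y \<partial>gauss_space) = (\<integral>\<omega>. x i \<omega> * x j \<omega> \<partial>M)" for i j
    proof -
      obtain n where n: "i < n" "j < n" by (metis less_Suc_eq_le max.cobounded1 max.cobounded2)
      have "(\<integral>y. V i y * V j y \<partial>gauss_space) = (\<integral>y. (\<Sum>k<n. \<Sum>l<n. a i k * a j l * (y (real k) * y (real l))) \<partial>gauss_space)"
        using n by (simp add: V[of _ n] sum_product mult_ac)
      also have "\<dots> = (\<Sum>k<n. \<Sum>l<n. a i k * a j l * (\<integral>y. y (real k) * y (real l) \<partial>gauss_space))"
        using sq_int_mult[OF sq_int_gauss sq_int_gauss] by simp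
      also have "\<dots> = (\<Sum>k<n. a i k * a j k)"
        by (simp add: gauss_component_product if_distrib[of "\<lambda>z. _ * z"] cong: if_cong)
      finally show ?thesis using a[OF n] by simp
    qed
    show "(\<integral>y. iexp (\<Sum>j<n. s j * V j y) \<partial>gauss_space) = of_real (exp (- (\<integral>\<omega>. (\<Sum>j<n. s j * x j \<omega>)\<^sup>2 \<partial>M) / 2))" for n s
    proof -
      have "(\<Sum>j<n. s j * V j y) = (\<Sum>k<n. (\<Sum>j<n. s j * a j k) * y (real k))" for y
      proof -
        have "(\<Sum>j<n. s j * V j y) = (\<Sum>j<n. \<Sum>k<n. s j * a j k * y (real k))"
          by (rule sum.cong) (auto simp: V[of _ n] sum_distrib_left mult.assoc)
        also have "\<dots> = (\<Sum>k<n. (\<Sum>j<n. s j * a j k) * y (real k))"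
          by (subst sum.swap) (simp add: sum_distrib_right)
        finally show ?thesis .
      qed
      moreover have "(\<Sum>k<n. (\<Sum>j<n. s j * a j k)\<^sup>2) = (\<integral>\<omega>. (\<Sum>j<n. s j * x j \<omega>)\<^sup>2 \<partial>M)"
      proof -
        have "(\<integral>\<omega>. (\<Sum>j<n. s j * x j \<omega>)\<^sup>2 \<partial>M) = (\<integral>\<omega>. (\<Sum>i<n. \<Sum>j<n. s i * s j * (x i \<omega> * x j \<omega>)) \<partial>M)"
          by (simp add: power2_eq_square sum_product mult_ac)
        also have "\<dots> = (\<Sum>i<n. \<Sum>j<n. s i * s j * (\<integral>\<omega>. x i \<omega> * x j \<omega> \<partial>M))"
          using sq_int_mult[OF x x] by simp
        also have "\<dots> = (\<Sum>i<n. \<Sum>j<n. s i * s j * (\<Sum>k<n. a i k * a j k))"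
          using a by (intro sum.cong refl) auto
        also have "\<dots> = (\<Sum>i<n. \<Sum>j<n. \<Sum>k<n. s i * a i k * (s j * a j k))"
          by (simp add: sum_distrib_left mult_ac)
        also have "\<dots> = (\<Sum>i<n. \<Sum>k<n. \<Sum>j<n. s i * a i k * (s j * a j k))"
          by (rule sum.cong[OF refl], rule sum.swap)
        also have "\<dots> = (\<Sum>k<n. \<Sum>i<n. \<Sum>j<n. s i * a i k * (s j * a j k))"
          by (rule sum.swap)
        also have "\<dots> = (\<Sum>k<n. (\<Sum>j<n. s j * a j k)\<^sup>2)"
          by (simp add: power2_eq_square sum_product)
        finally show ?thesis by simp
      qed
      ultimately show ?thesis
        using char_gauss_combination[where n = n and b = "\<lambda>k. \<Sum>j<n. s j * a j k"] by simp
    qed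
  qed
qed

text \<open>As a measurability rule this would also apply to unrelated functions.\<close>

declare measurable_gauss_component [measurable del]

section \<open>Random series\<close>

lemma sq_int_imp_integrable:
  assumes "prob_space M" "sq_int M f" shows "integrable M f"
proof -
  interpret prob_space M by fact
  have "sq_int M (\<lambda>_. 1)" by (simp add: sq_int_def)
  from sq_int_mult[OF assms(2) this] show ?thesis by simp
qed

lemma Cauchy_Schwarz_integral:
  assumes f: "sq_int M f" and g: "sq_int M g"
  shows "\<bar>\<integral>\<omega>. f \<omega> * g \<omega> \<partial>M\<bar> \<le> sqrt (\<integral>\<omega>. (f \<omega>)\<^sup>2 \<partial>M) * sqrt (\<integral>\<omega>. (g \<omega>)\<^sup>2 \<partial>M)"
proof -
  let ?f = "\<integral>\<omega>. (f \<omega>)\<^sup>2 \<partial>M" and ?g = "\<integral>\<omega>. (g \<omega>)\<^sup>2 \<partial>M" and ?c = "\<integral>\<omega>. f \<omega> * g \<omega> \<partial>M"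
  have [measurable]: "f \<in> borel_measurable M" "g \<in> borel_measurable M"
    and int: "integrable M (\<lambda>\<omega>. (f \<omega>)\<^sup>2)" "integrable M (\<lambda>\<omega>. (g \<omega>)\<^sup>2)" "integrable M (\<lambda>\<omega>. f \<omega> * g \<omega>)"
    using f g sq_int_mult[OF f g] by (auto simp: sq_int_def)
  have "?c\<^sup>2 \<le> ?f * ?g"
  proof (cases "?g = 0")
    case True
    then have "AE \<omega> in M. (g \<omega>)\<^sup>2 = 0"
      using int(2) by (subst (asm) integral_nonneg_eq_0_iff_AE) auto
    then have "AE \<omega> in M. f \<omega> * g \<omega> = 0" by eventually_elim simp
    then have "?c = (\<integral>\<omega>. 0 \<partial>M)" by (intro integral_cong_AE) auto
    then show ?thesis by (simp add: True)
  next
    case False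
    then have pos: "?g > 0" by (simp add: less_le)
    have "0 \<le> (\<integral>\<omega>. (?g * f \<omega> - ?c * g \<omega>)\<^sup>2 \<partial>M)" by simp
    also have "(\<lambda>\<omega>. (?g * f \<omega> - ?c * g \<omega>)\<^sup>2) = (\<lambda>\<omega>. ?g\<^sup>2 * (f \<omega>)\<^sup>2 - 2 * ?g * ?c * (f \<omega> * g \<omega>) + ?c\<^sup>2 * (g \<omega>)\<^sup>2)"
      by (simp add: fun_eq_iff power2_eq_square algebra_simps)
    also have "(\<integral>\<omega>. ?g\<^sup>2 * (f \<omega>)\<^sup>2 - 2 * ?g * ?c * (f \<omega> * g \<omega>) + ?c\<^sup>2 * (g \<omega>)\<^sup>2 \<partial>M) = ?g\<^sup>2 * ?f - 2 * ?g * ?c * ?c + ?c\<^sup>2 * ?g"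
      using int by simp
    also have "\<dots> = ?g * (?f * ?g - ?c\<^sup>2)" by (simp add: power2_eq_square algebra_simps)
    finally show ?thesis using pos by (simp add: zero_le_mult_iff)
  qed
  then have "sqrt (?c\<^sup>2) \<le> sqrt (?f * ?g)" by (rule real_sqrt_le_mono)
  then show ?thesis by (simp add: real_sqrt_mult)
qed

lemma Minkowski_integral:
  assumes f: "sq_int M f" and g: "sq_int M g"
  shows "sqrt (\<integral>\<omega>. (f \<omega> + g \<omega>)\<^sup>2 \<partial>M) \<le> sqrt (\<integral>\<omega>. (f \<omega>)\<^sup>2 \<partial>M) + sqrt (\<integral>\<omega>. (g \<omega>)\<^sup>2 \<partial>M)"
proof (rule real_le_lsqrt)
  let ?f = "\<integral>\<omega>. (f \<omega>)\<^sup>2 \<partial>M" and ?g = "\<integral>\<omega>. (g \<omega>)\<^sup>2 \<partial>M"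
  have int: "integrable M (\<lambda>\<omega>. (f \<omega>)\<^sup>2)" "integrable M (\<lambda>\<omega>. (g \<omega>)\<^sup>2)" "integrable M (\<lambda>\<omega>. f \<omega> * g \<omega>)"
    using f g sq_int_mult[OF f g] by (auto simp: sq_int_def)
  have "(\<integral>\<omega>. (f \<omega> + g \<omega>)\<^sup>2 \<partial>M) = (\<integral>\<omega>. (f \<omega>)\<^sup>2 + (g \<omega>)\<^sup>2 + 2 * (f \<omega> * g \<omega>) \<partial>M)"
    by (rule Bochner_Integration.integral_cong) (auto simp: power2_eq_square algebra_simps)
  also have "\<dots> = ?f + ?g + 2 * (\<integral>\<omega>. f \<omega> * g \<omega> \<partial>M)"
    using int by simp
  also have "\<dots> \<le> ?f + ?g + 2 * (sqrt ?f * sqrt ?g)"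
    using Cauchy_Schwarz_integral[OF f g] by linarith
  also have "\<dots> = (sqrt ?f + sqrt ?g)\<^sup>2" by (simp add: power2_sum)
  finally show "(\<integral>\<omega>. (f \<omega> + g \<omega>)\<^sup>2 \<partial>M) \<le> (sqrt ?f + sqrt ?g)\<^sup>2" .
qed simp

locale summable_sq_sequence = prob_space M for M :: "'a measure" +
  fixes V :: "nat \<Rightarrow> 'a \<Rightarrow> real" and c :: "nat \<Rightarrow> real"
  assumes sq_int_V: "\<And>j. sq_int M (V j)"
    and second_moment: "\<And>j. (\<integral>\<omega>. (V j \<omega>)\<^sup>2 \<partial>M) \<le> (c j)\<^sup>2"
    and c_nonneg: "\<And>j. c j \<ge> 0" and summable_c: "summable c"
    and summable_V: "\<And>\<omega>. \<omega> \<in> space M \<Longrightarrow> summable (\<lambda>j. \<bar>V j \<omega>\<bar>)"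
begin

lemma measurable_V [measurable]: "V j \<in> borel_measurable M"
  using sq_int_V by (simp add: sq_int_def)

lemma sqrt_second_moment: "sqrt (\<integral>\<omega>. (V j \<omega>)\<^sup>2 \<partial>M) \<le> c j"
  using second_moment[of j] c_nonneg[of j] by (simp add: real_le_lsqrt)

lemma abs_sum_second_moment:
  "sqrt (\<integral>\<omega>. (\<Sum>j<n. \<bar>V j \<omega>\<bar>)\<^sup>2 \<partial>M) \<le> (\<Sum>j<n. c j)"
proof (induction n)
  case (Suc n)
  have "sq_int M (\<lambda>\<omega>. \<bar>V j \<omega>\<bar>)" for j using sq_int_V[of j] by (simp add: sq_int_def)
  then have "sqrt (\<integral>\<omega>. ((\<Sum>j<n. \<bar>V j \<omega>\<bar>) + \<bar>V n \<omega>\<bar>)\<^sup>2 \<partial>M) \<le> sqrt (\<integral>\<omega>. (\<Sum>j<n. \<bar>V j \<omega>\<bar>)\<^sup>2 \<partial>M) + sqrt (\<integral>\<omega>. \<bar>V n \<omega>\<bar>\<^sup>2 \<partial>M)"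
    by (intro Minkowski_integral sq_int_sum)
  with Suc sqrt_second_moment[of n] show ?case by simp
qed simp

definition A :: "'a \<Rightarrow> real" where "A \<omega> = (\<Sum>j. \<bar>V j \<omega>\<bar>)"

text \<open>Minkowski bounds the L2 norms of the partial sums by the sum of \<open>c\<close>, and
  Fatou passes to the limit. Multiples of \<open>A\<close> then dominate all series with bounded
  coefficients.\<close>

lemma sq_int_A: "sq_int M A"
proof -
  have [measurable]: "A \<in> borel_measurable M" unfolding A_def by measurable
  have "integrable M (\<lambda>\<omega>. (A \<omega>)\<^sup>2)"
  proof (rule integrableI_bounded)
    have "(\<integral>\<^sup>+\<omega>. ennreal (norm ((A \<omega>)\<^sup>2)) \<partial>M) = (\<integral>\<^sup>+\<omega>. liminf (\<lambda>n. ennreal ((\<Sum>j<n. \<bar>V j \<omega>\<bar>)\<^sup>2)) \<partial>M)"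
    proof (rule nn_integral_cong)
      fix \<omega> assume "\<omega> \<in> space M"
      then have "(\<lambda>n. (\<Sum>j<n. \<bar>V j \<omega>\<bar>)\<^sup>2) \<longlonglongrightarrow> (A \<omega>)\<^sup>2"
        unfolding A_def by (intro tendsto_intros summable_LIMSEQ summable_V)
      then have "(\<lambda>n. ennreal ((\<Sum>j<n. \<bar>V j \<omega>\<bar>)\<^sup>2)) \<longlonglongrightarrow> ennreal ((A \<omega>)\<^sup>2)" by (rule tendsto_ennrealI)
      then show "ennreal (norm ((A \<omega>)\<^sup>2)) = liminf (\<lambda>n. ennreal ((\<Sum>j<n. \<bar>V j \<omega>\<bar>)\<^sup>2))"
        by (subst lim_imp_Liminf) auto
    qed
    also have "\<dots> \<le> liminf (\<lambda>n. \<integral>\<^sup>+\<omega>. ennreal ((\<Sum>j<n. \<bar>V j \<omega>\<bar>)\<^sup>2) \<partial>M)"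
      by (rule nn_integral_liminf) measurable
    also have "\<dots> \<le> liminf (\<lambda>n :: nat. ennreal ((suminf c)\<^sup>2))"
    proof (rule Liminf_mono, rule always_eventually, rule allI)
      fix n
      have "sq_int M (\<lambda>\<omega>. \<Sum>j<n. \<bar>V j \<omega>\<bar>)" using sq_int_V by (intro sq_int_sum) (simp add: sq_int_def)
      then have int: "integrable M (\<lambda>\<omega>. (\<Sum>j<n. \<bar>V j \<omega>\<bar>)\<^sup>2)" by (simp add: sq_int_def)
      have "sqrt (\<integral>\<omega>. (\<Sum>j<n. \<bar>V j \<omega>\<bar>)\<^sup>2 \<partial>M) \<le> suminf c"
        using abs_sum_second_moment[of n] sum_le_suminf[OF summable_c, of "{..<n}"] c_nonneg by (meson finite_lessThan order_trans)
      then have "(\<integral>\<omega>. (\<Sum>j<n. \<bar>V j \<omega>\<bar>)\<^sup>2 \<partial>M) \<le> (suminf c)\<^sup>2"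
        using sqrt_le_D by blast
      then show "(\<integral>\<^sup>+\<omega>. ennreal ((\<Sum>j<n. \<bar>V j \<omega>\<bar>)\<^sup>2) \<partial>M) \<le> ennreal ((suminf c)\<^sup>2)"
        using int by (subst nn_integral_eq_integral) (auto intro: ennreal_leI)
    qed
    also have "\<dots> < \<infinity>" by (simp add: Liminf_const)
    finally show "(\<integral>\<^sup>+\<omega>. ennreal (norm ((A \<omega>)\<^sup>2)) \<partial>M) < \<infinity>" .
  qed measurable
  then show ?thesis by (simp add: sq_int_def)
qed

definition series :: "(nat \<Rightarrow> real) \<Rightarrow> 'a \<Rightarrow> real" where
  "series b \<omega> = (\<Sum>j. b j * V j \<omega>)"

lemma measurable_series [measurable]: "series b \<in> borel_measurable M"
  unfolding series_def by measurable

lemma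
  assumes b: "\<And>j. \<bar>b j\<bar> \<le> K" and \<omega>: "\<omega> \<in> space M"
  shows summable_series: "summable (\<lambda>j. b j * V j \<omega>)"
    and partial_series_bound: "\<bar>\<Sum>j<n. b j * V j \<omega>\<bar> \<le> K * A \<omega>"
    and series_bound: "\<bar>series b \<omega>\<bar> \<le> K * A \<omega>"
proof -
  have bV: "norm (b j * V j \<omega>) \<le> K * \<bar>V j \<omega>\<bar>" for j
    using b[of j] by (simp add: abs_mult mult_right_mono)
  have s: "summable (\<lambda>j. K * \<bar>V j \<omega>\<bar>)" by (intro summable_mult summable_V \<omega>)
  show "summable (\<lambda>j. b j * V j \<omega>)" by (rule summable_comparison_test'[OF s bV])
  show *: "\<bar>\<Sum>j<n. b j * V j \<omega>\<bar> \<le> K * A \<omega>" for n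
  proof -
    have "\<bar>\<Sum>j<n. b j * V j \<omega>\<bar> \<le> (\<Sum>j<n. K * \<bar>V j \<omega>\<bar>)" using sum_norm_le[of "{..<n}", OF bV] by simp
    also have "\<dots> = K * (\<Sum>j<n. \<bar>V j \<omega>\<bar>)" by (simp add: sum_distrib_left)
    also have "\<dots> \<le> K * A \<omega>"
      unfolding A_def using b[of 0] by (intro mult_left_mono sum_le_suminf summable_V \<omega>) auto
    finally show ?thesis .
  qed
  have "(\<lambda>n. \<bar>\<Sum>j<n. b j * V j \<omega>\<bar>) \<longlonglongrightarrow> \<bar>series b \<omega>\<bar>"
    unfolding series_def by (intro tendsto_intros summable_LIMSEQ \<open>summable (\<lambda>j. b j * V j \<omega>)\<close>)
  then show "\<bar>series b \<omega>\<bar> \<le> K * A \<omega>" by (rule LIMSEQ_le_const2) (use * in auto)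
qed

lemma partial_series_tendsto:
  assumes "\<And>j. \<bar>b j\<bar> \<le> K" "\<omega> \<in> space M"
  shows "(\<lambda>n. \<Sum>j<n. b j * V j \<omega>) \<longlonglongrightarrow> series b \<omega>"
  unfolding series_def by (intro summable_LIMSEQ summable_series[OF assms])

lemma sq_int_series:
  assumes b: "\<And>j. \<bar>b j\<bar> \<le> K" shows "sq_int M (series b)"
  unfolding sq_int_def
proof
  have "integrable M (\<lambda>\<omega>. K\<^sup>2 * (A \<omega>)\<^sup>2)" using sq_int_A by (simp add: sq_int_def)
  then show "integrable M (\<lambda>\<omega>. (series b \<omega>)\<^sup>2)"
  proof (rule Bochner_Integration.integrable_bound)
    show "AE x in M. norm ((series b x)\<^sup>2) \<le> norm (K\<^sup>2 * (A x)\<^sup>2)"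
    proof (rule AE_I2)
      fix x assume "x \<in> space M"
      then have "\<bar>series b x\<bar>\<^sup>2 \<le> (K * A x)\<^sup>2" by (intro power_mono series_bound[OF b]) auto
      then show "norm ((series b x)\<^sup>2) \<le> norm (K\<^sup>2 * (A x)\<^sup>2)" by (simp add: power_mult_distrib)
    qed
  qed measurable
qed measurable

text \<open>Second moments of series are limits of double sums in the coordinate covariances, so two
  sequences with equal covariances give series with equal covariances.\<close>

lemma series_product:
  assumes b: "\<And>j. \<bar>b j\<bar> \<le> K" and d: "\<And>j. \<bar>d j\<bar> \<le> K'"
  shows "(\<lambda>n. \<Sum>j<n. \<Sum>k<n. b j * d k * (\<integral>\<omega>. V j \<omega> * V k \<omega> \<partial>M)) \<longlonglongrightarrow> (\<integral>\<omega>. series b \<omega> * series d \<omega> \<partial>M)"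
proof -
  have "(\<lambda>n. \<integral>\<omega>. (\<Sum>j<n. b j * V j \<omega>) * (\<Sum>k<n. d k * V k \<omega>) \<partial>M) \<longlonglongrightarrow> (\<integral>\<omega>. series b \<omega> * series d \<omega> \<partial>M)"
  proof (rule integral_dominated_convergence[where w = "\<lambda>\<omega>. (K * A \<omega>) * (K' * A \<omega>)"])
    show "integrable M (\<lambda>\<omega>. (K * A \<omega>) * (K' * A \<omega>))" by (intro sq_int_mult sq_int_cmult sq_int_A)
    show "AE \<omega> in M. (\<lambda>n. (\<Sum>j<n. b j * V j \<omega>) * (\<Sum>k<n. d k * V k \<omega>)) \<longlonglongrightarrow> series b \<omega> * series d \<omega>"
      by (intro AE_I2 tendsto_mult partial_series_tendsto[where K = K, OF b] partial_series_tendsto[where K = K', OF d])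
    show "AE \<omega> in M. norm ((\<Sum>j<n. b j * V j \<omega>) * (\<Sum>k<n. d k * V k \<omega>)) \<le> (K * A \<omega>) * (K' * A \<omega>)" for n
    proof (rule AE_I2)
      fix \<omega> assume \<omega>: "\<omega> \<in> space M"
      show "norm ((\<Sum>j<n. b j * V j \<omega>) * (\<Sum>k<n. d k * V k \<omega>)) \<le> (K * A \<omega>) * (K' * A \<omega>)"
        unfolding real_norm_def abs_mult[of "sum _ _"]
        using partial_series_bound[of b K, OF b \<omega>, of n] by (intro mult_mono partial_series_bound[OF b \<omega>] partial_series_bound[OF d \<omega>]) auto
    qed
  qed measurable
  moreover have "(\<integral>\<omega>. (\<Sum>j<n. b j * V j \<omega>) * (\<Sum>k<n. d k * V k \<omega>) \<partial>M) = (\<Sum>j<n. \<Sum>k<n. b j * d k * (\<integral>\<omega>. V j \<omega> * V k \<omega> \<partial>M))" for n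
  proof -
    have "(\<integral>\<omega>. (\<Sum>j<n. b j * V j \<omega>) * (\<Sum>k<n. d k * V k \<omega>) \<partial>M) = (\<integral>\<omega>. (\<Sum>j<n. \<Sum>k<n. b j * d k * (V j \<omega> * V k \<omega>)) \<partial>M)"
      by (simp add: sum_product mult_ac)
    also have "\<dots> = (\<Sum>j<n. \<Sum>k<n. b j * d k * (\<integral>\<omega>. V j \<omega> * V k \<omega> \<partial>M))"
      using sq_int_mult[OF sq_int_V sq_int_V] by simp
    finally show ?thesis .
  qed
  ultimately show ?thesis by simp
qed

lemma integral_series_eq_0:
  assumes b: "\<And>j. \<bar>b j\<bar> \<le> K" and mean: "\<And>j. (\<integral>\<omega>. V j \<omega> \<partial>M) = 0"
  shows "(\<integral>\<omega>. series b \<omega> \<partial>M) = 0"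
proof -
  have "(\<lambda>n. \<integral>\<omega>. (\<Sum>j<n. b j * V j \<omega>) \<partial>M) \<longlonglongrightarrow> (\<integral>\<omega>. series b \<omega> \<partial>M)"
  proof (rule integral_dominated_convergence[where w = "\<lambda>\<omega>. K * A \<omega>"])
    show "integrable M (\<lambda>\<omega>. K * A \<omega>)" using sq_int_imp_integrable[OF prob_space_axioms sq_int_A] by simp
    show "AE \<omega> in M. (\<lambda>n. \<Sum>j<n. b j * V j \<omega>) \<longlonglongrightarrow> series b \<omega>"
      by (intro AE_I2 partial_series_tendsto[where K = K, OF b])
    show "AE \<omega> in M. norm (\<Sum>j<n. b j * V j \<omega>) \<le> K * A \<omega>" for n
      unfolding real_norm_def by (intro AE_I2 partial_series_bound[OF b])
  qed measurable
  moreover have "(\<integral>\<omega>. (\<Sum>j<n. b j * V j \<omega>) \<partial>M) = 0" for n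
    using sq_int_imp_integrable[OF prob_space_axioms sq_int_V] by (simp add: mean)
  ultimately show ?thesis by (simp add: LIMSEQ_const_iff)
qed

text \<open>The Gaussian form survives the passage from partial sums to the series: the exponentials
  are bounded, and the squares of the partial sums are dominated by
  \<open>(K * A \<omega>)\<^sup>2\<close>, so the variances converge.\<close>

lemma char_series:
  assumes b: "\<And>j. \<bar>b j\<bar> \<le> K"
    and char: "\<And>n s. (\<integral>y. iexp (\<Sum>j<n. s j * V j y) \<partial>M) = of_real (exp (- (\<integral>\<omega>. (\<Sum>j<n. s j * V j \<omega>)\<^sup>2 \<partial>M) / 2))"
  shows "(\<integral>\<omega>. iexp (t * series b \<omega>) \<partial>M) = of_real (exp (- t\<^sup>2 * (\<integral>\<omega>. (series b \<omega>)\<^sup>2 \<partial>M) / 2))"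
proof -
  have 1: "(\<lambda>n. \<integral>\<omega>. iexp (t * (\<Sum>j<n. b j * V j \<omega>)) \<partial>M) \<longlonglongrightarrow> (\<integral>\<omega>. iexp (t * series b \<omega>) \<partial>M)"
  proof (rule integral_dominated_convergence[where w = "\<lambda>_. 1"])
    show "AE \<omega> in M. (\<lambda>n. iexp (t * (\<Sum>j<n. b j * V j \<omega>))) \<longlonglongrightarrow> iexp (t * series b \<omega>)"
      by (intro AE_I2 tendsto_exp tendsto_mult tendsto_const tendsto_of_real partial_series_tendsto[where K = K, OF b])
  qed auto
  have "(\<lambda>n. \<integral>\<omega>. (\<Sum>j<n. b j * V j \<omega>)\<^sup>2 \<partial>M) \<longlonglongrightarrow> (\<integral>\<omega>. (series b \<omega>)\<^sup>2 \<partial>M)"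
  proof (rule integral_dominated_convergence[where w = "\<lambda>\<omega>. (K * A \<omega>)\<^sup>2"])
    show "integrable M (\<lambda>\<omega>. (K * A \<omega>)\<^sup>2)" using sq_int_cmult[OF sq_int_A, of K] by (simp add: sq_int_def)
    show "AE \<omega> in M. (\<lambda>n. (\<Sum>j<n. b j * V j \<omega>)\<^sup>2) \<longlonglongrightarrow> (series b \<omega>)\<^sup>2"
      by (intro AE_I2 tendsto_power partial_series_tendsto[where K = K, OF b])
    show "AE \<omega> in M. norm ((\<Sum>j<n. b j * V j \<omega>)\<^sup>2) \<le> (K * A \<omega>)\<^sup>2" for n
    proof (rule AE_I2)
      fix \<omega> assume \<omega>: "\<omega> \<in> space M"
      have "\<bar>\<Sum>j<n. b j * V j \<omega>\<bar>\<^sup>2 \<le> (K * A \<omega>)\<^sup>2" by (intro power_mono partial_series_bound[OF b \<omega>]) simp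
      then show "norm ((\<Sum>j<n. b j * V j \<omega>)\<^sup>2) \<le> (K * A \<omega>)\<^sup>2" by simp
    qed
  qed measurable
  then have "(\<lambda>n. complex_of_real (exp (- t\<^sup>2 * (\<integral>\<omega>. (\<Sum>j<n. b j * V j \<omega>)\<^sup>2 \<partial>M) / 2))) \<longlonglongrightarrow> of_real (exp (- t\<^sup>2 * (\<integral>\<omega>. (series b \<omega>)\<^sup>2 \<partial>M) / 2))"
    by (intro tendsto_of_real tendsto_exp tendsto_divide tendsto_mult tendsto_const) auto
  moreover have "complex_of_real (exp (- t\<^sup>2 * (\<integral>\<omega>. (\<Sum>j<n. b j * V j \<omega>)\<^sup>2 \<partial>M) / 2)) = (\<integral>\<omega>. iexp (t * (\<Sum>j<n. b j * V j \<omega>)) \<partial>M)" for n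
  proof -
    have *: "(\<Sum>j<n. t * b j * V j \<omega>) = t * (\<Sum>j<n. b j * V j \<omega>)" for \<omega>
      by (simp add: sum_distrib_left mult.assoc)
    show ?thesis using char[of "\<lambda>j. t * b j" n] by (simp add: * power_mult_distrib)
  qed
  ultimately show ?thesis using LIMSEQ_unique[OF 1] by simp
qed

end

lemma char_normal_density:
  assumes s: "s > 0"
  shows "char (density lborel (\<lambda>x. ennreal (normal_density 0 s x))) t = of_real (exp (- t\<^sup>2 * s\<^sup>2 / 2))"
proof -
  interpret prob_space std_normal_distribution using prob_space_normal_density[of 1 0] by simp
  have "distributed std_normal_distribution lborel (\<lambda>x. x) (normal_density 0 1)"
    unfolding distributed_def by (auto intro!: measure_eqI simp: distr_id2 emeasure_distr)
  then have "distributed std_normal_distribution lborel (\<lambda>x. 0 + s * x) (normal_density (0 + s * 0) (\<bar>s\<bar> * 1))"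
    by (rule normal_density_affine) (use s in auto)
  then have *: "distr std_normal_distribution lborel (\<lambda>x. s * x) = density lborel (\<lambda>x. ennreal (normal_density 0 s x))"
    using s by (simp add: distributed_def)
  have "char (density lborel (\<lambda>x. ennreal (normal_density 0 s x))) t = char std_normal_distribution (t * s)"
    unfolding char_def *[symmetric] by (subst integral_distr) (auto simp: mult.assoc)
  then show ?thesis by (simp add: char_std_normal_distribution power_mult_distrib)
qed

lemma gaussian_char_imp_distributed:
  assumes "prob_space N" and [measurable]: "X \<in> borel_measurable N" and s: "s > 0"
    and char: "\<And>t. (\<integral>x. iexp (t * X x) \<partial>N) = of_real (exp (- t\<^sup>2 * s\<^sup>2 / 2))"
  shows "distributed N lborel X (\<lambda>x. ennreal (normal_density 0 s x))"
proof -
  interpret prob_space N by fact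
  have "distr N borel X = density lborel (\<lambda>x. ennreal (normal_density 0 s x))"
  proof (rule Levy_uniqueness)
    show "real_distribution (distr N borel X)" by (rule real_distribution_distr) simp
    have "prob_space (density lborel (\<lambda>x. ennreal (normal_density 0 s x)))"
      by (rule prob_space_normal_density) (rule s)
    then show "real_distribution (density lborel (\<lambda>x. ennreal (normal_density 0 s x)))"
      by (simp add: real_distribution_def real_distribution_axioms_def)
    show "char (distr N borel X) = char (density lborel (\<lambda>x. ennreal (normal_density 0 s x)))"
    proof
      fix t
      have "char (distr N borel X) t = (\<integral>x. iexp (t * X x) \<partial>N)"
        unfolding char_def by (subst integral_distr) auto
      then show "char (distr N borel X) t = char (density lborel (\<lambda>x. ennreal (normal_density 0 s x))) t"
        by (simp only: char char_normal_density[OF s])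
    qed
  qed
  moreover have "distr N lborel X = distr N borel X" by (rule distr_cong) auto
  ultimately show ?thesis unfolding distributed_def by auto
qed

section \<open>Convergence in distribution in metric spaces\<close>

definition bounded_lipschitz :: "'b metric \<Rightarrow> real \<Rightarrow> real \<Rightarrow> ('b \<Rightarrow> real) \<Rightarrow> bool" where
  "bounded_lipschitz m B L f \<longleftrightarrow> (\<forall>x\<in>mspace m. \<bar>f x\<bar> \<le> B) \<and>
     (\<forall>x\<in>mspace m. \<forall>y\<in>mspace m. \<bar>f x - f y\<bar> \<le> L * mdist m x y)"

lemma space_metric_borel [simp]: "space (metric_borel m) = mspace m"
  and sets_metric_borel: "sets (metric_borel m) = sigma_sets (mspace m) {A. openin (mtopology_of m) A}"
proof -
  interpret Metric_space "mspace m" "mdist m" by (rule Metric_space_mspace_mdist)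
  have "{A. openin (mtopology_of m) A} \<subseteq> Pow (mspace m)"
    by (auto simp: mtopology_of_def openin_mtopology)
  then show "space (metric_borel m) = mspace m" "sets (metric_borel m) = sigma_sets (mspace m) {A. openin (mtopology_of m) A}"
    by (auto simp: metric_borel_def space_measure_of_conv sets_measure_of)
qed

text \<open>A proper open set is where the truncated distance to its complement is positive, and
  that distance is bounded and 1-Lipschitz. Measurability against such test functions therefore
  reaches all open sets of any metric space.\<close>

lemma measurable_metric_borelI:
  assumes X: "\<And>\<omega>. \<omega> \<in> space M \<Longrightarrow> X \<omega> \<in> mspace m"
    and lip: "\<And>f. bounded_lipschitz m 1 1 f \<Longrightarrow> (\<lambda>\<omega>. f (X \<omega>)) \<in> borel_measurable M"
  shows "X \<in> measurable M (metric_borel m)"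
  unfolding metric_borel_def
proof (rule measurable_measure_of)
  interpret Metric_space "mspace m" "mdist m" by (rule Metric_space_mspace_mdist)
  show "{A. openin (mtopology_of m) A} \<subseteq> Pow (mspace m)"
    by (auto simp: mtopology_of_def openin_mtopology)
  show "X \<in> space M \<rightarrow> mspace m" using X by auto
  fix U assume "U \<in> {A. openin (mtopology_of m) A}"
  then have U: "U \<subseteq> mspace m" "\<And>x. x \<in> U \<Longrightarrow> \<exists>r>0. mball x r \<subseteq> U"
    by (auto simp: mtopology_of_def openin_mtopology)
  show "X -` U \<inter> space M \<in> sets M"
  proof (cases "U = mspace m")
    \<comment> \<open>The whole space is treated apart because the infimum over an empty complement
      has no useful value.\<close>
    case True
    then have "X -` U \<inter> space M = space M" using X by auto
    then show ?thesis by simp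
  next
    case False
    define C where "C = mspace m - U"
    have C: "C \<noteq> {}" using False U by (auto simp: C_def)
    define f where "f = (\<lambda>x. INF y\<in>C. min 1 (mdist m x y))"
    have bdd: "bdd_below ((\<lambda>y. min 1 (mdist m x y)) ` C)" for x
      by (rule bdd_belowI[of _ 0]) auto
    have f_le: "f x \<le> min 1 (mdist m x y)" if "y \<in> C" for x y
      unfolding f_def by (rule cINF_lower[OF bdd that])
    have f_ge: "f x \<ge> 0" for x
      unfolding f_def by (rule cINF_greatest[OF C]) auto
    have f1: "f x \<le> f y + mdist m x y" if "x \<in> mspace m" "y \<in> mspace m" for x y
    proof -
      have "f x - mdist m x y \<le> f y"
        unfolding f_def
      proof (rule cINF_greatest[OF C])
        fix z assume z: "z \<in> C"
        then have "z \<in> mspace m" by (simp add: C_def)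
        then have "mdist m x z \<le> mdist m x y + mdist m y z" using that triangle by blast
        moreover have "0 \<le> mdist m x y" by simp
        ultimately show "(INF y\<in>C. min 1 (mdist m x y)) - mdist m x y \<le> min 1 (mdist m y z)"
          using f_le[OF z, of x] unfolding f_def by linarith
      qed
      then show ?thesis by linarith
    qed
    have "bounded_lipschitz m 1 1 f"
      unfolding bounded_lipschitz_def
    proof (intro conjI ballI)
      fix x assume "x \<in> mspace m"
      obtain y where "y \<in> C" using C by blast
      then show "\<bar>f x\<bar> \<le> 1" using f_le[of y x] f_ge[of x] by simp
      fix y assume "y \<in> mspace m"
      then show "\<bar>f x - f y\<bar> \<le> 1 * mdist m x y"
        using f1[of x y] f1[of y x] \<open>x \<in> mspace m\<close> commute[of x y] by simp
    qed
    then have [measurable]: "(\<lambda>\<omega>. f (X \<omega>)) \<in> borel_measurable M" by (rule lip)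
    have pos: "f x > 0 \<longleftrightarrow> x \<in> U" if x: "x \<in> mspace m" for x
    proof
      assume f: "f x > 0"
      show "x \<in> U"
      proof (rule ccontr)
        assume "x \<notin> U"
        then have "x \<in> C" using x by (simp add: C_def)
        then show False using f_le[of x x] f x by simp
      qed
    next
      assume "x \<in> U"
      then obtain r where r: "r > 0" "mball x r \<subseteq> U" using U by blast
      have "min 1 r \<le> f x"
        unfolding f_def
      proof (rule cINF_greatest[OF C])
        fix y assume "y \<in> C"
        then have "y \<in> mspace m" "y \<notin> mball x r" using r by (auto simp: C_def)
        then have "mdist m x y \<ge> r" using x by simp
        then show "min 1 r \<le> min 1 (mdist m x y)" by auto
      qed
      then show "f x > 0" using r by (simp add: min_def split: if_splits)
    qed
    have "X -` U \<inter> space M = {\<omega> \<in> space M. f (X \<omega>) > 0}" using pos X by auto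
    then show ?thesis by simp
  qed
qed

text \<open>The Pasch-Hausdorff envelope: for \<open>\<Phi>\<close> bounded below, its largest
  minorant with Lipschitz constant \<open>n\<close>.\<close>

definition inf_conv :: "'b metric \<Rightarrow> ('b \<Rightarrow> real) \<Rightarrow> nat \<Rightarrow> 'b \<Rightarrow> real" where
  "inf_conv m \<Phi> n x = (INF y\<in>mspace m. \<Phi> y + real n * mdist m x y)"

lemma inf_convolution:
  fixes \<Phi> :: "'b \<Rightarrow> real" and n :: nat
  assumes \<Phi>: "\<And>x. x \<in> mspace m \<Longrightarrow> 0 \<le> \<Phi> x \<and> \<Phi> x \<le> B"
  shows inf_convolution_nonneg: "x \<in> mspace m \<Longrightarrow> 0 \<le> inf_conv m \<Phi> n x"
    and inf_convolution_le: "x \<in> mspace m \<Longrightarrow> inf_conv m \<Phi> n x \<le> \<Phi> x"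
    and inf_convolution_lipschitz: "bounded_lipschitz m B (real n) (inf_conv m \<Phi> n)"
    and inf_convolution_tendsto: "continuous_map (mtopology_of m) euclideanreal \<Phi> \<Longrightarrow> x \<in> mspace m \<Longrightarrow> (\<lambda>n. inf_conv m \<Phi> n x) \<longlonglongrightarrow> \<Phi> x"
proof -
  interpret Metric_space "mspace m" "mdist m" by (rule Metric_space_mspace_mdist)
  have bdd: "bdd_below ((\<lambda>y. \<Phi> y + real n * mdist m x y) ` mspace m)" for x n
    by (rule bdd_belowI[of _ 0]) (use \<Phi> in auto)
  have lower: "inf_conv m \<Phi> n x \<le> \<Phi> y + real n * mdist m x y" if "y \<in> mspace m" for x y n
    unfolding inf_conv_def by (rule cINF_lower[OF bdd that])
  have nonneg: "0 \<le> inf_conv m \<Phi> n x" if "x \<in> mspace m" for x n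
    unfolding inf_conv_def by (rule cINF_greatest) (use that \<Phi> in auto)
  have le: "inf_conv m \<Phi> n x \<le> \<Phi> x" if "x \<in> mspace m" for x n
    using lower[of x n x] that by simp
  show "x \<in> mspace m \<Longrightarrow> 0 \<le> inf_conv m \<Phi> n x" "x \<in> mspace m \<Longrightarrow> inf_conv m \<Phi> n x \<le> \<Phi> x"
    by (rule nonneg le; assumption)+
  have 1: "inf_conv m \<Phi> n x \<le> inf_conv m \<Phi> n y + real n * mdist m x y" if "x \<in> mspace m" "y \<in> mspace m" for x y n
  proof -
    have "inf_conv m \<Phi> n x - real n * mdist m x y \<le> (INF z\<in>mspace m. \<Phi> z + real n * mdist m y z)"
    proof (rule cINF_greatest)
      fix z assume z: "z \<in> mspace m"
      have "real n * mdist m x z \<le> real n * (mdist m x y + mdist m y z)"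
        using that z triangle by (intro mult_left_mono) auto
      then show "inf_conv m \<Phi> n x - real n * mdist m x y \<le> \<Phi> z + real n * mdist m y z"
        using lower[OF z, of n x] by (simp add: distrib_left)
    qed (use that in auto)
    then show ?thesis by (simp add: inf_conv_def)
  qed
  show "bounded_lipschitz m B (real n) (inf_conv m \<Phi> n)"
    unfolding bounded_lipschitz_def
  proof (intro conjI ballI)
    fix x assume x: "x \<in> mspace m"
    show "\<bar>inf_conv m \<Phi> n x\<bar> \<le> B" using nonneg[OF x, of n] le[OF x, of n] \<Phi>[OF x] by simp
    fix y assume y: "y \<in> mspace m"
    show "\<bar>inf_conv m \<Phi> n x - inf_conv m \<Phi> n y\<bar> \<le> real n * mdist m x y"
      using 1[OF x y, of n] 1[OF y x, of n] commute[of x y] by simp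
  qed
  show "(\<lambda>n. inf_conv m \<Phi> n x) \<longlonglongrightarrow> \<Phi> x" if cont: "continuous_map (mtopology_of m) euclideanreal \<Phi>" and x: "x \<in> mspace m"
  proof (rule LIMSEQ_I)
    fix e :: real assume e: "e > 0"
    have "openin (mtopology_of m) {y \<in> topspace (mtopology_of m). \<Phi> y \<in> ball (\<Phi> x) (e/2)}"
      by (rule openin_continuous_map_preimage[OF cont]) simp
    then obtain r where r: "r > 0" "mball x r \<subseteq> {y \<in> mspace m. \<Phi> y \<in> ball (\<Phi> x) (e/2)}"
      using x e by (auto simp: mtopology_of_def openin_mtopology)
    \<comment> \<open>From \<open>n0\<close> on, leaving the ball of radius \<open>r\<close> costs
      at least the bound \<open>B\<close> of \<open>\<Phi>\<close>; inside the ball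
      \<open>\<Phi>\<close> is within \<open>e / 2\<close> of its value at \<open>x\<close>.\<close>
    obtain n0 :: nat where n0: "real n0 * r \<ge> B"
      using reals_Archimedean3[OF r(1)] by (meson less_imp_le)
    show "\<exists>no. \<forall>n\<ge>no. norm (inf_conv m \<Phi> n x - \<Phi> x) < e"
    proof (intro exI allI impI)
      fix n assume n: "n \<ge> n0"
      have "\<Phi> x - e / 2 \<le> inf_conv m \<Phi> n x"
        unfolding inf_conv_def
      proof (rule cINF_greatest)
        fix y assume y: "y \<in> mspace m"
        show "\<Phi> x - e / 2 \<le> \<Phi> y + real n * mdist m x y"
        proof (cases "mdist m x y < r")
          case True
          then have "\<Phi> y \<in> ball (\<Phi> x) (e/2)" using r x y by auto
          then have "\<Phi> x - e / 2 \<le> \<Phi> y" by (simp add: dist_real_def abs_if field_simps split: if_splits)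
          moreover have "0 \<le> real n * mdist m x y" by simp
          ultimately show ?thesis by linarith
        next
          case False
          have "real n0 * r \<le> real n * mdist m x y"
            using False n r by (intro mult_mono) auto
          then show ?thesis using n0 \<Phi>[OF x] \<Phi>[OF y] e by linarith
        qed
      qed (use x in auto)
      then show "norm (inf_conv m \<Phi> n x - \<Phi> x) < e" using le[OF x, of n] e by simp
    qed
  qed
qed

text \<open>Convergence for Lipschitz minorants passes to \<open>\<Phi>\<close> from below only; the
  matching upper bound comes from applying the lemma to a reflected function.\<close>

lemma bounded_lipschitz_lower_bound:
  fixes X :: "nat \<Rightarrow> 'a \<Rightarrow> 'b" and Z :: "'c \<Rightarrow> 'b"
  assumes "prob_space M" "prob_space N"
    and X: "\<And>T \<omega>. \<omega> \<in> space M \<Longrightarrow> X T \<omega> \<in> mspace m" and Z: "\<And>\<omega>. \<omega> \<in> space N \<Longrightarrow> Z \<omega> \<in> mspace m"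
    and mX: "\<And>B L f T. bounded_lipschitz m B L f \<Longrightarrow> (\<lambda>\<omega>. f (X T \<omega>)) \<in> borel_measurable M"
    and mZ: "\<And>B L f. bounded_lipschitz m B L f \<Longrightarrow> (\<lambda>\<omega>. f (Z \<omega>)) \<in> borel_measurable N"
    and conv: "\<And>B L f. L \<ge> 0 \<Longrightarrow> bounded_lipschitz m B L f \<Longrightarrow> (\<lambda>T. \<integral>\<omega>. f (X T \<omega>) \<partial>M) \<longlonglongrightarrow> (\<integral>\<omega>. f (Z \<omega>) \<partial>N)"
    and \<Phi>: "\<And>x. x \<in> mspace m \<Longrightarrow> 0 \<le> \<Phi> x \<and> \<Phi> x \<le> B" and cont: "continuous_map (mtopology_of m) euclideanreal \<Phi>"
    and mX\<Phi>: "\<And>T. (\<lambda>\<omega>. \<Phi> (X T \<omega>)) \<in> borel_measurable M" and mZ\<Phi>: "(\<lambda>\<omega>. \<Phi> (Z \<omega>)) \<in> borel_measurable N"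
    and e: "e > 0"
  shows "\<forall>\<^sub>F T in sequentially. (\<integral>\<omega>. \<Phi> (X T \<omega>) \<partial>M) > (\<integral>\<omega>. \<Phi> (Z \<omega>) \<partial>N) - e"
proof -
  interpret M: prob_space M by fact
  interpret N: prob_space N by fact
  define \<phi> where "\<phi> = inf_conv m \<Phi>"
  note c = inf_convolution_nonneg[where \<Phi> = \<Phi> and m = m and B = B, OF \<Phi>, folded \<phi>_def]
    inf_convolution_le[where \<Phi> = \<Phi> and m = m and B = B, OF \<Phi>, folded \<phi>_def]
    inf_convolution_lipschitz[where \<Phi> = \<Phi> and m = m and B = B, OF \<Phi>, folded \<phi>_def]
    inf_convolution_tendsto[where \<Phi> = \<Phi> and m = m and B = B, OF \<Phi> cont, folded \<phi>_def]
  have lip: "bounded_lipschitz m B (real n) (\<phi> n)" for n by (rule c(3))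
  have "(\<lambda>n. \<integral>\<omega>. \<phi> n (Z \<omega>) \<partial>N) \<longlonglongrightarrow> (\<integral>\<omega>. \<Phi> (Z \<omega>) \<partial>N)"
  proof (rule integral_dominated_convergence[where w = "\<lambda>_. B"])
    show "AE x in N. (\<lambda>n. \<phi> n (Z x)) \<longlonglongrightarrow> \<Phi> (Z x)" by (intro AE_I2 c(4) Z)
    show "AE x in N. norm (\<phi> n (Z x)) \<le> B" for n
      using lip[of n] Z by (auto simp: bounded_lipschitz_def)
  qed (use mZ[OF lip] mZ\<Phi> in auto)
  then have "\<forall>\<^sub>F n in sequentially. (\<integral>\<omega>. \<phi> n (Z \<omega>) \<partial>N) > (\<integral>\<omega>. \<Phi> (Z \<omega>) \<partial>N) - e / 2"
    by (rule order_tendstoD) (use e in simp)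
  then obtain n where n: "(\<integral>\<omega>. \<phi> n (Z \<omega>) \<partial>N) > (\<integral>\<omega>. \<Phi> (Z \<omega>) \<partial>N) - e / 2"
    using eventually_happens trivial_limit_sequentially by blast
  have "\<forall>\<^sub>F T in sequentially. (\<integral>\<omega>. \<phi> n (X T \<omega>) \<partial>M) > (\<integral>\<omega>. \<phi> n (Z \<omega>) \<partial>N) - e / 2"
    by (rule order_tendstoD(1)[OF conv[OF _ lip]]) (use e in auto)
  then show ?thesis
  proof eventually_elim
    case (elim T)
    have "(\<integral>\<omega>. \<phi> n (X T \<omega>) \<partial>M) \<le> (\<integral>\<omega>. \<Phi> (X T \<omega>) \<partial>M)"
    proof (rule integral_mono)
      show "integrable M (\<lambda>\<omega>. \<phi> n (X T \<omega>))"
        by (rule M.integrable_const_bound[of _ B]) (use lip[of n] X mX[OF lip] in \<open>auto simp: bounded_lipschitz_def\<close>)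
      show "integrable M (\<lambda>\<omega>. \<Phi> (X T \<omega>))"
        by (rule M.integrable_const_bound[of _ B]) (use \<Phi> X mX\<Phi> in auto)
    qed (use c(2) X in auto)
    then show ?case using elim n by linarith
  qed
qed

theorem conv_in_distribution_bounded_lipschitz:
  fixes X :: "nat \<Rightarrow> 'a \<Rightarrow> 'b" and Z :: "'c \<Rightarrow> 'b"
  assumes "prob_space M" "prob_space N"
    and X: "\<And>T \<omega>. \<omega> \<in> space M \<Longrightarrow> X T \<omega> \<in> mspace m" and Z: "\<And>\<omega>. \<omega> \<in> space N \<Longrightarrow> Z \<omega> \<in> mspace m"
    and mX: "\<And>B L f T. bounded_lipschitz m B L f \<Longrightarrow> (\<lambda>\<omega>. f (X T \<omega>)) \<in> borel_measurable M"
    and mZ: "\<And>B L f. bounded_lipschitz m B L f \<Longrightarrow> (\<lambda>\<omega>. f (Z \<omega>)) \<in> borel_measurable N"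
    and conv: "\<And>B L f. L \<ge> 0 \<Longrightarrow> bounded_lipschitz m B L f \<Longrightarrow> (\<lambda>T. \<integral>\<omega>. f (X T \<omega>) \<partial>M) \<longlonglongrightarrow> (\<integral>\<omega>. f (Z \<omega>) \<partial>N)"
  shows "conv_in_distribution m M X N Z"
  unfolding conv_in_distribution_def
proof (intro conjI allI impI)
  interpret M: prob_space M by fact
  interpret N: prob_space N by fact
  show measX: "X T \<in> measurable M (metric_borel m)" for T
    using X mX by (intro measurable_metric_borelI)
  show measZ: "Z \<in> measurable N (metric_borel m)"
    using Z mZ by (intro measurable_metric_borelI)
  fix \<Phi> :: "'b \<Rightarrow> real" assume "continuous_map (mtopology_of m) euclideanreal \<Phi> \<and> bounded (\<Phi> ` mspace m)"
  then have cont: "continuous_map (mtopology_of m) euclideanreal \<Phi>" and bdd: "bounded (\<Phi> ` mspace m)" by auto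
  obtain K where K: "\<And>x. x \<in> mspace m \<Longrightarrow> \<bar>\<Phi> x\<bar> \<le> K"
    using bdd by (auto simp: bounded_iff)
  have m\<Phi>: "\<Phi> \<in> borel_measurable (metric_borel m)"
  proof (rule borel_measurableI)
    fix S :: "real set" assume "open S"
    then have "openin (mtopology_of m) {x \<in> topspace (mtopology_of m). \<Phi> x \<in> S}"
      by (intro openin_continuous_map_preimage[OF cont]) simp
    moreover have "{x \<in> topspace (mtopology_of m). \<Phi> x \<in> S} = \<Phi> -` S \<inter> space (metric_borel m)" by auto
    ultimately show "\<Phi> -` S \<inter> space (metric_borel m) \<in> sets (metric_borel m)"
      unfolding sets_metric_borel by auto
  qed
  have mX\<Phi>: "(\<lambda>\<omega>. \<Phi> (X T \<omega>)) \<in> borel_measurable M" for T using measX m\<Phi> by (rule measurable_compose)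
  have mZ\<Phi>: "(\<lambda>\<omega>. \<Phi> (Z \<omega>)) \<in> borel_measurable N" using measZ m\<Phi> by (rule measurable_compose)
  have intX: "integrable M (\<lambda>\<omega>. \<Phi> (X T \<omega>))" for T
    by (rule M.integrable_const_bound[of _ K]) (use K X mX\<Phi> in auto)
  have intZ: "integrable N (\<lambda>\<omega>. \<Phi> (Z \<omega>))"
    by (rule N.integrable_const_bound[of _ K]) (use K Z mZ\<Phi> in auto)
  show "(\<lambda>T. \<integral>\<omega>. \<Phi> (X T \<omega>) \<partial>M) \<longlonglongrightarrow> (\<integral>x. \<Phi> (Z x) \<partial>N)"
  proof (rule LIMSEQ_I)
    fix e :: real assume e: "e > 0"
    have "\<forall>\<^sub>F T in sequentially. (\<integral>\<omega>. K + \<Phi> (X T \<omega>) \<partial>M) > (\<integral>\<omega>. K + \<Phi> (Z \<omega>) \<partial>N) - e"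
    proof (rule bounded_lipschitz_lower_bound[OF assms, where B = "2 * K" and e = e])
      show "0 \<le> K + \<Phi> x \<and> K + \<Phi> x \<le> 2 * K" if "x \<in> mspace m" for x using K[OF that] by (auto simp: abs_le_iff)
      show "continuous_map (mtopology_of m) euclideanreal (\<lambda>x. K + \<Phi> x)" using cont by (intro continuous_intros)
    qed (use mX\<Phi> mZ\<Phi> e in auto)
    moreover have "\<forall>\<^sub>F T in sequentially. (\<integral>\<omega>. K - \<Phi> (X T \<omega>) \<partial>M) > (\<integral>\<omega>. K - \<Phi> (Z \<omega>) \<partial>N) - e"
    proof (rule bounded_lipschitz_lower_bound[OF assms, where B = "2 * K" and e = e])
      show "0 \<le> K - \<Phi> x \<and> K - \<Phi> x \<le> 2 * K" if "x \<in> mspace m" for x using K[OF that] by (auto simp: abs_le_iff)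
      show "continuous_map (mtopology_of m) euclideanreal (\<lambda>x. K - \<Phi> x)" using cont by (intro continuous_intros)
    qed (use mX\<Phi> mZ\<Phi> e in auto)
    ultimately have "\<forall>\<^sub>F T in sequentially. norm ((\<integral>\<omega>. \<Phi> (X T \<omega>) \<partial>M) - (\<integral>x. \<Phi> (Z x) \<partial>N)) < e"
      by eventually_elim (use intX intZ in \<open>auto simp: M.prob_space N.prob_space abs_less_iff\<close>)
    then show "\<exists>no. \<forall>T\<ge>no. norm ((\<integral>\<omega>. \<Phi> (X T \<omega>) \<partial>M) - (\<integral>x. \<Phi> (Z x) \<partial>N)) < e"
      by (simp add: eventually_sequentially)
  qed
qed

lemma restrict_in_C01: "continuous_on {0..1} h \<Longrightarrow> (\<lambda>u\<in>{0..1}. h u) \<in> mspace C01"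
proof -
  assume h: "continuous_on {0..1} h"
  have "compactin (top_of_set {0..1}) (topspace (top_of_set {0..1::real}))"
    by (simp add: compactin_subtopology)
  moreover have "continuous_on {0..1} (\<lambda>u\<in>{0..1}. h u)"
    using h by (subst continuous_on_cong[OF refl, of _ _ h]) auto
  ultimately show ?thesis
    unfolding C01_def by (subst compactin_mspace_cfunspace) auto
qed

lemma mdist_C01_le:
  assumes "a \<ge> 0" "\<And>u. u \<in> {0..1} \<Longrightarrow> \<bar>f u - h u\<bar> \<le> a"
  shows "mdist C01 (\<lambda>u\<in>{0..1}. f u) (\<lambda>u\<in>{0..1}. h u) \<le> a"
  unfolding C01_def by (rule mdist_cfunspace_le) (use assms in \<open>auto simp: dist_real_def\<close>)

section \<open>The INAR(1) model\<close>

lemma (in prob_space) nat_rv_sums: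
  fixes f :: "nat \<Rightarrow> real"
  assumes [measurable]: "X \<in> measurable M (count_space UNIV)" and int: "integrable M (\<lambda>\<omega>. f (X \<omega>))"
  shows "(\<lambda>k. f k * prob {\<omega> \<in> space M. X \<omega> = k}) sums (\<integral>\<omega>. f (X \<omega>) \<partial>M)"
proof -
  let ?f = "\<lambda>k \<omega>. f k * indicator {\<omega> \<in> space M. X \<omega> = k} \<omega>"
  have ind: "?f k \<omega> = (if k = X \<omega> then f k else 0)" if "\<omega> \<in> space M" for k \<omega>
    using that by (auto simp: indicator_def)
  have I: "(\<integral>\<omega>. ?f k \<omega> \<partial>M) = f k * prob {\<omega> \<in> space M. X \<omega> = k}" for k by simp
  have suminf_eq: "(\<Sum>k. ?f k \<omega>) = f (X \<omega>)" if "\<omega> \<in> space M" for \<omega>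
    using sums_single[of "X \<omega>" f] ind[OF that] by (simp add: sums_iff cong: if_cong)
  have "(\<lambda>k. \<integral>\<omega>. ?f k \<omega> \<partial>M) sums (\<integral>\<omega>. (\<Sum>k. ?f k \<omega>) \<partial>M)"
  proof (rule sums_integral)
    show "integrable M (?f k)" for k by (intro integrable_mult_right integrable_real_indicator) (auto simp: emeasure_eq_measure)
    show "AE \<omega> in M. summable (\<lambda>k. norm (?f k \<omega>))"
    proof (rule AE_I2)
      fix \<omega> assume "\<omega> \<in> space M"
      then have "norm (?f k \<omega>) = (if k = X \<omega> then \<bar>f k\<bar> else 0)" for k using ind by auto
      then show "summable (\<lambda>k. norm (?f k \<omega>))" using sums_single[of "X \<omega>" "\<lambda>k. \<bar>f k\<bar>"] by (simp add: sums_iff)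
    qed
    show "summable (\<lambda>k. \<integral>\<omega>. norm (?f k \<omega>) \<partial>M)"
    proof (rule summableI_nonneg_bounded)
      fix n
      have "(\<Sum>k<n. \<integral>\<omega>. norm (?f k \<omega>) \<partial>M) = (\<integral>\<omega>. (\<Sum>k<n. norm (?f k \<omega>)) \<partial>M)"
        by (rule Bochner_Integration.integral_sum[symmetric])
           (intro integrable_norm integrable_mult_right integrable_real_indicator, auto simp: emeasure_eq_measure)
      also have "\<dots> \<le> (\<integral>\<omega>. \<bar>f (X \<omega>)\<bar> \<partial>M)"
      proof (rule integral_mono)
        show "integrable M (\<lambda>\<omega>. \<Sum>k<n. norm (?f k \<omega>))"
          by (intro Bochner_Integration.integrable_sum integrable_norm integrable_mult_right integrable_real_indicator) (auto simp: emeasure_eq_measure)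
        fix \<omega> assume "\<omega> \<in> space M"
        then have "norm (?f k \<omega>) = (if k = X \<omega> then \<bar>f k\<bar> else 0)" for k using ind by auto
        then have "(\<Sum>k<n. norm (?f k \<omega>)) = (\<Sum>k<n. if k = X \<omega> then \<bar>f k\<bar> else 0)" by simp
        also have "\<dots> \<le> \<bar>f (X \<omega>)\<bar>" by simp
        finally show "(\<Sum>k<n. norm (?f k \<omega>)) \<le> \<bar>f (X \<omega>)\<bar>" .
      qed (use int in simp)
      finally show "(\<Sum>k<n. \<integral>\<omega>. norm (?f k \<omega>) \<partial>M) \<le> (\<integral>\<omega>. \<bar>f (X \<omega>)\<bar> \<partial>M)" .
    qed simp
  qed
  also have "(\<integral>\<omega>. (\<Sum>k. ?f k \<omega>) \<partial>M) = (\<integral>\<omega>. f (X \<omega>) \<partial>M)"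
    by (rule Bochner_Integration.integral_cong[OF refl suminf_eq])
  finally show ?thesis unfolding I .
qed

lemma measurable_map_list:
  fixes f :: "'k \<Rightarrow> 'a \<Rightarrow> nat"
  assumes "\<And>k. k \<in> set xs \<Longrightarrow> f k \<in> measurable M (count_space UNIV)"
  shows "(\<lambda>\<omega>. map (\<lambda>k. f k \<omega>) xs) \<in> measurable M (count_space UNIV)"
  using assms
proof (induction xs)
  case (Cons x xs)
  have "(\<lambda>\<omega>. y # map (\<lambda>k. f k \<omega>) xs) \<in> measurable M (count_space UNIV)" for y
    by (rule measurable_compose[OF Cons.IH measurable_count_space]) (use Cons.prems in auto)
  then show ?case
    using measurable_compose_countable[of "\<lambda>y \<omega>. y # map (\<lambda>k. f k \<omega>) xs" M "count_space UNIV" "f x"] Cons.prems by simp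
qed simp

locale inar = prob_space M for M :: "'a measure" +
  fixes p :: real and Y :: "int \<Rightarrow> 'a \<Rightarrow> nat" and U :: "int \<Rightarrow> nat \<Rightarrow> 'a \<Rightarrow> nat" and eps :: "int \<Rightarrow> 'a \<Rightarrow> nat"
  assumes p: "0 < p" "p < 1"
    and model: "INAR1 M p Y U eps" and stationary: "strictly_stationary M Y" and ergodic: "ergodic_process M Y"
begin

lemma measurable_Y [measurable]: "Y t \<in> measurable M (count_space UNIV)"
  using model by (simp add: INAR1_def)

lemma measurable_eps [measurable]: "eps t \<in> measurable M (count_space UNIV)"
proof -
  have "indep_vars (\<lambda>_. count_space UNIV) eps UNIV" using model by (simp add: INAR1_def)
  then show ?thesis by (simp add: indep_vars_def)
qed

lemma measurable_path: "(\<lambda>\<omega> t. Y (t + h) \<omega>) \<in> measurable M path_space"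
  unfolding path_space_def by (rule measurable_PiM_single') auto

lemma space_path_space [simp]: "space path_space = UNIV"
  by (simp add: path_space_def space_PiM)

lemma measurable_coordinate: "(\<lambda>y. y t) \<in> measurable path_space (count_space UNIV)"
  unfolding path_space_def by simp

lemma path_integral:
  fixes F :: "(int \<Rightarrow> nat) \<Rightarrow> real"
  assumes F: "F \<in> borel_measurable path_space"
  shows "(\<integral>\<omega>. F (\<lambda>t. Y (t + h) \<omega>) \<partial>M) = (\<integral>\<omega>. F (\<lambda>t. Y t \<omega>) \<partial>M)"
    and "integrable M (\<lambda>\<omega>. F (\<lambda>t. Y (t + h) \<omega>)) \<longleftrightarrow> integrable M (\<lambda>\<omega>. F (\<lambda>t. Y t \<omega>))"
proof -
  have "distr M path_space (\<lambda>\<omega> t. Y (t + h) \<omega>) = distr M path_space (\<lambda>\<omega> t. Y (t + 0) \<omega>)"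
    using stationary by (simp add: strictly_stationary_def)
  then show "(\<integral>\<omega>. F (\<lambda>t. Y (t + h) \<omega>) \<partial>M) = (\<integral>\<omega>. F (\<lambda>t. Y t \<omega>) \<partial>M)"
    "integrable M (\<lambda>\<omega>. F (\<lambda>t. Y (t + h) \<omega>)) \<longleftrightarrow> integrable M (\<lambda>\<omega>. F (\<lambda>t. Y t \<omega>))"
    using integral_distr[OF measurable_path[of h] F] integral_distr[OF measurable_path[of 0] F]
      integrable_distr_eq[OF measurable_path[of h] F] integrable_distr_eq[OF measurable_path[of 0] F] by simp_all
qed

lemma marginal_integral:
  fixes f :: "nat \<Rightarrow> real"
  shows "(\<integral>\<omega>. f (Y t \<omega>) \<partial>M) = (\<integral>\<omega>. f (Y 1 \<omega>) \<partial>M)"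
    and "integrable M (\<lambda>\<omega>. f (Y t \<omega>)) \<longleftrightarrow> integrable M (\<lambda>\<omega>. f (Y 1 \<omega>))"
proof -
  have "(\<lambda>y :: int \<Rightarrow> nat. f (y 1)) \<in> borel_measurable path_space"
    by (rule measurable_compose[OF measurable_coordinate]) simp
  from path_integral[OF this, of "t - 1"]
  show "(\<integral>\<omega>. f (Y t \<omega>) \<partial>M) = (\<integral>\<omega>. f (Y 1 \<omega>) \<partial>M)"
    "integrable M (\<lambda>\<omega>. f (Y t \<omega>)) \<longleftrightarrow> integrable M (\<lambda>\<omega>. f (Y 1 \<omega>))" by simp_all
qed

definition ymass :: "nat \<Rightarrow> real" where "ymass k = prob {\<omega> \<in> space M. Y 1 \<omega> = k}"

lemma prob_Y: "prob {\<omega> \<in> space M. Y t \<omega> = k} = ymass k"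
proof -
  have "prob {\<omega> \<in> space M. Y t \<omega> = k} = (\<integral>\<omega>. indicator {k} (Y t \<omega>) \<partial>M)" for t
  proof -
    have "(\<integral>\<omega>. indicator {k} (Y t \<omega>) \<partial>M) = (\<integral>\<omega>. indicator {\<omega> \<in> space M. Y t \<omega> = k} \<omega> \<partial>M)"
      by (rule Bochner_Integration.integral_cong) (auto simp: indicator_def)
    also have "\<dots> = prob {\<omega> \<in> space M. Y t \<omega> = k}" by simp
    finally show ?thesis by (rule sym)
  qed
  then show ?thesis unfolding ymass_def using marginal_integral(1)[of "indicator {k}" t] by simp
qed

definition emass :: "nat \<Rightarrow> real" where "emass k = prob {\<omega> \<in> space M. eps 0 \<omega> = k}"

lemma prob_eps: "prob {\<omega> \<in> space M. eps t \<omega> = k} = emass k"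
proof -
  have "distr M (count_space UNIV) (eps t) = distr M (count_space UNIV) (eps 0)"
    using model unfolding INAR1_def by blast
  moreover have "measure (distr M (count_space UNIV) (eps t)) {k} = prob {\<omega> \<in> space M. eps t \<omega> = k}" for t
    by (subst measure_distr) (auto intro!: arg_cong[of _ _ prob])
  ultimately show ?thesis unfolding emass_def by metis
qed

lemma emass_nonneg: "emass k \<ge> 0" by (simp add: emass_def)

lemma emass_sums:
  fixes f :: "nat \<Rightarrow> real"
  assumes "integrable M (\<lambda>\<omega>. f (eps 0 \<omega>))" shows "(\<lambda>k. f k * emass k) sums (\<integral>\<omega>. f (eps 0 \<omega>) \<partial>M)"
  unfolding emass_def by (rule nat_rv_sums) (use assms in auto)

lemma emass_sums_1: "emass sums 1"
  using emass_sums[of "\<lambda>_. 1"] by (simp add: prob_space)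

section \<open>The transition kernel of the chain\<close>

definition binw :: "nat \<Rightarrow> nat \<Rightarrow> real" where "binw y j = pmf (binomial_pmf y p) j"

lemma binw: "binw y j = real (y choose j) * p ^ j * (1 - p) ^ (y - j)"
  unfolding binw_def using p by (subst pmf_binomial) auto

lemma binw_nonneg: "binw y j \<ge> 0" by (simp add: binw_def)

lemma binw_finite: "j \<notin> {..y} \<Longrightarrow> binw y j = 0" by (simp add: binw)

lemma binw_sums: "(\<lambda>j. f j * binw y j) sums (\<Sum>j\<le>y. f j * binw y j)"
  by (rule sums_finite) (auto simp: binw_finite)

lemma binw_pgf: "(\<Sum>j\<le>y. u ^ j * binw y j) = (1 + p * (u - 1)) ^ y"
proof -
  have "(1 + p * (u - 1)) ^ y = (p * u + (1 - p)) ^ y" by (simp add: algebra_simps)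
  also have "\<dots> = (\<Sum>j\<le>y. real (y choose j) * (p * u) ^ j * (1 - p) ^ (y - j))"
    by (rule binomial_ring)
  also have "\<dots> = (\<Sum>j\<le>y. u ^ j * binw y j)" by (simp add: binw power_mult_distrib mult_ac)
  finally show ?thesis by simp
qed

lemma binw_sum: "(\<Sum>j\<le>y. binw y j) = 1"
  using binw_pgf[of 1 y] by simp

text \<open>From \<open>j \<le> y\<close> one gets \<open>j\<^sup>2 \<le> y * j\<close>, and the
  binomial mean is \<open>p * y\<close>. A factor \<open>p\<close> below 1 is all that the
  contraction needs.\<close>

lemma binw_square: "(\<Sum>j\<le>y. (real j)\<^sup>2 * binw y j) \<le> p * (real y)\<^sup>2"
proof -
  have "(\<Sum>j\<le>y. (real j)\<^sup>2 * binw y j) \<le> (\<Sum>j\<le>y. real y * (real j * Bernstein y j p))"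
    by (rule sum_mono) (use p in \<open>auto simp: binw Bernstein_def power2_eq_square mult.assoc intro!: mult_mono\<close>)
  also have "\<dots> = p * (real y)\<^sup>2"
    using sum_k_Bernstein[of y p] by (simp add: sum_distrib_left[symmetric] power2_eq_square)
  finally show ?thesis .
qed

text \<open>The transition probability of the chain \<open>Y\<close> from \<open>y\<close> to
  \<open>k\<close>: thinned survivors plus innovations.\<close>

definition kappa :: "nat \<Rightarrow> nat \<Rightarrow> real" where
  "kappa y k = (\<Sum>j\<le>k. binw y j * emass (k - j))"

lemma kappa_nonneg: "kappa y k \<ge> 0"
  unfolding kappa_def by (intro sum_nonneg mult_nonneg_nonneg binw_nonneg emass_nonneg)

lemma summable_emass_power:
  assumes "\<bar>u\<bar> \<le> 1" shows "summable (\<lambda>i. norm (u ^ i * emass i))"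
proof (rule summable_comparison_test'[OF sums_summable[OF emass_sums_1]])
  fix i
  have "\<bar>u\<bar> ^ i * emass i \<le> 1 * emass i"
    using assms by (intro mult_right_mono emass_nonneg power_le_one) auto
  then show "norm (norm (u ^ i * emass i)) \<le> emass i"
    using emass_nonneg[of i] by (simp add: abs_mult power_abs)
qed

text \<open>A Cauchy product of the weighted binomial and innovation laws. Weights
  \<open>u ^ j\<close> and \<open>u ^ i\<close> give the generating function of the kernel; with one
  weight constant and the other a square they give the pieces of the second-moment bound.\<close>

lemma kappa_product_sums:
  fixes a b :: "nat \<Rightarrow> real"
  assumes b: "summable (\<lambda>i. norm (b i * emass i))"
  shows "(\<lambda>k. \<Sum>j\<le>k. (a j * binw y j) * (b (k - j) * emass (k - j))) sums ((\<Sum>j\<le>y. a j * binw y j) * (\<Sum>i. b i * emass i))"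
proof -
  have "summable (\<lambda>j. norm (a j * binw y j))"
    by (rule summable_finite[of "{..y}"]) (auto simp: binw_finite)
  from Cauchy_product_sums[OF this b] show ?thesis
    using binw_sums[of a y] by (simp add: sums_iff)
qed

lemma kappa_pgf:
  assumes "\<bar>u\<bar> \<le> 1"
  shows "(\<lambda>k. u ^ k * kappa y k) sums ((1 + p * (u - 1)) ^ y * (\<Sum>i. u ^ i * emass i))"
proof -
  have "(\<lambda>k. \<Sum>j\<le>k. (u ^ j * binw y j) * (u ^ (k - j) * emass (k - j))) sums ((1 + p * (u - 1)) ^ y * (\<Sum>i. u ^ i * emass i))"
    using kappa_product_sums[of "\<lambda>i. u ^ i" "\<lambda>j. u ^ j" y] summable_emass_power[OF assms] by (simp add: binw_pgf)
  moreover have "(\<Sum>j\<le>k. (u ^ j * binw y j) * (u ^ (k - j) * emass (k - j))) = u ^ k * kappa y k" for k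
    unfolding kappa_def sum_distrib_left
  proof (rule sum.cong)
    fix j assume "j \<in> {..k}"
    then have "u ^ k = u ^ j * u ^ (k - j)" by (simp flip: power_add)
    then show "u ^ j * binw y j * (u ^ (k - j) * emass (k - j)) = u ^ k * (binw y j * emass (k - j))" by simp
  qed simp
  ultimately show ?thesis by simp
qed

lemma kappa_sums_1: "kappa y sums 1"
  using kappa_pgf[of 1 y] emass_sums_1 by (simp add: sums_iff)

lemma kappa_le_1: "kappa y k \<le> 1"
  using sum_le_suminf[OF sums_summable[OF kappa_sums_1[of y]], of "{k}"] kappa_nonneg kappa_sums_1[of y] by (simp add: sums_iff)

definition m2 :: real where "m2 = (\<integral>\<omega>. (real (eps 0 \<omega>))\<^sup>2 \<partial>M)"

lemma m2_sums: "(\<lambda>i. (real i)\<^sup>2 * emass i) sums m2"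
  unfolding m2_def using model by (intro emass_sums) (simp add: INAR1_def)

lemma m2_nonneg: "m2 \<ge> 0" by (simp add: m2_def)

text \<open>A drift inequality: for survivors \<open>j\<close> and innovations \<open>i\<close>,
  \<open>(j + i)\<^sup>2 \<le> (1 + d) * j\<^sup>2 + (1 + 1 / d) * i\<^sup>2\<close>, and thinning
  bounds the mean of \<open>j\<^sup>2\<close> by \<open>p * y\<^sup>2\<close>. The coefficient
  \<open>(1 + p) / 2\<close> of \<open>y\<^sup>2\<close> stays below 1.\<close>

lemma kappa_second_moment:
  shows "summable (\<lambda>k. (real k)\<^sup>2 * kappa y k)"
    and "(\<Sum>k. (real k)\<^sup>2 * kappa y k) \<le> (1 + p) / 2 * (real y)\<^sup>2 + (1 + p) / (1 - p) * m2"
proof -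
  \<comment> \<open>Chosen so that \<open>(1 + d) * p = (1 + p) / 2\<close>, halfway between
    \<open>p\<close> and 1.\<close>
  define d where "d = (1 - p) / (2 * p)"
  have d: "d > 0" using p by (simp add: d_def)
  have e2: "summable (\<lambda>i. norm ((real i)\<^sup>2 * emass i))"
    using m2_sums emass_nonneg by (simp add: sums_iff)
  let ?A = "\<lambda>k. \<Sum>j\<le>k. ((real j)\<^sup>2 * binw y j) * (1 * emass (k - j))"
  let ?B = "\<lambda>k. \<Sum>j\<le>k. (1 * binw y j) * ((real (k - j))\<^sup>2 * emass (k - j))"
  have A: "?A sums (\<Sum>j\<le>y. (real j)\<^sup>2 * binw y j)"
    using kappa_product_sums[of "\<lambda>_. 1" "\<lambda>j. (real j)\<^sup>2" y] emass_sums_1 emass_nonneg by (simp add: sums_iff)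
  have B: "?B sums m2"
    using kappa_product_sums[of "\<lambda>i. (real i)\<^sup>2" "\<lambda>j. 1" y] e2 m2_sums binw_sum[of y] by (simp add: sums_iff)
  have AB: "(\<lambda>k. (1 + d) * ?A k + (1 + 1 / d) * ?B k) sums ((1 + d) * (\<Sum>j\<le>y. (real j)\<^sup>2 * binw y j) + (1 + 1 / d) * m2)"
    by (intro sums_add sums_mult A B)
  have le: "(real k)\<^sup>2 * kappa y k \<le> (1 + d) * ?A k + (1 + 1 / d) * ?B k" for k
    unfolding kappa_def sum_distrib_left sum.distrib[symmetric]
  proof (rule sum_mono)
    fix j assume j: "j \<in> {..k}"
    have "0 \<le> (d * real j - real (k - j))\<^sup>2 / d" using d by simp
    also have "\<dots> = d * (real j)\<^sup>2 - 2 * real j * real (k - j) + (real (k - j))\<^sup>2 / d"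
      using d by (simp add: field_simps power2_eq_square)
    finally have "(real j + real (k - j))\<^sup>2 \<le> (1 + d) * (real j)\<^sup>2 + (1 + 1 / d) * (real (k - j))\<^sup>2"
      by (simp add: power2_eq_square algebra_simps)
    moreover have "real j + real (k - j) = real k" using j by simp
    ultimately have "(real k)\<^sup>2 * (binw y j * emass (k - j)) \<le> ((1 + d) * (real j)\<^sup>2 + (1 + 1 / d) * (real (k - j))\<^sup>2) * (binw y j * emass (k - j))"
      by (intro mult_right_mono mult_nonneg_nonneg binw_nonneg emass_nonneg) simp
    then show "(real k)\<^sup>2 * (binw y j * emass (k - j)) \<le> (1 + d) * ((real j)\<^sup>2 * binw y j * (1 * emass (k - j))) +
        (1 + 1 / d) * (1 * binw y j * ((real (k - j))\<^sup>2 * emass (k - j)))"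
      by (simp add: algebra_simps)
  qed
  show s: "summable (\<lambda>k. (real k)\<^sup>2 * kappa y k)"
    by (rule summable_comparison_test'[OF sums_summable[OF AB]]) (use le kappa_nonneg in \<open>auto simp: abs_mult\<close>)
  have "(\<Sum>k. (real k)\<^sup>2 * kappa y k) \<le> (1 + d) * (\<Sum>j\<le>y. (real j)\<^sup>2 * binw y j) + (1 + 1 / d) * m2"
    using suminf_le[OF le s sums_summable[OF AB]] AB by (simp add: sums_iff)
  also have "\<dots> \<le> (1 + d) * (p * (real y)\<^sup>2) + (1 + 1 / d) * m2"
    using d by (intro add_right_mono mult_left_mono binw_square) auto
  also have "(1 + d) * (p * (real y)\<^sup>2) = (1 + p) / 2 * (real y)\<^sup>2" using p by (simp add: d_def field_simps)
  also have "1 + 1 / d = (1 + p) / (1 - p)" using p by (simp add: d_def field_simps)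
  finally show "(\<Sum>k. (real k)\<^sup>2 * kappa y k) \<le> (1 + p) / 2 * (real y)\<^sup>2 + (1 + p) / (1 - p) * m2" .
qed

section \<open>Conditioning on the past and the centred indicators\<close>

lemma space_past [simp]: "space (past M Y t) = space M"
  by (simp add: past_def space_measure_of_conv)

lemma sets_past: "sets (past M Y t) = sigma_sets (space M) {Y s -` B \<inter> space M | s B. s \<le> t}"
  unfolding past_def by (rule sets_measure_of) auto

lemma subalgebra_past: "subalgebra M (past M Y t)"
  unfolding subalgebra_def
proof
  show "sets (past M Y t) \<subseteq> sets M"
    unfolding sets_past by (rule sets.sigma_sets_subset) (auto intro: measurable_sets[OF measurable_Y])
qed simp

lemma past_mono: "s \<le> t \<Longrightarrow> sets (past M Y s) \<subseteq> sets (past M Y t)"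
  unfolding sets_past by (rule sigma_sets_mono') fastforce

lemma measurable_past_mono: "s \<le> t \<Longrightarrow> f \<in> measurable (past M Y s) N \<Longrightarrow> f \<in> measurable (past M Y t) N"
  using past_mono[of s t] by (auto simp: measurable_def)

lemma measurable_past_imp: "f \<in> measurable (past M Y t) N \<Longrightarrow> f \<in> measurable M N"
  using subalgebra_past[of t] by (auto simp: measurable_def subalgebra_def)

lemma measurable_Y_past: "s \<le> t \<Longrightarrow> Y s \<in> measurable (past M Y t) (count_space UNIV)"
  by (rule measurableI) (auto simp: sets_past intro!: sigma_sets.Basic)

lemma sigma_finite_past: "sigma_finite_subalgebra M (past M Y t)"
  by (rule finite_measure_subalgebra_is_sigma_finite)
     (simp add: finite_measure_subalgebra_def finite_measure_subalgebra_axioms_def subalgebra_past finite_measure_axioms)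

lemma cond_exp_zero_integral:
  assumes zero: "AE \<omega> in M. real_cond_exp M (past M Y t) f \<omega> = 0"
    and h: "h \<in> borel_measurable (past M Y t)" and f: "f \<in> borel_measurable M" and int: "integrable M (\<lambda>\<omega>. h \<omega> * f \<omega>)"
  shows "(\<integral>\<omega>. h \<omega> * f \<omega> \<partial>M) = 0"
proof -
  interpret sigma_finite_subalgebra M "past M Y t" by (rule sigma_finite_past)
  have [measurable]: "h \<in> borel_measurable M" using measurable_past_imp[OF h] .
  have "(\<integral>\<omega>. h \<omega> * f \<omega> \<partial>M) = (\<integral>\<omega>. h \<omega> * real_cond_exp M (past M Y t) f \<omega> \<partial>M)"
    using real_cond_exp_intg(2)[OF int h f] by simp
  also have "\<dots> = (\<integral>\<omega>. 0 \<partial>M)"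
    by (rule integral_cong_AE) (use zero in auto)
  finally show ?thesis by simp
qed

definition innov :: "int \<Rightarrow> nat \<Rightarrow> 'a \<Rightarrow> real" where
  "innov t k \<omega> = (if Y t \<omega> = k then 1 else 0) - kappa (Y (t - 1) \<omega>) k"

lemma measurable_innov [measurable]: "innov t k \<in> borel_measurable M"
  unfolding innov_def by measurable

lemma innov_bounded: "\<bar>innov t k \<omega>\<bar> \<le> 1"
  using kappa_nonneg[of "Y (t - 1) \<omega>" k] kappa_le_1[of "Y (t - 1) \<omega>" k] by (simp add: innov_def)

text \<open>This is where the conditional law in \<open>INAR1\<close> is used: it says that the
  conditional expectation of the indicator is \<open>kappa\<close>. Since the centred indicator is
  bounded, integrability of the test function suffices.\<close>

lemma innov_orthogonal:
  assumes h: "h \<in> borel_measurable (past M Y (t - 1))" and int: "integrable M h"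
  shows "(\<integral>\<omega>. h \<omega> * innov t k \<omega> \<partial>M) = 0"
proof -
  interpret sigma_finite_subalgebra M "past M Y (t - 1)" by (rule sigma_finite_past)
  have [measurable]: "h \<in> borel_measurable M" using measurable_past_imp[OF h] .
  let ?I = "indicator {x \<in> space M. Y t x = k} :: 'a \<Rightarrow> real"
  have intI: "integrable M (\<lambda>\<omega>. h \<omega> * ?I \<omega>)"
    by (rule Bochner_Integration.integrable_bound[OF int]) (auto simp: indicator_def)
  have intk: "integrable M (\<lambda>\<omega>. h \<omega> * kappa (Y (t - 1) \<omega>) k)"
    by (rule Bochner_Integration.integrable_bound[OF int])
       (use kappa_nonneg kappa_le_1 in \<open>auto simp: abs_mult mult_left_le\<close>)
  have "(\<integral>\<omega>. h \<omega> * ?I \<omega> \<partial>M) = (\<integral>\<omega>. h \<omega> * real_cond_exp M (past M Y (t - 1)) ?I \<omega> \<partial>M)"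
    by (rule real_cond_exp_intg(2)[symmetric, OF intI h]) measurable
  also have "\<dots> = (\<integral>\<omega>. h \<omega> * kappa (Y (t - 1) \<omega>) k \<partial>M)"
  proof (rule integral_cong_AE)
    have "AE \<omega> in M. real_cond_exp M (past M Y (t - 1)) ?I \<omega> = (\<Sum>j\<le>k. pmf (binomial_pmf (Y (t - 1) \<omega>) p) j * measure M {x \<in> space M. eps t x = k - j})"
      using model unfolding INAR1_def by blast
    then show "AE \<omega> in M. h \<omega> * real_cond_exp M (past M Y (t - 1)) ?I \<omega> = h \<omega> * kappa (Y (t - 1) \<omega>) k"
      by eventually_elim (simp add: prob_eps kappa_def binw_def)
  qed measurable
  finally have eq: "(\<integral>\<omega>. h \<omega> * ?I \<omega> \<partial>M) = (\<integral>\<omega>. h \<omega> * kappa (Y (t - 1) \<omega>) k \<partial>M)" .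
  have "(\<integral>\<omega>. h \<omega> * innov t k \<omega> \<partial>M) = (\<integral>\<omega>. h \<omega> * ?I \<omega> - h \<omega> * kappa (Y (t - 1) \<omega>) k \<partial>M)"
    by (rule Bochner_Integration.integral_cong) (auto simp: innov_def indicator_def algebra_simps)
  then show ?thesis using eq intI intk by simp
qed

lemma integral_kappa: "(\<integral>\<omega>. kappa (Y t \<omega>) k \<partial>M) = ymass k"
proof -
  have "(\<integral>\<omega>. 1 * innov (t + 1) k \<omega> \<partial>M) = 0" by (rule innov_orthogonal) auto
  moreover have "innov (t + 1) k \<omega> = indicator {\<omega> \<in> space M. Y (t + 1) \<omega> = k} \<omega> - kappa (Y t \<omega>) k" if "\<omega> \<in> space M" for \<omega>
    using that by (simp add: innov_def indicator_def)
  then have "(\<integral>\<omega>. 1 * innov (t + 1) k \<omega> \<partial>M) = (\<integral>\<omega>. indicator {\<omega> \<in> space M. Y (t + 1) \<omega> = k} \<omega> - kappa (Y t \<omega>) k \<partial>M)"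
    by (intro Bochner_Integration.integral_cong) auto
  moreover have "integrable M (\<lambda>\<omega>. kappa (Y t \<omega>) k)"
    by (rule integrable_const_bound[of _ 1]) (use kappa_nonneg kappa_le_1 in auto)
  moreover have "(\<integral>\<omega>. indicator {\<omega> \<in> space M. Y (t + 1) \<omega> = k} \<omega> - kappa (Y t \<omega>) k \<partial>M) = ymass k - (\<integral>\<omega>. kappa (Y t \<omega>) k \<partial>M)"
    using calculation(3) by (subst Bochner_Integration.integral_diff) (auto simp: prob_Y emeasure_eq_measure)
  ultimately show ?thesis by simp
qed

text \<open>A centred indicator is at most 1 in absolute value, so its square is at most its
  absolute value, which is at most the indicator plus \<open>kappa\<close>; both have mean
  \<open>ymass k\<close>.\<close>

lemma innov_abs_moment: "(\<integral>\<omega>. (innov t k \<omega>)\<^sup>2 \<partial>M) \<le> 2 * ymass k"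
proof -
  have int: "integrable M (\<lambda>\<omega>. kappa (Y (t - 1) \<omega>) k)"
    by (rule integrable_const_bound[of _ 1]) (use kappa_nonneg kappa_le_1 in auto)
  have intI: "integrable M (indicator {\<omega> \<in> space M. Y t \<omega> = k} :: 'a \<Rightarrow> real)" by (auto simp: emeasure_eq_measure)
  have "(\<integral>\<omega>. (innov t k \<omega>)\<^sup>2 \<partial>M) \<le> (\<integral>\<omega>. indicator {\<omega> \<in> space M. Y t \<omega> = k} \<omega> + kappa (Y (t - 1) \<omega>) k \<partial>M)"
  proof (rule integral_mono)
    show "integrable M (\<lambda>\<omega>. (innov t k \<omega>)\<^sup>2)"
      by (rule integrable_const_bound[of _ 1]) (use innov_bounded in \<open>auto simp: abs_square_le_1\<close>)
    fix \<omega> assume "\<omega> \<in> space M"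
    have "\<bar>innov t k \<omega>\<bar> * \<bar>innov t k \<omega>\<bar> \<le> 1 * \<bar>innov t k \<omega>\<bar>"
      by (intro mult_right_mono innov_bounded) simp
    also have "\<dots> \<le> indicator {\<omega> \<in> space M. Y t \<omega> = k} \<omega> + kappa (Y (t - 1) \<omega>) k"
      using \<open>\<omega> \<in> space M\<close> kappa_nonneg[of "Y (t - 1) \<omega>" k] kappa_le_1[of "Y (t - 1) \<omega>" k]
      by (simp add: innov_def indicator_def)
    finally show "(innov t k \<omega>)\<^sup>2 \<le> indicator {\<omega> \<in> space M. Y t \<omega> = k} \<omega> + kappa (Y (t - 1) \<omega>) k"
      by (simp add: power2_eq_square)
  qed (use int intI in auto)
  also have "\<dots> = 2 * ymass k" using int intI by (simp add: integral_kappa prob_Y)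
  finally show ?thesis .
qed

text \<open>Invariance of the marginal law under the kernel. Boundedness of \<open>f\<close> permits
  the exchange of sum and integral before any moment of \<open>Y\<close> is known.\<close>

lemma integral_transition:
  fixes f :: "nat \<Rightarrow> real"
  assumes f: "\<And>k. 0 \<le> f k" "\<And>k. f k \<le> K"
  shows "(\<integral>\<omega>. f (Y 1 \<omega>) \<partial>M) = (\<integral>\<omega>. (\<Sum>k. f k * kappa (Y 1 \<omega>) k) \<partial>M)"
proof -
  have int: "integrable M (\<lambda>\<omega>. f (Y 1 \<omega>))" by (rule integrable_const_bound[of _ K]) (use f in auto)
  have s: "(\<lambda>k. f k * ymass k) sums (\<integral>\<omega>. f (Y 1 \<omega>) \<partial>M)"
    unfolding ymass_def by (rule nat_rv_sums) (use int in auto)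
  have intk: "integrable M (\<lambda>\<omega>. f k * kappa (Y 1 \<omega>) k)" for k
    by (intro integrable_mult_right integrable_const_bound[of _ 1]) (use kappa_nonneg kappa_le_1 in auto)
  have E: "(\<integral>\<omega>. f k * kappa (Y 1 \<omega>) k \<partial>M) = f k * ymass k" for k by (simp add: integral_kappa)
  have "(\<lambda>k. \<integral>\<omega>. f k * kappa (Y 1 \<omega>) k \<partial>M) sums (\<integral>\<omega>. (\<Sum>k. f k * kappa (Y 1 \<omega>) k) \<partial>M)"
  proof (rule sums_integral[OF intk])
    show "AE \<omega> in M. summable (\<lambda>k. norm (f k * kappa (Y 1 \<omega>) k))"
    proof (rule AE_I2)
      fix \<omega>
      show "summable (\<lambda>k. norm (f k * kappa (Y 1 \<omega>) k))"
        by (rule summable_comparison_test'[OF summable_mult[OF sums_summable[OF kappa_sums_1], of K]])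
           (use f kappa_nonneg in \<open>auto simp: abs_mult intro!: mult_right_mono\<close>)
    qed
    show "summable (\<lambda>k. \<integral>\<omega>. norm (f k * kappa (Y 1 \<omega>) k) \<partial>M)"
      using s f kappa_nonneg by (simp add: abs_mult E[simplified] sums_iff integral_kappa)
  qed
  then show ?thesis unfolding E using s sums_unique2 by blast
qed

text \<open>Stationarity would turn the drift inequality into a bound for the second moment if that
  moment were known to be finite. Truncating both sides at \<open>N\<close> keeps everything
  integrable, and Fatou's lemma removes the truncation.\<close>

lemma integrable_Y_square: "integrable M (\<lambda>\<omega>. (real (Y t \<omega>))\<^sup>2)"
proof -
  define l where "l = (1 + p) / 2"
  define C where "C = (1 + p) / (1 - p) * m2"
  have l: "l < 1" using p by (simp add: l_def)
  have C: "C \<ge> 0" unfolding C_def using p m2_nonneg by simp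
  have l0: "l \<ge> 0" using p by (simp add: l_def)
  \<comment> \<open>The truncated drift: its mean is nonpositive by stationarity, it is at least
    \<open>- C\<close>, and for large \<open>N\<close> it equals
    \<open>(1 - l) * y\<^sup>2 - C\<close>.\<close>
  define D where "D = (\<lambda>(N::nat) y. min ((real y)\<^sup>2) (real N) - min (l * (real y)\<^sup>2 + C) (real N))"
  have DC: "D N y + C \<ge> 0" for N y
  proof -
    have "l * (real y)\<^sup>2 \<le> 1 * (real y)\<^sup>2" using l by (intro mult_right_mono) auto
    then show ?thesis using C unfolding D_def by (auto simp: min_def)
  qed
  have "(\<integral>\<omega>. D N (Y 1 \<omega>) \<partial>M) \<le> 0" for N
  proof -
    have i1: "integrable M (\<lambda>\<omega>. min ((real (Y 1 \<omega>))\<^sup>2) (real N))" by (rule integrable_const_bound[of _ "real N"]) auto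
    have i2: "integrable M (\<lambda>\<omega>. min (l * (real (Y 1 \<omega>))\<^sup>2 + C) (real N))"
      by (rule integrable_const_bound[of _ "real N"]) (use C l0 in auto)
    have "(\<integral>\<omega>. min ((real (Y 1 \<omega>))\<^sup>2) (real N) \<partial>M) = (\<integral>\<omega>. (\<Sum>k. min ((real k)\<^sup>2) (real N) * kappa (Y 1 \<omega>) k) \<partial>M)"
      by (rule integral_transition[where f = "\<lambda>k. min ((real k)\<^sup>2) (real N)" and K = "real N"]) auto
    also have "\<dots> \<le> (\<integral>\<omega>. min (l * (real (Y 1 \<omega>))\<^sup>2 + C) (real N) \<partial>M)"
    proof (rule integral_mono_AE')
      show "AE \<omega> in M. (\<Sum>k. min ((real k)\<^sup>2) (real N) * kappa (Y 1 \<omega>) k) \<le> min (l * (real (Y 1 \<omega>))\<^sup>2 + C) (real N)"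
      proof (rule AE_I2)
        fix \<omega>
        let ?y = "Y 1 \<omega>"
        have sN: "summable (\<lambda>k. real N * kappa ?y k)" by (intro summable_mult sums_summable[OF kappa_sums_1])
        have s: "summable (\<lambda>k. min ((real k)\<^sup>2) (real N) * kappa ?y k)"
          by (rule summable_comparison_test'[OF sN]) (use kappa_nonneg in \<open>auto simp: abs_mult intro!: mult_right_mono\<close>)
        have "(\<Sum>k. min ((real k)\<^sup>2) (real N) * kappa ?y k) \<le> (\<Sum>k. (real k)\<^sup>2 * kappa ?y k)"
          by (rule suminf_le[OF _ s kappa_second_moment(1)]) (auto intro!: mult_right_mono kappa_nonneg)
        also have "\<dots> \<le> l * (real ?y)\<^sup>2 + C"
          using kappa_second_moment(2)[of ?y] by (simp add: l_def C_def)
        finally have 1: "(\<Sum>k. min ((real k)\<^sup>2) (real N) * kappa ?y k) \<le> l * (real ?y)\<^sup>2 + C" .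
        have "(\<Sum>k. min ((real k)\<^sup>2) (real N) * kappa ?y k) \<le> (\<Sum>k. real N * kappa ?y k)"
          by (rule suminf_le[OF _ s sN]) (auto intro!: mult_right_mono kappa_nonneg)
        also have "\<dots> = real N" using kappa_sums_1[of ?y] by (subst suminf_mult) (auto simp: sums_iff)
        finally show "(\<Sum>k. min ((real k)\<^sup>2) (real N) * kappa ?y k) \<le> min (l * (real ?y)\<^sup>2 + C) (real N)" using 1 by simp
      qed
      show "AE \<omega> in M. 0 \<le> min (l * (real (Y 1 \<omega>))\<^sup>2 + C) (real N)" using l0 C by auto
    qed (rule i2)
    finally show ?thesis unfolding D_def using i1 i2 by simp
  qed
  note D0 = this
  have intD: "integrable M (\<lambda>\<omega>. D N (Y 1 \<omega>))" for N
  proof (rule integrable_const_bound[of _ "real N"])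
    show "AE \<omega> in M. norm (D N (Y 1 \<omega>)) \<le> real N"
    proof (rule AE_I2)
      fix \<omega>
      have "0 \<le> l * (real (Y 1 \<omega>))\<^sup>2 + C" using l0 C by simp
      moreover have "\<bar>min a n - min b n\<bar> \<le> n" if "0 \<le> a" "0 \<le> b" "0 \<le> n" for a b n :: real
        using that by (auto simp: min_def abs_if)
      ultimately show "norm (D N (Y 1 \<omega>)) \<le> real N" unfolding D_def real_norm_def by simp
    qed
  qed simp
  have "(\<integral>\<^sup>+\<omega>. ennreal ((1 - l) * (real (Y 1 \<omega>))\<^sup>2) \<partial>M) = (\<integral>\<^sup>+\<omega>. liminf (\<lambda>N. ennreal (D N (Y 1 \<omega>) + C)) \<partial>M)"
  proof (rule nn_integral_cong)
    fix \<omega>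
    obtain N0 :: nat where N0: "real N0 \<ge> max ((real (Y 1 \<omega>))\<^sup>2) (l * (real (Y 1 \<omega>))\<^sup>2 + C)" using real_arch_simple by blast
    have "\<forall>\<^sub>F N in sequentially. ennreal (D N (Y 1 \<omega>) + C) = ennreal ((1 - l) * (real (Y 1 \<omega>))\<^sup>2)"
      using eventually_ge_at_top[of N0]
    proof eventually_elim
      case (elim N)
      then have "real N \<ge> max ((real (Y 1 \<omega>))\<^sup>2) (l * (real (Y 1 \<omega>))\<^sup>2 + C)" using N0 by linarith
      then show ?case unfolding D_def by (simp add: min_def algebra_simps)
    qed
    then have "(\<lambda>N. ennreal (D N (Y 1 \<omega>) + C)) \<longlonglongrightarrow> ennreal ((1 - l) * (real (Y 1 \<omega>))\<^sup>2)" by (rule tendsto_eventually)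
    then show "ennreal ((1 - l) * (real (Y 1 \<omega>))\<^sup>2) = liminf (\<lambda>N. ennreal (D N (Y 1 \<omega>) + C))"
      by (subst lim_imp_Liminf) auto
  qed
  also have "\<dots> \<le> liminf (\<lambda>N. \<integral>\<^sup>+\<omega>. ennreal (D N (Y 1 \<omega>) + C) \<partial>M)"
    by (rule nn_integral_liminf) simp
  also have "\<dots> \<le> liminf (\<lambda>N :: nat. ennreal C)"
  proof (rule Liminf_mono, rule always_eventually, rule allI)
    fix N
    have "(\<integral>\<^sup>+\<omega>. ennreal (D N (Y 1 \<omega>) + C) \<partial>M) = ennreal (\<integral>\<omega>. D N (Y 1 \<omega>) + C \<partial>M)"
      by (rule nn_integral_eq_integral) (use intD DC in auto)
    also have "\<dots> \<le> ennreal C"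
      using D0[of N] intD[of N] by (intro ennreal_leI) (simp add: prob_space)
    finally show "(\<integral>\<^sup>+\<omega>. ennreal (D N (Y 1 \<omega>) + C) \<partial>M) \<le> ennreal C" .
  qed
  also have "\<dots> < \<infinity>" by (simp add: Liminf_const)
  finally have "integrable M (\<lambda>\<omega>. (1 - l) * (real (Y 1 \<omega>))\<^sup>2)"
    using l by (intro integrableI_bounded) (auto simp: abs_mult)
  then have "integrable M (\<lambda>\<omega>. (real (Y 1 \<omega>))\<^sup>2)" using l by simp
  then show ?thesis using marginal_integral(2)[of "\<lambda>k. (real k)\<^sup>2" t] by simp
qed

lemma ymass_nonneg: "ymass k \<ge> 0" by (simp add: ymass_def)

lemma ymass_sums:
  fixes f :: "nat \<Rightarrow> real"
  assumes "integrable M (\<lambda>\<omega>. f (Y 1 \<omega>))"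
  shows "(\<lambda>k. f k * ymass k) sums (\<integral>\<omega>. f (Y 1 \<omega>) \<partial>M)"
  unfolding ymass_def by (rule nat_rv_sums) (use assms in auto)

text \<open>Write \<open>sqrt (ymass k)\<close> as \<open>(k + 1) * sqrt (ymass k)\<close> times
  \<open>1 / (k + 1)\<close>. The product is at most the sum of the squares, and both squares are
  summable: the first by the second moment, the other as an inverse square series.\<close>

lemma summable_sqrt_ymass: "summable (\<lambda>k. sqrt (ymass k))"
proof -
  have "(\<lambda>k. (real k)\<^sup>2 * ymass k) sums (\<integral>\<omega>. (real (Y 1 \<omega>))\<^sup>2 \<partial>M)" "(\<lambda>k. 1 * ymass k) sums (\<integral>\<omega>. 1 \<partial>M)"
    using integrable_Y_square[of 1] by (intro ymass_sums; simp)+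
  then have 1: "summable (\<lambda>k. 2 * ((real k)\<^sup>2 * ymass k) + 2 * (1 * ymass k))"
    by (intro summable_add summable_mult) (auto simp: sums_iff)
  have 2: "summable (\<lambda>k. 1 / (real (Suc k))\<^sup>2)"
    using inverse_power_summable[of 2, where 'a = real] by (subst summable_Suc_iff) (simp add: field_simps)
  show ?thesis
  proof (rule summable_comparison_test'[OF summable_add[OF 1 2]])
    fix k
    let ?a = "sqrt (ymass k) * real (Suc k)"
    have "sqrt (ymass k) = ?a * (1 / real (Suc k))" by simp
    also have "\<dots> \<le> ?a\<^sup>2 + (1 / real (Suc k))\<^sup>2"
    proof -
      have "0 \<le> ?a * (1 / real (Suc k))" using ymass_nonneg[of k] by simp
      moreover have "2 * ?a * (1 / real (Suc k)) \<le> ?a\<^sup>2 + (1 / real (Suc k))\<^sup>2" by (rule sum_squares_bound)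
      ultimately show ?thesis by linarith
    qed
    also have "?a\<^sup>2 = ymass k * (real k + 1)\<^sup>2" using ymass_nonneg[of k] by (simp add: power_mult_distrib add.commute)
    also have "ymass k * (real k + 1)\<^sup>2 \<le> ymass k * (2 * (real k)\<^sup>2 + 2)"
      using sum_squares_bound[of "real k" 1] by (intro mult_left_mono ymass_nonneg) (simp add: power2_eq_square algebra_simps)
    finally show "norm (sqrt (ymass k)) \<le> 2 * ((real k)\<^sup>2 * ymass k) + 2 * (1 * ymass k) + 1 / (real (Suc k))\<^sup>2"
      using ymass_nonneg[of k] by (simp add: algebra_simps power_divide)
  qed
qed

end

section \<open>The martingale differences of the model\<close>

context inar
begin

definition path_law :: "(int \<Rightarrow> nat) measure" where
  "path_law = distr M path_space (\<lambda>\<omega> t. Y t \<omega>)"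

definition shift :: "(int \<Rightarrow> nat) \<Rightarrow> int \<Rightarrow> nat" where "shift y = (\<lambda>t. y (t + 1))"

lemma measurable_path0: "(\<lambda>\<omega> t. Y t \<omega>) \<in> measurable M path_space"
  using measurable_path[of 0] by simp

lemma measurable_shift: "shift \<in> measurable path_space path_space"
proof -
  have "(\<lambda>y t. y (t + 1)) \<in> measurable path_space (PiM UNIV (\<lambda>_. count_space UNIV))"
    by (rule measurable_PiM_single') (auto intro: measurable_coordinate)
  then show ?thesis by (simp add: shift_def[abs_def] path_space_def)
qed

lemma sets_path_law [measurable_cong]: "sets path_law = sets path_space" by (simp add: path_law_def)

lemma space_path_law [simp]: "space path_law = UNIV" by (simp add: path_law_def)

lemma shift_funpow: "(shift ^^ i) y = (\<lambda>t. y (t + int i))"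
  by (induction i) (auto simp: shift_def algebra_simps)

text \<open>The probability space of the process carries no shift map, so the ergodic theorem is
  applied to the law of the whole path. There stationarity makes the shift measure preserving, and
  \<open>ergodic_process\<close> speaks of exactly its invariant sets.\<close>

lemma ergodic_map_path_law: "ergodic_map path_law shift"
proof -
  interpret P: prob_space path_law
    unfolding path_law_def by (rule prob_space_distr[OF measurable_path0])
  show ?thesis
  proof
    show "shift \<in> measurable path_law path_law"
      using measurable_shift by (simp cong: measurable_cong_sets add: sets_path_law)
    have "distr path_law path_law shift = distr path_law path_space shift"
      by (rule distr_cong) (auto simp: sets_path_law)
    also have "\<dots> = distr M path_space (\<lambda>\<omega> t. Y (t + 1) \<omega>)"
      unfolding path_law_def by (subst distr_distr[OF measurable_shift measurable_path0]) (simp add: comp_def shift_def)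
    also have "\<dots> = path_law"
      using stationary by (simp add: strictly_stationary_def path_law_def)
    finally show "distr path_law path_law shift = path_law" .
    fix A assume A: "A \<in> sets path_law" "shift -` A \<inter> space path_law = A"
    then have "prob {\<omega> \<in> space M. (\<lambda>t. Y t \<omega>) \<in> A} \<in> {0, 1}"
      using ergodic unfolding ergodic_process_def shift_def by (auto simp: sets_path_law)
    moreover have "measure path_law A = prob {\<omega> \<in> space M. (\<lambda>t. Y t \<omega>) \<in> A}"
      unfolding path_law_def using A by (subst measure_distr[OF measurable_path0]) (auto simp: sets_path_law intro!: arg_cong[of _ _ prob])
    ultimately show "measure path_law A \<in> {0, 1}" by simp
  qed
qed

lemma ergodic_L1:
  fixes F :: "(int \<Rightarrow> nat) \<Rightarrow> real"
  assumes F [measurable]: "F \<in> borel_measurable path_space" and int: "integrable M (\<lambda>\<omega>. F (\<lambda>t. Y t \<omega>))"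
    and nonneg: "\<And>y. F y \<ge> 0"
  shows "(\<lambda>n. \<integral>\<omega>. \<bar>(\<Sum>i<n. F (\<lambda>t. Y (t + int i) \<omega>)) / real n - (\<integral>\<omega>. F (\<lambda>t. Y t \<omega>) \<partial>M)\<bar> \<partial>M) \<longlonglongrightarrow> 0"
proof -
  interpret E: ergodic_map path_law shift by (rule ergodic_map_path_law)
  have F': "F \<in> borel_measurable path_law" by simp
  have intF: "integrable path_law F"
    unfolding path_law_def by (subst integrable_distr_eq[OF measurable_path0 F]) (rule int)
  have EF: "(\<integral>y. F y \<partial>path_law) = (\<integral>\<omega>. F (\<lambda>t. Y t \<omega>) \<partial>M)"
    unfolding path_law_def by (rule integral_distr[OF measurable_path0 F])
  have m: "(\<lambda>y. \<bar>E.birkhoff_sum F n y / real n - c\<bar>) \<in> borel_measurable path_space" for n c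
  proof -
    have [measurable]: "(\<lambda>y. F ((shift ^^ i) y)) \<in> borel_measurable path_space" for i
    proof -
      have "shift ^^ i \<in> measurable path_space path_space"
        by (induction i) (auto intro: measurable_compose[OF _ measurable_shift] simp: measurable_shift)
      then show ?thesis by (rule measurable_compose) (rule F)
    qed
    show ?thesis unfolding E.birkhoff_sum_def by measurable
  qed
  have "(\<integral>y. \<bar>E.birkhoff_sum F n y / real n - c\<bar> \<partial>path_law) = (\<integral>\<omega>. \<bar>(\<Sum>i<n. F (\<lambda>t. Y (t + int i) \<omega>)) / real n - c\<bar> \<partial>M)" for n c
    unfolding path_law_def by (subst integral_distr[OF measurable_path0 m]) (simp add: E.birkhoff_sum_def shift_funpow)
  then show ?thesis using E.birkhoff_L1[OF intF nonneg] by (simp add: EF)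
qed

section \<open>Empirical frequencies of the observed values\<close>

definition freq :: "nat \<Rightarrow> nat \<Rightarrow> 'a \<Rightarrow> real" where
  "freq T k \<omega> = (\<Sum>t\<in>{1..int T}. if Y t \<omega> = k then 1 else 0) / real T"

lemma measurable_freq [measurable]: "freq T k \<in> borel_measurable M"
  unfolding freq_def by measurable

lemma freq_nonneg: "freq T k \<omega> \<ge> 0"
  unfolding freq_def by (intro divide_nonneg_nonneg sum_nonneg) auto

lemma sum_int_interval: "(\<Sum>t\<in>{a + 1..a + int n}. f t) = (\<Sum>i<n. f (a + 1 + int i))"
  by (rule sum.reindex_bij_witness[where i = "\<lambda>i. a + 1 + int i" and j = "\<lambda>t. nat (t - a - 1)"]) auto

lemma freq_sums:
  fixes f :: "nat \<Rightarrow> real"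
  shows "(\<lambda>k. f k * freq T k \<omega>) sums ((\<Sum>t\<in>{1..int T}. f (Y t \<omega>)) / real T)"
proof -
  have "(\<lambda>k. \<Sum>t\<in>{1..int T}. if k = Y t \<omega> then f k else 0) sums (\<Sum>t\<in>{1..int T}. f (Y t \<omega>))"
    by (rule sums_sum) (rule sums_single)
  then have "(\<lambda>k. (\<Sum>t\<in>{1..int T}. if k = Y t \<omega> then f k else 0) / real T) sums ((\<Sum>t\<in>{1..int T}. f (Y t \<omega>)) / real T)"
    by (rule sums_divide)
  moreover have "(\<Sum>t\<in>{1..int T}. if k = Y t \<omega> then f k else 0) / real T = f k * freq T k \<omega>" for k
  proof -
    have "(\<Sum>t\<in>{1..int T}. if k = Y t \<omega> then f k else 0) = f k * (\<Sum>t\<in>{1..int T}. if Y t \<omega> = k then 1 else 0)"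
      unfolding sum_distrib_left by (rule sum.cong) auto
    then show ?thesis by (simp add: freq_def)
  qed
  ultimately show ?thesis by simp
qed

lemma integral_freq: "T > 0 \<Longrightarrow> (\<integral>\<omega>. freq T k \<omega> \<partial>M) = ymass k" and integrable_freq: "integrable M (freq T k)"
proof -
  have int: "integrable M (\<lambda>\<omega>. if Y t \<omega> = k then 1 else 0 :: real)" for t
    by (rule integrable_const_bound[of _ 1]) auto
  have E: "(\<integral>\<omega>. (if Y t \<omega> = k then 1 else 0 :: real) \<partial>M) = ymass k" for t
  proof -
    have "(\<integral>\<omega>. (if Y t \<omega> = k then 1 else 0 :: real) \<partial>M) = (\<integral>\<omega>. indicator {\<omega> \<in> space M. Y t \<omega> = k} \<omega> \<partial>M)"
      by (rule Bochner_Integration.integral_cong) (auto simp: indicator_def)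
    then show ?thesis by (simp add: prob_Y)
  qed
  show "T > 0 \<Longrightarrow> (\<integral>\<omega>. freq T k \<omega> \<partial>M) = ymass k" "integrable M (freq T k)"
    unfolding freq_def using int by (auto simp: E)
qed

lemma freq_L1: "(\<lambda>T. \<integral>\<omega>. \<bar>freq T k \<omega> - ymass k\<bar> \<partial>M) \<longlonglongrightarrow> 0"
proof -
  let ?F = "\<lambda>y :: int \<Rightarrow> nat. if y 1 = k then 1 else 0 :: real"
  have "(\<lambda>n. \<integral>\<omega>. \<bar>(\<Sum>i<n. ?F (\<lambda>t. Y (t + int i) \<omega>)) / real n - (\<integral>\<omega>. ?F (\<lambda>t. Y t \<omega>) \<partial>M)\<bar> \<partial>M) \<longlonglongrightarrow> 0"
  proof (rule ergodic_L1)
    show "?F \<in> borel_measurable path_space" by (rule measurable_compose[OF measurable_coordinate]) simp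
    show "integrable M (\<lambda>\<omega>. ?F (\<lambda>t. Y t \<omega>))" by (rule integrable_const_bound[of _ 1]) auto
  qed auto
  moreover have "(\<Sum>i<n. ?F (\<lambda>t. Y (t + int i) \<omega>)) / real n = freq n k \<omega>" for n \<omega>
    unfolding freq_def using sum_int_interval[of "\<lambda>t. if Y t \<omega> = k then 1 else 0 :: real" 0 n] by simp
  moreover have "(\<integral>\<omega>. ?F (\<lambda>t. Y t \<omega>) \<partial>M) = ymass k"
  proof -
    have "(\<integral>\<omega>. ?F (\<lambda>t. Y t \<omega>) \<partial>M) = (\<integral>\<omega>. indicator {\<omega> \<in> space M. Y 1 \<omega> = k} \<omega> \<partial>M)"
      by (rule Bochner_Integration.integral_cong) (auto simp: indicator_def)
    then show ?thesis by (simp add: ymass_def)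
  qed
  ultimately show ?thesis by simp
qed

text \<open>A weighted total variation distance between empirical and stationary law. The weight
  \<open>k + 1\<close> majorises \<open>x ^ k\<close> and \<open>k * x ^ (k - 1)\<close> on the unit
  interval, so this one variable controls the empirical generating function and its derivative for
  all \<open>x\<close> at once.\<close>

definition freq_dev :: "nat \<Rightarrow> 'a \<Rightarrow> real" where
  "freq_dev T \<omega> = (\<Sum>k. (real k + 1) * \<bar>freq T k \<omega> - ymass k\<bar>)"

lemma summable_weighted_ymass: "summable (\<lambda>k. (real k + 1) * ymass k)"
proof -
  have "integrable M (\<lambda>\<omega>. real (Y 1 \<omega>))"
    using integrable_Y_square[of 1] by (rule square_integrable_imp_integrable[rotated]) measurable
  then have "(\<lambda>k. (real k + 1) * ymass k) sums (\<integral>\<omega>. real (Y 1 \<omega>) + 1 \<partial>M)"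
    by (intro ymass_sums) auto
  then show ?thesis by (simp add: sums_iff)
qed

lemma summable_freq_dev: "summable (\<lambda>k. (real k + 1) * \<bar>freq T k \<omega> - ymass k\<bar>)"
proof (rule summable_comparison_test')
  show "summable (\<lambda>k. (real k + 1) * freq T k \<omega> + (real k + 1) * ymass k)"
    by (intro summable_add summable_weighted_ymass sums_summable[OF freq_sums])
  fix k
  have "\<bar>freq T k \<omega> - ymass k\<bar> \<le> freq T k \<omega> + ymass k"
    using freq_nonneg[of T k \<omega>] ymass_nonneg[of k] by simp
  then have "(real k + 1) * \<bar>freq T k \<omega> - ymass k\<bar> \<le> (real k + 1) * (freq T k \<omega> + ymass k)"
    by (intro mult_left_mono) auto
  then show "norm ((real k + 1) * \<bar>freq T k \<omega> - ymass k\<bar>) \<le> (real k + 1) * freq T k \<omega> + (real k + 1) * ymass k"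
    by (simp add: abs_mult distrib_left)
qed

lemma measurable_freq_dev [measurable]: "freq_dev T \<in> borel_measurable M"
  unfolding freq_dev_def by measurable

lemma freq_dev_nonneg: "freq_dev T \<omega> \<ge> 0"
  unfolding freq_dev_def by (intro suminf_nonneg summable_freq_dev) auto

text \<open>Tannery's theorem: each summand tends to zero in mean by the ergodic theorem, and its
  mean is at most \<open>2 * ((k + 1) * ymass k)\<close> because the frequencies have mean
  \<open>ymass k\<close>. At \<open>T = 0\<close> division by zero makes the frequencies 0, so this
  mean is wrong there; hence the restriction to \<open>T > 0\<close>.\<close>

lemma freq_dev_L1: 
  shows "(\<lambda>T. \<integral>\<omega>. freq_dev T \<omega> \<partial>M) \<longlonglongrightarrow> 0" and integrable_freq_dev: "T > 0 \<Longrightarrow> integrable M (freq_dev T)"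
proof -
  let ?e = "\<lambda>T k. \<integral>\<omega>. (real k + 1) * \<bar>freq T k \<omega> - ymass k\<bar> \<partial>M"
  have int: "integrable M (\<lambda>\<omega>. (real k + 1) * \<bar>freq T k \<omega> - ymass k\<bar>)" for T k
    by (intro integrable_mult_right integrable_abs Bochner_Integration.integrable_diff integrable_freq integrable_const)
  have e_le: "?e T k \<le> 2 * ((real k + 1) * ymass k)" if "T > 0" for T k
  proof -
    have "(\<integral>\<omega>. \<bar>freq T k \<omega> - ymass k\<bar> \<partial>M) \<le> (\<integral>\<omega>. freq T k \<omega> + ymass k \<partial>M)"
    proof (rule integral_mono)
      fix \<omega> show "\<bar>freq T k \<omega> - ymass k\<bar> \<le> freq T k \<omega> + ymass k"
        using freq_nonneg[of T k \<omega>] ymass_nonneg[of k] by simp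
    qed (intro integrable_abs Bochner_Integration.integrable_add Bochner_Integration.integrable_diff integrable_freq integrable_const)+
    also have "\<dots> = (\<integral>\<omega>. freq T k \<omega> \<partial>M) + (\<integral>\<omega>. ymass k \<partial>M)"
      by (intro Bochner_Integration.integral_add integrable_freq integrable_const)
    also have "\<dots> = 2 * ymass k" by (simp add: integral_freq[OF that] prob_space)
    finally have "(real k + 1) * (\<integral>\<omega>. \<bar>freq T k \<omega> - ymass k\<bar> \<partial>M) \<le> (real k + 1) * (2 * ymass k)"
      by (rule mult_left_mono) simp
    then show ?thesis by simp
  qed
  have e_nonneg: "?e T k \<ge> 0" for T k by simp
  have es: "summable (\<lambda>k. ?e T k)" if "T > 0" for T
    by (rule summable_comparison_test'[OF summable_mult[OF summable_weighted_ymass, of 2]])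
       (use e_le[OF that] e_nonneg in \<open>simp del: integral_mult_right_zero Bochner_Integration.integral_mult_right\<close>)
  have si: "(\<lambda>k. ?e T k) sums (\<integral>\<omega>. freq_dev T \<omega> \<partial>M) \<and> integrable M (freq_dev T)" if "T > 0" for T
    unfolding freq_dev_def
  proof
    have a: "AE \<omega> in M. summable (\<lambda>k. norm ((real k + 1) * \<bar>freq T k \<omega> - ymass k\<bar>))"
      using summable_freq_dev by (simp add: abs_mult)
    have b: "summable (\<lambda>k. \<integral>\<omega>. norm ((real k + 1) * \<bar>freq T k \<omega> - ymass k\<bar>) \<partial>M)"
      using es[OF that] by (simp add: abs_mult)
    show "(\<lambda>k. ?e T k) sums (\<integral>\<omega>. (\<Sum>k. (real k + 1) * \<bar>freq T k \<omega> - ymass k\<bar>) \<partial>M)"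
      by (rule sums_integral[OF int a b])
    show "integrable M (\<lambda>\<omega>. \<Sum>k. (real k + 1) * \<bar>freq T k \<omega> - ymass k\<bar>)"
      by (rule integrable_suminf[OF int a b])
  qed
  then show "T > 0 \<Longrightarrow> integrable M (freq_dev T)" by blast
  have "(\<lambda>T. suminf (\<lambda>k. ?e T k)) \<longlonglongrightarrow> suminf (\<lambda>k. 0 :: real)"
  proof (rule tannerys_theorem[THEN conjunct2, THEN conjunct2])
    show "summable (\<lambda>k. 2 * ((real k + 1) * ymass k))" by (intro summable_mult summable_weighted_ymass)
    show "(\<lambda>T. ?e T k) \<longlonglongrightarrow> 0" for k using tendsto_mult_right_zero[OF freq_L1[of k], of "real k + 1"] by simp
    show "\<forall>\<^sub>F (k, T) in at_top \<times>\<^sub>F sequentially. norm (?e T k) \<le> 2 * ((real k + 1) * ymass k)"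
      unfolding eventually_prod_filter
    proof (intro exI conjI allI impI)
      show "\<forall>\<^sub>F k in at_top. True" "\<forall>\<^sub>F T in sequentially. T > (0::nat)" by (auto intro: eventually_gt_at_top)
      fix k T :: nat assume "T > 0"
      from e_le[OF this, of k] e_nonneg[of k T]
      show "case (k, T) of (k, T) \<Rightarrow> norm (?e T k) \<le> 2 * ((real k + 1) * ymass k)"
        by (simp only: case_prod_conv real_norm_def abs_of_nonneg)
    qed
  qed simp
  then have "(\<lambda>T. suminf (\<lambda>k. ?e T k)) \<longlonglongrightarrow> 0" by simp
  moreover have "\<forall>\<^sub>F T in sequentially. suminf (\<lambda>k. ?e T k) = (\<integral>\<omega>. freq_dev T \<omega> \<partial>M)"
    using eventually_gt_at_top[of 0] by eventually_elim (use si in \<open>simp only: sums_iff\<close>)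
  ultimately show "(\<lambda>T. \<integral>\<omega>. freq_dev T \<omega> \<partial>M) \<longlonglongrightarrow> 0" by (rule Lim_transform_eventually)
qed

end

section \<open>The martingale difference sequence and its normalised sums\<close>

locale inar_mds = inar +
  fixes \<theta> :: real and q :: nat and l1 l2 :: "nat list \<Rightarrow> real \<times> real \<Rightarrow> real"
  assumes q: "1 \<le> q"
    and mds: "\<And>l. l \<in> {l1, l2} \<Longrightarrow> martingale_difference M (past M Y) (int q + 1) (\<lambda>t \<omega>. l (lags Y q t \<omega>) (p, \<theta>))"
    and sq_l: "\<And>l t. l \<in> {l1, l2} \<Longrightarrow> t \<ge> int q + 1 \<Longrightarrow> integrable M (\<lambda>\<omega>. (l (lags Y q t \<omega>) (p, \<theta>))\<^sup>2)"
begin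

text \<open>Coordinates \<open>0\<close> and \<open>1\<close> carry the two components of the estimator's expansion, coordinate
  \<open>k + 2\<close> the centred indicator of \<open>Y t = k\<close>.\<close>

definition xi :: "nat \<Rightarrow> nat list \<Rightarrow> real" where
  "xi j xs = (if j = 0 then l1 xs (p, \<theta>) else if j = 1 then l2 xs (p, \<theta>)
     else (if xs ! 0 = j - 2 then 1 else 0) - kappa (xs ! 1) (j - 2))"

definition X :: "int \<Rightarrow> nat \<Rightarrow> 'a \<Rightarrow> real" where "X t j \<omega> = xi j (lags Y q t \<omega>)"

lemma X_simps: "X t 0 \<omega> = l1 (lags Y q t \<omega>) (p, \<theta>)" "X t (Suc 0) \<omega> = l2 (lags Y q t \<omega>) (p, \<theta>)"
  "X t (Suc (Suc k)) \<omega> = innov t k \<omega>"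
proof -
  have "lags Y q t \<omega> ! 0 = Y t \<omega>" "lags Y q t \<omega> ! 1 = Y (t - 1) \<omega>"
    using q unfolding lags_def by (subst nth_map; simp del: upt_Suc)+
  then show "X t 0 \<omega> = l1 (lags Y q t \<omega>) (p, \<theta>)" "X t (Suc 0) \<omega> = l2 (lags Y q t \<omega>) (p, \<theta>)"
    "X t (Suc (Suc k)) \<omega> = innov t k \<omega>"
    by (simp_all add: X_def xi_def innov_def)
qed

lemma measurable_lags_past: "lags Y q t \<in> measurable (past M Y t) (count_space UNIV)"
  unfolding lags_def by (rule measurable_map_list) (rule measurable_Y_past, simp)

lemma measurable_X_past: "X t j \<in> borel_measurable (past M Y t)"
  unfolding X_def by (rule measurable_compose[OF measurable_lags_past]) simp

lemma measurable_X [measurable]: "X t j \<in> borel_measurable M"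
  by (rule measurable_past_imp[OF measurable_X_past])

lemma sq_int_X: "t \<ge> int q + 1 \<Longrightarrow> sq_int M (X t j)"
proof -
  assume t: "t \<ge> int q + 1"
  consider "j = 0" | "j = Suc 0" | k where "j = Suc (Suc k)" by (metis not0_implies_Suc)
  then have "integrable M (\<lambda>\<omega>. (X t j \<omega>)\<^sup>2)"
  proof cases
    case 3
    then show ?thesis
      by (intro integrable_const_bound[of _ 1]) (use innov_bounded in \<open>auto simp: X_simps abs_square_le_1\<close>)
  qed (use sq_l t in \<open>auto simp: X_simps\<close>)
  then show ?thesis by (simp add: sq_int_def)
qed

lemma X_orthogonal:
  assumes t: "t \<ge> int q + 1" and h: "h \<in> borel_measurable (past M Y (t - 1))" "sq_int M h"
  shows "(\<integral>\<omega>. h \<omega> * X t j \<omega> \<partial>M) = 0"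
proof -
  have int: "integrable M (\<lambda>\<omega>. h \<omega> * X t j \<omega>)" using sq_int_mult[OF h(2) sq_int_X[OF t]] .
  have l: "(\<integral>\<omega>. h \<omega> * X t j \<omega> \<partial>M) = 0" if "l \<in> {l1, l2}" "X t j = (\<lambda>\<omega>. l (lags Y q t \<omega>) (p, \<theta>))" for l
    by (rule cond_exp_zero_integral[OF _ h(1) measurable_X int])
       (use mds[OF that(1)] t in \<open>auto simp: martingale_difference_def that(2)\<close>)
  consider "j = 0" | "j = Suc 0" | k where "j = Suc (Suc k)" by (metis not0_implies_Suc)
  then show ?thesis
  proof cases
    case 1 then show ?thesis by (intro l[of l1]) (auto simp: X_simps fun_eq_iff)
  next
    case 2 then show ?thesis by (intro l[of l2]) (auto simp: X_simps fun_eq_iff)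
  next
    case 3
    then show ?thesis
      using innov_orthogonal[OF h(1) sq_int_imp_integrable[OF prob_space_axioms h(2)]] by (simp add: X_simps)
  qed
qed

text \<open>\<open>lags\<close> as a function of the path alone, so that stationarity and the
  ergodic theorem, which concern the path law, apply to it.\<close>

definition lag_path :: "int \<Rightarrow> (int \<Rightarrow> nat) \<Rightarrow> nat list" where
  "lag_path t y = map (\<lambda>k. y (t - int k)) [0..<Suc q]"

lemma measurable_lag_path [measurable]: "lag_path t \<in> measurable path_space (count_space UNIV)"
  unfolding lag_path_def by (rule measurable_map_list) (rule measurable_coordinate)

lemma lags_lag_path: "lags Y q (t + h) \<omega> = lag_path t (\<lambda>s. Y (s + h) \<omega>)"
  by (simp add: lags_def lag_path_def algebra_simps del: upt_Suc)

text \<open>Finite combinations reduce the vector limit theorem to the real one. Index 0 is time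
  \<open>q + 1\<close>, the first time at which all lags belong to the sample.\<close>

definition comb :: "(nat \<Rightarrow> real) \<Rightarrow> nat \<Rightarrow> nat \<Rightarrow> 'a \<Rightarrow> real" where
  "comb s m n \<omega> = (\<Sum>j<m. s j * X (int q + 1 + int n) j \<omega>)"

definition xcomb :: "(nat \<Rightarrow> real) \<Rightarrow> nat \<Rightarrow> nat list \<Rightarrow> real" where
  "xcomb s m xs = (\<Sum>j<m. s j * xi j xs)"

lemma comb_xcomb: "comb s m n \<omega> = xcomb s m (lag_path (int q + 1) (\<lambda>t. Y (t + int n) \<omega>))"
  unfolding comb_def xcomb_def X_def lags_lag_path ..

lemma sq_int_comb: "sq_int M (comb s m n)"
  unfolding comb_def by (intro sq_int_sum sq_int_cmult sq_int_X) simp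

lemma measurable_comb [measurable]: "comb s m n \<in> borel_measurable M"
  using sq_int_comb by (simp add: sq_int_def)

lemma comb_orthogonal:
  assumes h: "h \<in> borel_measurable (past M Y (int q + int n))" "sq_int M h"
  shows "(\<integral>\<omega>. h \<omega> * comb s m n \<omega> \<partial>M) = 0"
proof -
  have "(\<integral>\<omega>. h \<omega> * comb s m n \<omega> \<partial>M) = (\<integral>\<omega>. (\<Sum>j<m. s j * (h \<omega> * X (int q + 1 + int n) j \<omega>)) \<partial>M)"
    by (simp add: comb_def sum_distrib_left mult_ac)
  also have "\<dots> = (\<Sum>j<m. s j * (\<integral>\<omega>. h \<omega> * X (int q + 1 + int n) j \<omega> \<partial>M))"
    using sq_int_mult[OF h(2) sq_int_X] by simp
  also have "\<dots> = 0"
    using h by (intro sum.neutral ballI) (subst X_orthogonal, auto)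
  finally show ?thesis .
qed

lemma measurable_comb_past: "n < k \<Longrightarrow> comb s m n \<in> borel_measurable (past M Y (int q + int k))"
  unfolding comb_def by (intro borel_measurable_sum borel_measurable_times borel_measurable_const measurable_past_mono[OF _ measurable_X_past]) simp

lemma stationary_martingale_difference_comb:
  "stationary_martingale_difference M (comb s m) (\<integral>\<omega>. (comb s m 0 \<omega>)\<^sup>2 \<partial>M)"
proof
  show "comb s m t \<in> borel_measurable M" for t by simp
  show "integrable M (\<lambda>\<omega>. (comb s m 0 \<omega>)\<^sup>2)" using sq_int_comb by (simp add: sq_int_def)
  show "distr M borel (\<lambda>\<omega> n. comb s m (t + n) \<omega>) = distr M borel (\<lambda>\<omega> n. comb s m n \<omega>)" for t
  proof -
    define \<Psi> where "\<Psi> = (\<lambda>(y :: int \<Rightarrow> nat) (n :: nat). xcomb s m (lag_path (int q + 1 + int n) y))"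
    have \<Psi>: "\<Psi> \<in> measurable path_space borel"
      unfolding \<Psi>_def by (rule measurable_coordinatewise_then_product) simp
    have *: "(\<lambda>\<omega> n. comb s m (t + n) \<omega>) = \<Psi> \<circ> (\<lambda>\<omega> r. Y (r + int t) \<omega>)" for t
      by (simp add: fun_eq_iff \<Psi>_def comb_xcomb lag_path_def algebra_simps del: upt_Suc)
    have "distr M path_space (\<lambda>\<omega> r. Y (r + int t) \<omega>) = distr M path_space (\<lambda>\<omega> r. Y (r + int 0) \<omega>)"
      using stationary by (simp add: strictly_stationary_def)
    then have "distr M borel (\<lambda>\<omega> n. comb s m (t + n) \<omega>) = distr M borel (\<lambda>\<omega> n. comb s m (0 + n) \<omega>)"
      unfolding * distr_distr[OF \<Psi> measurable_path, symmetric] by simp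
    then show ?thesis by simp
  qed
  show "(\<integral>\<omega>. iexp (c * (\<Sum>s'<t. comb s m s' \<omega>)) * of_real (comb s m t \<omega>) \<partial>M) = 0" for t c
  proof -
    \<comment> \<open>Orthogonality is available for real test functions, so the exponential is
      split into cosine and sine, each a bounded function of the past.\<close>
    have meas: "(\<lambda>\<omega>. c * (\<Sum>s'<t. comb s m s' \<omega>)) \<in> borel_measurable (past M Y (int q + int t))"
      by (intro borel_measurable_sum borel_measurable_times borel_measurable_const measurable_comb_past) simp
    have measc: "(\<lambda>\<omega>. cos (c * (\<Sum>s'<t. comb s m s' \<omega>))) \<in> borel_measurable (past M Y (int q + int t))"
      and meass: "(\<lambda>\<omega>. sin (c * (\<Sum>s'<t. comb s m s' \<omega>))) \<in> borel_measurable (past M Y (int q + int t))"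
    proof -
      have m: "(cos :: real \<Rightarrow> real) \<in> borel_measurable borel" "(sin :: real \<Rightarrow> real) \<in> borel_measurable borel" by measurable
      show "(\<lambda>\<omega>. cos (c * (\<Sum>s'<t. comb s m s' \<omega>))) \<in> borel_measurable (past M Y (int q + int t))"
        "(\<lambda>\<omega>. sin (c * (\<Sum>s'<t. comb s m s' \<omega>))) \<in> borel_measurable (past M Y (int q + int t))"
        by (rule measurable_compose[OF meas m(1)]) (rule measurable_compose[OF meas m(2)])
    qed
    have sqc: "sq_int M (\<lambda>\<omega>. cos (c * (\<Sum>s'<t. comb s m s' \<omega>)))" and sqs: "sq_int M (\<lambda>\<omega>. sin (c * (\<Sum>s'<t. comb s m s' \<omega>)))"
      unfolding sq_int_def by (auto intro!: integrable_const_bound[of _ 1] simp: abs_square_le_1)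
    note ic = sq_int_mult[OF sqc sq_int_comb[of s m t]] and is' = sq_int_mult[OF sqs sq_int_comb[of s m t]]
    have "(\<integral>\<omega>. iexp (c * (\<Sum>s'<t. comb s m s' \<omega>)) * of_real (comb s m t \<omega>) \<partial>M)
      = (\<integral>\<omega>. of_real (cos (c * (\<Sum>s'<t. comb s m s' \<omega>)) * comb s m t \<omega>) + \<i> * of_real (sin (c * (\<Sum>s'<t. comb s m s' \<omega>)) * comb s m t \<omega>) \<partial>M)"
      by (rule Bochner_Integration.integral_cong[OF refl]) (simp only: cis_conv_exp[symmetric] complex_eq_iff, simp)
    also have "\<dots> = of_real (\<integral>\<omega>. cos (c * (\<Sum>s'<t. comb s m s' \<omega>)) * comb s m t \<omega> \<partial>M) + \<i> * of_real (\<integral>\<omega>. sin (c * (\<Sum>s'<t. comb s m s' \<omega>)) * comb s m t \<omega> \<partial>M)"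
      using ic is' by (subst Bochner_Integration.integral_add) (auto simp del: of_real_mult)
    also have "\<dots> = 0"
      by (simp only: comb_orthogonal[OF measc sqc] comb_orthogonal[OF meass sqs]) simp
    finally show ?thesis .
  qed
  let ?F = "\<lambda>y. (xcomb s m (lag_path (int q + 1) y))\<^sup>2"
  have F: "?F (\<lambda>t. Y (t + int i) \<omega>) = (comb s m i \<omega>)\<^sup>2" for i \<omega> by (simp add: comb_xcomb)
  have F0: "?F (\<lambda>t. Y t \<omega>) = (comb s m 0 \<omega>)\<^sup>2" for \<omega> by (simp add: comb_xcomb)
  have "(\<lambda>n. \<integral>\<omega>. \<bar>(\<Sum>i<n. ?F (\<lambda>t. Y (t + int i) \<omega>)) / real n - (\<integral>\<omega>. ?F (\<lambda>t. Y t \<omega>) \<partial>M)\<bar> \<partial>M) \<longlonglongrightarrow> 0"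
    by (rule ergodic_L1) (use sq_int_comb[of s m 0] in \<open>auto simp: F0 sq_int_def\<close>)
  then show "(\<lambda>n. \<integral>\<omega>. \<bar>(\<Sum>j<n. (comb s m j \<omega>)\<^sup>2) / real n - (\<integral>\<omega>. (comb s m 0 \<omega>)\<^sup>2 \<partial>M)\<bar> \<partial>M) \<longlonglongrightarrow> 0"
    by (simp only: F F0)
qed simp

definition V :: "nat \<Rightarrow> 'a \<Rightarrow> nat \<Rightarrow> real" where
  "V T \<omega> j = 1 / sqrt (real T) * (\<Sum>t\<in>{int q + 1..int T}. X t j \<omega>)"

lemma interval_sum: "(\<Sum>t\<in>{int q + 1..int T}. f t) = (\<Sum>n<T - q. f (int q + 1 + int n))"
proof (cases "q \<le> T")
  case True
  then have *: "int T = int q + int (T - q)" by simp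
  show ?thesis by (subst *) (rule sum_int_interval)
qed simp

lemma V_comb: "(\<Sum>j<m. s j * V T \<omega> j) = 1 / sqrt (real T) * (\<Sum>n<T - q. comb s m n \<omega>)"
proof -
  have "(\<Sum>j<m. s j * V T \<omega> j) = (\<Sum>j<m. \<Sum>n<T - q. 1 / sqrt (real T) * (s j * X (int q + 1 + int n) j \<omega>))"
    by (simp add: V_def interval_sum sum_distrib_left mult_ac)
  also have "\<dots> = (\<Sum>n<T - q. \<Sum>j<m. 1 / sqrt (real T) * (s j * X (int q + 1 + int n) j \<omega>))"
    by (rule sum.swap)
  also have "\<dots> = 1 / sqrt (real T) * (\<Sum>n<T - q. comb s m n \<omega>)"
    by (simp add: comb_def sum_distrib_left)
  finally show ?thesis .
qed

lemma measurable_V [measurable]: "(\<lambda>\<omega>. V T \<omega> j) \<in> borel_measurable M"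
  unfolding V_def by (intro borel_measurable_times borel_measurable_const borel_measurable_sum measurable_X)

lemma comb_char_tendsto:
  "(\<lambda>T. (\<integral>\<omega>. iexp (1 / sqrt (real T) * (\<Sum>n<T - q. comb s m n \<omega>)) \<partial>M)
      - of_real (exp (- (real (T - q) / real T) * (\<integral>\<omega>. (comb s m 0 \<omega>)\<^sup>2 \<partial>M) / 2))) \<longlonglongrightarrow> 0"
  by (rule stationary_martingale_difference.central_limit[OF stationary_martingale_difference_comb]) simp

lemma sample_fraction_tendsto: "(\<lambda>T. real (T - q) / real T) \<longlonglongrightarrow> 1"
proof -
  have "(\<lambda>T. 1 - real q / real T) \<longlonglongrightarrow> 1 - 0" by (intro tendsto_intros lim_const_over_n)
  moreover have "\<forall>\<^sub>F T in sequentially. 1 - real q / real T = real (T - q) / real T"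
    using eventually_ge_at_top[of "Suc q"] by eventually_elim (simp add: of_nat_diff field_simps)
  ultimately show ?thesis by (simp add: Lim_transform_eventually)
qed

theorem V_char_tendsto:
  "(\<lambda>T. \<integral>\<omega>. iexp (\<Sum>j<m. s j * V T \<omega> j) \<partial>M) \<longlonglongrightarrow> of_real (exp (- (\<integral>\<omega>. (\<Sum>j<m. s j * X (int q + 1) j \<omega>)\<^sup>2 \<partial>M) / 2))"
proof -
  define v where "v = (\<integral>\<omega>. (comb s m 0 \<omega>)\<^sup>2 \<partial>M)"
  have v: "(\<integral>\<omega>. (\<Sum>j<m. s j * X (int q + 1) j \<omega>)\<^sup>2 \<partial>M) = v"
    unfolding v_def comb_def of_nat_0 add_0_right ..
  have "(\<lambda>T. complex_of_real (exp (- (real (T - q) / real T) * v / 2))) \<longlonglongrightarrow> of_real (exp (- 1 * v / 2))"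
    by (intro tendsto_intros sample_fraction_tendsto) auto
  from tendsto_add[OF comb_char_tendsto[of s m, folded v_def] this]
  show ?thesis unfolding V_comb v diff_add_cancel by (simp only: add_0 mult_minus1)
qed

lemma partial_sum_second_moment_step:
  "(\<integral>\<omega>. (\<Sum>n<Suc N. comb s m n \<omega>)\<^sup>2 \<partial>M) = (\<integral>\<omega>. (\<Sum>n<N. comb s m n \<omega>)\<^sup>2 \<partial>M) + (\<integral>\<omega>. (comb s m N \<omega>)\<^sup>2 \<partial>M)"
proof -
  let ?S = "\<lambda>\<omega>. \<Sum>n<N. comb s m n \<omega>" and ?d = "comb s m N"
  have sqS: "sq_int M ?S" by (rule sq_int_sum) (rule sq_int_comb)
  have orth: "(\<integral>\<omega>. ?S \<omega> * ?d \<omega> \<partial>M) = 0"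
    by (rule comb_orthogonal[OF _ sqS]) (intro borel_measurable_sum measurable_comb_past, simp)
  have i1: "integrable M (\<lambda>\<omega>. (?S \<omega>)\<^sup>2)" and i2: "integrable M (\<lambda>\<omega>. (?d \<omega>)\<^sup>2)"
    using sqS sq_int_comb[of s m N] unfolding sq_int_def by blast+
  have i3: "integrable M (\<lambda>\<omega>. ?S \<omega> * ?d \<omega>)" by (rule sq_int_mult[OF sqS sq_int_comb])
  have "(\<lambda>\<omega>. (\<Sum>n<Suc N. comb s m n \<omega>)\<^sup>2) = (\<lambda>\<omega>. ((?S \<omega>)\<^sup>2 + (?d \<omega>)\<^sup>2) + 2 * (?S \<omega> * ?d \<omega>))"
    unfolding sum.lessThan_Suc power2_sum by (simp add: algebra_simps)
  then have "(\<integral>\<omega>. (\<Sum>n<Suc N. comb s m n \<omega>)\<^sup>2 \<partial>M) = (\<integral>\<omega>. ((?S \<omega>)\<^sup>2 + (?d \<omega>)\<^sup>2) + 2 * (?S \<omega> * ?d \<omega>) \<partial>M)"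
    by (rule arg_cong)
  also have "\<dots> = (\<integral>\<omega>. (?S \<omega>)\<^sup>2 + (?d \<omega>)\<^sup>2 \<partial>M) + (\<integral>\<omega>. 2 * (?S \<omega> * ?d \<omega>) \<partial>M)"
    by (intro Bochner_Integration.integral_add Bochner_Integration.integrable_add integrable_mult_right i1 i2 i3)
  also have "(\<integral>\<omega>. 2 * (?S \<omega> * ?d \<omega>) \<partial>M) = 0" unfolding integral_mult_right_zero orth by (rule mult_zero_right)
  also have "(\<integral>\<omega>. (?S \<omega>)\<^sup>2 + (?d \<omega>)\<^sup>2 \<partial>M) = (\<integral>\<omega>. (?S \<omega>)\<^sup>2 \<partial>M) + (\<integral>\<omega>. (?d \<omega>)\<^sup>2 \<partial>M)"
    by (rule Bochner_Integration.integral_add[OF i1 i2])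
  finally show ?thesis by (simp only: add_0_right)
qed

lemma comb_second_moment: "(\<integral>\<omega>. (comb s m n \<omega>)\<^sup>2 \<partial>M) = (\<integral>\<omega>. (comb s m 0 \<omega>)\<^sup>2 \<partial>M)"
proof -
  have m: "(\<lambda>z :: nat \<Rightarrow> real. (z 0)\<^sup>2) \<in> borel_measurable borel" by simp
  show ?thesis
    using stationary_martingale_difference.shift_integral[OF stationary_martingale_difference_comb m, of s m n]
    by (simp only: add_0_right)
qed

lemma partial_sum_second_moment:
  "(\<integral>\<omega>. (\<Sum>n<N. comb s m n \<omega>)\<^sup>2 \<partial>M) = real N * (\<integral>\<omega>. (comb s m 0 \<omega>)\<^sup>2 \<partial>M)"
proof (induction N)
  case (Suc N)
  then show ?case
    unfolding partial_sum_second_moment_step comb_second_moment[of s m N]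
    by (simp only: of_nat_Suc distrib_right mult_1_left add.commute)
qed simp

definition cc :: "nat \<Rightarrow> real" where "cc j = sqrt (\<integral>\<omega>. (X (int q + 1) j \<omega>)\<^sup>2 \<partial>M)"

lemma cc_nonneg: "cc j \<ge> 0" by (simp add: cc_def)

text \<open>Orthogonal increments give \<open>T - q\<close> equal contributions, and the
  normalisation by \<open>T\<close> leaves a factor of at most 1. The bound is uniform in
  \<open>T\<close>, as the truncation argument requires.\<close>

lemma V_second_moment: "integrable M (\<lambda>\<omega>. (V T \<omega> j)\<^sup>2)" "(\<integral>\<omega>. (V T \<omega> j)\<^sup>2 \<partial>M) \<le> (cc j)\<^sup>2"
proof -
  let ?s = "\<lambda>i. if i = j then 1 else 0 :: real"
  have V: "V T \<omega> j = 1 / sqrt (real T) * (\<Sum>n<T - q. comb ?s (Suc j) n \<omega>)" for \<omega>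
    using V_comb[of ?s T \<omega> "Suc j"] by (simp add: if_distrib[of "\<lambda>z. z * _"] cong: if_cong)
  have c0: "comb ?s (Suc j) 0 \<omega> = X (int q + 1) j \<omega>" for \<omega>
    by (simp add: comb_def if_distrib[of "\<lambda>z. z * _"] cong: if_cong)
  have "sq_int M (\<lambda>\<omega>. V T \<omega> j)" unfolding V by (intro sq_int_cmult sq_int_sum sq_int_comb)
  then show "integrable M (\<lambda>\<omega>. (V T \<omega> j)\<^sup>2)" by (simp add: sq_int_def)
  have "(\<integral>\<omega>. (V T \<omega> j)\<^sup>2 \<partial>M) = (1 / sqrt (real T))\<^sup>2 * (\<integral>\<omega>. (\<Sum>n<T - q. comb ?s (Suc j) n \<omega>)\<^sup>2 \<partial>M)"
    unfolding V power_mult_distrib by simp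
  also have "\<dots> = (real (T - q) / real T) * (cc j)\<^sup>2"
    unfolding partial_sum_second_moment c0 by (simp add: cc_def power_divide)
  also have "\<dots> \<le> 1 * (cc j)\<^sup>2"
    by (intro mult_right_mono) (auto simp: divide_le_eq)
  finally show "(\<integral>\<omega>. (V T \<omega> j)\<^sup>2 \<partial>M) \<le> (cc j)\<^sup>2" by simp
qed

lemma summable_cc: "summable cc"
proof -
  have "summable (\<lambda>k. cc (Suc (Suc k)))"
  proof (rule summable_comparison_test'[OF summable_mult[OF summable_sqrt_ymass, of "sqrt 2"]])
    fix k
    have "cc (Suc (Suc k)) \<le> sqrt (2 * ymass k)"
      unfolding cc_def X_simps by (rule real_sqrt_le_mono) (rule innov_abs_moment)
    then show "norm (cc (Suc (Suc k))) \<le> sqrt 2 * sqrt (ymass k)"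
      using cc_nonneg by (simp add: real_sqrt_mult)
  qed
  then show ?thesis using summable_Suc_iff[of cc] summable_Suc_iff[of "\<lambda>j. cc (Suc j)"] by simp
qed

text \<open>Each centred indicator is dominated by the sum of two probability mass functions.
  Summability thus holds at every point, and no exceptional null set has to be carried
  along.\<close>

lemma summable_innov: "summable (\<lambda>k. \<bar>innov t k \<omega>\<bar>)"
proof (rule summable_comparison_test')
  show "summable (\<lambda>k. (if k = Y t \<omega> then 1 else 0) + kappa (Y (t - 1) \<omega>) k)"
    by (intro summable_add sums_summable[OF kappa_sums_1] sums_summable[OF sums_single[of _ "\<lambda>_. 1"]])
  show "norm \<bar>innov t k \<omega>\<bar> \<le> (if k = Y t \<omega> then 1 else 0) + kappa (Y (t - 1) \<omega>) k" for k
    using kappa_nonneg[of "Y (t - 1) \<omega>" k] by (auto simp: innov_def)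
qed

lemma summable_X: "summable (\<lambda>j. \<bar>X t j \<omega>\<bar>)"
proof -
  have "summable (\<lambda>k. \<bar>X t (Suc (Suc k)) \<omega>\<bar>)" unfolding X_simps by (rule summable_innov)
  then show ?thesis using summable_Suc_iff[of "\<lambda>j. \<bar>X t j \<omega>\<bar>"] summable_Suc_iff[of "\<lambda>j. \<bar>X t (Suc j) \<omega>\<bar>"] by simp
qed

lemma summable_V: "summable (\<lambda>j. \<bar>V T \<omega> j\<bar>)"
proof (rule summable_comparison_test')
  show "summable (\<lambda>j. 1 / sqrt (real T) * (\<Sum>t\<in>{int q + 1..int T}. \<bar>X t j \<omega>\<bar>))"
    by (intro summable_mult summable_sum summable_X)
  show "norm \<bar>V T \<omega> j\<bar> \<le> 1 / sqrt (real T) * (\<Sum>t\<in>{int q + 1..int T}. \<bar>X t j \<omega>\<bar>)" for j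
    unfolding V_def abs_mult by (auto intro!: divide_right_mono sum_abs)
qed

end

section \<open>Convergence and boundedness in probability\<close>

text \<open>The sample is measurable into a discrete space, on which every function is measurable.
  Statistics defined by integrals over \<open>u\<close> thus need only be shown to depend on the
  sample alone, without joint measurability.\<close>

lemma measurable_factor:
  assumes f: "f \<in> measurable M (count_space UNIV)" and X: "\<And>\<omega>. \<omega> \<in> space M \<Longrightarrow> X \<omega> \<in> space N"
    and dep: "\<And>\<omega> \<omega>'. \<omega> \<in> space M \<Longrightarrow> \<omega>' \<in> space M \<Longrightarrow> f \<omega> = f \<omega>' \<Longrightarrow> X \<omega> = X \<omega>'"
  shows "X \<in> measurable M N"
proof (rule measurableI)
  fix A assume "A \<in> sets N"
  have "X -` A \<inter> space M = f -` (f ` {\<omega> \<in> space M. X \<omega> \<in> A}) \<inter> space M" (is "?L = ?R")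
  proof
    show "?R \<subseteq> ?L"
    proof
      fix \<omega> assume "\<omega> \<in> ?R"
      then obtain \<omega>' where "\<omega> \<in> space M" "\<omega>' \<in> space M" "X \<omega>' \<in> A" "f \<omega> = f \<omega>'" by auto
      with dep[of \<omega> \<omega>'] show "\<omega> \<in> ?L" by simp
    qed
  qed auto
  then show "X -` A \<inter> space M \<in> sets M" using measurable_sets[OF f] by simp
qed (rule X)

text \<open>Tightness is asked only eventually, so finitely many sample sizes never matter.\<close>

definition bounded_in_prob :: "'a measure \<Rightarrow> (nat \<Rightarrow> 'a \<Rightarrow> real) \<Rightarrow> bool" where
  "bounded_in_prob M R \<longleftrightarrow> (\<forall>e>0. \<exists>K>0. \<forall>\<^sub>F T in sequentially. measure M {\<omega> \<in> space M. \<bar>R T \<omega>\<bar> \<ge> K} < e)"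

context prob_space
begin

lemma zero_in_prob_iff:
  "tends_to_zero_in_prob M R \<longleftrightarrow> (\<forall>d>0. \<forall>e>0. \<forall>\<^sub>F T in sequentially. prob {\<omega> \<in> space M. \<bar>R T \<omega>\<bar> \<ge> d} < e)"
  unfolding tends_to_zero_in_prob_def
proof (intro iffI allI impI)
  fix d e :: real assume "\<forall>e>0. (\<lambda>T. prob {\<omega> \<in> space M. e \<le> \<bar>R T \<omega>\<bar>}) \<longlonglongrightarrow> 0" "0 < d" "0 < e"
  then show "\<forall>\<^sub>F T in sequentially. prob {\<omega> \<in> space M. d \<le> \<bar>R T \<omega>\<bar>} < e" by (intro order_tendstoD(2)[of _ 0]) auto
next
  fix d :: real assume *: "\<forall>d>0. \<forall>e>0. \<forall>\<^sub>F T in sequentially. prob {\<omega> \<in> space M. d \<le> \<bar>R T \<omega>\<bar>} < e" "0 < d"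
  show "(\<lambda>T. prob {\<omega> \<in> space M. d \<le> \<bar>R T \<omega>\<bar>}) \<longlonglongrightarrow> 0"
    by (rule order_tendstoI) (use * in \<open>auto intro!: always_eventually intro: less_le_trans[OF _ measure_nonneg]\<close>)
qed

lemma zero_in_probD:
  assumes "tends_to_zero_in_prob M R" "d > 0" "e > 0"
  shows "\<forall>\<^sub>F T in sequentially. prob {\<omega> \<in> space M. \<bar>R T \<omega>\<bar> \<ge> d} < e"
  using assms zero_in_prob_iff by blast

text \<open>The comparison is asked only on events \<open>G T\<close> of probability tending to 1,
  because the expansion of the statistic holds only where the estimator is close to the true
  parameter.\<close>

lemma zero_in_prob_le:
  assumes R: "tends_to_zero_in_prob M R" and G: "(\<lambda>T. prob {\<omega> \<in> space M. \<not> G T \<omega>}) \<longlonglongrightarrow> 0"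
    and [measurable]: "\<And>T. R T \<in> borel_measurable M" "\<And>T. {\<omega> \<in> space M. \<not> G T \<omega>} \<in> sets M"
    and le: "\<forall>\<^sub>F T in sequentially. \<forall>\<omega>\<in>space M. G T \<omega> \<longrightarrow> \<bar>R' T \<omega>\<bar> \<le> \<bar>R T \<omega>\<bar>"
  shows "tends_to_zero_in_prob M R'"
  unfolding zero_in_prob_iff
proof (intro allI impI)
  fix d e :: real assume d: "d > 0" and e: "e > 0"
  have "\<forall>\<^sub>F T in sequentially. prob {\<omega> \<in> space M. \<bar>R T \<omega>\<bar> \<ge> d} < e / 2"
    by (rule zero_in_probD[OF R d]) (use e in simp)
  moreover have "\<forall>\<^sub>F T in sequentially. prob {\<omega> \<in> space M. \<not> G T \<omega>} < e / 2"
    using order_tendstoD(2)[OF G, of "e / 2"] e by simp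
  ultimately show "\<forall>\<^sub>F T in sequentially. prob {\<omega> \<in> space M. \<bar>R' T \<omega>\<bar> \<ge> d} < e"
    using le
  proof eventually_elim
    case (elim T)
    have "prob {\<omega> \<in> space M. \<bar>R' T \<omega>\<bar> \<ge> d} \<le> prob ({\<omega> \<in> space M. \<bar>R T \<omega>\<bar> \<ge> d} \<union> {\<omega> \<in> space M. \<not> G T \<omega>})"
      by (rule finite_measure_mono) (use elim in fastforce, measurable)
    also have "\<dots> \<le> prob {\<omega> \<in> space M. \<bar>R T \<omega>\<bar> \<ge> d} + prob {\<omega> \<in> space M. \<not> G T \<omega>}"
      by (rule measure_Un_le) measurable
    finally show ?case using elim by linarith
  qed
qed

lemma zero_in_prob_add:
  assumes R: "tends_to_zero_in_prob M R" "tends_to_zero_in_prob M R'"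
    and [measurable]: "\<And>T. R T \<in> borel_measurable M" "\<And>T. R' T \<in> borel_measurable M"
  shows "tends_to_zero_in_prob M (\<lambda>T \<omega>. R T \<omega> + R' T \<omega>)"
  unfolding zero_in_prob_iff
proof (intro allI impI)
  fix d e :: real assume d: "d > 0" and e: "e > 0"
  have "\<forall>\<^sub>F T in sequentially. prob {\<omega> \<in> space M. \<bar>R T \<omega>\<bar> \<ge> d / 2} < e / 2" "\<forall>\<^sub>F T in sequentially. prob {\<omega> \<in> space M. \<bar>R' T \<omega>\<bar> \<ge> d / 2} < e / 2"
    by (rule zero_in_probD[OF R(1)] zero_in_probD[OF R(2)]; use d e in simp)+
  then show "\<forall>\<^sub>F T in sequentially. prob {\<omega> \<in> space M. \<bar>R T \<omega> + R' T \<omega>\<bar> \<ge> d} < e"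
  proof eventually_elim
    case (elim T)
    have "prob {\<omega> \<in> space M. \<bar>R T \<omega> + R' T \<omega>\<bar> \<ge> d} \<le> prob ({\<omega> \<in> space M. \<bar>R T \<omega>\<bar> \<ge> d / 2} \<union> {\<omega> \<in> space M. \<bar>R' T \<omega>\<bar> \<ge> d / 2})"
      by (rule finite_measure_mono) auto
    also have "\<dots> \<le> prob {\<omega> \<in> space M. \<bar>R T \<omega>\<bar> \<ge> d / 2} + prob {\<omega> \<in> space M. \<bar>R' T \<omega>\<bar> \<ge> d / 2}"
      by (rule measure_Un_le) measurable
    finally show ?case using elim by linarith
  qed
qed

lemma bounded_in_probD:
  assumes "bounded_in_prob M R" "e > 0"
  obtains K where "K > 0" "\<forall>\<^sub>F T in sequentially. prob {\<omega> \<in> space M. \<bar>R T \<omega>\<bar> \<ge> K} < e"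
  using assms unfolding bounded_in_prob_def by blast

lemma zero_mult_bounded_in_prob:
  assumes R: "tends_to_zero_in_prob M R" "bounded_in_prob M B"
    and [measurable]: "\<And>T. R T \<in> borel_measurable M" "\<And>T. B T \<in> borel_measurable M"
  shows "tends_to_zero_in_prob M (\<lambda>T \<omega>. R T \<omega> * B T \<omega>)"
  unfolding zero_in_prob_iff
proof (intro allI impI)
  fix d e :: real assume d: "d > 0" and e: "e > 0"
  obtain K where K: "K > 0" "\<forall>\<^sub>F T in sequentially. prob {\<omega> \<in> space M. \<bar>B T \<omega>\<bar> \<ge> K} < e / 2"
    by (rule bounded_in_probD[OF R(2), of "e / 2"]) (use e in auto)
  have "\<forall>\<^sub>F T in sequentially. prob {\<omega> \<in> space M. \<bar>R T \<omega>\<bar> \<ge> d / K} < e / 2"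
    by (rule zero_in_probD[OF R(1)]) (use d e K in auto)
  with K(2) show "\<forall>\<^sub>F T in sequentially. prob {\<omega> \<in> space M. \<bar>R T \<omega> * B T \<omega>\<bar> \<ge> d} < e"
  proof eventually_elim
    case (elim T)
    have *: "\<bar>R T \<omega> * B T \<omega>\<bar> < d" if "\<bar>R T \<omega>\<bar> < d / K" "\<bar>B T \<omega>\<bar> < K" for \<omega>
    proof -
      have "\<bar>R T \<omega>\<bar> * \<bar>B T \<omega>\<bar> \<le> \<bar>R T \<omega>\<bar> * K" using that by (intro mult_left_mono) auto
      also have "\<dots> < d / K * K" using that K by (intro mult_strict_right_mono) auto
      finally show ?thesis using K by (simp add: abs_mult)
    qed
    have sub: "{\<omega> \<in> space M. \<bar>R T \<omega> * B T \<omega>\<bar> \<ge> d} \<subseteq> {\<omega> \<in> space M. \<bar>R T \<omega>\<bar> \<ge> d / K} \<union> {\<omega> \<in> space M. \<bar>B T \<omega>\<bar> \<ge> K}"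
      using * by (intro subsetI) (metis (mono_tags, lifting) UnCI linorder_not_le mem_Collect_eq)
    have "prob {\<omega> \<in> space M. \<bar>R T \<omega> * B T \<omega>\<bar> \<ge> d} \<le> prob ({\<omega> \<in> space M. \<bar>R T \<omega>\<bar> \<ge> d / K} \<union> {\<omega> \<in> space M. \<bar>B T \<omega>\<bar> \<ge> K})"
      by (rule finite_measure_mono[OF sub]) measurable
    also have "\<dots> \<le> prob {\<omega> \<in> space M. \<bar>R T \<omega>\<bar> \<ge> d / K} + prob {\<omega> \<in> space M. \<bar>B T \<omega>\<bar> \<ge> K}"
      by (rule measure_Un_le) measurable
    finally show ?case using elim by linarith
  qed
qed

lemma bounded_in_prob_add:
  assumes R: "bounded_in_prob M R" "bounded_in_prob M R'"
    and [measurable]: "\<And>T. R T \<in> borel_measurable M" "\<And>T. R' T \<in> borel_measurable M"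
  shows "bounded_in_prob M (\<lambda>T \<omega>. R T \<omega> + R' T \<omega>)"
  unfolding bounded_in_prob_def
proof (intro allI impI)
  fix e :: real assume e: "e > 0"
  obtain K where K: "K > 0" "\<forall>\<^sub>F T in sequentially. prob {\<omega> \<in> space M. \<bar>R T \<omega>\<bar> \<ge> K} < e / 2"
    by (rule bounded_in_probD[OF R(1), of "e / 2"]) (use e in auto)
  obtain K' where K': "K' > 0" "\<forall>\<^sub>F T in sequentially. prob {\<omega> \<in> space M. \<bar>R' T \<omega>\<bar> \<ge> K'} < e / 2"
    by (rule bounded_in_probD[OF R(2), of "e / 2"]) (use e in auto)
  from K(2) K'(2) have "\<forall>\<^sub>F T in sequentially. prob {\<omega> \<in> space M. \<bar>R T \<omega> + R' T \<omega>\<bar> \<ge> K + K'} < e"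
  proof eventually_elim
    case (elim T)
    have "prob {\<omega> \<in> space M. \<bar>R T \<omega> + R' T \<omega>\<bar> \<ge> K + K'} \<le> prob ({\<omega> \<in> space M. \<bar>R T \<omega>\<bar> \<ge> K} \<union> {\<omega> \<in> space M. \<bar>R' T \<omega>\<bar> \<ge> K'})"
      by (rule finite_measure_mono) auto
    also have "\<dots> \<le> prob {\<omega> \<in> space M. \<bar>R T \<omega>\<bar> \<ge> K} + prob {\<omega> \<in> space M. \<bar>R' T \<omega>\<bar> \<ge> K'}"
      by (rule measure_Un_le) measurable
    finally show ?case using elim by linarith
  qed
  then show "\<exists>K>0. \<forall>\<^sub>F T in sequentially. prob {\<omega> \<in> space M. \<bar>R T \<omega> + R' T \<omega>\<bar> \<ge> K} < e"
    using K(1) K'(1) by (intro exI[of _ "K + K'"]) auto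
qed

lemma zero_imp_bounded_in_prob: "tends_to_zero_in_prob M R \<Longrightarrow> bounded_in_prob M R"
  unfolding zero_in_prob_iff bounded_in_prob_def by (meson zero_less_one)

lemma prob_ge_le_moment:
  assumes [measurable]: "R \<in> borel_measurable M" and int: "integrable M R" and K: "K > 0"
  shows "prob {\<omega> \<in> space M. \<bar>R \<omega>\<bar> \<ge> K} \<le> (\<integral>\<omega>. \<bar>R \<omega>\<bar> \<partial>M) / K"
  using integral_Markov_inequality_measure[where u = "\<lambda>\<omega>. \<bar>R \<omega>\<bar>" and A = "{}" and c = K] int K by (simp add: integral_nonneg)

lemma bounded_moment_imp_bounded_in_prob:
  assumes [measurable]: "\<And>T. R T \<in> borel_measurable M" and int: "\<And>T. integrable M (R T)" and C: "\<And>T. (\<integral>\<omega>. \<bar>R T \<omega>\<bar> \<partial>M) \<le> C"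
  shows "bounded_in_prob M R"
  unfolding bounded_in_prob_def
proof (intro allI impI)
  fix e :: real assume e: "e > 0"
  have C0: "C \<ge> 0" using C[of 0] by (meson abs_ge_zero integral_nonneg order_trans Bochner_Integration.integral_nonneg)
  define K where "K = (C + 1) / e"
  have K: "K > 0" using C0 e by (simp add: K_def)
  have "prob {\<omega> \<in> space M. \<bar>R T \<omega>\<bar> \<ge> K} < e" for T
  proof -
    have "prob {\<omega> \<in> space M. \<bar>R T \<omega>\<bar> \<ge> K} \<le> (\<integral>\<omega>. \<bar>R T \<omega>\<bar> \<partial>M) / K" by (rule prob_ge_le_moment) (use int K in auto)
    also have "\<dots> \<le> C / K" using C K by (intro divide_right_mono) auto
    also have "\<dots> < e" using C0 e by (simp add: K_def field_simps)
    finally show ?thesis .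
  qed
  then show "\<exists>K>0. \<forall>\<^sub>F T in sequentially. prob {\<omega> \<in> space M. \<bar>R T \<omega>\<bar> \<ge> K} < e" using K by auto
qed

lemma L1_imp_zero_in_prob:
  assumes [measurable]: "\<And>T. R T \<in> borel_measurable M" and int: "\<forall>\<^sub>F T in sequentially. integrable M (R T)"
    and lim: "(\<lambda>T. \<integral>\<omega>. \<bar>R T \<omega>\<bar> \<partial>M) \<longlonglongrightarrow> 0"
  shows "tends_to_zero_in_prob M R"
  unfolding zero_in_prob_iff
proof (intro allI impI)
  fix d e :: real assume d: "d > 0" and e: "e > 0"
  have "\<forall>\<^sub>F T in sequentially. (\<integral>\<omega>. \<bar>R T \<omega>\<bar> \<partial>M) < e * d" by (rule order_tendstoD(2)[OF lim]) (use d e in simp)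
  with int show "\<forall>\<^sub>F T in sequentially. prob {\<omega> \<in> space M. \<bar>R T \<omega>\<bar> \<ge> d} < e"
  proof eventually_elim
    case (elim T)
    have "prob {\<omega> \<in> space M. \<bar>R T \<omega>\<bar> \<ge> d} \<le> (\<integral>\<omega>. \<bar>R T \<omega>\<bar> \<partial>M) / d" by (rule prob_ge_le_moment) (use elim d in auto)
    also have "\<dots> < e" using elim d by (simp add: pos_divide_less_eq)
    finally show ?case .
  qed
qed

lemma deterministic_zero_in_prob:
  assumes "c \<longlonglongrightarrow> 0" shows "tends_to_zero_in_prob M (\<lambda>T \<omega>. c T)"
proof (rule L1_imp_zero_in_prob)
  have "(\<lambda>T. \<bar>c T\<bar>) \<longlonglongrightarrow> \<bar>0\<bar>" by (intro tendsto_intros assms)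
  then show "(\<lambda>T. \<integral>\<omega>. \<bar>c T\<bar> \<partial>M) \<longlonglongrightarrow> 0" by (simp add: prob_space)
qed auto

lemma deterministic_bounded_in_prob: "bounded_in_prob M (\<lambda>T \<omega>. c)"
  by (rule bounded_moment_imp_bounded_in_prob[where C = "\<bar>c\<bar>"]) (auto simp: prob_space)

lemma zero_in_prob_abs: "tends_to_zero_in_prob M R \<Longrightarrow> tends_to_zero_in_prob M (\<lambda>T \<omega>. \<bar>R T \<omega>\<bar>)"
  by (simp add: tends_to_zero_in_prob_def)

lemma bounded_in_prob_abs: "bounded_in_prob M R \<Longrightarrow> bounded_in_prob M (\<lambda>T \<omega>. \<bar>R T \<omega>\<bar>)"
  by (simp add: bounded_in_prob_def)

lemma bounded_in_prob_mult:
  assumes R: "bounded_in_prob M R" "bounded_in_prob M B"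
    and [measurable]: "\<And>T. R T \<in> borel_measurable M" "\<And>T. B T \<in> borel_measurable M"
  shows "bounded_in_prob M (\<lambda>T \<omega>. R T \<omega> * B T \<omega>)"
  unfolding bounded_in_prob_def
proof (intro allI impI)
  fix e :: real assume e: "e > 0"
  obtain K where K: "K > 0" "\<forall>\<^sub>F T in sequentially. prob {\<omega> \<in> space M. \<bar>R T \<omega>\<bar> \<ge> K} < e / 2"
    by (rule bounded_in_probD[OF R(1), of "e / 2"]) (use e in auto)
  obtain K' where K': "K' > 0" "\<forall>\<^sub>F T in sequentially. prob {\<omega> \<in> space M. \<bar>B T \<omega>\<bar> \<ge> K'} < e / 2"
    by (rule bounded_in_probD[OF R(2), of "e / 2"]) (use e in auto)
  from K(2) K'(2) have "\<forall>\<^sub>F T in sequentially. prob {\<omega> \<in> space M. \<bar>R T \<omega> * B T \<omega>\<bar> \<ge> K * K'} < e"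
  proof eventually_elim
    case (elim T)
    have *: "\<bar>R T \<omega> * B T \<omega>\<bar> < K * K'" if "\<bar>R T \<omega>\<bar> < K" "\<bar>B T \<omega>\<bar> < K'" for \<omega>
      unfolding abs_mult using that by (intro mult_strict_mono') auto
    have sub: "{\<omega> \<in> space M. \<bar>R T \<omega> * B T \<omega>\<bar> \<ge> K * K'} \<subseteq> {\<omega> \<in> space M. \<bar>R T \<omega>\<bar> \<ge> K} \<union> {\<omega> \<in> space M. \<bar>B T \<omega>\<bar> \<ge> K'}"
      using * by (intro subsetI) (metis (mono_tags, lifting) UnCI linorder_not_le mem_Collect_eq)
    have "prob {\<omega> \<in> space M. \<bar>R T \<omega> * B T \<omega>\<bar> \<ge> K * K'} \<le> prob ({\<omega> \<in> space M. \<bar>R T \<omega>\<bar> \<ge> K} \<union> {\<omega> \<in> space M. \<bar>B T \<omega>\<bar> \<ge> K'})"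
      by (rule finite_measure_mono[OF sub]) measurable
    also have "\<dots> \<le> prob {\<omega> \<in> space M. \<bar>R T \<omega>\<bar> \<ge> K} + prob {\<omega> \<in> space M. \<bar>B T \<omega>\<bar> \<ge> K'}"
      by (rule measure_Un_le) measurable
    finally show ?case using elim by linarith
  qed
  then show "\<exists>K>0. \<forall>\<^sub>F T in sequentially. prob {\<omega> \<in> space M. \<bar>R T \<omega> * B T \<omega>\<bar> \<ge> K} < e"
    using K(1) K'(1) by (intro exI[of _ "K * K'"]) auto
qed

end

section \<open>The series expansion of the approximating process\<close>

lemma (in prob_space) integrable_pgf:
  fixes u :: real
  assumes [measurable]: "X \<in> measurable M (count_space UNIV)" and u: "\<bar>u\<bar> \<le> 1"
  shows "integrable M (\<lambda>\<omega>. u ^ X \<omega>)"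
  by (rule integrable_const_bound[of _ 1]) (use u in \<open>auto simp: power_abs power_le_one\<close>)

lemma (in prob_space) pgf_bounds:
  assumes X: "X \<in> measurable M (count_space UNIV)" and u: "u \<in> {0..1}"
  shows "0 \<le> pgf M X u" "pgf M X u \<le> 1"
proof -
  show "0 \<le> pgf M X u" unfolding pgf_def using u by (intro Bochner_Integration.integral_nonneg) auto
  have "pgf M X u \<le> (\<integral>\<omega>. 1 \<partial>M)"
    unfolding pgf_def by (rule integral_mono[OF integrable_pgf[OF X]]) (use u in \<open>auto simp: power_le_one\<close>)
  then show "pgf M X u \<le> 1" by (simp add: prob_space)
qed

text \<open>The exponent map \<open>r\<close> allows for two uses, \<open>n\<close> for the
  generating function and \<open>n - 1\<close> for its derivative. Dominated convergence covers the
  whole closed interval, the point 1 included.\<close>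

lemma (in prob_space) continuous_on_weighted_pgf:
  fixes f :: "nat \<Rightarrow> real" and r :: "nat \<Rightarrow> nat"
  assumes [measurable]: "X \<in> measurable M (count_space UNIV)" and int: "integrable M (\<lambda>\<omega>. f (X \<omega>))"
  shows "continuous_on {0..1} (\<lambda>u. \<integral>\<omega>. f (X \<omega>) * u ^ r (X \<omega>) \<partial>M)"
  unfolding continuous_on_sequentially
proof (intro allI ballI impI)
  fix x :: "nat \<Rightarrow> real" and a assume "a \<in> {0..1}" and x: "(\<forall>n. x n \<in> {0..1}) \<and> x \<longlonglongrightarrow> a"
  have "(\<lambda>n. \<integral>\<omega>. f (X \<omega>) * x n ^ r (X \<omega>) \<partial>M) \<longlonglongrightarrow> (\<integral>\<omega>. f (X \<omega>) * a ^ r (X \<omega>) \<partial>M)"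
  proof (rule integral_dominated_convergence[where w = "\<lambda>\<omega>. \<bar>f (X \<omega>)\<bar>"])
    show "AE \<omega> in M. (\<lambda>n. f (X \<omega>) * x n ^ r (X \<omega>)) \<longlonglongrightarrow> f (X \<omega>) * a ^ r (X \<omega>)"
      using x by (intro AE_I2 tendsto_intros) auto
    show "AE \<omega> in M. norm (f (X \<omega>) * x n ^ r (X \<omega>)) \<le> \<bar>f (X \<omega>)\<bar>" for n
    proof (rule AE_I2)
      fix \<omega>
      have "x n \<in> {0..1}" using x by blast
      then have "\<bar>x n ^ r (X \<omega>)\<bar> \<le> 1" by (simp add: power_le_one)
      then show "norm (f (X \<omega>) * x n ^ r (X \<omega>)) \<le> \<bar>f (X \<omega>)\<bar>"
        unfolding real_norm_def abs_mult by (rule mult_left_le) simp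
    qed
    show "integrable M (\<lambda>\<omega>. \<bar>f (X \<omega>)\<bar>)" using int by simp
  qed simp_all
  then show "((\<lambda>u. \<integral>\<omega>. f (X \<omega>) * u ^ r (X \<omega>) \<partial>M) \<circ> x) \<longlonglongrightarrow> (\<integral>\<omega>. f (X \<omega>) * a ^ r (X \<omega>) \<partial>M)"
    by (simp add: comp_def)
qed

lemma (in prob_space) continuous_on_pgf:
  assumes X: "X \<in> measurable M (count_space UNIV)"
  shows "continuous_on {0..1} (pgf M X)"
  using continuous_on_weighted_pgf[OF X, of "\<lambda>_. 1" "\<lambda>n. n"] by (simp add: pgf_def[abs_def])

context inar
begin

abbreviation gY :: "real \<Rightarrow> real" where "gY \<equiv> pgf M (Y 1)"

text \<open>The derivative series of \<open>gY\<close>, meaningful also at the end point 1 of the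
  interval. For \<open>Y 1 \<omega> = 0\<close> the truncated exponent is harmless because of the
  factor 0.\<close>

definition dgY :: "real \<Rightarrow> real" where "dgY x = (\<integral>\<omega>. real (Y 1 \<omega>) * x ^ (Y 1 \<omega> - 1) \<partial>M)"

definition m1 :: real where "m1 = (\<integral>\<omega>. real (Y 1 \<omega>) \<partial>M)"

lemma integrable_Y: "integrable M (\<lambda>\<omega>. real (Y 1 \<omega>))"
proof -
  have "sq_int M (\<lambda>\<omega>. real (Y 1 \<omega>))" unfolding sq_int_def using integrable_Y_square[of 1] by simp
  then show ?thesis by (rule sq_int_imp_integrable[OF prob_space_axioms])
qed

lemma m1_nonneg: "m1 \<ge> 0" by (simp add: m1_def)

lemma gY_sums: "\<bar>x\<bar> \<le> 1 \<Longrightarrow> (\<lambda>k. x ^ k * ymass k) sums gY x"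
  unfolding pgf_def by (rule ymass_sums) (rule integrable_pgf[OF measurable_Y])

lemma
  assumes x: "\<bar>x\<bar> \<le> 1"
  shows dgY_sums: "(\<lambda>k. real k * x ^ (k - 1) * ymass k) sums dgY x"
    and dgY_bound: "\<bar>dgY x\<bar> \<le> m1"
proof -
  have le: "\<bar>real k * x ^ (k - 1)\<bar> \<le> real k" for k
  proof -
    have "\<bar>x ^ (k - 1)\<bar> \<le> 1" using x by (simp add: power_abs power_le_one)
    then have "real k * \<bar>x ^ (k - 1)\<bar> \<le> real k" by (intro mult_left_le) auto
    then show ?thesis by (simp add: abs_mult)
  qed
  have int: "integrable M (\<lambda>\<omega>. real (Y 1 \<omega>) * x ^ (Y 1 \<omega> - 1))"
    by (rule Bochner_Integration.integrable_bound[OF integrable_Y]) (use le in auto)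
  show "(\<lambda>k. real k * x ^ (k - 1) * ymass k) sums dgY x"
    unfolding dgY_def by (rule ymass_sums) (rule int)
  have "\<bar>dgY x\<bar> \<le> (\<integral>\<omega>. \<bar>real (Y 1 \<omega>) * x ^ (Y 1 \<omega> - 1)\<bar> \<partial>M)" unfolding dgY_def by (rule integral_abs_bound)
  also have "\<dots> \<le> m1" unfolding m1_def by (rule integral_mono) (use int integrable_Y le in auto)
  finally show "\<bar>dgY x\<bar> \<le> m1" .
qed

lemma gY_has_derivative:
  assumes x: "\<bar>x\<bar> < 1" shows "(gY has_field_derivative dgY x) (at x)"
proof -
  have "summable (\<lambda>n. ymass n * 1 ^ n)" using gY_sums[of 1] by (simp add: sums_iff)
  from termdiffs_strong[OF this, of x] x
  have D: "((\<lambda>x. \<Sum>n. ymass n * x ^ n) has_field_derivative (\<Sum>n. diffs ymass n * x ^ n)) (at x)" by simp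
  have "(\<lambda>n. real (Suc n) * x ^ (Suc n - 1) * ymass (Suc n)) sums dgY x"
    using dgY_sums[of x] x by (subst sums_Suc_iff) auto
  then have "(\<Sum>n. diffs ymass n * x ^ n) = dgY x" by (simp add: diffs_def sums_iff mult_ac)
  with D have D': "((\<lambda>x. \<Sum>n. ymass n * x ^ n) has_field_derivative dgY x) (at x)" by simp
  show ?thesis
  proof (rule has_field_derivative_transform_within_open[OF D', of "{-1<..<1}"])
    show "(\<Sum>n. ymass n * z ^ n) = gY z" if "z \<in> {-1<..<1}" for z
      using gY_sums[of z] that by (simp add: sums_iff mult.commute abs_le_iff)
  qed (use x in auto)
qed

lemma thinned_in_unit: "u \<in> {0..1} \<Longrightarrow> r \<in> {0..1} \<Longrightarrow> 1 + r * (u - 1) \<in> {0..1::real}"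
proof -
  assume u: "u \<in> {0..1}" and r: "r \<in> {0..1}"
  have "r * (1 - u) \<le> 1 * 1" using u r by (intro mult_mono) auto
  moreover have "r * (1 - u) \<ge> 0" using u r by simp
  ultimately show ?thesis by (simp add: algebra_simps)
qed

lemma p_unit: "p \<in> {0..1}" using p by simp

text \<open>For \<open>u < 1\<close> the thinned argument lies strictly between 0 and 1, inside the
  disc of convergence. At \<open>u = 1\<close> the function of \<open>r\<close> is constant and the
  factor \<open>u - 1\<close> vanishes, so the two sides agree without a derivative of
  \<open>gY\<close> at 1.\<close>

lemma deriv_thinned_pgf:
  assumes u: "u \<in> {0..1}"
  shows "deriv (\<lambda>r. gY (1 + r * (u - 1))) p = dgY (1 + p * (u - 1)) * (u - 1)"
proof (cases "u = 1")
  case True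
  then show ?thesis by simp
next
  case False
  have "p * (1 - u) \<le> p * 1" using u p by (intro mult_left_mono) auto
  then have "p * (1 - u) < 1" using p by linarith
  moreover have "p * (1 - u) > 0" using u p False by simp
  ultimately have "\<bar>1 + p * (u - 1)\<bar> < 1" by (simp add: algebra_simps)
  from gY_has_derivative[OF this]
  have "((\<lambda>r. gY (1 + r * (u - 1))) has_field_derivative dgY (1 + p * (u - 1)) * (u - 1)) (at p)"
    by (rule DERIV_chain'[rotated]) (auto intro!: derivative_eq_intros)
  then show ?thesis by (rule DERIV_imp_deriv)
qed

lemma continuous_on_dgY: "continuous_on {0..1} dgY"
  using continuous_on_weighted_pgf[OF measurable_Y integrable_Y, of "\<lambda>n. n - 1"] by (simp add: dgY_def[abs_def])

end

locale inar_test = inar_mds M p Y U eps \<theta> q l1 l2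
  for M :: "'a measure" and p :: real and Y :: "int \<Rightarrow> 'a \<Rightarrow> nat" and U :: "int \<Rightarrow> nat \<Rightarrow> 'a \<Rightarrow> nat" and eps :: "int \<Rightarrow> 'a \<Rightarrow> nat"
    and \<theta> :: real and q :: nat and l1 l2 :: "nat list \<Rightarrow> real \<times> real \<Rightarrow> real" +
  fixes g :: "real \<Rightarrow> real \<Rightarrow> real" and \<Theta> :: "real set" and v w :: "real \<Rightarrow> real" and D1 D2 D3 :: real
    and phat thhat :: "nat list \<Rightarrow> real"
  assumes Theta: "open \<Theta>" "\<theta> \<in> \<Theta>"
    and family: "\<And>\<theta>'. \<theta>' \<in> \<Theta> \<Longrightarrow> \<exists>Q :: nat pmf. \<forall>u\<in>{0..1}. g u \<theta>' = pgf (measure_pmf Q) (\<lambda>n. n) u"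
    and A1: "\<And>t u. u \<in> {0..1} \<Longrightarrow> pgf M (eps t) u = g u \<theta>"
    and D_pos: "0 < D1" "0 < D2" "0 < D3"
    and v_measurable: "v \<in> borel_measurable (lebesgue_on {0..1})"
    and g_differentiable: "\<And>u \<theta>'. u \<in> {0..1} \<Longrightarrow> \<theta>' \<in> \<Theta> \<Longrightarrow> g u differentiable (at \<theta>')"
    and A2: "\<And>u \<theta>'. u \<in> {0..1} \<Longrightarrow> \<theta>' \<in> \<Theta> \<Longrightarrow> \<bar>\<theta>' - \<theta>\<bar> \<le> D2 \<Longrightarrow>
         \<bar>deriv (g u) \<theta>' - deriv (g u) \<theta>\<bar> \<le> D1 * \<bar>\<theta>' - \<theta>\<bar> * v u \<and> \<bar>deriv (g u) \<theta>'\<bar> \<le> D3 * v u"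
    and w_measurable: "w \<in> borel_measurable (lebesgue_on {0..1})" and w_nonneg: "\<And>u. u \<in> {0..1} \<Longrightarrow> 0 \<le> w u"
    and w_integrable: "integrable (lebesgue_on {0..1}) w"
    and wv_integrable: "integrable (lebesgue_on {0..1}) (\<lambda>u. w u * (v u)\<^sup>2)"
    and estimator: "\<And>T \<omega>. T \<ge> 1 \<Longrightarrow> \<omega> \<in> space M \<Longrightarrow> thhat (sample Y T \<omega>) \<in> \<Theta>"
    and A4: "tends_to_zero_in_prob M (\<lambda>T \<omega>. sqrt (real T) * (phat (sample Y T \<omega>) - p)
         - 1 / sqrt (real T) * (\<Sum>t\<in>{int q + 1..int T}. l1 (lags Y q t \<omega>) (p, \<theta>)))"
      "tends_to_zero_in_prob M (\<lambda>T \<omega>. sqrt (real T) * (thhat (sample Y T \<omega>) - \<theta>)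
         - 1 / sqrt (real T) * (\<Sum>t\<in>{int q + 1..int T}. l2 (lags Y q t \<omega>) (p, \<theta>)))"
begin

lemma g_bounds: "u \<in> {0..1} \<Longrightarrow> \<theta>' \<in> \<Theta> \<Longrightarrow> 0 \<le> g u \<theta>' \<and> g u \<theta>' \<le> 1"
proof -
  assume u: "u \<in> {0..1}" and "\<theta>' \<in> \<Theta>"
  then obtain Q :: "nat pmf" where Q: "\<forall>u\<in>{0..1}. g u \<theta>' = pgf (measure_pmf Q) (\<lambda>n. n) u" using family by blast
  show ?thesis using measure_pmf.pgf_bounds[of "\<lambda>n. n" Q u] u Q by simp
qed

lemma continuous_on_g: "\<theta>' \<in> \<Theta> \<Longrightarrow> continuous_on {0..1} (\<lambda>u. g u \<theta>')"
proof -
  assume "\<theta>' \<in> \<Theta>"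
  then obtain Q :: "nat pmf" where Q: "\<forall>u\<in>{0..1}. g u \<theta>' = pgf (measure_pmf Q) (\<lambda>n. n) u" using family by blast
  have "continuous_on {0..1} (pgf (measure_pmf Q) (\<lambda>n. n))" by (rule measure_pmf.continuous_on_pgf) simp
  then show ?thesis using Q by (subst continuous_on_cong[OF refl]) auto
qed

abbreviation dg :: "real \<Rightarrow> real" where "dg u \<equiv> deriv (g u) \<theta>"

lemma dg_bound: "u \<in> {0..1} \<Longrightarrow> \<bar>dg u\<bar> \<le> D3 * v u"
  using A2[of u \<theta>] Theta D_pos by simp

text \<open>The sign of \<open>v\<close> is forced by the bound on the derivative at the true
  parameter.\<close>

lemma v_nonneg: "u \<in> {0..1} \<Longrightarrow> v u \<ge> 0"
  using dg_bound[of u] D_pos by (meson abs_ge_zero order_trans zero_le_mult_iff not_less)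

lemma g_has_derivative:
  "u \<in> {0..1} \<Longrightarrow> \<theta>' \<in> \<Theta> \<Longrightarrow> (g u has_field_derivative deriv (g u) \<theta>') (at \<theta>')"
  using g_differentiable[of u \<theta>'] by (simp add: DERIV_deriv_iff_real_differentiable)

lemma measurable_continuous_unit: "continuous_on {0..1} f \<Longrightarrow> f \<in> borel_measurable (lebesgue_on {0..1::real})" for f :: "real \<Rightarrow> real"
  by (rule continuous_imp_measurable_on_sets_lebesgue) auto

text \<open>The derivative in the parameter is a limit of difference quotients along
  \<open>\<theta> + h n\<close>; these parameters stay in the open set \<open>\<Theta>\<close>,
  where \<open>g\<close> is continuous in \<open>u\<close>.\<close>

lemma measurable_dg: "dg \<in> borel_measurable (lebesgue_on {0..1})"
proof -
  obtain d where d: "d > 0" "cball \<theta> d \<subseteq> \<Theta>" using Theta open_contains_cball by blast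
  define h where "h = (\<lambda>n :: nat. d / real (Suc n))"
  have h: "h n > 0" "h n \<le> d" for n using d by (auto simp: h_def field_simps)
  have h0: "h \<longlonglongrightarrow> 0" unfolding h_def using LIMSEQ_Suc[OF lim_const_over_n[of d]] by simp
  have mem: "\<theta> + h n \<in> \<Theta>" for n
    using d h[of n] by (intro subsetD[OF d(2)]) (simp add: dist_real_def)
  show ?thesis
  proof (rule borel_measurable_LIMSEQ_real)
    show "(\<lambda>u. (g u (\<theta> + h n) - g u \<theta>) / h n) \<in> borel_measurable (lebesgue_on {0..1})" for n
      using measurable_continuous_unit[OF continuous_on_g[OF mem[of n]]] measurable_continuous_unit[OF continuous_on_g[OF Theta(2)]]
      by (intro borel_measurable_divide borel_measurable_diff) auto
    fix u assume "u \<in> space (lebesgue_on {0..1::real})"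
    then have "u \<in> {0..1}" by simp
    from g_has_derivative[OF this Theta(2)]
    have "((\<lambda>h. (g u (\<theta> + h) - g u \<theta>) / h) \<longlongrightarrow> dg u) (at 0)" by (simp add: DERIV_def)
    then show "(\<lambda>n. (g u (\<theta> + h n) - g u \<theta>) / h n) \<longlonglongrightarrow> dg u"
      by (rule filterlim_compose) (use h h0 in \<open>auto simp: filterlim_at less_imp_neq[symmetric]\<close>)
  qed
qed

text \<open>The linear functional of the sequence that produces the process at \<open>u\<close>; the
  signs of the first two coefficients are those with which the estimator's terms enter
  \<open>Z_adj\<close>.\<close>

definition coef :: "real \<Rightarrow> nat \<Rightarrow> real" where
  "coef u j = (if j = 0 then - h1 M g Y u p \<theta> else if j = 1 then - h2 M g Y u p \<theta> else u ^ (j - 2))"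

lemma coef_simps: "coef u 0 = - h1 M g Y u p \<theta>" "coef u (Suc 0) = - h2 M g Y u p \<theta>" "coef u (Suc (Suc k)) = u ^ k"
  by (simp_all add: coef_def)

lemma h1_eq: "u \<in> {0..1} \<Longrightarrow> h1 M g Y u p \<theta> = dgY (1 + p * (u - 1)) * (u - 1) * g u \<theta>"
  by (simp add: h1_def deriv_thinned_pgf)

lemma h1_bound: "u \<in> {0..1} \<Longrightarrow> \<bar>h1 M g Y u p \<theta>\<bar> \<le> m1"
proof -
  assume u: "u \<in> {0..1}"
  have "\<bar>dgY (1 + p * (u - 1))\<bar> \<le> m1" using thinned_in_unit[OF u p_unit] by (intro dgY_bound) auto
  then have "\<bar>dgY (1 + p * (u - 1))\<bar> * \<bar>u - 1\<bar> * \<bar>g u \<theta>\<bar> \<le> m1 * 1 * 1"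
    using u g_bounds[OF u Theta(2)] m1_nonneg by (intro mult_mono) auto
  then show ?thesis using u by (simp add: h1_eq abs_mult)
qed

lemma h2_bound: "u \<in> {0..1} \<Longrightarrow> \<bar>h2 M g Y u p \<theta>\<bar> \<le> D3 * v u"
proof -
  assume u: "u \<in> {0..1}"
  have "\<bar>gY (1 + p * (u - 1))\<bar> * \<bar>dg u\<bar> \<le> 1 * (D3 * v u)"
    using pgf_bounds[OF measurable_Y thinned_in_unit[OF u p_unit]] dg_bound[OF u] by (intro mult_mono) auto
  then show ?thesis by (simp add: h2_def abs_mult)
qed

definition K0 :: real where "K0 = max 1 (max m1 D3)"

lemma K0_pos: "K0 > 0" "K0 \<ge> 1" "K0 \<ge> m1" "K0 \<ge> D3" by (auto simp: K0_def)

text \<open>Uniform in \<open>j\<close> but not in \<open>u\<close>: the coefficient from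
  \<open>h2\<close> brings in the possibly unbounded \<open>v\<close>.\<close>

lemma coef_bound: "u \<in> {0..1} \<Longrightarrow> \<bar>coef u j\<bar> \<le> K0 * (1 + v u)"
proof -
  assume u: "u \<in> {0..1}"
  have v: "v u \<ge> 0" using v_nonneg[OF u] .
  have K1: "K0 * 1 \<le> K0 * (1 + v u)" using v K0_pos by (intro mult_left_mono) auto
  consider "j = 0" | "j = Suc 0" | k where "j = Suc (Suc k)" by (metis not0_implies_Suc)
  then show ?thesis
  proof cases
    case 1
    have "\<bar>coef u j\<bar> = \<bar>h1 M g Y u p \<theta>\<bar>" by (simp add: 1 coef_simps)
    then show ?thesis using h1_bound[OF u] K0_pos K1 by linarith
  next
    case 2
    have "D3 * v u \<le> K0 * v u" using v K0_pos by (intro mult_right_mono) auto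
    also have "\<dots> \<le> K0 * (1 + v u)" using K0_pos by (intro mult_left_mono) auto
    finally show ?thesis using h2_bound[OF u] 2 by (simp add: coef_simps)
  next
    case 3
    have "\<bar>u ^ k\<bar> \<le> 1" using u by (simp add: power_le_one)
    moreover have "coef u j = u ^ k" by (simp add: 3 coef_simps)
    ultimately show ?thesis using K0_pos K1 by linarith
  qed
qed

lemma continuous_on_thinned: "continuous_on {0..1} f \<Longrightarrow> continuous_on {0..1} (\<lambda>u. f (1 + p * (u - 1)))" for f :: "real \<Rightarrow> real"
  by (rule continuous_on_compose2[of "{0..1}" f]) (use thinned_in_unit[OF _ p_unit] in \<open>auto intro!: continuous_intros\<close>)

lemma continuous_on_h1: "continuous_on {0..1} (\<lambda>u. h1 M g Y u p \<theta>)"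
proof -
  have "continuous_on {0..1} (\<lambda>u. dgY (1 + p * (u - 1)) * (u - 1) * g u \<theta>)"
    by (intro continuous_intros continuous_on_thinned continuous_on_dgY continuous_on_g Theta)
  then show ?thesis by (subst continuous_on_cong[OF refl h1_eq]) auto
qed

lemma continuous_on_gY: "continuous_on {0..1} (\<lambda>u. gY (1 + p * (u - 1)))"
  by (intro continuous_on_thinned continuous_on_pgf measurable_Y)

lemma measurable_coef: "(\<lambda>u. coef u j) \<in> borel_measurable (lebesgue_on {0..1})"
proof -
  consider "j = 0" | "j = Suc 0" | k where "j = Suc (Suc k)" by (metis not0_implies_Suc)
  then show ?thesis
  proof cases
    case 1
    show ?thesis unfolding 1 coef_simps
      by (intro borel_measurable_uminus measurable_continuous_unit continuous_on_h1)
  next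
    case 2
    show ?thesis unfolding 2 coef_simps h2_def
      by (intro borel_measurable_uminus borel_measurable_times measurable_dg measurable_continuous_unit[OF continuous_on_gY])
  next
    case 3
    show ?thesis unfolding 3 coef_simps
      by (intro measurable_continuous_unit continuous_intros)
  qed
qed

lemma continuous_on_coef:
  assumes "continuous_on {0..1} dg" shows "continuous_on {0..1} (\<lambda>u. coef u j)"
proof -
  consider "j = 0" | "j = Suc 0" | k where "j = Suc (Suc k)" by (metis not0_implies_Suc)
  then show ?thesis
  proof cases
    case 1
    show ?thesis unfolding 1 coef_simps by (intro continuous_intros continuous_on_h1)
  next
    case 2
    show ?thesis unfolding 2 coef_simps h2_def by (intro continuous_intros continuous_on_gY assms)
  next
    case 3
    show ?thesis unfolding 3 coef_simps by (intro continuous_intros)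
  qed
qed

lemma emass_pgf: "u \<in> {0..1} \<Longrightarrow> (\<Sum>i. u ^ i * emass i) = g u \<theta>"
proof -
  assume u: "u \<in> {0..1}"
  have "(\<lambda>i. u ^ i * emass i) sums pgf M (eps 0) u"
    unfolding pgf_def by (rule emass_sums, rule integrable_pgf[OF measurable_eps]) (use u in auto)
  then show ?thesis using A1[OF u, of 0] by (simp add: sums_iff)
qed

text \<open>The series of \<open>kappa\<close> is the conditional generating function, a product
  because survivors and innovations are convolved; its innovation factor is \<open>g\<close> at the
  true parameter.\<close>

lemma Z_inc_sums:
  assumes u: "u \<in> {0..1}" shows "(\<lambda>k. u ^ k * innov t k \<omega>) sums Z_inc g Y t u p \<theta> \<omega>"
proof -
  have "(\<lambda>k. (if k = Y t \<omega> then u ^ k else 0) - u ^ k * kappa (Y (t - 1) \<omega>) k) sums (u ^ Y t \<omega> - (1 + p * (u - 1)) ^ Y (t - 1) \<omega> * g u \<theta>)"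
    using kappa_pgf[of u "Y (t - 1) \<omega>"] u by (intro sums_diff sums_single) (simp add: emass_pgf)
  moreover have "(if k = Y t \<omega> then u ^ k else 0) - u ^ k * kappa (Y (t - 1) \<omega>) k = u ^ k * innov t k \<omega>" for k
    by (simp add: innov_def algebra_simps)
  ultimately show ?thesis by (simp add: Z_inc_def)
qed

lemma Z_adj_sums:
  assumes u: "u \<in> {0..1}" shows "(\<lambda>j. coef u j * X t j \<omega>) sums Z_adj M g Y q l1 l2 t u p \<theta> \<omega>"
proof -
  have "(\<lambda>k. coef u (Suc (Suc k)) * X t (Suc (Suc k)) \<omega>) sums Z_inc g Y t u p \<theta> \<omega>"
    unfolding coef_simps X_simps by (rule Z_inc_sums[OF u])
  then have "(\<lambda>j. coef u (Suc j) * X t (Suc j) \<omega>) sums (Z_inc g Y t u p \<theta> \<omega> + coef u (Suc 0) * X t (Suc 0) \<omega>)"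
    by (rule sums_Suc)
  then have "(\<lambda>j. coef u j * X t j \<omega>) sums (Z_inc g Y t u p \<theta> \<omega> + coef u (Suc 0) * X t (Suc 0) \<omega> + coef u 0 * X t 0 \<omega>)"
    by (rule sums_Suc)
  then show ?thesis by (simp add: Z_adj_def coef_simps X_simps algebra_simps)
qed

lemma Z_bar_sums:
  assumes u: "u \<in> {0..1}" shows "(\<lambda>j. coef u j * V T \<omega> j) sums Z_bar M g Y q l1 l2 T u p \<theta> \<omega>"
proof -
  have "(\<lambda>j. 1 / sqrt (real T) * (\<Sum>t\<in>{int q + 1..int T}. coef u j * X t j \<omega>)) sums Z_bar M g Y q l1 l2 T u p \<theta> \<omega>"
    unfolding Z_bar_def by (intro sums_mult sums_sum Z_adj_sums u)
  then show ?thesis by (simp add: V_def sum_distrib_left mult_ac)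
qed

end

section \<open>Expansion of the test statistic\<close>

text \<open>The constant \<open>n\<^sup>2\<close> is crude, but its average over the sample is the
  empirical second moment, which is bounded in probability.\<close>

lemma power_taylor:
  fixes x y :: real
  assumes x: "x \<in> {0..1}" and y: "y \<in> {0..1}"
  shows "\<bar>x ^ n - y ^ n - real n * y ^ (n - 1) * (x - y)\<bar> \<le> (real n)\<^sup>2 * (x - y)\<^sup>2"
proof (induction n)
  case (Suc n)
  have eq: "x ^ Suc n - y ^ Suc n - real (Suc n) * y ^ n * (x - y)
     = x * (x ^ n - y ^ n - real n * y ^ (n - 1) * (x - y)) + real n * y ^ (n - 1) * (x - y)\<^sup>2"
  proof (cases n)
    case (Suc m)
    then show ?thesis by (simp add: power2_eq_square algebra_simps)
  qed (simp add: algebra_simps)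
  have y1: "\<bar>y ^ (n - 1)\<bar> \<le> 1" using y by (simp add: power_le_one)
  have "\<bar>x * (x ^ n - y ^ n - real n * y ^ (n - 1) * (x - y))\<bar> \<le> 1 * ((real n)\<^sup>2 * (x - y)\<^sup>2)"
    unfolding abs_mult[of x] using x by (intro mult_mono Suc) auto
  moreover have "\<bar>real n * y ^ (n - 1) * (x - y)\<^sup>2\<bar> \<le> real n * 1 * (x - y)\<^sup>2"
    unfolding abs_mult using y1 by (intro mult_mono) auto
  ultimately have "\<bar>x ^ Suc n - y ^ Suc n - real (Suc n) * y ^ n * (x - y)\<bar> \<le> (real n)\<^sup>2 * (x - y)\<^sup>2 + real n * (x - y)\<^sup>2"
    unfolding eq by linarith
  also have "\<dots> \<le> (real (Suc n))\<^sup>2 * (x - y)\<^sup>2"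
  proof -
    have "(real n)\<^sup>2 + real n \<le> (real (Suc n))\<^sup>2" by (simp add: power2_eq_square algebra_simps)
    from mult_right_mono[OF this, of "(x - y)\<^sup>2"] show ?thesis by (simp add: distrib_right)
  qed
  finally show ?case by simp
qed simp

section \<open>Empirical generating functions and their deviations\<close>

context inar
begin

definition dghat :: "nat \<Rightarrow> real \<Rightarrow> 'a \<Rightarrow> real" where
  "dghat T x \<omega> = (\<Sum>t\<in>{1..int T}. real (Y t \<omega>) * x ^ (Y t \<omega> - 1)) / real T"

definition mean_square :: "nat \<Rightarrow> 'a \<Rightarrow> real" where
  "mean_square T \<omega> = (\<Sum>t\<in>{1..int T}. (real (Y t \<omega>))\<^sup>2) / real T"

lemma mean_square_nonneg: "mean_square T \<omega> \<ge> 0"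
  unfolding mean_square_def by (intro divide_nonneg_nonneg sum_nonneg) auto

lemma ghat_bounds:
  assumes x: "x \<in> {0..1}" shows "0 \<le> ghat Y T x \<omega>" "ghat Y T x \<omega> \<le> 1"
proof -
  show "0 \<le> ghat Y T x \<omega>" unfolding ghat_def using x by (intro mult_nonneg_nonneg sum_nonneg) auto
  have "(\<Sum>t\<in>{1..int T}. x ^ Y t \<omega>) \<le> (\<Sum>t\<in>{1..int T}. 1)"
    using x by (intro sum_mono) (auto simp: power_le_one)
  then have "(\<Sum>t\<in>{1..int T}. x ^ Y t \<omega>) \<le> real T" by simp
  then show "ghat Y T x \<omega> \<le> 1" unfolding ghat_def by (cases "T = 0") (auto simp: divide_le_eq)
qed

lemma freq_deviation:
  fixes f :: "nat \<Rightarrow> real"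
  assumes f: "\<And>k. \<bar>f k\<bar> \<le> real k + 1" and s: "(\<lambda>k. f k * ymass k) sums l"
  shows "\<bar>(\<Sum>t\<in>{1..int T}. f (Y t \<omega>)) / real T - l\<bar> \<le> freq_dev T \<omega>"
proof -
  have d: "(\<lambda>k. f k * freq T k \<omega> - f k * ymass k) sums ((\<Sum>t\<in>{1..int T}. f (Y t \<omega>)) / real T - l)"
    by (intro sums_diff freq_sums s)
  have le: "\<bar>f k * freq T k \<omega> - f k * ymass k\<bar> \<le> (real k + 1) * \<bar>freq T k \<omega> - ymass k\<bar>" for k
    unfolding right_diff_distrib[symmetric] abs_mult using f by (rule mult_right_mono) simp
  have sa: "summable (\<lambda>k. \<bar>f k * freq T k \<omega> - f k * ymass k\<bar>)"
    by (rule summable_comparison_test'[OF summable_freq_dev[of T \<omega>]]) (use le in simp)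
  have "\<bar>(\<Sum>t\<in>{1..int T}. f (Y t \<omega>)) / real T - l\<bar> \<le> (\<Sum>k. \<bar>f k * freq T k \<omega> - f k * ymass k\<bar>)"
    using summable_rabs[OF sa] d by (simp add: sums_iff)
  also have "\<dots> \<le> freq_dev T \<omega>" unfolding freq_dev_def by (rule suminf_le[OF le sa summable_freq_dev])
  finally show ?thesis .
qed

lemma ghat_deviation:
  assumes x: "x \<in> {0..1}" shows "\<bar>ghat Y T x \<omega> - gY x\<bar> \<le> freq_dev T \<omega>"
proof -
  have "\<bar>x ^ k\<bar> \<le> real k + 1" for k
  proof -
    have "\<bar>x ^ k\<bar> \<le> 1" using x by (simp add: power_le_one)
    then show ?thesis by linarith
  qed
  from freq_deviation[where f = "\<lambda>k. x ^ k" and T = T and \<omega> = \<omega>, OF this gY_sums] x show ?thesis by (simp add: ghat_def)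
qed

lemma dghat_deviation:
  assumes x: "x \<in> {0..1}" shows "\<bar>dghat T x \<omega> - dgY x\<bar> \<le> freq_dev T \<omega>"
proof -
  have le: "\<bar>real k * x ^ (k - 1)\<bar> \<le> real k + 1" for k
  proof -
    have "\<bar>x ^ (k - 1)\<bar> \<le> 1" using x by (simp add: power_le_one)
    then have "real k * \<bar>x ^ (k - 1)\<bar> \<le> real k" by (intro mult_left_le) auto
    then show ?thesis by (simp add: abs_mult)
  qed
  have "(\<lambda>k. real k * x ^ (k - 1) * ymass k) sums dgY x" by (rule dgY_sums) (use x in auto)
  from freq_deviation[where f = "\<lambda>k. real k * x ^ (k - 1)" and T = T and \<omega> = \<omega>, OF le this] show ?thesis by (simp add: dghat_def)
qed

lemma ghat_taylor:
  assumes x: "x \<in> {0..1}" and y: "y \<in> {0..1}"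
  shows "\<bar>ghat Y T x \<omega> - ghat Y T y \<omega> - (x - y) * dghat T y \<omega>\<bar> \<le> (x - y)\<^sup>2 * mean_square T \<omega>"
proof -
  have "ghat Y T x \<omega> - ghat Y T y \<omega> - (x - y) * dghat T y \<omega>
     = (\<Sum>t\<in>{1..int T}. x ^ Y t \<omega> - y ^ Y t \<omega> - real (Y t \<omega>) * y ^ (Y t \<omega> - 1) * (x - y)) / real T"
    unfolding ghat_def dghat_def sum_subtractf sum_distrib_right[symmetric]
    by (simp add: diff_divide_distrib)
  also have "\<bar>\<dots>\<bar> \<le> (\<Sum>t\<in>{1..int T}. (real (Y t \<omega>))\<^sup>2 * (x - y)\<^sup>2) / real T"
    unfolding abs_divide abs_of_nat by (intro divide_right_mono order_trans[OF sum_abs] sum_mono power_taylor x y of_nat_0_le_iff)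
  also have "\<dots> = (x - y)\<^sup>2 * mean_square T \<omega>"
    by (simp add: mean_square_def sum_distrib_left sum_divide_distrib mult_ac)
  finally show ?thesis .
qed

text \<open>The test statistic sums from time 1, the process from \<open>q + 1\<close> and, in its
  thinned part, over lagged values. Each change of range drops \<open>q\<close> terms with values in
  the unit interval: times 1 to \<open>q\<close>, or times 1 to \<open>q - 1\<close> together with
  \<open>T\<close>.\<close>

lemma early_terms_bound:
  assumes x: "x \<in> {0..1}" and T: "q < T" and q: "1 \<le> q"
  shows "\<bar>(\<Sum>t\<in>{1..int T}. x ^ Y t \<omega>) - (\<Sum>t\<in>{int q + 1..int T}. x ^ Y t \<omega>)\<bar> \<le> real q"
    and "\<bar>(\<Sum>t\<in>{1..int T}. x ^ Y t \<omega>) - (\<Sum>t\<in>{int q + 1..int T}. x ^ Y (t - 1) \<omega>)\<bar> \<le> real q"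
proof -
  let ?f = "\<lambda>t. x ^ Y t \<omega>"
  have f: "0 \<le> ?f t" "?f t \<le> 1" for t using x by (auto simp: power_le_one)
  have bound: "\<bar>sum ?f S\<bar> \<le> real (card S)" for S
  proof -
    have "sum ?f S \<le> (\<Sum>t\<in>S. 1)" by (rule sum_mono) (rule f)
    moreover have "0 \<le> sum ?f S" by (rule sum_nonneg) (rule f)
    ultimately show ?thesis by simp
  qed
  have "{1..int T} = {1..int q} \<union> {int q + 1..int T}" using T by auto
  then have "sum ?f {1..int T} = sum ?f {1..int q} + sum ?f {int q + 1..int T}"
    by (simp add: sum.union_disjoint)
  then show "\<bar>sum ?f {1..int T} - sum ?f {int q + 1..int T}\<bar> \<le> real q"
    using bound[of "{1..int q}"] by simp
  have "(\<Sum>t\<in>{int q + 1..int T}. ?f (t - 1)) = sum ?f {int q..int T - 1}"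
    by (rule sum.reindex_bij_witness[where i = "\<lambda>t. t + 1" and j = "\<lambda>t. t - 1"]) auto
  moreover have "{1..int T} = ({1..int q - 1} \<union> {int T}) \<union> {int q..int T - 1}" using T q by auto
  then have "sum ?f {1..int T} = sum ?f ({1..int q - 1} \<union> {int T}) + sum ?f {int q..int T - 1}"
    using T by (subst sum.union_disjoint[symmetric]) auto
  moreover have "card ({1..int q - 1} \<union> {int T}) \<le> q"
    using card_Un_le[of "{1..int q - 1}" "{int T}"] q by simp
  ultimately show "\<bar>sum ?f {1..int T} - (\<Sum>t\<in>{int q + 1..int T}. ?f (t - 1))\<bar> \<le> real q"
    using bound[of "{1..int q - 1} \<union> {int T}"] by simp
qed

end

context inar_test
begin

text \<open>The mean value inequality on a ball inside \<open>\<Theta>\<close>, applied to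
  \<open>g u\<close> and, for the second-order bound, to \<open>g u\<close> minus its linear part at
  the true parameter, whose derivative is the difference that the Lipschitz condition
  controls.\<close>

lemma g_lipschitz:
  assumes u: "u \<in> {0..1}" and ball: "cball \<theta> \<bar>\<theta>' - \<theta>\<bar> \<subseteq> \<Theta>" and D2: "\<bar>\<theta>' - \<theta>\<bar> \<le> D2"
  shows "\<bar>g u \<theta>' - g u \<theta>\<bar> \<le> D3 * v u * \<bar>\<theta>' - \<theta>\<bar>"
    and "\<bar>g u \<theta>' - g u \<theta> - (\<theta>' - \<theta>) * dg u\<bar> \<le> D1 * v u * (\<theta>' - \<theta>)\<^sup>2"
proof -
  let ?B = "cball \<theta> \<bar>\<theta>' - \<theta>\<bar>"
  have mem: "\<theta> \<in> ?B" "\<theta>' \<in> ?B" by (simp_all add: dist_real_def abs_minus_commute)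
  have der: "(g u has_field_derivative deriv (g u) z) (at z within ?B)" if "z \<in> ?B" for z
    by (rule has_field_derivative_at_within, rule g_has_derivative[OF u subsetD[OF ball that]])
  have zD: "z \<in> \<Theta>" "\<bar>z - \<theta>\<bar> \<le> D2" "\<bar>z - \<theta>\<bar> \<le> \<bar>\<theta>' - \<theta>\<bar>" if "z \<in> ?B" for z
  proof -
    show "z \<in> \<Theta>" using that ball by blast
    have "dist \<theta> z \<le> \<bar>\<theta>' - \<theta>\<bar>" using that by simp
    then show "\<bar>z - \<theta>\<bar> \<le> \<bar>\<theta>' - \<theta>\<bar>" by (simp add: dist_real_def abs_minus_commute)
    with D2 show "\<bar>z - \<theta>\<bar> \<le> D2" by linarith
  qed
  have "norm (g u \<theta>' - g u \<theta>) \<le> D3 * v u * norm (\<theta>' - \<theta>)"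
    proof (rule field_differentiable_bound[OF convex_cball der _ mem(2,1)])
    fix z assume "z \<in> ?B"
    then show "norm (deriv (g u) z) \<le> D3 * v u" using A2[OF u zD(1,2)] by simp
  qed
  then show "\<bar>g u \<theta>' - g u \<theta>\<bar> \<le> D3 * v u * \<bar>\<theta>' - \<theta>\<bar>" by simp
  let ?\<phi> = "\<lambda>z. g u z - z * dg u"
  have "norm (?\<phi> \<theta>' - ?\<phi> \<theta>) \<le> (D1 * \<bar>\<theta>' - \<theta>\<bar> * v u) * norm (\<theta>' - \<theta>)"
  proof (rule field_differentiable_bound[OF convex_cball _ _ mem(2,1)])
    fix z assume z: "z \<in> ?B"
    show "(?\<phi> has_field_derivative deriv (g u) z - dg u) (at z within ?B)"
      by (rule derivative_eq_intros der[OF z] refl)+ simp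
    have "\<bar>deriv (g u) z - dg u\<bar> \<le> D1 * \<bar>z - \<theta>\<bar> * v u" using A2[OF u zD(1,2)[OF z]] by blast
    also have "\<dots> \<le> D1 * \<bar>\<theta>' - \<theta>\<bar> * v u"
      using D_pos zD(3)[OF z] v_nonneg[OF u] by (intro mult_right_mono mult_left_mono) auto
    finally show "norm (deriv (g u) z - dg u) \<le> D1 * \<bar>\<theta>' - \<theta>\<bar> * v u" by simp
  qed
  also have "?\<phi> \<theta>' - ?\<phi> \<theta> = g u \<theta>' - g u \<theta> - (\<theta>' - \<theta>) * dg u" by (simp add: algebra_simps)
  also have "(D1 * \<bar>\<theta>' - \<theta>\<bar> * v u) * norm (\<theta>' - \<theta>) = D1 * v u * (\<theta>' - \<theta>)\<^sup>2"
  proof -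
    have "(\<theta>' - \<theta>)\<^sup>2 = \<bar>\<theta>' - \<theta>\<bar> * \<bar>\<theta>' - \<theta>\<bar>" by (simp add: power2_eq_square)
    then show ?thesis by (simp only: real_norm_def mult_ac)
  qed
  finally show "\<bar>g u \<theta>' - g u \<theta> - (\<theta>' - \<theta>) * dg u\<bar> \<le> D1 * v u * (\<theta>' - \<theta>)\<^sup>2" by simp
qed

definition Perr :: "nat \<Rightarrow> 'a \<Rightarrow> real" where "Perr T \<omega> = sqrt (real T) * (phat (sample Y T \<omega>) - p)"
definition Qerr :: "nat \<Rightarrow> 'a \<Rightarrow> real" where "Qerr T \<omega> = sqrt (real T) * (thhat (sample Y T \<omega>) - \<theta>)"

text \<open>The random factor of the expansion error, free of \<open>u\<close>. Its first line is a
  numerator bounded in probability over \<open>sqrt (real T)\<close>, its second a factor bounded in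
  probability times \<open>freq_dev\<close>, its third the error in the expansion of the
  estimator.\<close>

definition Rem :: "nat \<Rightarrow> 'a \<Rightarrow> real" where
  "Rem T \<omega> = (2 * real q + (Perr T \<omega>)\<^sup>2 * mean_square T \<omega> + D3 * m1 * \<bar>Perr T \<omega>\<bar> * \<bar>Qerr T \<omega>\<bar> + D1 * (Qerr T \<omega>)\<^sup>2) / sqrt (real T)
     + (\<bar>Perr T \<omega>\<bar> + D3 * \<bar>Qerr T \<omega>\<bar>) * freq_dev T \<omega>
     + m1 * \<bar>Perr T \<omega> - V T \<omega> 0\<bar> + D3 * \<bar>Qerr T \<omega> - V T \<omega> 1\<bar>"

lemma remainder_first_order_p:
  assumes u: "u \<in> {0..1}" and T: "T > 0" and ph: "phat (sample Y T \<omega>) \<in> {0..1}"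
    and th: "cball \<theta> \<bar>thhat (sample Y T \<omega>) - \<theta>\<bar> \<subseteq> \<Theta>" "\<bar>thhat (sample Y T \<omega>) - \<theta>\<bar> \<le> D2"
  shows "\<bar>sqrt (real T) * g u (thhat (sample Y T \<omega>)) * (ghat Y T (1 + phat (sample Y T \<omega>) * (u - 1)) \<omega> - ghat Y T (1 + p * (u - 1)) \<omega>)
        - h1 M g Y u p \<theta> * V T \<omega> 0\<bar>
     \<le> (Perr T \<omega>)\<^sup>2 * mean_square T \<omega> / sqrt (real T) + \<bar>Perr T \<omega>\<bar> * freq_dev T \<omega>
       + D3 * v u * m1 * \<bar>Perr T \<omega>\<bar> * \<bar>Qerr T \<omega>\<bar> / sqrt (real T) + m1 * \<bar>Perr T \<omega> - V T \<omega> 0\<bar>"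
proof -
  define s where "s = sqrt (real T)"
  have s: "s > 0" using T by (simp add: s_def)
  define ph where "ph = phat (sample Y T \<omega>)"
  define th where "th = thhat (sample Y T \<omega>)"
  define P where "P = Perr T \<omega>" define Q where "Q = Qerr T \<omega>"
  define x where "x = 1 + ph * (u - 1)" define x0 where "x0 = 1 + p * (u - 1)"
  define gh where "gh = g u th" define g0 where "g0 = g u \<theta>"
  define da where "da = dghat T x0 \<omega>" define G where "G = dgY x0"
  define r where "r = ghat Y T x \<omega> - ghat Y T x0 \<omega> - (x - x0) * da"
  define V0 where "V0 = V T \<omega> 0"
  have P: "P = s * (ph - p)" and Q: "Q = s * (th - \<theta>)" by (simp_all add: P_def Q_def Perr_def Qerr_def s_def ph_def th_def)
  have sx: "s * (x - x0) = P * (u - 1)" by (simp add: P x_def x0_def algebra_simps)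
  have xin: "x \<in> {0..1}" "x0 \<in> {0..1}"
    using thinned_in_unit[OF u] assms(3) p_unit by (auto simp: x_def x0_def ph_def)
  have th_mem: "th \<in> \<Theta>" using th(1) by (auto simp: th_def dist_real_def abs_minus_commute subset_iff)
  have gh1: "\<bar>gh\<bar> \<le> 1" and g01: "\<bar>g0\<bar> \<le> 1"
    using g_bounds[OF u th_mem] g_bounds[OF u Theta(2)] by (auto simp: gh_def g0_def)
  have u1: "\<bar>u - 1\<bar> \<le> 1" using u by auto
  have G1: "\<bar>G\<bar> \<le> m1" unfolding G_def using xin by (intro dgY_bound) auto
  have da1: "\<bar>da - G\<bar> \<le> freq_dev T \<omega>" unfolding da_def G_def by (rule dghat_deviation) (rule xin)
  have gd: "\<bar>gh - g0\<bar> \<le> D3 * v u * \<bar>Q\<bar> / s"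
  proof -
    have "\<bar>th - \<theta>\<bar> = \<bar>Q\<bar> / s" using s by (simp add: Q abs_mult)
    then show ?thesis using g_lipschitz(1)[OF u th(1,2)] by (simp add: gh_def g0_def th_def)
  qed
  have r1: "\<bar>s * r\<bar> \<le> P\<^sup>2 * mean_square T \<omega> / s"
  proof -
    have "\<bar>r\<bar> \<le> (x - x0)\<^sup>2 * mean_square T \<omega>" unfolding r_def da_def by (rule ghat_taylor) (rule xin)+
    then have "s * \<bar>r\<bar> \<le> s * ((x - x0)\<^sup>2 * mean_square T \<omega>)" using s by (intro mult_left_mono) auto
    also have "\<dots> = (s * (x - x0))\<^sup>2 * mean_square T \<omega> / s" using s by (simp add: power2_eq_square)
    also have "(s * (x - x0))\<^sup>2 \<le> P\<^sup>2"
      unfolding sx power_mult_distrib using u1 by (intro mult_left_le) (auto simp: abs_square_le_1)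
    finally show ?thesis using s mean_square_nonneg[of T \<omega>] by (simp add: abs_mult divide_right_mono mult_right_mono)
  qed
  \<comment> \<open>Four errors, one per term: the Taylor remainder of the empirical function, the
    empirical derivative against \<open>dgY\<close>, the estimated \<open>g\<close> against the true
    one, and the estimation error against its martingale part.\<close>
  have "s * gh * (ghat Y T x \<omega> - ghat Y T x0 \<omega>) - h1 M g Y u p \<theta> * V0
     = gh * (s * r) + gh * (u - 1) * P * (da - G) + (gh - g0) * (u - 1) * P * G + g0 * (u - 1) * G * (P - V0)"
  proof -
    have eq: "ghat Y T x \<omega> - ghat Y T x0 \<omega> = r + (x - x0) * da" by (simp add: r_def)
    have "s * gh * (ghat Y T x \<omega> - ghat Y T x0 \<omega>) = gh * (s * r) + gh * (s * (x - x0)) * da"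
      unfolding eq by (simp add: algebra_simps)
    then have *: "s * gh * (ghat Y T x \<omega> - ghat Y T x0 \<omega>) = gh * (s * r) + gh * (P * (u - 1)) * da"
      unfolding sx .
    show ?thesis unfolding * h1_eq[OF u] x0_def[symmetric] G_def[symmetric] g0_def[symmetric]
      by (simp add: algebra_simps)
  qed
  also have "\<bar>\<dots>\<bar> \<le> \<bar>gh * (s * r)\<bar> + \<bar>gh * (u - 1) * P * (da - G)\<bar> + \<bar>(gh - g0) * (u - 1) * P * G\<bar> + \<bar>g0 * (u - 1) * G * (P - V0)\<bar>"
    by linarith
  also have "\<bar>gh * (s * r)\<bar> \<le> 1 * (P\<^sup>2 * mean_square T \<omega> / s)"
    unfolding abs_mult[of gh] by (intro mult_mono gh1 r1) auto
  also have "\<bar>gh * (u - 1) * P * (da - G)\<bar> \<le> 1 * 1 * \<bar>P\<bar> * freq_dev T \<omega>"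
    unfolding abs_mult using freq_dev_nonneg by (intro mult_mono gh1 u1 da1) auto
  also have "\<bar>(gh - g0) * (u - 1) * P * G\<bar> \<le> (D3 * v u * \<bar>Q\<bar> / s) * 1 * \<bar>P\<bar> * m1"
    unfolding abs_mult using v_nonneg[OF u] D_pos s by (intro mult_mono gd u1 G1) auto
  also have "\<bar>g0 * (u - 1) * G * (P - V0)\<bar> \<le> 1 * 1 * m1 * \<bar>P - V0\<bar>"
    unfolding abs_mult using m1_nonneg by (intro mult_mono g01 u1 G1) auto
  finally show ?thesis
    unfolding s_def ph_def th_def P_def Q_def x_def x0_def gh_def V0_def by (simp add: mult_ac)
qed

lemma remainder_first_order_theta:
  assumes u: "u \<in> {0..1}" and T: "T > 0"
    and th: "cball \<theta> \<bar>thhat (sample Y T \<omega>) - \<theta>\<bar> \<subseteq> \<Theta>" "\<bar>thhat (sample Y T \<omega>) - \<theta>\<bar> \<le> D2"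
  shows "\<bar>sqrt (real T) * (g u (thhat (sample Y T \<omega>)) - g u \<theta>) * ghat Y T (1 + p * (u - 1)) \<omega> - h2 M g Y u p \<theta> * V T \<omega> 1\<bar>
     \<le> D1 * v u * (Qerr T \<omega>)\<^sup>2 / sqrt (real T) + D3 * v u * \<bar>Qerr T \<omega>\<bar> * freq_dev T \<omega> + D3 * v u * \<bar>Qerr T \<omega> - V T \<omega> 1\<bar>"
proof -
  define s where "s = sqrt (real T)"
  have s: "s > 0" using T by (simp add: s_def)
  define th where "th = thhat (sample Y T \<omega>)"
  define Q where "Q = Qerr T \<omega>"
  define x0 where "x0 = 1 + p * (u - 1)"
  define r where "r = g u th - g u \<theta> - (th - \<theta>) * dg u"
  define a where "a = ghat Y T x0 \<omega>" define G where "G = gY x0"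
  define V1 where "V1 = V T \<omega> 1"
  have Q: "Q = s * (th - \<theta>)" by (simp add: Q_def Qerr_def s_def th_def)
  have x0: "x0 \<in> {0..1}" using thinned_in_unit[OF u p_unit] by (simp add: x0_def)
  have a1: "\<bar>a\<bar> \<le> 1" and aG: "\<bar>a - G\<bar> \<le> freq_dev T \<omega>"
    using ghat_bounds[OF x0, of T \<omega>] ghat_deviation[OF x0, of T \<omega>] by (auto simp: a_def G_def)
  have G1: "\<bar>G\<bar> \<le> 1" using pgf_bounds[OF measurable_Y x0] by (auto simp: G_def)
  have v: "v u \<ge> 0" using v_nonneg[OF u] .
  have r1: "\<bar>s * r\<bar> \<le> D1 * v u * Q\<^sup>2 / s"
  proof -
    have "s * \<bar>r\<bar> \<le> s * (D1 * v u * (th - \<theta>)\<^sup>2)"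
      using g_lipschitz(2)[OF u th] s by (intro mult_left_mono) (auto simp: r_def th_def)
    also have "\<dots> = D1 * v u * Q\<^sup>2 / s" using s by (simp add: Q power2_eq_square)
    finally show ?thesis using s by (simp add: abs_mult)
  qed
  \<comment> \<open>Likewise three errors: the Taylor remainder in the parameter, the empirical
    function against \<open>gY\<close>, and the estimation error against its martingale
    part.\<close>
  have "s * (g u th - g u \<theta>) * a - h2 M g Y u p \<theta> * V1 = s * r * a + Q * dg u * (a - G) + dg u * G * (Q - V1)"
  proof -
    have eq: "s * (g u th - g u \<theta>) = s * r + Q * dg u" by (simp add: r_def Q algebra_simps)
    show ?thesis unfolding eq h2_def x0_def[symmetric] G_def[symmetric] by (simp add: algebra_simps)
  qed
  also have "\<bar>\<dots>\<bar> \<le> \<bar>s * r * a\<bar> + \<bar>Q * dg u * (a - G)\<bar> + \<bar>dg u * G * (Q - V1)\<bar>" by linarith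
  also have "\<bar>s * r * a\<bar> \<le> D1 * v u * Q\<^sup>2 / s * 1"
    unfolding abs_mult[of "s * r"] using s v D_pos by (intro mult_mono r1 a1) auto
  also have "\<bar>Q * dg u * (a - G)\<bar> \<le> \<bar>Q\<bar> * (D3 * v u) * freq_dev T \<omega>"
    unfolding abs_mult using v D_pos freq_dev_nonneg by (intro mult_mono dg_bound[OF u] aG) auto
  also have "\<bar>dg u * G * (Q - V1)\<bar> \<le> (D3 * v u) * 1 * \<bar>Q - V1\<bar>"
    unfolding abs_mult using v D_pos by (intro mult_mono dg_bound[OF u] G1) auto
  finally show ?thesis
    unfolding s_def th_def Q_def x0_def a_def V1_def by (simp add: mult_ac)
qed

lemma Z_bar_decomposition:
  "Z_bar M g Y q l1 l2 T u p \<theta> \<omega> = 1 / sqrt (real T) * (\<Sum>t\<in>{int q + 1..int T}. u ^ Y t \<omega>)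
     - g u \<theta> * (1 / sqrt (real T) * (\<Sum>t\<in>{int q + 1..int T}. (1 + p * (u - 1)) ^ Y (t - 1) \<omega>))
     - h1 M g Y u p \<theta> * V T \<omega> 0 - h2 M g Y u p \<theta> * V T \<omega> 1"
proof -
  have "Z_adj M g Y q l1 l2 t u p \<theta> \<omega> = u ^ Y t \<omega> - g u \<theta> * (1 + p * (u - 1)) ^ Y (t - 1) \<omega>
      - h1 M g Y u p \<theta> * X t 0 \<omega> - h2 M g Y u p \<theta> * X t 1 \<omega>" for t
    by (simp add: Z_adj_def Z_inc_def X_simps mult.commute)
  then show ?thesis
    unfolding Z_bar_def V_def by (simp only: sum_subtractf sum_distrib_left[symmetric]) (simp add: right_diff_distrib)
qed

text \<open>The two estimates are exchanged in turn, first in the thinned argument while the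
  estimated \<open>g\<close> is kept, then in \<open>g\<close> with the true argument. The leading
  terms are those of \<open>h1\<close> and \<open>h2\<close>; \<open>E1\<close> and
  \<open>E2\<close> account for the different summation ranges.\<close>

theorem remainder_bound:
  assumes u: "u \<in> {0..1}" and T: "T > q" and ph: "phat (sample Y T \<omega>) \<in> {0..1}"
    and th: "cball \<theta> \<bar>thhat (sample Y T \<omega>) - \<theta>\<bar> \<subseteq> \<Theta>" "\<bar>thhat (sample Y T \<omega>) - \<theta>\<bar> \<le> D2"
  shows "\<bar>sqrt (real T) * (ghat Y T u \<omega> - ghat0 g phat thhat Y T u \<omega>) - Z_bar M g Y q l1 l2 T u p \<theta> \<omega>\<bar> \<le> Rem T \<omega> * (1 + v u)"
proof -
  define s where "s = sqrt (real T)"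
  have T0: "T > 0" using T by simp
  have s: "s > 0" and sT: "s / real T = 1 / s" using T by (auto simp: s_def field_simps)
  define x where "x = 1 + phat (sample Y T \<omega>) * (u - 1)" define x0 where "x0 = 1 + p * (u - 1)"
  define gh where "gh = g u (thhat (sample Y T \<omega>))" define g0 where "g0 = g u \<theta>"
  have x0: "x0 \<in> {0..1}" using thinned_in_unit[OF u p_unit] by (simp add: x0_def)
  have v: "v u \<ge> 0" using v_nonneg[OF u] .
  define E1 where "E1 = s * ghat Y T u \<omega> - 1 / s * (\<Sum>t\<in>{int q + 1..int T}. u ^ Y t \<omega>)"
  define E2 where "E2 = s * ghat Y T x0 \<omega> - 1 / s * (\<Sum>t\<in>{int q + 1..int T}. x0 ^ Y (t - 1) \<omega>)"
  have sg: "s * ghat Y T z \<omega> = 1 / s * (\<Sum>t\<in>{1..int T}. z ^ Y t \<omega>)" for z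
  proof -
    have "s * ghat Y T z \<omega> = s / real T * (\<Sum>t\<in>{1..int T}. z ^ Y t \<omega>)" by (simp add: ghat_def)
    then show ?thesis unfolding sT .
  qed
  have E1: "\<bar>E1\<bar> \<le> real q / s"
    unfolding E1_def sg right_diff_distrib[symmetric] abs_mult using early_terms_bound(1)[OF u T q, of \<omega>] s by (simp add: divide_right_mono)
  have E2: "\<bar>E2\<bar> \<le> real q / s"
    unfolding E2_def sg right_diff_distrib[symmetric] abs_mult using early_terms_bound(2)[OF x0 T q, of \<omega>] s by (simp add: divide_right_mono)
  have g01: "\<bar>g0\<bar> \<le> 1" using g_bounds[OF u Theta(2)] by (auto simp: g0_def)
  have gE2: "\<bar>g0 * E2\<bar> \<le> 1 * (real q / s)" unfolding abs_mult by (intro mult_mono g01 E2) auto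
  define B1 where "B1 = s * gh * (ghat Y T x \<omega> - ghat Y T x0 \<omega>) - h1 M g Y u p \<theta> * V T \<omega> 0"
  define B2 where "B2 = s * (gh - g0) * ghat Y T x0 \<omega> - h2 M g Y u p \<theta> * V T \<omega> 1"
  have "s * (ghat Y T u \<omega> - ghat0 g phat thhat Y T u \<omega>) - Z_bar M g Y q l1 l2 T u p \<theta> \<omega> = E1 - g0 * E2 - B1 - B2"
    unfolding Z_bar_decomposition ghat0_def s_def[symmetric] x_def[symmetric] x0_def[symmetric] gh_def[symmetric] g0_def[symmetric]
      E1_def E2_def B1_def B2_def by (simp add: algebra_simps)
  also have "\<bar>\<dots>\<bar> \<le> \<bar>E1\<bar> + \<bar>g0 * E2\<bar> + \<bar>B1\<bar> + \<bar>B2\<bar>" by linarith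
  also have "\<dots> \<le> real q / s + real q / s
     + ((Perr T \<omega>)\<^sup>2 * mean_square T \<omega> / s + \<bar>Perr T \<omega>\<bar> * freq_dev T \<omega> + D3 * v u * m1 * \<bar>Perr T \<omega>\<bar> * \<bar>Qerr T \<omega>\<bar> / s + m1 * \<bar>Perr T \<omega> - V T \<omega> 0\<bar>)
     + (D1 * v u * (Qerr T \<omega>)\<^sup>2 / s + D3 * v u * \<bar>Qerr T \<omega>\<bar> * freq_dev T \<omega> + D3 * v u * \<bar>Qerr T \<omega> - V T \<omega> 1\<bar>)"
    using remainder_first_order_p[OF u T0 ph th, folded s_def x_def x0_def gh_def] remainder_first_order_theta[OF u T0 th, folded s_def x0_def gh_def g0_def]
      E1 gE2 unfolding B1_def B2_def by linarith
  also have "\<dots> \<le> Rem T \<omega> * (1 + v u)"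
  proof -
    \<comment> \<open>\<open>a\<close> collects the terms without \<open>v u\<close> and
      \<open>b\<close> the coefficients of those with it; as both are nonnegative, the sum
      \<open>a + b\<close> can be pulled out in front of \<open>1 + v u\<close>.\<close>
    define a where "a = real q / s + real q / s + (Perr T \<omega>)\<^sup>2 * mean_square T \<omega> / s + \<bar>Perr T \<omega>\<bar> * freq_dev T \<omega> + m1 * \<bar>Perr T \<omega> - V T \<omega> 0\<bar>"
    define b where "b = D3 * m1 * \<bar>Perr T \<omega>\<bar> * \<bar>Qerr T \<omega>\<bar> / s + D1 * (Qerr T \<omega>)\<^sup>2 / s + D3 * \<bar>Qerr T \<omega>\<bar> * freq_dev T \<omega> + D3 * \<bar>Qerr T \<omega> - V T \<omega> 1\<bar>"
    have a0: "a \<ge> 0" unfolding a_def using s m1_nonneg mean_square_nonneg freq_dev_nonneg by (intro add_nonneg_nonneg mult_nonneg_nonneg divide_nonneg_nonneg) auto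
    have b0: "b \<ge> 0" unfolding b_def using s m1_nonneg D_pos freq_dev_nonneg by (intro add_nonneg_nonneg mult_nonneg_nonneg divide_nonneg_nonneg) auto
    have "Rem T \<omega> = a + b" unfolding Rem_def a_def b_def s_def[symmetric] by (simp add: add_divide_distrib distrib_right)
    moreover have "a + b * v u \<le> (a + b) * (1 + v u)"
    proof -
      have "0 \<le> a * v u" "0 \<le> b * 1" using a0 b0 v by auto
      then show ?thesis by (simp add: algebra_simps)
    qed
    moreover have "a + b * v u = real q / s + real q / s
     + ((Perr T \<omega>)\<^sup>2 * mean_square T \<omega> / s + \<bar>Perr T \<omega>\<bar> * freq_dev T \<omega> + D3 * v u * m1 * \<bar>Perr T \<omega>\<bar> * \<bar>Qerr T \<omega>\<bar> / s + m1 * \<bar>Perr T \<omega> - V T \<omega> 0\<bar>)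
     + (D1 * v u * (Qerr T \<omega>)\<^sup>2 / s + D3 * v u * \<bar>Qerr T \<omega>\<bar> * freq_dev T \<omega> + D3 * v u * \<bar>Qerr T \<omega> - V T \<omega> 1\<bar>)"
      by (simp add: a_def b_def algebra_simps)
    ultimately show ?thesis by simp
  qed
  finally show ?thesis by (simp add: s_def)
qed

end

section \<open>Stochastic order of the remainder terms\<close>

context inar
begin

lemma measurable_sample: "sample Y T \<in> measurable M (count_space UNIV)"
  unfolding sample_def by (rule measurable_map_list) (rule measurable_Y)

lemma sample_eqD:
  assumes "sample Y T \<omega> = sample Y T \<omega>'" "t \<in> {1..int T}" shows "Y t \<omega> = Y t \<omega>'"
  using assms by (auto simp: sample_def)

lemma measurable_mean_square [measurable]: "mean_square T \<in> borel_measurable M"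
  unfolding mean_square_def by measurable

lemma mean_square_bounded: "bounded_in_prob M mean_square"
proof (rule bounded_moment_imp_bounded_in_prob)
  show int: "integrable M (mean_square T)" for T
    unfolding mean_square_def by (intro integrable_divide Bochner_Integration.integrable_sum integrable_Y_square)
  fix T
  have e: "(\<integral>\<omega>. (real (Y t \<omega>))\<^sup>2 \<partial>M) = (\<integral>\<omega>. (real (Y 1 \<omega>))\<^sup>2 \<partial>M)" for t
    using marginal_integral(1)[of "\<lambda>k. (real k)\<^sup>2" t] by simp
  have "(\<integral>\<omega>. mean_square T \<omega> \<partial>M) = (\<Sum>t\<in>{1..int T}. \<integral>\<omega>. (real (Y t \<omega>))\<^sup>2 \<partial>M) / real T"
    unfolding mean_square_def using integrable_Y_square by simp
  also have "(\<Sum>t\<in>{1..int T}. \<integral>\<omega>. (real (Y t \<omega>))\<^sup>2 \<partial>M) = (\<Sum>t\<in>{1..int T}. \<integral>\<omega>. (real (Y 1 \<omega>))\<^sup>2 \<partial>M)"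
    by (rule sum.cong[OF refl e])
  also have "\<dots> / real T = real T * (\<integral>\<omega>. (real (Y 1 \<omega>))\<^sup>2 \<partial>M) / real T" by simp
  also have "\<dots> \<le> (\<integral>\<omega>. (real (Y 1 \<omega>))\<^sup>2 \<partial>M)" by (cases "T = 0") auto
  finally show "(\<integral>\<omega>. \<bar>mean_square T \<omega>\<bar> \<partial>M) \<le> (\<integral>\<omega>. (real (Y 1 \<omega>))\<^sup>2 \<partial>M)"
    using mean_square_nonneg by simp
qed simp

lemma freq_dev_zero: "tends_to_zero_in_prob M freq_dev"
proof (rule L1_imp_zero_in_prob)
  show "\<forall>\<^sub>F T in sequentially. integrable M (freq_dev T)"
    using eventually_gt_at_top[of 0] by eventually_elim (rule integrable_freq_dev)
  show "(\<lambda>T. \<integral>\<omega>. \<bar>freq_dev T \<omega>\<bar> \<partial>M) \<longlonglongrightarrow> 0" using freq_dev_L1 freq_dev_nonneg by simp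
qed simp

lemma inverse_sqrt_zero: "tends_to_zero_in_prob M (\<lambda>T \<omega>. 1 / sqrt (real T))"
  by (rule deterministic_zero_in_prob, rule tendsto_divide_0[OF tendsto_const])
     (auto intro!: filterlim_compose[OF sqrt_at_top filterlim_real_sequentially] filterlim_at_top_imp_at_infinity)

end

context inar_mds
begin

lemma summable_sq_sequence_V: "summable_sq_sequence M (\<lambda>j \<omega>. V T \<omega> j) cc"
proof
  show "sq_int M (\<lambda>\<omega>. V T \<omega> j)" for j
    unfolding sq_int_def by (intro conjI measurable_V V_second_moment)
qed (use V_second_moment cc_nonneg summable_cc summable_V in auto)

text \<open>The l1 norm of the normalised sums, which bounds the process up to a constant and the
  factor \<open>1 + v u\<close>.\<close>

definition VA :: "nat \<Rightarrow> 'a \<Rightarrow> real" where "VA T \<omega> = (\<Sum>j. \<bar>V T \<omega> j\<bar>)"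

lemma VA_nonneg: "VA T \<omega> \<ge> 0"
  unfolding VA_def by (intro suminf_nonneg summable_V) auto

lemma measurable_VA: "VA T \<in> borel_measurable M" and integrable_VA: "integrable M (VA T)"
  and VA_moment: "(\<integral>\<omega>. VA T \<omega> \<partial>M) \<le> suminf cc"
proof -
  have intV: "integrable M (\<lambda>\<omega>. V T \<omega> j)" for j
    by (rule sq_int_imp_integrable[OF prob_space_axioms]) (simp add: sq_int_def V_second_moment)
  have le: "(\<integral>\<omega>. \<bar>V T \<omega> j\<bar> \<partial>M) \<le> cc j" for j
  proof -
    interpret S: summable_sq_sequence M "\<lambda>j \<omega>. V T \<omega> j" cc by (rule summable_sq_sequence_V)
    have "\<bar>\<integral>\<omega>. \<bar>V T \<omega> j\<bar> * 1 \<partial>M\<bar> \<le> sqrt (\<integral>\<omega>. \<bar>V T \<omega> j\<bar>\<^sup>2 \<partial>M) * sqrt (\<integral>\<omega>. 1\<^sup>2 \<partial>M)"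
      by (rule Cauchy_Schwarz_integral) (use V_second_moment measurable_V in \<open>auto simp: sq_int_def\<close>)
    then show ?thesis using S.sqrt_second_moment[of j] by (simp add: prob_space)
  qed
  have s: "summable (\<lambda>j. \<integral>\<omega>. norm \<bar>V T \<omega> j\<bar> \<partial>M)"
    by (rule summable_comparison_test'[OF summable_cc]) (use le in simp)
  have a: "AE \<omega> in M. summable (\<lambda>j. norm \<bar>V T \<omega> j\<bar>)" using summable_V by simp
  show "integrable M (VA T)" unfolding VA_def by (rule integrable_suminf[OF integrable_abs[OF intV] a s])
  then show "VA T \<in> borel_measurable M" by simp
  have "(\<integral>\<omega>. VA T \<omega> \<partial>M) = (\<Sum>j. \<integral>\<omega>. \<bar>V T \<omega> j\<bar> \<partial>M)"
    unfolding VA_def by (rule integral_suminf[OF integrable_abs[OF intV] a s])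
  also have "\<dots> \<le> suminf cc"
    by (rule suminf_le[OF le _ summable_cc]) (use s in simp)
  finally show "(\<integral>\<omega>. VA T \<omega> \<partial>M) \<le> suminf cc" .
qed

lemma VA_bounded: "bounded_in_prob M VA"
  by (rule bounded_moment_imp_bounded_in_prob[where C = "suminf cc"])
     (use measurable_VA integrable_VA VA_moment VA_nonneg in auto)

lemma V_bounded: "bounded_in_prob M (\<lambda>T \<omega>. V T \<omega> j)"
proof (rule bounded_moment_imp_bounded_in_prob[where C = "suminf cc"])
  show int: "integrable M (\<lambda>\<omega>. V T \<omega> j)" for T
    by (rule sq_int_imp_integrable[OF prob_space_axioms]) (simp add: sq_int_def V_second_moment)
  fix T
  have "\<bar>V T \<omega> j\<bar> \<le> VA T \<omega>" for \<omega>
    unfolding VA_def using sum_le_suminf[OF summable_V[of T \<omega>], of "{j}"] by simp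
  then have "(\<integral>\<omega>. \<bar>V T \<omega> j\<bar> \<partial>M) \<le> (\<integral>\<omega>. VA T \<omega> \<partial>M)"
    by (intro integral_mono integrable_abs int integrable_VA)
  with VA_moment[of T] show "(\<integral>\<omega>. \<bar>V T \<omega> j\<bar> \<partial>M) \<le> suminf cc" by linarith
qed simp

end

context inar_test
begin

abbreviation "Zb T u \<omega> \<equiv> Z_bar M g Y q l1 l2 T u p \<theta> \<omega>"
abbreviation "L01 \<equiv> lebesgue_on {0..1::real}"

definition Qstat :: "nat \<Rightarrow> 'a \<Rightarrow> real" where
  "Qstat T \<omega> = (\<integral>u. (Zb T u \<omega>)\<^sup>2 * w u \<partial>L01)"

lemma Zb_sample:
  assumes eq: "sample Y T \<omega> = sample Y T \<omega>'" shows "Zb T u \<omega> = Zb T u \<omega>'"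
proof -
  have "Z_adj M g Y q l1 l2 t u p \<theta> \<omega> = Z_adj M g Y q l1 l2 t u p \<theta> \<omega>'" if t: "t \<in> {int q + 1..int T}" for t
  proof -
    have "Y (t - int k) \<omega> = Y (t - int k) \<omega>'" if "k \<le> q" for k
      by (rule sample_eqD[OF eq]) (use that t in auto)
    then have "lags Y q t \<omega> = lags Y q t \<omega>'" "Y t \<omega> = Y t \<omega>'" "Y (t - 1) \<omega> = Y (t - 1) \<omega>'"
      using q by (auto simp: lags_def simp del: upt_Suc dest: meta_spec[of _ 0] meta_spec[of _ 1])
    then show ?thesis by (simp add: Z_adj_def Z_inc_def)
  qed
  then show ?thesis unfolding Z_bar_def by (intro arg_cong2[where f = times] sum.cong refl)
qed

lemma measurable_Qstat [measurable]: "Qstat T \<in> borel_measurable M"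
proof (rule measurable_factor[OF measurable_sample[of T]])
  fix \<omega> \<omega>' assume eq: "sample Y T \<omega> = sample Y T \<omega>'"
  show "Qstat T \<omega> = Qstat T \<omega>'" unfolding Qstat_def Zb_sample[OF eq] ..
qed simp

lemma measurable_S_stat [measurable]: "S_stat g phat thhat w Y T \<in> borel_measurable M"
proof (rule measurable_factor[OF measurable_sample[of T]])
  fix \<omega> \<omega>' assume eq: "sample Y T \<omega> = sample Y T \<omega>'"
  have "ghat Y T x \<omega> = ghat Y T x \<omega>'" for x
    unfolding ghat_def using sample_eqD[OF eq] by simp
  then show "S_stat g phat thhat w Y T \<omega> = S_stat g phat thhat w Y T \<omega>'"
    by (simp add: S_stat_def ghat0_def eq)
qed simp

lemma measurable_Perr [measurable]: "Perr T \<in> borel_measurable M" and measurable_Qerr [measurable]: "Qerr T \<in> borel_measurable M"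
proof -
  have "(\<lambda>\<omega>. f (sample Y T \<omega>)) \<in> borel_measurable M" for f :: "nat list \<Rightarrow> real"
    by (rule measurable_compose[OF measurable_sample]) simp
  from this[of "\<lambda>xs. sqrt (real T) * (phat xs - p)"] this[of "\<lambda>xs. sqrt (real T) * (thhat xs - \<theta>)"]
  show "Perr T \<in> borel_measurable M" "Qerr T \<in> borel_measurable M" by (simp_all add: Perr_def[abs_def] Qerr_def[abs_def])
qed

lemma Perr_zero: "tends_to_zero_in_prob M (\<lambda>T \<omega>. Perr T \<omega> - V T \<omega> 0)"
  and Qerr_zero: "tends_to_zero_in_prob M (\<lambda>T \<omega>. Qerr T \<omega> - V T \<omega> 1)"
  using A4 by (simp_all add: Perr_def Qerr_def V_def X_simps)

lemma Perr_bounded: "bounded_in_prob M Perr" and Qerr_bounded: "bounded_in_prob M Qerr"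
proof -
  have "bounded_in_prob M (\<lambda>T \<omega>. (Perr T \<omega> - V T \<omega> 0) + V T \<omega> 0)"
    by (intro bounded_in_prob_add zero_imp_bounded_in_prob Perr_zero V_bounded) measurable
  then show "bounded_in_prob M Perr" by simp
  have "bounded_in_prob M (\<lambda>T \<omega>. (Qerr T \<omega> - V T \<omega> 1) + V T \<omega> 1)"
    by (intro bounded_in_prob_add zero_imp_bounded_in_prob Qerr_zero V_bounded) measurable
  then show "bounded_in_prob M Qerr" by simp
qed

lemma measurable_Rem [measurable]: "Rem T \<in> borel_measurable M"
  unfolding Rem_def by measurable

lemma Rem_nonneg: "Rem T \<omega> \<ge> 0"
  unfolding Rem_def using D_pos m1_nonneg mean_square_nonneg freq_dev_nonneg
  by (intro add_nonneg_nonneg mult_nonneg_nonneg divide_nonneg_nonneg) auto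

lemma Rem_zero: "tends_to_zero_in_prob M Rem"
proof -
  note bnd = Perr_bounded Qerr_bounded mean_square_bounded deterministic_bounded_in_prob bounded_in_prob_abs
    bounded_in_prob_add bounded_in_prob_mult
  \<comment> \<open>Squares are written as products so that the closure rule for products
    applies.\<close>
  let ?N = "\<lambda>T \<omega>. 2 * real q + (Perr T \<omega> * Perr T \<omega>) * mean_square T \<omega> + D3 * m1 * \<bar>Perr T \<omega>\<bar> * \<bar>Qerr T \<omega>\<bar> + D1 * (Qerr T \<omega> * Qerr T \<omega>)"
  have N: "bounded_in_prob M ?N" by (intro bnd) measurable
  have P: "bounded_in_prob M (\<lambda>T \<omega>. \<bar>Perr T \<omega>\<bar> + D3 * \<bar>Qerr T \<omega>\<bar>)" by (intro bnd) measurable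
  have z1: "tends_to_zero_in_prob M (\<lambda>T \<omega>. 1 / sqrt (real T) * ?N T \<omega>)"
    by (intro zero_mult_bounded_in_prob inverse_sqrt_zero N) measurable
  have z2: "tends_to_zero_in_prob M (\<lambda>T \<omega>. freq_dev T \<omega> * (\<bar>Perr T \<omega>\<bar> + D3 * \<bar>Qerr T \<omega>\<bar>))"
    by (intro zero_mult_bounded_in_prob freq_dev_zero P) measurable
  have z3: "tends_to_zero_in_prob M (\<lambda>T \<omega>. \<bar>Perr T \<omega> - V T \<omega> 0\<bar> * m1)"
    by (intro zero_mult_bounded_in_prob zero_in_prob_abs Perr_zero deterministic_bounded_in_prob) measurable
  have z4: "tends_to_zero_in_prob M (\<lambda>T \<omega>. \<bar>Qerr T \<omega> - V T \<omega> 1\<bar> * D3)"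
    by (intro zero_mult_bounded_in_prob zero_in_prob_abs Qerr_zero deterministic_bounded_in_prob) measurable
  have "tends_to_zero_in_prob M (\<lambda>T \<omega>. 1 / sqrt (real T) * ?N T \<omega> + freq_dev T \<omega> * (\<bar>Perr T \<omega>\<bar> + D3 * \<bar>Qerr T \<omega>\<bar>)
      + \<bar>Perr T \<omega> - V T \<omega> 0\<bar> * m1 + \<bar>Qerr T \<omega> - V T \<omega> 1\<bar> * D3)"
    by (intro zero_in_prob_add z1 z2 z3 z4) measurable
  moreover have "(\<lambda>T \<omega>. 1 / sqrt (real T) * ?N T \<omega> + freq_dev T \<omega> * (\<bar>Perr T \<omega>\<bar> + D3 * \<bar>Qerr T \<omega>\<bar>)
      + \<bar>Perr T \<omega> - V T \<omega> 0\<bar> * m1 + \<bar>Qerr T \<omega> - V T \<omega> 1\<bar> * D3) = Rem"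
    by (intro ext) (simp add: Rem_def power2_eq_square mult.commute)
  ultimately show ?thesis by simp
qed

definition delta :: real where "delta = (SOME d. d > 0 \<and> d \<le> D2 \<and> cball \<theta> d \<subseteq> \<Theta>)"

lemma delta: "delta > 0" "delta \<le> D2" "cball \<theta> delta \<subseteq> \<Theta>"
proof -
  obtain d where "d > 0" "cball \<theta> d \<subseteq> \<Theta>" using Theta open_contains_cball by blast
  then have "min d D2 > 0 \<and> min d D2 \<le> D2 \<and> cball \<theta> (min d D2) \<subseteq> \<Theta>" using D_pos by auto
  then have "delta > 0 \<and> delta \<le> D2 \<and> cball \<theta> delta \<subseteq> \<Theta>" unfolding delta_def by (rule someI)
  then show "delta > 0" "delta \<le> D2" "cball \<theta> delta \<subseteq> \<Theta>" by auto
qed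

text \<open>On this event the estimated thinning argument stays in the unit interval, and a ball
  reaching the estimated parameter lies in the region where the derivative bounds hold.\<close>

definition good :: "nat \<Rightarrow> 'a \<Rightarrow> bool" where
  "good T \<omega> \<longleftrightarrow> phat (sample Y T \<omega>) \<in> {0..1} \<and> \<bar>thhat (sample Y T \<omega>) - \<theta>\<bar> \<le> delta"

lemma measurable_bad [measurable]: "{\<omega> \<in> space M. \<not> good T \<omega>} \<in> sets M"
proof -
  have "{\<omega> \<in> space M. \<not> good T \<omega>} = sample Y T -` {xs. \<not> (phat xs \<in> {0..1} \<and> \<bar>thhat xs - \<theta>\<bar> \<le> delta)} \<inter> space M"
    by (auto simp: good_def)
  moreover have "\<dots> \<in> sets M" by (rule measurable_sets[OF measurable_sample]) simp
  ultimately show ?thesis by (simp only:)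
qed

lemma good_tendsto: "(\<lambda>T. prob {\<omega> \<in> space M. \<not> good T \<omega>}) \<longlonglongrightarrow> 0"
proof -
  \<comment> \<open>An estimate closer to \<open>p\<close> than \<open>p\<close> is to either end of
    the unit interval lies in that interval.\<close>
  let ?m = "min p (1 - p)"
  have zP: "tends_to_zero_in_prob M (\<lambda>T \<omega>. 1 / sqrt (real T) * Perr T \<omega>)" and zQ: "tends_to_zero_in_prob M (\<lambda>T \<omega>. 1 / sqrt (real T) * Qerr T \<omega>)"
    by (intro zero_mult_bounded_in_prob inverse_sqrt_zero Perr_bounded Qerr_bounded; measurable)+
  have m: "?m > 0" using p by simp
  have "(\<lambda>T. prob {\<omega> \<in> space M. \<bar>1 / sqrt (real T) * Perr T \<omega>\<bar> \<ge> ?m} + prob {\<omega> \<in> space M. \<bar>1 / sqrt (real T) * Qerr T \<omega>\<bar> \<ge> delta}) \<longlonglongrightarrow> 0 + 0"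
    using zP zQ m delta(1) unfolding tends_to_zero_in_prob_def by (intro tendsto_add) blast+
  then have lim: "(\<lambda>T. prob {\<omega> \<in> space M. \<bar>1 / sqrt (real T) * Perr T \<omega>\<bar> \<ge> ?m} + prob {\<omega> \<in> space M. \<bar>1 / sqrt (real T) * Qerr T \<omega>\<bar> \<ge> delta}) \<longlonglongrightarrow> 0"
    by simp
  show ?thesis
  proof (rule tendsto_sandwich[OF _ _ tendsto_const lim])
    show "\<forall>\<^sub>F T in sequentially. 0 \<le> prob {\<omega> \<in> space M. \<not> good T \<omega>}" by simp
    show "\<forall>\<^sub>F T in sequentially. prob {\<omega> \<in> space M. \<not> good T \<omega>} \<le> prob {\<omega> \<in> space M. \<bar>1 / sqrt (real T) * Perr T \<omega>\<bar> \<ge> ?m} + prob {\<omega> \<in> space M. \<bar>1 / sqrt (real T) * Qerr T \<omega>\<bar> \<ge> delta}"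
      using eventually_gt_at_top[of 0]
    proof eventually_elim
      case (elim T)
      have e: "1 / sqrt (real T) * Perr T \<omega> = phat (sample Y T \<omega>) - p" "1 / sqrt (real T) * Qerr T \<omega> = thhat (sample Y T \<omega>) - \<theta>" for \<omega>
        using elim by (simp_all add: Perr_def Qerr_def)
      have sub: "{\<omega> \<in> space M. \<not> good T \<omega>} \<subseteq> {\<omega> \<in> space M. \<bar>1 / sqrt (real T) * Perr T \<omega>\<bar> \<ge> ?m} \<union> {\<omega> \<in> space M. \<bar>1 / sqrt (real T) * Qerr T \<omega>\<bar> \<ge> delta}"
      proof
        fix \<omega> assume a: "\<omega> \<in> {\<omega> \<in> space M. \<not> good T \<omega>}"
        have "\<bar>phat (sample Y T \<omega>) - p\<bar> \<ge> ?m \<or> \<bar>thhat (sample Y T \<omega>) - \<theta>\<bar> \<ge> delta"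
          using a by (auto simp: good_def min_def abs_if)
        then show "\<omega> \<in> {\<omega> \<in> space M. \<bar>1 / sqrt (real T) * Perr T \<omega>\<bar> \<ge> ?m} \<union> {\<omega> \<in> space M. \<bar>1 / sqrt (real T) * Qerr T \<omega>\<bar> \<ge> delta}"
          using a unfolding e by blast
      qed
      have mP: "{\<omega> \<in> space M. \<bar>1 / sqrt (real T) * Perr T \<omega>\<bar> \<ge> ?m} \<in> sets M" and mQ: "{\<omega> \<in> space M. \<bar>1 / sqrt (real T) * Qerr T \<omega>\<bar> \<ge> delta} \<in> sets M"
        by measurable
      show ?case
        by (rule order_trans[OF finite_measure_mono[OF sub sets.Un[OF mP mQ]] measure_Un_le[OF mP mQ]])
    qed
  qed
qed

lemma measurable_Zb: "(\<lambda>u. Zb T u \<omega>) \<in> borel_measurable L01"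
proof -
  have "(\<lambda>u. \<Sum>j. coef u j * V T \<omega> j) \<in> borel_measurable L01"
    by (intro borel_measurable_suminf borel_measurable_times measurable_coef borel_measurable_const)
  then show ?thesis by (rule measurable_cong[THEN iffD1, rotated]) (use Z_bar_sums in \<open>auto simp: sums_iff\<close>)
qed

lemma coef_series_bound:
  assumes u: "u \<in> {0..1}" and x: "summable (\<lambda>j. \<bar>x j\<bar>)"
  shows "summable (\<lambda>j. coef u j * x j)" "\<bar>\<Sum>j. coef u j * x j\<bar> \<le> K0 * (1 + v u) * (\<Sum>j. \<bar>x j\<bar>)"
proof -
  have le: "\<bar>coef u j * x j\<bar> \<le> K0 * (1 + v u) * \<bar>x j\<bar>" for j
    unfolding abs_mult using coef_bound[OF u] by (intro mult_right_mono) auto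
  have sx: "summable (\<lambda>j. K0 * (1 + v u) * \<bar>x j\<bar>)" by (intro summable_mult x)
  have sa: "summable (\<lambda>j. \<bar>coef u j * x j\<bar>)" by (rule summable_comparison_test'[OF sx]) (use le in simp)
  then show "summable (\<lambda>j. coef u j * x j)" by (rule summable_rabs_cancel)
  have "\<bar>\<Sum>j. coef u j * x j\<bar> \<le> (\<Sum>j. \<bar>coef u j * x j\<bar>)" by (rule summable_rabs[OF sa])
  also have "\<dots> \<le> (\<Sum>j. K0 * (1 + v u) * \<bar>x j\<bar>)" by (rule suminf_le[OF le sa sx])
  also have "\<dots> = K0 * (1 + v u) * (\<Sum>j. \<bar>x j\<bar>)" by (rule suminf_mult[OF x])
  finally show "\<bar>\<Sum>j. coef u j * x j\<bar> \<le> K0 * (1 + v u) * (\<Sum>j. \<bar>x j\<bar>)" .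
qed

lemma Zb_bound: "u \<in> {0..1} \<Longrightarrow> \<bar>Zb T u \<omega>\<bar> \<le> K0 * (1 + v u) * VA T \<omega>"
  using coef_series_bound(2)[OF _ summable_V[of T \<omega>], of u] Z_bar_sums[of u T \<omega>] by (simp add: VA_def sums_iff)

text \<open>Finite by the integrability of \<open>w\<close> and of
  \<open>w u * (v u)\<^sup>2\<close>; it turns pointwise bounds with the factor
  \<open>1 + v u\<close> into bounds for the weighted integral of the square.\<close>

definition kap :: real where "kap = (\<integral>u. (1 + v u)\<^sup>2 * w u \<partial>L01)"

lemma integrable_weight: "integrable L01 (\<lambda>u. (1 + v u)\<^sup>2 * w u)"
proof (rule Bochner_Integration.integrable_bound)
  show "integrable L01 (\<lambda>u. 2 * w u + 2 * (w u * (v u)\<^sup>2))" using w_integrable wv_integrable by simp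
  show "(\<lambda>u. (1 + v u)\<^sup>2 * w u) \<in> borel_measurable L01" using v_measurable w_measurable by measurable
  show "AE u in L01. norm ((1 + v u)\<^sup>2 * w u) \<le> norm (2 * w u + 2 * (w u * (v u)\<^sup>2))"
  proof (rule AE_I2)
    fix u assume "u \<in> space L01"
    then have u: "u \<in> {0..1}" by simp
    have "(1 + v u)\<^sup>2 \<le> 2 + 2 * (v u)\<^sup>2"
      using sum_squares_bound[of 1 "v u"] by (simp add: power2_eq_square algebra_simps)
    then have "(1 + v u)\<^sup>2 * w u \<le> (2 + 2 * (v u)\<^sup>2) * w u" by (intro mult_right_mono w_nonneg u)
    then show "norm ((1 + v u)\<^sup>2 * w u) \<le> norm (2 * w u + 2 * (w u * (v u)\<^sup>2))"
      using w_nonneg[OF u] by (simp add: algebra_simps)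
  qed
qed

lemma kap_nonneg: "kap \<ge> 0"
  unfolding kap_def by (intro Bochner_Integration.integral_nonneg mult_nonneg_nonneg w_nonneg) auto

lemma integrable_weighted_square:
  assumes f: "f \<in> borel_measurable L01" and b: "\<And>u. u \<in> {0..1} \<Longrightarrow> \<bar>f u\<bar> \<le> C * (1 + v u)"
  shows "integrable L01 (\<lambda>u. (f u)\<^sup>2 * w u)" "(\<integral>u. (f u)\<^sup>2 * w u \<partial>L01) \<le> C\<^sup>2 * kap"
proof -
  have le: "(f u)\<^sup>2 * w u \<le> C\<^sup>2 * ((1 + v u)\<^sup>2 * w u)" if u: "u \<in> {0..1}" for u
  proof -
    have "\<bar>f u\<bar>\<^sup>2 \<le> (C * (1 + v u))\<^sup>2" by (rule power_mono[OF b[OF u]]) simp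
    then have "(f u)\<^sup>2 * w u \<le> (C * (1 + v u))\<^sup>2 * w u" by (intro mult_right_mono w_nonneg u) simp
    then show ?thesis by (simp add: power_mult_distrib mult.assoc)
  qed
  have int: "integrable L01 (\<lambda>u. C\<^sup>2 * ((1 + v u)\<^sup>2 * w u))" using integrable_weight by simp
  show i: "integrable L01 (\<lambda>u. (f u)\<^sup>2 * w u)"
  proof (rule Bochner_Integration.integrable_bound[OF int])
    show "(\<lambda>u. (f u)\<^sup>2 * w u) \<in> borel_measurable L01" using f w_measurable by measurable
    show "AE u in L01. norm ((f u)\<^sup>2 * w u) \<le> norm (C\<^sup>2 * ((1 + v u)\<^sup>2 * w u))"
      using le w_nonneg by (intro AE_I2) (auto simp: abs_mult)
  qed
  have "(\<integral>u. (f u)\<^sup>2 * w u \<partial>L01) \<le> (\<integral>u. C\<^sup>2 * ((1 + v u)\<^sup>2 * w u) \<partial>L01)"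
    by (rule integral_mono[OF i int]) (use le in auto)
  then show "(\<integral>u. (f u)\<^sup>2 * w u \<partial>L01) \<le> C\<^sup>2 * kap" by (simp add: kap_def)
qed

text \<open>A difference of squares is the difference, small by the remainder bound, times the sum,
  which is at most twice the bound of the process plus the remainder. The two factors
  \<open>1 + v u\<close> multiply to a square and integrate to \<open>kap\<close>.\<close>

lemma S_Q_difference:
  assumes T: "T > q" and good: "good T \<omega>" and \<omega>: "\<omega> \<in> space M"
  shows "\<bar>S_stat g phat thhat w Y T \<omega> - Qstat T \<omega>\<bar> \<le> Rem T \<omega> * ((2 * K0 * VA T \<omega> + Rem T \<omega>) * kap)"
proof -
  let ?R = "Rem T \<omega>" and ?B = "K0 * VA T \<omega>"
  define s where "s = sqrt (real T)"
  define a where "a = (\<lambda>u. s * (ghat Y T u \<omega> - ghat0 g phat thhat Y T u \<omega>))"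
  have th_mem: "thhat (sample Y T \<omega>) \<in> \<Theta>" using estimator T \<omega> by simp
  have gd: "\<bar>thhat (sample Y T \<omega>) - \<theta>\<bar> \<le> delta" using good by (simp add: good_def)
  have ball: "cball \<theta> \<bar>thhat (sample Y T \<omega>) - \<theta>\<bar> \<subseteq> \<Theta>" "\<bar>thhat (sample Y T \<omega>) - \<theta>\<bar> \<le> D2"
    by (rule subset_trans[OF subset_cball[OF gd] delta(3)]) (rule order_trans[OF gd delta(2)])
  have diff: "\<bar>a u - Zb T u \<omega>\<bar> \<le> ?R * (1 + v u)" if "u \<in> {0..1}" for u
    unfolding a_def s_def by (rule remainder_bound[OF that T _ ball]) (use good in \<open>simp add: good_def\<close>)
  have R0: "?R \<ge> 0" by (rule Rem_nonneg)
  have B0: "?B \<ge> 0" using K0_pos VA_nonneg by simp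
  have Zbd: "\<bar>Zb T u \<omega>\<bar> \<le> ?B * (1 + v u)" if "u \<in> {0..1}" for u using Zb_bound[OF that, of T \<omega>] by (simp add: mult_ac)
  have abd: "\<bar>a u\<bar> \<le> (?B + ?R) * (1 + v u)" if "u \<in> {0..1}" for u
    using diff[OF that] Zbd[OF that] unfolding distrib_right[of ?B ?R] by linarith
  have ghat_cont: "continuous_on {0..1} (\<lambda>u. ghat Y T (f u) \<omega>)" if "continuous_on {0..1} f" for f
    unfolding ghat_def by (intro continuous_on_mult_left continuous_on_sum continuous_on_power that)
  have "continuous_on {0..1} a"
    unfolding a_def ghat0_def
    by (intro continuous_on_mult_left continuous_on_diff continuous_on_mult continuous_on_add continuous_on_const
          continuous_on_id ghat_cont continuous_on_g th_mem)
  then have am: "a \<in> borel_measurable L01" by (rule measurable_continuous_unit)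
  note ia = integrable_weighted_square(1)[OF am abd] and iz = integrable_weighted_square(1)[OF measurable_Zb Zbd]
  have "S_stat g phat thhat w Y T \<omega> = (\<integral>u. (a u)\<^sup>2 * w u \<partial>L01)"
  proof -
    have "(\<integral>u. (a u)\<^sup>2 * w u \<partial>L01) = (\<integral>u. real T * ((ghat Y T u \<omega> - ghat0 g phat thhat Y T u \<omega>)\<^sup>2 * w u) \<partial>L01)"
      by (simp add: a_def s_def power_mult_distrib mult.assoc)
    then show ?thesis by (simp add: S_stat_def)
  qed
  then have eq: "S_stat g phat thhat w Y T \<omega> - Qstat T \<omega> = (\<integral>u. (a u)\<^sup>2 * w u - (Zb T u \<omega>)\<^sup>2 * w u \<partial>L01)"
    unfolding Qstat_def by (simp only: Bochner_Integration.integral_diff[OF ia iz])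
  have "\<bar>S_stat g phat thhat w Y T \<omega> - Qstat T \<omega>\<bar> \<le> (\<integral>u. \<bar>(a u)\<^sup>2 * w u - (Zb T u \<omega>)\<^sup>2 * w u\<bar> \<partial>L01)"
    unfolding eq by (rule integral_abs_bound)
  also have "\<dots> \<le> (\<integral>u. ?R * (2 * ?B + ?R) * ((1 + v u)\<^sup>2 * w u) \<partial>L01)"
  proof (rule integral_mono)
    show "integrable L01 (\<lambda>u. \<bar>(a u)\<^sup>2 * w u - (Zb T u \<omega>)\<^sup>2 * w u\<bar>)"
      by (intro integrable_abs Bochner_Integration.integrable_diff ia iz)
    show "integrable L01 (\<lambda>u. ?R * (2 * ?B + ?R) * ((1 + v u)\<^sup>2 * w u))"
      by (intro integrable_mult_right integrable_weight)
    fix u assume "u \<in> space L01"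
    then have u: "u \<in> {0..1}" by simp
    have "\<bar>(a u)\<^sup>2 * w u - (Zb T u \<omega>)\<^sup>2 * w u\<bar> = \<bar>a u - Zb T u \<omega>\<bar> * \<bar>a u + Zb T u \<omega>\<bar> * w u"
    proof -
      have "(a u)\<^sup>2 * w u - (Zb T u \<omega>)\<^sup>2 * w u = (a u - Zb T u \<omega>) * (a u + Zb T u \<omega>) * w u"
        by (simp add: power2_eq_square algebra_simps)
      then show ?thesis using w_nonneg[OF u] by (simp only: abs_mult abs_of_nonneg)
    qed
    also have "\<dots> \<le> (?R * (1 + v u)) * ((2 * ?B + ?R) * (1 + v u)) * w u"
    proof (intro mult_right_mono mult_mono diff[OF u] w_nonneg[OF u])
      show "\<bar>a u + Zb T u \<omega>\<bar> \<le> (2 * ?B + ?R) * (1 + v u)"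
      proof -
        have "(2 * ?B + ?R) * (1 + v u) = (?B + ?R) * (1 + v u) + ?B * (1 + v u)" by (simp add: algebra_simps)
        then show ?thesis using abd[OF u] Zbd[OF u] by linarith
      qed
      show "0 \<le> ?R * (1 + v u)" using R0 v_nonneg[OF u] by simp
    qed auto
    also have "\<dots> = ?R * (2 * ?B + ?R) * ((1 + v u)\<^sup>2 * w u)" by (simp add: power2_eq_square mult_ac)
    finally show "\<bar>(a u)\<^sup>2 * w u - (Zb T u \<omega>)\<^sup>2 * w u\<bar> \<le> ?R * (2 * ?B + ?R) * ((1 + v u)\<^sup>2 * w u)" .
  qed
  also have "\<dots> = ?R * ((2 * K0 * VA T \<omega> + ?R) * kap)" by (simp add: kap_def mult.assoc)
  finally show ?thesis .
qed

theorem S_Q_zero: "tends_to_zero_in_prob M (\<lambda>T \<omega>. S_stat g phat thhat w Y T \<omega> - Qstat T \<omega>)"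
proof (rule zero_in_prob_le[OF _ good_tendsto])
  have [measurable]: "VA T \<in> borel_measurable M" for T by (rule measurable_VA)
  have "bounded_in_prob M (\<lambda>T \<omega>. (2 * K0 * VA T \<omega> + Rem T \<omega>) * kap)"
    by (intro bounded_in_prob_mult bounded_in_prob_add VA_bounded zero_imp_bounded_in_prob Rem_zero deterministic_bounded_in_prob) measurable
  then show "tends_to_zero_in_prob M (\<lambda>T \<omega>. Rem T \<omega> * ((2 * K0 * VA T \<omega> + Rem T \<omega>) * kap))"
    by (intro zero_mult_bounded_in_prob Rem_zero) measurable
  show "\<forall>\<^sub>F T in sequentially. \<forall>\<omega>\<in>space M. good T \<omega> \<longrightarrow>
      \<bar>S_stat g phat thhat w Y T \<omega> - Qstat T \<omega>\<bar> \<le> \<bar>Rem T \<omega> * ((2 * K0 * VA T \<omega> + Rem T \<omega>) * kap)\<bar>"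
    using eventually_gt_at_top[of q]
  proof eventually_elim
    case (elim T)
    then show ?case using S_Q_difference by (meson abs_ge_self order_trans)
  qed
  show "(\<lambda>\<omega>. Rem T \<omega> * ((2 * K0 * VA T \<omega> + Rem T \<omega>) * kap)) \<in> borel_measurable M" for T by measurable
qed measurable

end

section \<open>The Gaussian limit\<close>

lemma integral_linear_combination_square:
  assumes f: "\<And>j. sq_int M (f j)"
  shows "(\<integral>\<omega>. (\<Sum>j<n. s j * f j \<omega>)\<^sup>2 \<partial>M) = (\<Sum>i<n. \<Sum>j<n. s i * s j * (\<integral>\<omega>. f i \<omega> * f j \<omega> \<partial>M))"
proof -
  have int: "integrable M (\<lambda>\<omega>. s i * s j * (f i \<omega> * f j \<omega>))" for i j
    by (intro integrable_mult_right sq_int_mult f)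
  have "(\<integral>\<omega>. (\<Sum>j<n. s j * f j \<omega>)\<^sup>2 \<partial>M) = (\<integral>\<omega>. (\<Sum>i<n. \<Sum>j<n. s i * s j * (f i \<omega> * f j \<omega>)) \<partial>M)"
    by (simp add: power2_eq_square sum_product mult_ac)
  also have "\<dots> = (\<Sum>i<n. \<Sum>j<n. \<integral>\<omega>. s i * s j * (f i \<omega> * f j \<omega>) \<partial>M)"
    using int by (simp add: Bochner_Integration.integral_sum Bochner_Integration.integrable_sum)
  finally show ?thesis by simp
qed

text \<open>The first absolute moments are at most \<open>c j\<close>, so the Gaussian sequence is
  absolutely summable almost surely. Setting it to zero on the exceptional null set makes this hold
  everywhere and changes no integral.\<close>

lemma gaussian_summable_sequence:
  assumes x: "\<And>j. sq_int M (x j)" and c: "\<And>j. c j = sqrt (\<integral>\<omega>. (x j \<omega>)\<^sup>2 \<partial>M)" "summable c"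
  obtains W :: "nat \<Rightarrow> (real \<Rightarrow> real) \<Rightarrow> real" where
    "summable_sq_sequence gauss_space W c"
    "\<And>j. (\<integral>y. W j y \<partial>gauss_space) = 0"
    "\<And>i j. (\<integral>y. W i y * W j y \<partial>gauss_space) = (\<integral>\<omega>. x i \<omega> * x j \<omega> \<partial>M)"
    "\<And>n s. (\<integral>y. iexp (\<Sum>j<n. s j * W j y) \<partial>gauss_space) = of_real (exp (- (\<integral>\<omega>. (\<Sum>j<n. s j * x j \<omega>)\<^sup>2 \<partial>M) / 2))"
proof -
  interpret prob_space gauss_space by (rule prob_space_gauss_space)
  obtain G where sqG: "\<And>j. sq_int gauss_space (G j)" and G:
    "\<And>j. (\<integral>y. G j y \<partial>gauss_space) = 0"
    "\<And>i j. (\<integral>y. G i y * G j y \<partial>gauss_space) = (\<integral>\<omega>. x i \<omega> * x j \<omega> \<partial>M)"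
    "\<And>n s. (\<integral>y. iexp (\<Sum>j<n. s j * G j y) \<partial>gauss_space) = of_real (exp (- (\<integral>\<omega>. (\<Sum>j<n. s j * x j \<omega>)\<^sup>2 \<partial>M) / 2))"
    using gaussian_sequence[of M x, OF x] by blast
  have c0: "c j \<ge> 0" for j by (simp add: c)
  have c2: "(c j)\<^sup>2 = (\<integral>\<omega>. (x j \<omega>)\<^sup>2 \<partial>M)" for j by (simp add: c)
  have G2: "(\<integral>y. (G j y)\<^sup>2 \<partial>gauss_space) = (c j)\<^sup>2" for j
    using G(2)[of j j] unfolding c2 unfolding power2_eq_square .
  have mG [measurable]: "G j \<in> borel_measurable gauss_space" for j using sqG by (simp add: sq_int_def)
  define S where "S = {y \<in> space gauss_space. (\<Sum>j. ennreal \<bar>G j y\<bar>) \<noteq> top}"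
  have [measurable]: "S \<in> sets gauss_space" unfolding S_def by measurable
  have summ: "summable (\<lambda>j. \<bar>G j y\<bar>)" if "y \<in> S" for y
    by (rule summable_suminf_not_top) (use that in \<open>auto simp: S_def\<close>)
  have "(\<integral>\<^sup>+y. (\<Sum>j. ennreal \<bar>G j y\<bar>) \<partial>gauss_space) = (\<Sum>j. \<integral>\<^sup>+y. ennreal \<bar>G j y\<bar> \<partial>gauss_space)"
    by (rule nn_integral_suminf) measurable
  also have "\<dots> \<le> (\<Sum>j. ennreal (c j))"
  proof (rule suminf_le)
    fix j
    have "integrable gauss_space (G j)" by (rule sq_int_imp_integrable[OF prob_space_axioms sqG])
    then have "(\<integral>\<^sup>+y. ennreal \<bar>G j y\<bar> \<partial>gauss_space) = ennreal (\<integral>y. \<bar>G j y\<bar> \<partial>gauss_space)"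
      by (intro nn_integral_eq_integral integrable_abs) auto
    also have "\<dots> \<le> ennreal (c j)"
      by (intro ennreal_leI abs_moment_le) (use sqG G2 c0 in \<open>auto simp: sq_int_def\<close>)
    finally show "(\<integral>\<^sup>+y. ennreal \<bar>G j y\<bar> \<partial>gauss_space) \<le> ennreal (c j)" .
  qed auto
  finally have "(\<integral>\<^sup>+y. (\<Sum>j. ennreal \<bar>G j y\<bar>) \<partial>gauss_space) \<noteq> \<infinity>"
    using ennreal_suminf_neq_top[OF c(2) c0] by (auto simp: top_unique)
  then have "AE y in gauss_space. (\<Sum>j. ennreal \<bar>G j y\<bar>) \<noteq> \<infinity>"
    by (rule nn_integral_PInf_AE[rotated]) measurable
  then have AES: "AE y in gauss_space. y \<in> S" by (rule AE_mp) (auto simp: S_def)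
  define W where "W = (\<lambda>j y. if y \<in> S then G j y else 0)"
  have mW [measurable]: "W j \<in> borel_measurable gauss_space" for j unfolding W_def by measurable
  have WG: "AE y in gauss_space. \<forall>j. W j y = G j y" using AES by eventually_elim (simp add: W_def)
  show ?thesis
  proof (rule that[of W])
    show "(\<integral>y. W j y \<partial>gauss_space) = 0" for j
      using WG by (subst G(1)[of j, symmetric], intro integral_cong_AE) auto
    show "(\<integral>y. W i y * W j y \<partial>gauss_space) = (\<integral>\<omega>. x i \<omega> * x j \<omega> \<partial>M)" for i j
      using WG by (subst G(2)[of i j, symmetric], intro integral_cong_AE) auto
    show "(\<integral>y. iexp (\<Sum>j<n. s j * W j y) \<partial>gauss_space) = of_real (exp (- (\<integral>\<omega>. (\<Sum>j<n. s j * x j \<omega>)\<^sup>2 \<partial>M) / 2))" for n s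
      using WG by (subst G(3)[of s n, symmetric], intro integral_cong_AE) auto
    show "summable_sq_sequence gauss_space W c"
    proof
      show sq: "sq_int gauss_space (W j)" for j
      proof -
        have "integrable gauss_space (\<lambda>y. (W j y)\<^sup>2) \<longleftrightarrow> integrable gauss_space (\<lambda>y. (G j y)\<^sup>2)"
          using WG by (intro integrable_cong_AE) auto
        then show ?thesis using sqG[of j] by (simp add: sq_int_def)
      qed
      have "(\<integral>y. (W j y)\<^sup>2 \<partial>gauss_space) = (c j)\<^sup>2" for j
        using WG by (subst G2[of j, symmetric], intro integral_cong_AE) auto
      then show "(\<integral>y. (W j y)\<^sup>2 \<partial>gauss_space) \<le> (c j)\<^sup>2" for j by simp
      show "summable (\<lambda>j. \<bar>W j y\<bar>)" for y using summ[of y] by (cases "y \<in> S") (auto simp: W_def)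
    qed (use c0 c(2) in auto)
  qed
qed

locale inar_limit = inar_test M p Y U eps \<theta> q l1 l2 g \<Theta> v w D1 D2 D3 phat thhat
  for M :: "'a measure" and p :: real and Y :: "int \<Rightarrow> 'a \<Rightarrow> nat" and U :: "int \<Rightarrow> nat \<Rightarrow> 'a \<Rightarrow> nat" and eps :: "int \<Rightarrow> 'a \<Rightarrow> nat"
    and \<theta> :: real and q :: nat and l1 l2 :: "nat list \<Rightarrow> real \<times> real \<Rightarrow> real"
    and g :: "real \<Rightarrow> real \<Rightarrow> real" and \<Theta> :: "real set" and v w :: "real \<Rightarrow> real" and D1 D2 D3 :: real
    and phat thhat :: "nat list \<Rightarrow> real" +
  fixes N :: "'c measure" and W :: "nat \<Rightarrow> 'c \<Rightarrow> real"
  assumes W: "summable_sq_sequence N W cc"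
    and W_mean: "\<And>j. (\<integral>y. W j y \<partial>N) = 0"
    and W_product: "\<And>i j. (\<integral>y. W i y * W j y \<partial>N) = (\<integral>\<omega>. X (int q + 1) i \<omega> * X (int q + 1) j \<omega> \<partial>M)"
    and W_char: "\<And>n s. (\<integral>y. iexp (\<Sum>j<n. s j * W j y) \<partial>N) =
      of_real (exp (- (\<integral>\<omega>. (\<Sum>j<n. s j * X (int q + 1) j \<omega>)\<^sup>2 \<partial>M) / 2))"
begin

sublocale W: summable_sq_sequence N W cc by (rule W)

text \<open>The increments at time \<open>q + 1\<close> form a sequence of the same kind as
  \<open>W\<close> and with the same covariances, so the covariance of the limit comes from
  comparing two series with equal coefficients.\<close>

sublocale X: summable_sq_sequence M "X (int q + 1)" cc
proof
  show "sq_int M (X (int q + 1) j)" for j by (rule sq_int_X) simp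
  show "(\<integral>\<omega>. (X (int q + 1) j \<omega>)\<^sup>2 \<partial>M) \<le> (cc j)\<^sup>2" for j by (simp add: cc_def)
qed (use cc_nonneg summable_cc summable_X in auto)

abbreviation Z :: "real \<Rightarrow> 'c \<Rightarrow> real" where "Z u \<equiv> W.series (coef u)"

lemma W_char': "(\<integral>y. iexp (\<Sum>j<n. s j * W j y) \<partial>N) = of_real (exp (- (\<integral>y. (\<Sum>j<n. s j * W j y)\<^sup>2 \<partial>N) / 2))"
  unfolding W_char integral_linear_combination_square[OF X.sq_int_V] integral_linear_combination_square[OF W.sq_int_V] W_product ..

text \<open>A combination of values of \<open>Z\<close> is again a series in \<open>W\<close>, with
  coefficients \<open>b\<close> that are bounded in \<open>j\<close> because the points are finitely
  many. Its characteristic function identifies the law; variance zero gives the degenerate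
  alternative.\<close>

lemma Z_gaussian: "gaussian_process N {0..1} Z"
  unfolding gaussian_process_def
proof (intro allI impI)
  fix A :: "real set" and a :: "real \<Rightarrow> real" assume A: "finite A \<and> A \<subseteq> {0..1}"
  define b where "b = (\<lambda>j. \<Sum>u\<in>A. a u * coef u j)"
  have b: "\<bar>b j\<bar> \<le> (\<Sum>u\<in>A. \<bar>a u\<bar> * (K0 * (1 + v u)))" for j
  proof -
    have "\<bar>b j\<bar> \<le> (\<Sum>u\<in>A. \<bar>a u * coef u j\<bar>)" unfolding b_def by (rule sum_abs)
    also have "\<dots> \<le> (\<Sum>u\<in>A. \<bar>a u\<bar> * (K0 * (1 + v u)))"
      unfolding abs_mult by (intro sum_mono mult_left_mono coef_bound) (use A in auto)
    finally show ?thesis .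
  qed
  have eq: "(\<Sum>u\<in>A. a u * Z u y) = W.series b y" if y: "y \<in> space N" for y
  proof -
    have s: "summable (\<lambda>j. coef u j * W j y)" if "u \<in> A" for u
      by (rule coef_series_bound(1)[OF _ W.summable_V[OF y]]) (use A that in auto)
    have "(\<Sum>u\<in>A. a u * Z u y) = (\<Sum>u\<in>A. \<Sum>j. a u * (coef u j * W j y))"
      unfolding W.series_def by (intro sum.cong refl suminf_mult[symmetric] s)
    also have "\<dots> = (\<Sum>j. \<Sum>u\<in>A. a u * (coef u j * W j y))"
      by (intro suminf_sum[symmetric] summable_mult s)
    also have "\<dots> = W.series b y"
      unfolding W.series_def b_def by (simp add: sum_distrib_right mult.assoc)
    finally show ?thesis .
  qed
  define s where "s = sqrt (\<integral>y. (W.series b y)\<^sup>2 \<partial>N)"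
  have s2: "s\<^sup>2 = (\<integral>y. (W.series b y)\<^sup>2 \<partial>N)" by (simp add: s_def)
  have s0: "s \<ge> 0" by (simp add: s_def)
  have meas: "(\<lambda>y. \<Sum>u\<in>A. a u * Z u y) \<in> borel_measurable N" by measurable
  show "gaussian_rv N (\<lambda>y. \<Sum>u\<in>A. a u * Z u y)"
  proof (cases "s = 0")
    case True
    have "integrable N (\<lambda>y. (W.series b y)\<^sup>2)" using W.sq_int_series[OF b] by (simp add: sq_int_def)
    moreover have "(\<integral>y. (W.series b y)\<^sup>2 \<partial>N) = 0" using s2 True by simp
    ultimately have "AE y in N. (W.series b y)\<^sup>2 = 0"
      by (subst (asm) integral_nonneg_eq_0_iff_AE) auto
    then have "AE y in N. (\<Sum>u\<in>A. a u * Z u y) = 0"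
      by (rule AE_mp) (rule AE_I2, simp add: eq)
    then show ?thesis unfolding gaussian_rv_def using meas by blast
  next
    case False
    then have s: "s > 0" using s0 by simp
    have "distributed N lborel (\<lambda>y. \<Sum>u\<in>A. a u * Z u y) (\<lambda>x. ennreal (normal_density 0 s x))"
    proof (rule gaussian_char_imp_distributed[OF W.prob_space_axioms meas s])
      fix t
      have "(\<integral>y. iexp (t * (\<Sum>u\<in>A. a u * Z u y)) \<partial>N) = (\<integral>y. iexp (t * W.series b y) \<partial>N)"
        by (rule Bochner_Integration.integral_cong[OF refl]) (simp only: eq)
      then show "(\<integral>y. iexp (t * (\<Sum>u\<in>A. a u * Z u y)) \<partial>N) = of_real (exp (- t\<^sup>2 * s\<^sup>2 / 2))"
        unfolding W.char_series[OF b W_char'] s2 .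
    qed
    then show ?thesis unfolding gaussian_rv_def using meas s by blast
  qed
qed

lemma Z_joint_measurable: "(\<lambda>(u, y). Z u y) \<in> borel_measurable (L01 \<Otimes>\<^sub>M N)"
proof -
  have "(\<lambda>z. coef (fst z) j) \<in> borel_measurable (L01 \<Otimes>\<^sub>M N)" for j
    by (rule measurable_compose[OF measurable_fst measurable_coef])
  moreover have "(\<lambda>z. W j (snd z)) \<in> borel_measurable (L01 \<Otimes>\<^sub>M N)" for j
    by (rule measurable_compose[OF measurable_snd W.measurable_V])
  ultimately have "(\<lambda>z. \<Sum>j. coef (fst z) j * W j (snd z)) \<in> borel_measurable (L01 \<Otimes>\<^sub>M N)"
    by (intro borel_measurable_suminf borel_measurable_times)
  then show ?thesis by (simp add: W.series_def case_prod_beta)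
qed

lemma Z_mean: "u \<in> {0..1} \<Longrightarrow> (\<integral>y. Z u y \<partial>N) = 0"
  by (rule W.integral_series_eq_0[OF coef_bound W_mean])

lemma Z_covariance:
  assumes u: "u1 \<in> {0..1}" "u2 \<in> {0..1}"
  shows "(\<integral>y. Z u1 y * Z u2 y \<partial>N) =
    (\<integral>\<omega>. Z_adj M g Y q l1 l2 (int q + 1) u1 p \<theta> \<omega> * Z_adj M g Y q l1 l2 (int q + 1) u2 p \<theta> \<omega> \<partial>M)"
proof -
  have adj: "X.series (coef u) \<omega> = Z_adj M g Y q l1 l2 (int q + 1) u p \<theta> \<omega>" if "u \<in> {0..1}" for u \<omega>
    using Z_adj_sums[OF that] by (simp add: X.series_def sums_iff)
  have "(\<lambda>n. \<Sum>j<n. \<Sum>k<n. coef u1 j * coef u2 k * (\<integral>y. W j y * W k y \<partial>N)) \<longlonglongrightarrow> (\<integral>y. Z u1 y * Z u2 y \<partial>N)"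
    by (rule W.series_product[OF coef_bound[OF u(1)] coef_bound[OF u(2)]])
  moreover have "(\<lambda>n. \<Sum>j<n. \<Sum>k<n. coef u1 j * coef u2 k * (\<integral>y. W j y * W k y \<partial>N)) \<longlonglongrightarrow>
      (\<integral>\<omega>. X.series (coef u1) \<omega> * X.series (coef u2) \<omega> \<partial>M)"
    unfolding W_product by (rule X.series_product[OF coef_bound[OF u(1)] coef_bound[OF u(2)]])
  ultimately have "(\<integral>y. Z u1 y * Z u2 y \<partial>N) = (\<integral>\<omega>. X.series (coef u1) \<omega> * X.series (coef u2) \<omega> \<partial>M)"
    by (rule LIMSEQ_unique)
  then show ?thesis by (simp only: adj u)
qed

end

section \<open>Weak convergence of the statistics on the real line\<close>

lemma cts_step_bounds: "a < b \<Longrightarrow> 0 \<le> cts_step a b x \<and> cts_step a b x \<le> 1"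
  by (auto simp: cts_step_def field_simps)

lemma cts_step_lipschitz: "a < b \<Longrightarrow> \<bar>cts_step a b x - cts_step a b y\<bar> \<le> \<bar>x - y\<bar> / (b - a)"
proof -
  assume ab: "a < b"
  have eq: "cts_step a b z = (b - max a (min b z)) / (b - a)" for z
    using ab by (auto simp: cts_step_def max_def min_def)
  have "cts_step a b x - cts_step a b y = (max a (min b y) - max a (min b x)) / (b - a)"
    unfolding eq by (simp add: diff_divide_distrib)
  moreover have "\<bar>max a (min b y) - max a (min b x)\<bar> \<le> \<bar>x - y\<bar>" by (auto simp: max_def min_def)
  ultimately show ?thesis using ab by (simp add: divide_right_mono)
qed

lemma measurable_cts_step [measurable]: "cts_step a b \<in> borel_measurable borel"
  unfolding cts_step_def[abs_def] by measurable

text \<open>The square is not globally Lipschitz, but \<open>cts_step a b\<close> vanishes from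
  \<open>b\<close> on, so only arguments up to \<open>sqrt b\<close> matter, where the square has
  Lipschitz constant \<open>2 * sqrt b\<close>. The test function is thus Lipschitz in the norm
  although the statistic is its square.\<close>

lemma cts_step_square_lipschitz:
  assumes ab: "a < b" and rs: "r \<ge> 0" "s \<ge> 0"
  shows "\<bar>cts_step a b (r\<^sup>2) - cts_step a b (s\<^sup>2)\<bar> \<le> 2 * sqrt (max 0 b) / (b - a) * \<bar>r - s\<bar>"
proof (cases "b \<le> 0")
  case True
  have "cts_step a b (z\<^sup>2) = 0" for z
    using ab True zero_le_power2[of z] unfolding cts_step_def by (smt (verit))
  then show ?thesis using ab by simp
next
  case False
  define c where "c = sqrt b"
  have c: "c > 0" "c\<^sup>2 = b" using False by (simp_all add: c_def)
  have cut: "cts_step a b (z\<^sup>2) = cts_step a b ((min z c)\<^sup>2)" if "z \<ge> 0" for z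
  proof (cases "z \<le> c")
    case False
    then have "c\<^sup>2 \<le> z\<^sup>2" using c by (intro power_mono) auto
    then have "cts_step a b (z\<^sup>2) = 0" "cts_step a b (c\<^sup>2) = 0" using c(2) ab by (auto simp: cts_step_def)
    then show ?thesis using False by simp
  qed simp
  have "\<bar>cts_step a b (r\<^sup>2) - cts_step a b (s\<^sup>2)\<bar> \<le> \<bar>(min r c)\<^sup>2 - (min s c)\<^sup>2\<bar> / (b - a)"
    unfolding cut[OF rs(1)] cut[OF rs(2)] by (rule cts_step_lipschitz[OF ab])
  also have "\<bar>(min r c)\<^sup>2 - (min s c)\<^sup>2\<bar> = (min r c + min s c) * \<bar>min r c - min s c\<bar>"
  proof -
    have "(min r c)\<^sup>2 - (min s c)\<^sup>2 = (min r c + min s c) * (min r c - min s c)"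
      by (simp add: power2_eq_square algebra_simps)
    then show ?thesis using rs c by (simp add: abs_mult)
  qed
  also have "\<dots> \<le> (2 * c) * \<bar>r - s\<bar>"
    using rs c by (intro mult_mono) auto
  finally show ?thesis using ab False by (simp add: c_def divide_right_mono)
qed

lemma weak_conv_m_cts_step:
  assumes "prob_space M" "prob_space N" and [measurable]: "\<And>T. R T \<in> borel_measurable M" "R' \<in> borel_measurable N"
    and conv: "\<And>a b. a < b \<Longrightarrow> (\<lambda>T. \<integral>\<omega>. cts_step a b (R T \<omega>) \<partial>M) \<longlonglongrightarrow> (\<integral>y. cts_step a b (R' y) \<partial>N)"
  shows "weak_conv_m (\<lambda>T. distr M borel (R T)) (distr N borel R')"
proof (rule integral_cts_step_conv_imp_weak_conv)
  show "real_distribution (distr M borel (R T))" for T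
    using prob_space.real_distribution_distr[OF assms(1)] by simp
  show "real_distribution (distr N borel R')" using prob_space.real_distribution_distr[OF assms(2)] by simp
  show "(\<lambda>T. \<integral>x. cts_step a b x \<partial>distr M borel (R T)) \<longlonglongrightarrow> (\<integral>x. cts_step a b x \<partial>distr N borel R')" if "a < b" for a b
    using conv[OF that] by (simp add: integral_distr)
qed

context prob_space
begin

text \<open>Slutsky's lemma for one test function: where the two variables are within
  \<open>d\<close> the Lipschitz bound applies, elsewhere the values differ by at most 1.\<close>

lemma zero_in_prob_imp_cts_step:
  assumes [measurable]: "\<And>T. R T \<in> borel_measurable M" "\<And>T. R' T \<in> borel_measurable M"
    and zero: "tends_to_zero_in_prob M (\<lambda>T \<omega>. R T \<omega> - R' T \<omega>)" and ab: "a < b"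
    and lim: "(\<lambda>T. \<integral>\<omega>. cts_step a b (R' T \<omega>) \<partial>M) \<longlonglongrightarrow> l"
  shows "(\<lambda>T. \<integral>\<omega>. cts_step a b (R T \<omega>) \<partial>M) \<longlonglongrightarrow> l"
proof -
  have int: "integrable M (\<lambda>\<omega>. cts_step a b (f \<omega>))" if [measurable]: "f \<in> borel_measurable M" for f
    using cts_step_bounds[OF ab] by (intro integrable_const_bound[of _ 1]) auto
  have bound: "\<bar>(\<integral>\<omega>. cts_step a b (R T \<omega>) \<partial>M) - (\<integral>\<omega>. cts_step a b (R' T \<omega>) \<partial>M)\<bar>
      \<le> d / (b - a) + prob {\<omega> \<in> space M. \<bar>R T \<omega> - R' T \<omega>\<bar> \<ge> d}" if d: "d > 0" for T d
  proof -
    let ?S = "{\<omega> \<in> space M. \<bar>R T \<omega> - R' T \<omega>\<bar> \<ge> d}"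
    have S: "integrable M (indicator ?S :: 'a \<Rightarrow> real)" by (intro integrable_real_indicator) (auto simp: emeasure_eq_measure)
    have eq: "(\<integral>\<omega>. cts_step a b (R T \<omega>) \<partial>M) - (\<integral>\<omega>. cts_step a b (R' T \<omega>) \<partial>M) = (\<integral>\<omega>. cts_step a b (R T \<omega>) - cts_step a b (R' T \<omega>) \<partial>M)"
      by (intro Bochner_Integration.integral_diff[symmetric] int) measurable
    have "\<bar>(\<integral>\<omega>. cts_step a b (R T \<omega>) \<partial>M) - (\<integral>\<omega>. cts_step a b (R' T \<omega>) \<partial>M)\<bar> \<le> (\<integral>\<omega>. \<bar>cts_step a b (R T \<omega>) - cts_step a b (R' T \<omega>)\<bar> \<partial>M)"
      unfolding eq by (rule integral_abs_bound)
    also have "\<dots> \<le> (\<integral>\<omega>. d / (b - a) + indicator ?S \<omega> \<partial>M)"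
    proof (rule integral_mono)
      show "integrable M (\<lambda>\<omega>. \<bar>cts_step a b (R T \<omega>) - cts_step a b (R' T \<omega>)\<bar>)"
        by (intro integrable_abs Bochner_Integration.integrable_diff int) measurable
      show "integrable M (\<lambda>\<omega>. d / (b - a) + indicator ?S \<omega>)" using S by simp
      fix \<omega> assume \<omega>: "\<omega> \<in> space M"
      show "\<bar>cts_step a b (R T \<omega>) - cts_step a b (R' T \<omega>)\<bar> \<le> d / (b - a) + indicator ?S \<omega>"
      proof (cases "\<omega> \<in> ?S")
        case True
        then show ?thesis
          using cts_step_bounds[OF ab, of "R T \<omega>"] cts_step_bounds[OF ab, of "R' T \<omega>"] d ab
          by (auto simp: abs_le_iff intro: add_increasing)
      next
        case False
        then have "\<bar>R T \<omega> - R' T \<omega>\<bar> \<le> d" using \<omega> by auto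
        then have "\<bar>R T \<omega> - R' T \<omega>\<bar> / (b - a) \<le> d / (b - a)" using ab by (intro divide_right_mono) auto
        then show ?thesis using cts_step_lipschitz[OF ab, of "R T \<omega>" "R' T \<omega>"] False by simp
      qed
    qed
    also have "\<dots> = d / (b - a) + prob ?S" using S by (simp add: prob_space)
    finally show ?thesis .
  qed
  have "(\<lambda>T. (\<integral>\<omega>. cts_step a b (R T \<omega>) \<partial>M) - (\<integral>\<omega>. cts_step a b (R' T \<omega>) \<partial>M)) \<longlonglongrightarrow> 0"
  proof (rule LIMSEQ_I)
    fix e :: real assume e: "e > 0"
    define d where "d = e / 2 * (b - a)"
    have "b - a > 0" "b - a \<noteq> 0" using ab by simp_all
    then have d: "d > 0" "d / (b - a) = e / 2"
      using e by (simp_all only: d_def nonzero_mult_div_cancel_right half_gt_zero mult_pos_pos not_False_eq_True)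
    have "\<forall>\<^sub>F T in sequentially. prob {\<omega> \<in> space M. \<bar>R T \<omega> - R' T \<omega>\<bar> \<ge> d} < e / 2"
      by (rule zero_in_probD[OF zero d(1)]) (use e in simp)
    then obtain T0 where T0: "\<And>T. T \<ge> T0 \<Longrightarrow> prob {\<omega> \<in> space M. \<bar>R T \<omega> - R' T \<omega>\<bar> \<ge> d} < e / 2"
      unfolding eventually_sequentially by blast
    show "\<exists>T0. \<forall>T\<ge>T0. norm ((\<integral>\<omega>. cts_step a b (R T \<omega>) \<partial>M) - (\<integral>\<omega>. cts_step a b (R' T \<omega>) \<partial>M) - 0) < e"
    proof (intro exI allI impI)
      fix T assume "T \<ge> T0"
      from T0[OF this] bound[OF d(1), of T] d(2)
      show "norm ((\<integral>\<omega>. cts_step a b (R T \<omega>) \<partial>M) - (\<integral>\<omega>. cts_step a b (R' T \<omega>) \<partial>M) - 0) < e" by simp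
    qed
  qed
  from tendsto_add[OF this lim] show ?thesis by simp
qed

text \<open>Convergence of characteristic functions thus yields that of cosines with arbitrary
  phase, the building blocks of \<open>trig_poly\<close>.\<close>

lemma integral_cos_shift:
  assumes [measurable]: "f \<in> borel_measurable M"
  shows "(\<integral>\<omega>. cos (f \<omega> + b) \<partial>M) = Re (iexp b * (\<integral>\<omega>. iexp (f \<omega>) \<partial>M))"
proof -
  have int: "integrable M (\<lambda>\<omega>. iexp (f \<omega>))" by (rule integrable_const_bound[of _ 1]) auto
  have "cos (f \<omega> + b) = Re (iexp b * iexp (f \<omega>))" for \<omega>
    by (simp add: exp_add[symmetric] distrib_left[symmetric] Re_exp add.commute)
  then have "(\<integral>\<omega>. cos (f \<omega> + b) \<partial>M) = (\<integral>\<omega>. Re (iexp b * iexp (f \<omega>)) \<partial>M)" by (simp only:)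
  also have "\<dots> = Re (\<integral>\<omega>. iexp b * iexp (f \<omega>) \<partial>M)"
    by (rule integral_Re) (intro integrable_mult_right int)
  finally show ?thesis by simp
qed

end

context inar_test
begin

text \<open>On summable sequences, the squared norm of the series in the L2 space with weight
  \<open>w\<close>; its root is Lipschitz in the l1 norm of the coordinates.\<close>

definition qf :: "(nat \<Rightarrow> real) \<Rightarrow> real" where
  "qf x = (\<integral>u. (\<Sum>j. coef u j * x j)\<^sup>2 * w u \<partial>L01)"

lemma qf_nonneg: "qf x \<ge> 0"
  unfolding qf_def by (intro Bochner_Integration.integral_nonneg mult_nonneg_nonneg w_nonneg) auto

lemma Qstat_qf: "Qstat T \<omega> = qf (V T \<omega>)"
  unfolding Qstat_def qf_def
  by (rule Bochner_Integration.integral_cong[OF refl]) (use Z_bar_sums in \<open>auto simp: sums_iff\<close>)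

text \<open>Attaching \<open>sqrt (w u)\<close> to the series turns the weighted norm into an
  ordinary L2 norm on the interval, so that Minkowski's inequality applies.\<close>

lemma qf_weighted:
  assumes x: "summable (\<lambda>j. \<bar>x j\<bar>)"
  shows "sq_int L01 (\<lambda>u. (\<Sum>j. coef u j * x j) * sqrt (w u))"
    "(\<integral>u. ((\<Sum>j. coef u j * x j) * sqrt (w u))\<^sup>2 \<partial>L01) = qf x"
    "sqrt (qf x) \<le> K0 * sqrt kap * (\<Sum>j. \<bar>x j\<bar>)"
proof -
  let ?f = "\<lambda>u. \<Sum>j. coef u j * x j"
  have m: "?f \<in> borel_measurable L01"
    by (intro borel_measurable_suminf borel_measurable_times measurable_coef borel_measurable_const)
  have b: "\<bar>?f u\<bar> \<le> K0 * (\<Sum>j. \<bar>x j\<bar>) * (1 + v u)" if "u \<in> {0..1}" for u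
    using coef_series_bound(2)[OF that x] by (simp add: mult_ac)
  note int = integrable_weighted_square[OF m b]
  have sq: "(?f u * sqrt (w u))\<^sup>2 = (?f u)\<^sup>2 * w u" if "u \<in> space L01" for u
    using w_nonneg[of u] that by (simp add: power_mult_distrib)
  have "integrable L01 (\<lambda>u. (?f u * sqrt (w u))\<^sup>2)"
    using int(1) by (subst Bochner_Integration.integrable_cong[OF refl sq])
  moreover have "(\<lambda>u. ?f u * sqrt (w u)) \<in> borel_measurable L01" using m w_measurable by measurable
  ultimately show "sq_int L01 (\<lambda>u. ?f u * sqrt (w u))" by (simp add: sq_int_def)
  show "(\<integral>u. (?f u * sqrt (w u))\<^sup>2 \<partial>L01) = qf x"
    unfolding qf_def by (rule Bochner_Integration.integral_cong[OF refl sq])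
  have "sqrt (qf x) \<le> sqrt ((K0 * (\<Sum>j. \<bar>x j\<bar>))\<^sup>2 * kap)"
    using int(2) unfolding qf_def by (rule real_sqrt_le_mono)
  also have "\<dots> = K0 * sqrt kap * (\<Sum>j. \<bar>x j\<bar>)"
    using K0_pos suminf_nonneg[OF x] by (simp add: real_sqrt_mult)
  finally show "sqrt (qf x) \<le> K0 * sqrt kap * (\<Sum>j. \<bar>x j\<bar>)" .
qed

lemma summable_abs_diff: "summable (\<lambda>j. \<bar>x j\<bar>) \<Longrightarrow> summable (\<lambda>j. \<bar>y j\<bar>) \<Longrightarrow> summable (\<lambda>j. \<bar>x j - y j\<bar>)" for x y :: "nat \<Rightarrow> real"
  by (rule summable_comparison_test'[of "\<lambda>j. \<bar>x j\<bar> + \<bar>y j\<bar>" 0], rule summable_add) (auto simp: abs_triangle_ineq4)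

lemma coef_series_diff:
  assumes "u \<in> {0..1}" "summable (\<lambda>j. \<bar>x j\<bar>)" "summable (\<lambda>j. \<bar>y j\<bar>)"
  shows "(\<Sum>j. coef u j * x j) = (\<Sum>j. coef u j * y j) + (\<Sum>j. coef u j * (x j - y j))"
  using suminf_diff[OF coef_series_bound(1)[OF assms(1,2)] coef_series_bound(1)[OF assms(1,3)]]
  by (simp add: right_diff_distrib)

lemma sqrt_qf_triangle:
  assumes x: "summable (\<lambda>j. \<bar>x j\<bar>)" and y: "summable (\<lambda>j. \<bar>y j\<bar>)"
  shows "sqrt (qf x) \<le> sqrt (qf y) + K0 * sqrt kap * (\<Sum>j. \<bar>x j - y j\<bar>)"
proof -
  let ?f = "\<lambda>x u. (\<Sum>j. coef u j * x j) * sqrt (w u)"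
  note d = summable_abs_diff[OF x y]
  have "(\<integral>u. (?f y u + ?f (\<lambda>j. x j - y j) u)\<^sup>2 \<partial>L01) = (\<integral>u. (?f x u)\<^sup>2 \<partial>L01)"
    by (rule Bochner_Integration.integral_cong[OF refl]) (simp add: coef_series_diff[OF _ x y] distrib_right)
  then have "sqrt (qf x) = sqrt (\<integral>u. (?f y u + ?f (\<lambda>j. x j - y j) u)\<^sup>2 \<partial>L01)"
    by (simp only: qf_weighted(2)[OF x])
  also have "\<dots> \<le> sqrt (\<integral>u. (?f y u)\<^sup>2 \<partial>L01) + sqrt (\<integral>u. (?f (\<lambda>j. x j - y j) u)\<^sup>2 \<partial>L01)"
    by (rule Minkowski_integral[OF qf_weighted(1)[OF y] qf_weighted(1)[OF d]])
  also have "\<dots> \<le> sqrt (qf y) + K0 * sqrt kap * (\<Sum>j. \<bar>x j - y j\<bar>)"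
    unfolding qf_weighted(2)[OF y] qf_weighted(2)[OF d] using qf_weighted(3)[OF d] by simp
  finally show ?thesis .
qed

lemma l1_lipschitz_cts_step_qf:
  assumes ab: "a < b"
  shows "l1_lipschitz 1 (2 * sqrt (max 0 b) / (b - a) * (K0 * sqrt kap)) (\<lambda>x. cts_step a b (qf x))"
  unfolding l1_lipschitz_def
proof (intro conjI allI impI)
  fix x show "\<bar>cts_step a b (qf x)\<bar> \<le> 1" using cts_step_bounds[OF ab, of "qf x"] by simp
next
  fix x y :: "nat \<Rightarrow> real" assume x: "summable (\<lambda>j. \<bar>x j\<bar>)" and y: "summable (\<lambda>j. \<bar>y j\<bar>)"
  have "\<bar>sqrt (qf x) - sqrt (qf y)\<bar> \<le> K0 * sqrt kap * (\<Sum>j. \<bar>x j - y j\<bar>)"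
    using sqrt_qf_triangle[OF x y] sqrt_qf_triangle[OF y x] by (simp add: abs_minus_commute[of "y _"])
  then have "2 * sqrt (max 0 b) / (b - a) * \<bar>sqrt (qf x) - sqrt (qf y)\<bar> \<le> 2 * sqrt (max 0 b) / (b - a) * (K0 * sqrt kap * (\<Sum>j. \<bar>x j - y j\<bar>))"
    using ab by (intro mult_left_mono) auto
  moreover have "\<bar>cts_step a b (qf x) - cts_step a b (qf y)\<bar> \<le> 2 * sqrt (max 0 b) / (b - a) * \<bar>sqrt (qf x) - sqrt (qf y)\<bar>"
    using cts_step_square_lipschitz[OF ab, of "sqrt (qf x)" "sqrt (qf y)"] qf_nonneg by simp
  ultimately show "\<bar>cts_step a b (qf x) - cts_step a b (qf y)\<bar> \<le> 2 * sqrt (max 0 b) / (b - a) * (K0 * sqrt kap) * (\<Sum>j. \<bar>x j - y j\<bar>)"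
    by (simp add: mult.assoc)
qed

text \<open>Apart from the first two, the coefficients are powers of \<open>u\<close>; those two are
  bounded as continuous functions on a compact interval.\<close>

lemma coef_uniform_bound:
  assumes "continuous_on {0..1} dg"
  obtains K where "K \<ge> 0" "\<And>u j. u \<in> {0..1} \<Longrightarrow> \<bar>coef u j\<bar> \<le> K"
proof -
  have "\<exists>B. \<forall>u\<in>{0..1}. \<bar>coef u j\<bar> \<le> B" for j
    using compact_imp_bounded[OF compact_continuous_image[OF continuous_on_coef[OF assms, of j]]]
    by (auto simp: bounded_iff)
  then obtain B where B: "\<And>j u. u \<in> {0..1} \<Longrightarrow> \<bar>coef u j\<bar> \<le> B j" by metis
  have "\<bar>coef u j\<bar> \<le> max 1 (max (B 0) (B (Suc 0)))" if u: "u \<in> {0..1}" for u j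
  proof -
    consider "j = 0" | "j = Suc 0" | k where "j = Suc (Suc k)" by (metis not0_implies_Suc)
    then show ?thesis
    proof cases
      case 3
      have "\<bar>u ^ k\<bar> \<le> 1" using u by (simp add: power_le_one)
      then show ?thesis by (simp add: 3 coef_simps)
    qed (use B[OF u, of 0] B[OF u, of "Suc 0"] in auto)
  qed
  then show ?thesis by (intro that[of "max 1 (max (B 0) (B (Suc 0)))"]) auto
qed

lemma continuous_on_coef_series:
  assumes dg: "continuous_on {0..1} dg" and x: "summable (\<lambda>j. \<bar>x j\<bar>)"
  shows "continuous_on {0..1} (\<lambda>u. \<Sum>j. coef u j * x j)"
proof -
  obtain K where K: "K \<ge> 0" "\<And>u j. u \<in> {0..1} \<Longrightarrow> \<bar>coef u j\<bar> \<le> K" using coef_uniform_bound[OF dg] by blast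
  have "uniform_limit {0..1} (\<lambda>n u. \<Sum>j<n. coef u j * x j) (\<lambda>u. \<Sum>j. coef u j * x j) sequentially"
    by (rule Weierstrass_m_test[where M = "\<lambda>j. K * \<bar>x j\<bar>"])
       (use K x in \<open>auto simp: abs_mult intro!: mult_right_mono summable_mult\<close>)
  then show ?thesis
    by (rule uniform_limit_theorem[rotated]) (auto intro!: always_eventually continuous_intros continuous_on_coef dg)
qed

text \<open>With coefficients bounded uniformly in \<open>u\<close>, the map from sequences to
  functions is Lipschitz from the l1 norm to the supremum distance, so Lipschitz test functions pull
  back.\<close>

lemma l1_lipschitz_C01:
  assumes dg: "continuous_on {0..1} dg" and f: "bounded_lipschitz C01 B L f" and L: "L \<ge> 0"
  obtains L' where "L' \<ge> 0" "l1_lipschitz B L' (\<lambda>x. f (\<lambda>u\<in>{0..1}. \<Sum>j. coef u j * x j))"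
proof -
  obtain K where K: "K \<ge> 0" "\<And>u j. u \<in> {0..1} \<Longrightarrow> \<bar>coef u j\<bar> \<le> K" using coef_uniform_bound[OF dg] by blast
  let ?h = "\<lambda>x. \<lambda>u\<in>{0..1}. \<Sum>j. coef u j * x j"
  have mem: "?h x \<in> mspace C01" if "summable (\<lambda>j. \<bar>x j\<bar>)" for x
    by (rule restrict_in_C01[OF continuous_on_coef_series[OF dg that]])
  have lip: "\<bar>f (?h x) - f (?h y)\<bar> \<le> L * K * (\<Sum>j. \<bar>x j - y j\<bar>)"
    if x: "summable (\<lambda>j. \<bar>x j\<bar>)" and y: "summable (\<lambda>j. \<bar>y j\<bar>)" for x y
  proof -
    note d = summable_abs_diff[OF x y]
    have le: "\<bar>(\<Sum>j. coef u j * x j) - (\<Sum>j. coef u j * y j)\<bar> \<le> K * (\<Sum>j. \<bar>x j - y j\<bar>)" if u: "u \<in> {0..1}" for u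
    proof -
      have "(\<Sum>j. coef u j * x j) - (\<Sum>j. coef u j * y j) = (\<Sum>j. coef u j * (x j - y j))"
        using coef_series_diff[OF u x y] by simp
      also have "\<bar>\<dots>\<bar> \<le> (\<Sum>j. K * \<bar>x j - y j\<bar>)"
        using norm_suminf_le[of "\<lambda>j. coef u j * (x j - y j)" "\<lambda>j. K * \<bar>x j - y j\<bar>"] K(2)[OF u] summable_mult[OF d]
        by (simp add: abs_mult mult_right_mono)
      finally show ?thesis using suminf_mult[OF d] by simp
    qed
    have "mdist C01 (?h x) (?h y) \<le> K * (\<Sum>j. \<bar>x j - y j\<bar>)"
      by (rule mdist_C01_le[OF _ le]) (use K suminf_nonneg[OF d] in auto)
    then have "L * mdist C01 (?h x) (?h y) \<le> L * (K * (\<Sum>j. \<bar>x j - y j\<bar>))" using L by (rule mult_left_mono)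
    moreover have "\<bar>f (?h x) - f (?h y)\<bar> \<le> L * mdist C01 (?h x) (?h y)"
      using f mem[OF x] mem[OF y] unfolding bounded_lipschitz_def by blast
    ultimately show ?thesis by simp
  qed
  show ?thesis
  proof (rule that[of "L * K"])
    show "l1_lipschitz B (L * K) (\<lambda>x. f (?h x))"
      unfolding l1_lipschitz_def using lip mem f unfolding bounded_lipschitz_def by blast
  qed (use L K in simp)
qed

end

context inar_limit
begin

lemma V_cos_tendsto:
  "(\<lambda>T. \<integral>\<omega>. cos ((\<Sum>j<n. s j * V T \<omega> j) + b) \<partial>M) \<longlonglongrightarrow> (\<integral>y. cos ((\<Sum>j<n. s j * W j y) + b) \<partial>N)"
proof -
  have W: "(\<integral>y. cos ((\<Sum>j<n. s j * W j y) + b) \<partial>N) = Re (iexp b * (\<integral>y. iexp (\<Sum>j<n. s j * W j y) \<partial>N))"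
    by (rule W.integral_cos_shift) measurable
  have V: "(\<integral>\<omega>. cos ((\<Sum>j<n. s j * V T \<omega> j) + b) \<partial>M) = Re (iexp b * (\<integral>\<omega>. iexp (\<Sum>j<n. s j * V T \<omega> j) \<partial>M))" for T
    by (rule integral_cos_shift) measurable
  show ?thesis unfolding V W W_char
    by (intro tendsto_Re tendsto_mult tendsto_const V_char_tendsto)
qed

lemma V_weak_convergence:
  assumes "l1_lipschitz B L F" "L \<ge> 0"
  shows "(\<lambda>T. \<integral>\<omega>. F (V T \<omega>) \<partial>M) \<longlonglongrightarrow> (\<integral>y. F (\<lambda>j. W j y) \<partial>N)"
proof (rule l1_weak_convergence[where X = V and Z = "\<lambda>y j. W j y" and c = cc and B = B and L = L])
  show "prob_space M" "prob_space N" by (rule prob_space_axioms W.prob_space_axioms)+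
  show "integrable N (\<lambda>y. (W j y)\<^sup>2)" for j using W.sq_int_V by (simp add: sq_int_def)
qed (use assms measurable_V W.measurable_V summable_V W.summable_V V_second_moment W.second_moment cc_nonneg summable_cc V_cos_tendsto in auto)

abbreviation Qlim :: "'c \<Rightarrow> real" where "Qlim y \<equiv> \<integral>u. (Z u y)\<^sup>2 * w u \<partial>L01"

lemma Qlim_qf: "Qlim y = qf (\<lambda>j. W j y)"
  by (simp add: qf_def W.series_def)

text \<open>Unlike \<open>Qstat\<close>, this integral does not factor through a discrete sample, so
  its measurability rests on the joint measurability of \<open>Z\<close>.\<close>

lemma measurable_Qlim: "Qlim \<in> borel_measurable N"
proof -
  interpret L: finite_measure L01 by (rule finite_measure_lebesgue_on) simp
  have "(\<lambda>z. Z (fst z) (snd z)) \<in> borel_measurable (L01 \<Otimes>\<^sub>M N)"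
    using Z_joint_measurable by (simp add: case_prod_beta')
  then have [measurable]: "(\<lambda>z. Z (snd z) (fst z)) \<in> borel_measurable (N \<Otimes>\<^sub>M L01)"
    using measurable_compose[OF measurable_pair_swap'[of N L01], of "\<lambda>z. Z (fst z) (snd z)" borel] by (simp add: case_prod_beta')
  note w_measurable [measurable]
  show ?thesis
    by (rule L.borel_measurable_lebesgue_integral) (simp add: case_prod_beta')
qed

lemma Qstat_cts_step: "a < b \<Longrightarrow> (\<lambda>T. \<integral>\<omega>. cts_step a b (Qstat T \<omega>) \<partial>M) \<longlonglongrightarrow> (\<integral>y. cts_step a b (Qlim y) \<partial>N)"
proof -
  assume ab: "a < b"
  show ?thesis
    unfolding Qstat_qf Qlim_qf by (rule V_weak_convergence[OF l1_lipschitz_cts_step_qf[OF ab]]) (use ab K0_pos kap_nonneg in simp)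
qed

lemma Qstat_weak_convergence: "weak_conv_m (\<lambda>T. distr M borel (Qstat T)) (distr N borel Qlim)"
  by (intro weak_conv_m_cts_step prob_space_axioms W.prob_space_axioms measurable_Qstat measurable_Qlim Qstat_cts_step)

lemma S_stat_weak_convergence: "weak_conv_m (\<lambda>T. distr M borel (S_stat g phat thhat w Y T)) (distr N borel Qlim)"
  by (intro weak_conv_m_cts_step prob_space_axioms W.prob_space_axioms measurable_S_stat measurable_Qlim
        zero_in_prob_imp_cts_step[OF measurable_S_stat measurable_Qstat S_Q_zero _ Qstat_cts_step])

lemma Z_bar_weak_convergence:
  assumes dg: "continuous_on {0..1} dg"
  shows "conv_in_distribution C01 M (\<lambda>T \<omega>. \<lambda>u\<in>{0..1}. Zb T u \<omega>) N (\<lambda>y. \<lambda>u\<in>{0..1}. Z u y)"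
proof -
  let ?h = "\<lambda>x. \<lambda>u\<in>{0..1}. \<Sum>j. coef u j * x j"
  have Zb: "(\<lambda>u\<in>{0..1}. Zb T u \<omega>) = ?h (V T \<omega>)" for T \<omega>
    by (rule restrict_ext) (use Z_bar_sums in \<open>simp add: sums_iff\<close>)
  have Z: "(\<lambda>u\<in>{0..1}. Z u y) = ?h (\<lambda>j. W j y)" for y by (simp add: W.series_def)
  have mem: "?h x \<in> mspace C01" if "summable (\<lambda>j. \<bar>x j\<bar>)" for x
    by (rule restrict_in_C01[OF continuous_on_coef_series[OF dg that]])
  have meas: "(\<lambda>\<omega>. f (?h (V T \<omega>))) \<in> borel_measurable M" "(\<lambda>y. f (?h (\<lambda>j. W j y))) \<in> borel_measurable N"
    if f: "bounded_lipschitz C01 B L f" for B L f T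
  proof -
    have "L * mdist C01 x y \<le> max L 0 * mdist C01 x y" for x y by (intro mult_right_mono) auto
    then have "bounded_lipschitz C01 B (max L 0) f"
      using f unfolding bounded_lipschitz_def by (meson order_trans)
    then obtain L' where L': "l1_lipschitz B L' (\<lambda>x. f (?h x))"
      using l1_lipschitz_C01[OF dg, of B "max L 0" f] by auto
    show "(\<lambda>\<omega>. f (?h (V T \<omega>))) \<in> borel_measurable M"
      by (rule measurable_l1_lipschitz[OF L' measurable_V summable_V])
    show "(\<lambda>y. f (?h (\<lambda>j. W j y))) \<in> borel_measurable N"
      by (rule measurable_l1_lipschitz[OF L' W.measurable_V W.summable_V])
  qed
  show ?thesis unfolding Zb Z
  proof (rule conv_in_distribution_bounded_lipschitz[OF prob_space_axioms W.prob_space_axioms])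
    fix B L f assume "L \<ge> 0" and "bounded_lipschitz C01 B L f"
    then obtain L' where "L' \<ge> 0" "l1_lipschitz B L' (\<lambda>x. f (?h x))" using l1_lipschitz_C01[OF dg] by blast
    then show "(\<lambda>T. \<integral>\<omega>. f (?h (V T \<omega>)) \<partial>M) \<longlonglongrightarrow> (\<integral>y. f (?h (\<lambda>j. W j y)) \<partial>N)"
      by (intro V_weak_convergence)
  qed (use mem meas summable_V W.summable_V in auto)
qed

end

theorem theorem4p1:
  fixes M :: "'a measure"
    and Y :: "int \<Rightarrow> 'a \<Rightarrow> nat" and U :: "int \<Rightarrow> nat \<Rightarrow> 'a \<Rightarrow> nat" and eps :: "int \<Rightarrow> 'a \<Rightarrow> nat"
    and g :: "real \<Rightarrow> real \<Rightarrow> real" and \<Theta> :: "real set" and p0 \<theta>0 :: real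
    and v w :: "real \<Rightarrow> real" and D1 D2 D3 :: real
    and phat thhat :: "nat list \<Rightarrow> real"
    and q :: nat and l1 l2 :: "nat list \<Rightarrow> real \<times> real \<Rightarrow> real"
  assumes "prob_space M"
    and p0: "0 < p0" "p0 < 1"
    and Theta: "open \<Theta>" "\<theta>0 \<in> \<Theta>"
    and family: "\<forall>\<theta>\<in>\<Theta>. \<exists>Q :: nat pmf. \<forall>u\<in>{0..1}. g u \<theta> = pgf (measure_pmf Q) (\<lambda>n. n) u"
    and model: "INAR1 M p0 Y U eps" "strictly_stationary M Y" "ergodic_process M Y"
    and A1: "\<forall>t. \<forall>u\<in>{0..1}. pgf M (eps t) u = g u \<theta>0"
    and A2: "0 < D1" "0 < D2" "0 < D3"
      "v \<in> borel_measurable (lebesgue_on {0..1})"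
      "\<forall>u\<in>{0..1}. \<forall>\<theta>\<in>\<Theta>. g u differentiable (at \<theta>)"
      "\<forall>u\<in>{0..1}. \<forall>\<theta>\<in>\<Theta>. \<bar>\<theta> - \<theta>0\<bar> \<le> D2 \<longrightarrow>
         \<bar>deriv (g u) \<theta> - deriv (g u) \<theta>0\<bar> \<le> D1 * \<bar>\<theta> - \<theta>0\<bar> * v u \<and>
         \<bar>deriv (g u) \<theta>\<bar> \<le> D3 * v u"
    and A3: "w \<in> borel_measurable (lebesgue_on {0..1})" "\<forall>u\<in>{0..1}. 0 \<le> w u"
      "integrable (lebesgue_on {0..1}) w" "0 < (\<integral>u. w u \<partial>lebesgue_on {0..1})"
      "integrable (lebesgue_on {0..1}) (\<lambda>u. w u * (v u)\<^sup>2)"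
    and estimator: "\<forall>T\<ge>1. \<forall>\<omega>\<in>space M. thhat (sample Y T \<omega>) \<in> \<Theta>"
    and A4: "1 \<le> q"
      "tends_to_zero_in_prob M (\<lambda>T \<omega>. sqrt (real T) * (phat (sample Y T \<omega>) - p0)
         - 1 / sqrt (real T) * (\<Sum>t\<in>{int q + 1..int T}. l1 (lags Y q t \<omega>) (p0, \<theta>0)))"
      "tends_to_zero_in_prob M (\<lambda>T \<omega>. sqrt (real T) * (thhat (sample Y T \<omega>) - \<theta>0)
         - 1 / sqrt (real T) * (\<Sum>t\<in>{int q + 1..int T}. l2 (lags Y q t \<omega>) (p0, \<theta>0)))"
      "\<forall>l\<in>{l1, l2}.
         martingale_difference M (past M Y) (int q + 1) (\<lambda>t \<omega>. l (lags Y q t \<omega>) (p0, \<theta>0)) \<and>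
         (\<forall>t \<ge> int q + 1. integrable M (\<lambda>\<omega>. (l (lags Y q t \<omega>) (p0, \<theta>0))\<^sup>2))"
  shows
    "(\<exists>\<mu>. real_distribution \<mu> \<and>
        weak_conv_m (\<lambda>T. distr M borel (S_stat g phat thhat w Y T)) \<mu> \<and>
        weak_conv_m (\<lambda>T. distr M borel
          (\<lambda>\<omega>. \<integral>u. (Z_bar M g Y q l1 l2 T u p0 \<theta>0 \<omega>)\<^sup>2 * w u \<partial>lebesgue_on {0..1})) \<mu>) \<and>
     (\<exists>(N :: (real \<Rightarrow> real) measure) (Z :: real \<Rightarrow> (real \<Rightarrow> real) \<Rightarrow> real).
        prob_space N \<and>
        gaussian_process N {0..1} Z \<and>
        (\<lambda>(u, x). Z u x) \<in> borel_measurable (lebesgue_on {0..1} \<Otimes>\<^sub>M N) \<and>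
        (\<forall>u\<in>{0..1}. (\<integral>x. Z u x \<partial>N) = 0) \<and>
        (\<forall>u1\<in>{0..1}. \<forall>u2\<in>{0..1}. (\<integral>x. Z u1 x * Z u2 x \<partial>N) =
           (\<integral>\<omega>. Z_adj M g Y q l1 l2 (int q + 1) u1 p0 \<theta>0 \<omega> *
                Z_adj M g Y q l1 l2 (int q + 1) u2 p0 \<theta>0 \<omega> \<partial>M)) \<and>
        (continuous_on {0..1} (\<lambda>u. deriv (g u) \<theta>0) \<longrightarrow>
           conv_in_distribution C01
             M (\<lambda>T \<omega>. \<lambda>u\<in>{0..1}. Z_bar M g Y q l1 l2 T u p0 \<theta>0 \<omega>)
             N (\<lambda>x. \<lambda>u\<in>{0..1}. Z u x)) \<and>
        weak_conv_m (\<lambda>T. distr M borel (S_stat g phat thhat w Y T))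
          (distr N borel (\<lambda>x. \<integral>u. (Z u x)\<^sup>2 * w u \<partial>lebesgue_on {0..1})))"
proof -
  interpret inar_test M p0 Y U eps \<theta>0 q l1 l2 g \<Theta> v w D1 D2 D3 phat thhat
    by (intro inar_test.intro inar_mds.intro inar.intro inar_axioms.intro inar_mds_axioms.intro inar_test_axioms.intro)
       (use assms in \<open>auto simp only: ball_simps\<close>)
  \<comment> \<open>The Gaussian sequence copies the covariances of a single increment: by
    orthogonality and stationarity these are the limits of the covariances of the normalised
    sums.\<close>
  obtain W :: "nat \<Rightarrow> (real \<Rightarrow> real) \<Rightarrow> real" where W: "summable_sq_sequence gauss_space W cc"
    "\<And>j. (\<integral>y. W j y \<partial>gauss_space) = 0"
    "\<And>i j. (\<integral>y. W i y * W j y \<partial>gauss_space) = (\<integral>\<omega>. X (int q + 1) i \<omega> * X (int q + 1) j \<omega> \<partial>M)"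
    "\<And>n s. (\<integral>y. iexp (\<Sum>j<n. s j * W j y) \<partial>gauss_space) =
      of_real (exp (- (\<integral>\<omega>. (\<Sum>j<n. s j * X (int q + 1) j \<omega>)\<^sup>2 \<partial>M) / 2))"
    using gaussian_summable_sequence[of M "X (int q + 1)" cc, OF sq_int_X cc_def summable_cc] by auto
  interpret L: inar_limit M p0 Y U eps \<theta>0 q l1 l2 g \<Theta> v w D1 D2 D3 phat thhat gauss_space W
    by (intro inar_limit.intro inar_limit_axioms.intro inar_test_axioms W)
  \<comment> \<open>One law serves as the common limit of the statistic and its approximation, that
    of the quadratic functional of the Gaussian process.\<close>
  have \<mu>: "real_distribution (distr gauss_space borel L.Qlim)"
    using L.W.real_distribution_distr[OF L.measurable_Qlim] .
  show ?thesis
    using \<mu> L.S_stat_weak_convergence L.Qstat_weak_convergence L.Z_gaussian L.Z_joint_measurable L.Z_mean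
      L.Z_covariance L.Z_bar_weak_convergence L.W.prob_space_axioms
    unfolding Qstat_def[abs_def] by (intro conjI exI[of _ "distr gauss_space borel L.Qlim"] exI[of _ gauss_space] exI[of _ L.Z]) blast+
qed

end
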